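(* Let $(X,\omega)$ be a compact connected Hermitian manifold without boundary, of complex dimension $n\ge2$, let $\omega_h$ be another Hermitian metric on $X$, and let $\theta$ be a smooth $(1,0)$-form on $X$. Let $p>2n$, $\gamma>0$, $K>0$. Then there is a constant $C>0$ depending only on $n,\gamma,\omega,p,\theta,\omega_h,K$ with the following property. Let $f:\Gamma\to\mathbb{R}_+$ satisfy the structural conditions (1)--(4) (listed in the context) with constant $\gamma$, let $F$ be a smooth real function on $X$ with $\|e^{2nF}\|_{L^1(\log L)^p(X,\omega)}\le K$, and let $\varphi\in C^2(X)$ be a solution of $$f(\lambda[\tilde h_\varphi])=e^F,\qquad \lambda[\tilde h_\varphi]\in\Gamma,$$ normalized by $\sup_X\varphi=0$, where $$\tilde h_\varphi=\omega^{-1}\cdot\Bigl\{\omega_h+\frac1{n-1}\bigl((\Delta_\omega\varphi)\,\omega-i\partial\bar\partial\varphi\bigr)+\chi[\varphi]\Bigr\},\qquad \chi[\varphi]=i(\varphi_j\bar\theta_k+\theta_j\varphi_{\bar k})\,dz^j\wedge d\bar z^k .$$ Then $$\sup_X|\varphi|\le C.$$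
   Context: $\mathbb{R}_+=(0,\infty)$. Structural conditions on $f:\Gamma\to\mathbb{R}_+$: (1) $\Gamma\subset\mathbb{R}^n$ is an (open) cone, symmetric under permutations of the coordinates, with $\Gamma_n\subset\Gamma\subset\Gamma_1$, where $\Gamma_k=\{\lambda\in\mathbb{R}^n:\sigma_j(\lambda)>0 \text{ for } 1\le j\le k\}$ and $\sigma_j$ is the $j$-th elementary symmetric polynomial; (2) $f$ is a ($C^1$) symmetric function of $\lambda=(\lambda_1,\dots,\lambda_n)\in\Gamma$, homogeneous of degree one; (3) $\partial f/\partial\lambda_j>0$ on $\Gamma$ for every $j$; (4) $\prod_{j=1}^n \frac{\partial f}{\partial\lambda_j}\ge\gamma$ for all $\lambda\in\Gamma$. $\Delta_\omega\varphi=n\,\frac{i\partial\bar\partial\varphi\wedge\omega^{n-1}}{\omega^n}$ is the complex Laplacian. For a real $(1,1)$-form $\alpha$, $\omega^{-1}\cdot\alpha$ is the endomorphism of $T^{1,0}X$ obtained from $\alpha$ by raising an index with $\omega$ (in coordinates $g^{j\bar k}\alpha_{\bar k i}$, where $\omega=i\sum g_{\bar k j}\,dz^j\wedge d\bar z^k$ and $(g^{j\bar k})$ is the inverse matrix). $\lambda[\tilde h_\varphi]$ denotes the unordered vector of eigenvalues of $\tilde h_\varphi$. Locally $\theta=\theta_j\,dz^j$, $\bar\theta_k=\overline{\theta_k}$, $\varphi_j=\partial\varphi/\partial z^j$ and $\varphi_{\bar k}=\partial\varphi/\partial\bar z^k$. $\|e^{2nF}\|_{L^1(\log L)^p(X,\omega)}=\int_X(1+|F|^p)\,e^{2nF}\,\omega^n$.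 *)

theory Defs
  imports "HOL-Analysis.Analysis"
begin

section \<open>Differentiability on open sets\<close>

fun Ck_on :: "nat \<Rightarrow> 'a::real_normed_vector set \<Rightarrow> ('a \<Rightarrow> 'b::real_normed_vector) \<Rightarrow> bool" where
  "Ck_on 0 S f \<longleftrightarrow> continuous_on S f"
| "Ck_on (Suc k) S f \<longleftrightarrow>
     (\<forall>x\<in>S. f differentiable (at x)) \<and> (\<forall>v. Ck_on k S (\<lambda>x. frechet_derivative f (at x) v))"

definition smooth_on :: "'a::real_normed_vector set \<Rightarrow> ('a \<Rightarrow> 'b::real_normed_vector) \<Rightarrow> bool" where
  "smooth_on S f \<longleftrightarrow> (\<forall>k. Ck_on k S f)"

definition holomorphic_map_on :: "(complex^'n) set \<Rightarrow> (complex^'n \<Rightarrow> complex^'m) \<Rightarrow> bool" where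
  "holomorphic_map_on S f \<longleftrightarrow>
     (\<forall>z\<in>S. \<exists>L. (f has_derivative L) (at z) \<and> (\<forall>c v. L (c *s v) = c *s L v))"

text \<open>The Wirtinger derivatives \<open>\<partial>/\<partial>z\<^sup>j\<close> and \<open>\<partial>/\<partial>\<bar>z\<^sup>j\<close>.\<close>

definition d_z :: "'n::finite \<Rightarrow> (complex^'n \<Rightarrow> complex) \<Rightarrow> complex^'n \<Rightarrow> complex" where
  "d_z j u z = (frechet_derivative u (at z) (axis j 1)
                 - \<i> * frechet_derivative u (at z) (axis j \<i>)) / 2"

definition d_zbar :: "'n::finite \<Rightarrow> (complex^'n \<Rightarrow> complex) \<Rightarrow> complex^'n \<Rightarrow> complex" where
  "d_zbar j u z = (frechet_derivative u (at z) (axis j 1)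
                    + \<i> * frechet_derivative u (at z) (axis j \<i>)) / 2"


section \<open>Complex manifolds\<close>

text \<open>A chart is a domain together with a coordinate map; the values of the map outside the
  domain are irrelevant.\<close>

type_synonym ('a, 'n) chart = "'a set \<times> ('a \<Rightarrow> complex^'n)"

definition chart_image :: "('a, 'n) chart \<Rightarrow> (complex^'n) set" where
  "chart_image c = snd c ` fst c"

definition chart_inv :: "('a, 'n) chart \<Rightarrow> complex^'n \<Rightarrow> 'a" where
  "chart_inv c = inv_into (fst c) (snd c)"

definition is_chart :: "'a topology \<Rightarrow> ('a, 'n::finite) chart \<Rightarrow> bool" where
  "is_chart X c \<longleftrightarrow> openin X (fst c) \<and> open (chart_image c) \<and>
     homeomorphic_map (subtopology X (fst c)) (top_of_set (chart_image c)) (snd c)"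

definition complex_manifold :: "'a topology \<Rightarrow> ('a, 'n::finite) chart set \<Rightarrow> bool" where
  "complex_manifold X A \<longleftrightarrow>
     Hausdorff_space X \<and> second_countable X \<and>
     (\<forall>c\<in>A. is_chart X c) \<and> (\<Union>c\<in>A. fst c) = topspace X \<and>
     (\<forall>c\<in>A. \<forall>d\<in>A. holomorphic_map_on (snd c ` (fst c \<inter> fst d)) (snd d \<circ> chart_inv c))"

definition compact_connected_complex_manifold ::
    "'a topology \<Rightarrow> ('a, 'n::finite) chart set \<Rightarrow> bool" where
  "compact_connected_complex_manifold X A \<longleftrightarrow>
     complex_manifold X A \<and> topspace X \<noteq> {} \<and> compact_space X \<and> connected_space X"

definition Ck_function :: "nat \<Rightarrow> ('a, 'n::finite) chart set \<Rightarrow> ('a \<Rightarrow> real) \<Rightarrow> bool" where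
  "Ck_function k A u \<longleftrightarrow> (\<forall>c\<in>A. Ck_on k (chart_image c) (u \<circ> chart_inv c))"

definition smooth_function :: "('a, 'n::finite) chart set \<Rightarrow> ('a \<Rightarrow> real) \<Rightarrow> bool" where
  "smooth_function A u \<longleftrightarrow> (\<forall>c\<in>A. smooth_on (chart_image c) (u \<circ> chart_inv c))"

text \<open>\<open>jacobian c d x $ a $ j = \<partial>w\<^sup>a/\<partial>z\<^sup>j\<close> at the point \<open>x\<close>, where \<open>z\<close> are the coordinates of the
  chart \<open>c\<close> and \<open>w\<close> those of \<open>d\<close>.\<close>

definition jacobian :: "('a, 'n::finite) chart \<Rightarrow> ('a, 'n) chart \<Rightarrow> 'a \<Rightarrow> complex^'n^'n" where
  "jacobian c d x =
     (\<chi> a. \<chi> j. frechet_derivative (snd d \<circ> chart_inv c) (at (snd c x)) (axis j 1) $ a)"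


section \<open>Forms of type (1,0) and (1,1)\<close>

text \<open>A (1,0)-form \<open>\<theta> = \<theta>\<^sub>j dz\<^sup>j\<close> is given by its components \<open>\<theta> c x $ j\<close> in each chart \<open>c\<close> of the
  atlas. A (1,1)-form \<open>\<alpha> = i \<Sum> \<alpha>\<^sub>k\<^sub>j dz\<^sup>j \<and> d\<bar>z\<^sup>k\<close> is given by matrices \<open>\<alpha> c x $ k $ j\<close>, whose
  first index is the barred one. The components in different charts are related by the usual
  transformation laws.\<close>

definition smooth_10_form ::
    "('a, 'n::finite) chart set \<Rightarrow> (('a, 'n) chart \<Rightarrow> 'a \<Rightarrow> complex^'n) \<Rightarrow> bool" where
  "smooth_10_form A \<theta> \<longleftrightarrow>
     (\<forall>c\<in>A. \<forall>j. smooth_on (chart_image c) (\<lambda>z. \<theta> c (chart_inv c z) $ j)) \<and>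
     (\<forall>c\<in>A. \<forall>d\<in>A. \<forall>x\<in>fst c \<inter> fst d. \<forall>j.
        \<theta> c x $ j = (\<Sum>a\<in>UNIV. \<theta> d x $ a * jacobian c d x $ a $ j))"

definition smooth_11_form ::
    "('a, 'n::finite) chart set \<Rightarrow> (('a, 'n) chart \<Rightarrow> 'a \<Rightarrow> complex^'n^'n) \<Rightarrow> bool" where
  "smooth_11_form A \<alpha> \<longleftrightarrow>
     (\<forall>c\<in>A. \<forall>k j. smooth_on (chart_image c) (\<lambda>z. \<alpha> c (chart_inv c z) $ k $ j)) \<and>
     (\<forall>c\<in>A. \<forall>d\<in>A. \<forall>x\<in>fst c \<inter> fst d. \<forall>k j.
        \<alpha> c x $ k $ j =
          (\<Sum>b\<in>UNIV. \<Sum>a\<in>UNIV. cnj (jacobian c d x $ b $ k) * \<alpha> d x $ b $ a * jacobian c d x $ a $ j))"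

definition positive_hermitian :: "complex^'n^'n \<Rightarrow> bool" where
  "positive_hermitian g \<longleftrightarrow>
     (\<forall>k j. cnj (g $ k $ j) = g $ j $ k) \<and>
     (\<forall>v. v \<noteq> 0 \<longrightarrow> 0 < Re (\<Sum>k\<in>UNIV. \<Sum>j\<in>UNIV. g $ k $ j * v $ j * cnj (v $ k)))"

definition hermitian_metric ::
    "('a, 'n::finite) chart set \<Rightarrow> (('a, 'n) chart \<Rightarrow> 'a \<Rightarrow> complex^'n^'n) \<Rightarrow> bool" where
  "hermitian_metric A \<omega> \<longleftrightarrow>
     smooth_11_form A \<omega> \<and> (\<forall>c\<in>A. \<forall>x\<in>fst c. positive_hermitian (\<omega> c x))"

text \<open>The alternating 2-form \<open>i \<Sum> a\<^sub>k\<^sub>j dz\<^sup>j \<and> d\<bar>z\<^sup>k\<close> as a function of two tangent vectors.\<close>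

definition form_of :: "complex^'n^'n \<Rightarrow> complex^'n \<Rightarrow> complex^'n \<Rightarrow> complex" where
  "form_of a v w =
     \<i> * (\<Sum>j\<in>UNIV. \<Sum>k\<in>UNIV. a $ k $ j * (v $ j * cnj (w $ k) - w $ j * cnj (v $ k)))"

text \<open>The wedge product of \<open>n\<close> 2-forms \<open>\<alpha>\<^sub>l\<close>, evaluated on the standard real frame
  \<open>(e\<^sub>l, i e\<^sub>l)\<^sub>l\<close> of \<open>\<complex>\<^sup>n\<close>: the factor \<open>l\<close> has the two argument slots \<open>(l, False)\<close> and \<open>(l, True)\<close>.
  As forms of even degree commute and the frame consists of consecutive pairs, no ordering of the
  index type is needed.\<close>

definition std_frame :: "'n::finite \<times> bool \<Rightarrow> complex^'n" where
  "std_frame s = axis (fst s) (if snd s then \<i> else 1)"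

definition wedge_on_frame :: "('n::finite \<Rightarrow> complex^'n \<Rightarrow> complex^'n \<Rightarrow> complex) \<Rightarrow> complex" where
  "wedge_on_frame \<alpha> =
     (\<Sum>\<pi> | \<pi> permutes (UNIV :: ('n \<times> bool) set).
        of_int (sign \<pi>) *
        (\<Prod>l\<in>UNIV. \<alpha> l (std_frame (\<pi> (l, False))) (std_frame (\<pi> (l, True))))) / 2 ^ CARD('n)"

text \<open>\<open>laplacian g a = n \<alpha> \<and> \<omega>\<^sup>n\<^sup>-\<^sup>1 / \<omega>\<^sup>n\<close>, where \<open>\<omega>\<close> and \<open>\<alpha>\<close> have coefficients \<open>g\<close> and \<open>a\<close>. The factor
  \<open>n\<close> is written as the sum over the position \<open>l\<close> of \<open>\<alpha>\<close> in the product, on which the product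
  does not depend.\<close>

definition laplacian :: "complex^'n^'n \<Rightarrow> complex^'n^'n \<Rightarrow> complex" where
  "laplacian g a =
     (\<Sum>l\<in>UNIV. wedge_on_frame (\<lambda>m. if m = l then form_of a else form_of g))
       / wedge_on_frame (\<lambda>m. form_of g)"


section \<open>The volume form and the entropy norm\<close>

text \<open>The density of \<open>\<omega>\<^sup>n\<close> with respect to Lebesgue measure in the chart \<open>c\<close>
  (it equals \<open>n! 2\<^sup>n det g\<close>).\<close>

definition volume_density ::
    "(('a, 'n::finite) chart \<Rightarrow> 'a \<Rightarrow> complex^'n^'n) \<Rightarrow> ('a, 'n) chart \<Rightarrow> complex^'n \<Rightarrow> real" where
  "volume_density \<omega> c z = Re (wedge_on_frame (\<lambda>l. form_of (\<omega> c (chart_inv c z))))"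

definition chart_volume ::
    "'a topology \<Rightarrow> (('a, 'n::finite) chart \<Rightarrow> 'a \<Rightarrow> complex^'n^'n) \<Rightarrow> ('a, 'n) chart \<Rightarrow> 'a measure" where
  "chart_volume X \<omega> c =
     distr (density (restrict_space lborel (chart_image c)) (\<lambda>z. ennreal (volume_density \<omega> c z)))
       (sigma (topspace X) {U. openin X U}) (chart_inv c)"

text \<open>The Borel measure of the volume form \<open>\<omega>\<^sup>n\<close>. By the change of variables formula, the measures
  \<open>chart_volume X \<omega> c\<close> and \<open>chart_volume X \<omega> d\<close> agree on the overlap of \<open>c\<close> and \<open>d\<close>. Their supremum
  in the lattice of measures is therefore the measure on \<open>X\<close> that restricts to each of them on the
  respective chart domain.\<close>

definition volume_measure ::
    "'a topology \<Rightarrow> ('a, 'n::finite) chart set \<Rightarrow> (('a, 'n) chart \<Rightarrow> 'a \<Rightarrow> complex^'n^'n) \<Rightarrow> 'a measure" where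
  "volume_measure X A \<omega> = (SUP c\<in>A. chart_volume X \<omega> c)"

text \<open>\<open>\<parallel>e\<^sup>2\<^sup>n\<^sup>F\<parallel>\<close> in \<open>L\<^sup>1(log L)\<^sup>p(X,\<omega>)\<close>.\<close>

definition entropy_norm ::
    "'a topology \<Rightarrow> ('a, 'n::finite) chart set \<Rightarrow> (('a, 'n) chart \<Rightarrow> 'a \<Rightarrow> complex^'n^'n)
      \<Rightarrow> real \<Rightarrow> ('a \<Rightarrow> real) \<Rightarrow> ennreal" where
  "entropy_norm X A \<omega> p F =
     (\<integral>\<^sup>+ x. ennreal ((1 + \<bar>F x\<bar> powr p) * exp (2 * real CARD('n) * F x)) \<partial>volume_measure X A \<omega>)"


section \<open>Structural conditions on the operator\<close>

definition elem_sym :: "nat \<Rightarrow> real^'n \<Rightarrow> real" where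
  "elem_sym j \<mu> = (\<Sum>S | S \<subseteq> UNIV \<and> card S = j. \<Prod>i\<in>S. \<mu> $ i)"

definition Gamma_cone :: "nat \<Rightarrow> (real^'n) set" where
  "Gamma_cone k = {\<mu>. \<forall>j\<in>{1..k}. 0 < elem_sym j \<mu>}"

definition partial_deriv :: "'n::finite \<Rightarrow> (real^'n \<Rightarrow> real) \<Rightarrow> real^'n \<Rightarrow> real" where
  "partial_deriv j f \<mu> = frechet_derivative f (at \<mu>) (axis j 1)"

definition admissible_cone :: "(real^'n::finite) set \<Rightarrow> bool" where
  "admissible_cone \<Gamma> \<longleftrightarrow>
     open \<Gamma> \<and> (\<forall>\<mu>\<in>\<Gamma>. \<forall>t>0. t *\<^sub>R \<mu> \<in> \<Gamma>) \<and>
     (\<forall>\<pi>. \<pi> permutes UNIV \<longrightarrow> (\<forall>\<mu>\<in>\<Gamma>. (\<chi> i. \<mu> $ \<pi> i) \<in> \<Gamma>)) \<and>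
     Gamma_cone CARD('n) \<subseteq> \<Gamma> \<and> \<Gamma> \<subseteq> Gamma_cone 1"

definition structural_conditions :: "(real^'n::finite) set \<Rightarrow> (real^'n \<Rightarrow> real) \<Rightarrow> real \<Rightarrow> bool" where
  "structural_conditions \<Gamma> f \<gamma> \<longleftrightarrow>
     admissible_cone \<Gamma> \<and> (\<forall>\<mu>\<in>\<Gamma>. 0 < f \<mu>) \<and>
     Ck_on 1 \<Gamma> f \<and>
     (\<forall>\<pi>. \<pi> permutes UNIV \<longrightarrow> (\<forall>\<mu>\<in>\<Gamma>. f (\<chi> i. \<mu> $ \<pi> i) = f \<mu>)) \<and>
     (\<forall>\<mu>\<in>\<Gamma>. \<forall>t>0. f (t *\<^sub>R \<mu>) = t * f \<mu>) \<and>
     (\<forall>\<mu>\<in>\<Gamma>. \<forall>j. 0 < partial_deriv j f \<mu>) \<and>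
     (\<forall>\<mu>\<in>\<Gamma>. \<gamma> \<le> (\<Prod>j\<in>UNIV. partial_deriv j f \<mu>))"


section \<open>The endomorphism \<open>h\<^sub>\<phi>\<close> and the equation\<close>

definition in_chart :: "('a, 'n) chart \<Rightarrow> ('a \<Rightarrow> real) \<Rightarrow> complex^'n \<Rightarrow> complex" where
  "in_chart c \<phi> = (\<lambda>z. complex_of_real (\<phi> (chart_inv c z)))"

text \<open>The coefficients \<open>\<partial>\<^sup>2\<phi>/\<partial>z\<^sup>j\<partial>\<bar>z\<^sup>k\<close> of \<open>i\<partial>\<bar>\<partial>\<phi>\<close>, at position \<open>(k, j)\<close>.\<close>

definition ddbar :: "('a, 'n::finite) chart \<Rightarrow> ('a \<Rightarrow> real) \<Rightarrow> 'a \<Rightarrow> complex^'n^'n" where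
  "ddbar c \<phi> x = (\<chi> k. \<chi> j. d_z j (d_zbar k (in_chart c \<phi>)) (snd c x))"

definition chi_form ::
    "(('a, 'n::finite) chart \<Rightarrow> 'a \<Rightarrow> complex^'n) \<Rightarrow> ('a, 'n) chart \<Rightarrow> ('a \<Rightarrow> real) \<Rightarrow> 'a \<Rightarrow> complex^'n^'n"
  where
  "chi_form \<theta> c \<phi> x =
     (\<chi> k. \<chi> j. d_z j (in_chart c \<phi>) (snd c x) * cnj (\<theta> c x $ k)
                + \<theta> c x $ j * d_zbar k (in_chart c \<phi>) (snd c x))"

definition tilde_h ::
    "(('a, 'n::finite) chart \<Rightarrow> 'a \<Rightarrow> complex^'n^'n) \<Rightarrow> (('a, 'n) chart \<Rightarrow> 'a \<Rightarrow> complex^'n^'n)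
      \<Rightarrow> (('a, 'n) chart \<Rightarrow> 'a \<Rightarrow> complex^'n) \<Rightarrow> ('a \<Rightarrow> real) \<Rightarrow> ('a, 'n) chart \<Rightarrow> 'a \<Rightarrow> complex^'n^'n"
  where
  "tilde_h \<omega> \<omega>\<^sub>h \<theta> \<phi> c x =
     matrix_inv (\<omega> c x) **
       (\<chi> k. \<chi> j. \<omega>\<^sub>h c x $ k $ j
          + (laplacian (\<omega> c x) (ddbar c \<phi> x) * \<omega> c x $ k $ j - ddbar c \<phi> x $ k $ j)
              / of_nat (CARD('n) - 1)
          + chi_form \<theta> c \<phi> x $ k $ j)"

text \<open>\<open>\<mu>\<close> lists the eigenvalues of \<open>M\<close> with (algebraic) multiplicity, in some order.\<close>

definition eigenvalue_vector :: "complex^'n^'n \<Rightarrow> real^'n \<Rightarrow> bool" where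
  "eigenvalue_vector M \<mu> \<longleftrightarrow>
     (\<forall>t. det (mat t - M) = (\<Prod>i\<in>UNIV. t - complex_of_real (\<mu> $ i)))"

text \<open>\<open>f(\<lambda>[h\<^sub>\<phi>]) = e\<^sup>F\<close> with \<open>\<lambda>[h\<^sub>\<phi>] \<in> \<Gamma>\<close>. The eigenvalues do not depend on the chart. They are real,
  as the endomorphism is self-adjoint with respect to \<open>\<omega>\<close>; by the symmetry of \<open>\<Gamma>\<close> and \<open>f\<close> their
  order is immaterial.\<close>

definition solves_equation ::
    "('a, 'n::finite) chart set \<Rightarrow> (('a, 'n) chart \<Rightarrow> 'a \<Rightarrow> complex^'n^'n)
      \<Rightarrow> (('a, 'n) chart \<Rightarrow> 'a \<Rightarrow> complex^'n^'n) \<Rightarrow> (('a, 'n) chart \<Rightarrow> 'a \<Rightarrow> complex^'n)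
      \<Rightarrow> (real^'n) set \<Rightarrow> (real^'n \<Rightarrow> real) \<Rightarrow> ('a \<Rightarrow> real) \<Rightarrow> ('a \<Rightarrow> real) \<Rightarrow> bool" where
  "solves_equation A \<omega> \<omega>\<^sub>h \<theta> \<Gamma> f F \<phi> \<longleftrightarrow>
     (\<forall>c\<in>A. \<forall>x\<in>fst c. \<exists>\<mu>. eigenvalue_vector (tilde_h \<omega> \<omega>\<^sub>h \<theta> \<phi> c x) \<mu> \<and>
        \<mu> \<in> \<Gamma> \<and> f \<mu> = exp (F x))"

end

theory Submission
  imports Defs "HOL-Computational_Algebra.Polynomial"
begin

text \<open>Since \<open>\<Gamma> \<subseteq> \<Gamma>\<^sub>1\<close>, the trace of \<open>h\<^sub>\<phi>\<close> is nonnegative; for \<open>w = - \<phi> \<ge> 0\<close> this is in a chart a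
  linear inequality \<open>L w \<le> C\<close> with an elliptic operator \<open>L\<close> that does not depend on \<open>f\<close>, \<open>F\<close>, \<open>\<Gamma>\<close>. If \<open>w\<close> is
  bounded at one point of a ball, Alexandrov's contact sets give a sublevel set of definite measure.
  The equation for \<open>ln (1 + w)\<close> bounds its gradient in \<open>L\<^sup>2\<close>, and a Poincare inequality then makes the
  superlevel sets \<open>{w > T}\<close> uniformly small. Such bounds propagate through \<open>X\<close> by connectedness, starting
  at a zero of \<open>\<phi>\<close>.

  At the minimum of \<open>\<phi>\<close> Alexandrov's argument is applied to the equation itself. The real determinant of
  \<open>D\<^sup>2\<phi> + 2 \<epsilon>\<close> on the contact set is at most a multiple of \<open>f\<^sup>2\<^sup>n = e\<^sup>2\<^sup>n\<^sup>F\<close>: \<open>f\<^sup>n\<close> dominates the product of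
  the eigenvalues of \<open>h\<^sub>\<phi>\<close>, and these dominate sums over all but one of the eigenvalues of \<open>i\<partial>\<bar>\<partial>\<phi>\<close>. By the
  entropy bound the integral of \<open>e\<^sup>2\<^sup>n\<^sup>F\<close> over a set of small measure is small, but the slopes
  of the contact set fill a ball of fixed radius. Hence the contact set, on which \<open>\<phi>\<close> is close to its
  minimum, is not small, and the minimum cannot lie far below \<open>-T\<close>.\<close>

section \<open>Hermitian forms and unitary frames\<close>

text \<open>At the minimum of \<phi> the obstacle is the first-order term \<chi>[\<phi>], which has
  no sign. On a contact set the gradient is of order \<epsilon> R, so \<chi>[\<phi>] is of order
  \<epsilon>; a small \<epsilon>, fixed by the metrics, \<theta> and the ball, lets \<omega>_h
  absorb it together with the shift of the Hessian. This makes the eigenvalues nonnegative there,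
  although \<Gamma> may exceed the positive cone, and only then is f^n comparable with their
  product.

  That argument alone cannot exclude a function that is very negative on most of X; this is what the
  linear inequality is for. Division by 1 + w gives the logarithmic gradient an inequality with a
  negative quadratic term, hence a bound independent of the size of w. As this controls only
  oscillation, a sublevel set of definite measure must serve as an anchor.

  Every constant has to be fixed before \<phi>, so the propagation through X concerns whole families
  of functions.\<close>

definition sesq :: "complex^'n^'n \<Rightarrow> complex^'n \<Rightarrow> complex^'n \<Rightarrow> complex" where
  "sesq A v w = (\<Sum>k\<in>UNIV. \<Sum>j\<in>UNIV. A $ k $ j * w $ j * cnj (v $ k))"

definition hermitian :: "complex^'n^'n \<Rightarrow> bool" where
  "hermitian A \<longleftrightarrow> (\<forall>k j. cnj (A $ k $ j) = A $ j $ k)"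

lemma positive_hermitian_iff:
  "positive_hermitian g \<longleftrightarrow> hermitian g \<and> (\<forall>v. v \<noteq> 0 \<longrightarrow> 0 < Re (sesq g v v))"
  by (simp add: positive_hermitian_def hermitian_def sesq_def)

lemma sesq_add_left: "sesq A (v + v') w = sesq A v w + sesq A v' w"
  by (simp add: sesq_def algebra_simps sum.distrib)

lemma sesq_add_right: "sesq A v (w + w') = sesq A v w + sesq A v w'"
  by (simp add: sesq_def algebra_simps sum.distrib)

text \<open>The conjugate sits on the first argument because the first index of a coefficient matrix
  is the barred one.\<close>

lemma sesq_scale_left: "sesq A (c *s v) w = cnj c * sesq A v w"
  by (simp add: sesq_def algebra_simps sum_distrib_left)

lemma sesq_scale_right: "sesq A v (c *s w) = c * sesq A v w"
  by (simp add: sesq_def algebra_simps sum_distrib_left)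

lemma sesq_scaleR: "sesq A (c *\<^sub>R v) (d *\<^sub>R w) = c * d * sesq A v w"
  by (simp add: sesq_def sum_distrib_left scaleR_conv_of_real[where 'a=complex] mult_ac)

lemma sesq_diff_left: "sesq A (v - v') w = sesq A v w - sesq A v' w"
  by (simp add: sesq_def algebra_simps sum_subtractf)

lemma sesq_diff_right: "sesq A v (w - w') = sesq A v w - sesq A v w'"
  by (simp add: sesq_def algebra_simps sum_subtractf)

lemma sesq_zero [simp]: "sesq A 0 w = 0" "sesq A v 0 = 0"
  by (simp_all add: sesq_def)

lemma sesq_cnj:
  assumes "hermitian A"
  shows "cnj (sesq A v w) = sesq A w v"
proof -
  have "cnj (sesq A v w) = (\<Sum>k\<in>UNIV. \<Sum>j\<in>UNIV. A $ j $ k * cnj (w $ j) * v $ k)"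
    using assms by (simp add: sesq_def hermitian_def)
  also have "\<dots> = sesq A w v"
    unfolding sesq_def by (subst sum.swap) (simp add: mult_ac)
  finally show ?thesis .
qed

lemma sesq_diag_real: "hermitian A \<Longrightarrow> Im (sesq A v v) = 0"
  using sesq_cnj[of A v v] by (metis Reals_cnj_iff complex_is_Real_iff)

lemma sesq_diag_of_real: "hermitian A \<Longrightarrow> sesq A v v = of_real (Re (sesq A v v))"
  by (simp add: complex_eq_iff sesq_diag_real)

lemma continuous_on_sesq [continuous_intros]:
  assumes "continuous_on S f" "continuous_on S g" "continuous_on S A"
  shows "continuous_on S (\<lambda>x. sesq (A x) (f x) (g x))"
  unfolding sesq_def using assms by (intro continuous_intros) auto

lemma cnj_mult_self: "cnj z * z = of_real ((norm z)\<^sup>2)" "z * cnj z = of_real ((norm z)\<^sup>2)"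
  by (metis complex_norm_square mult.commute)+

lemma sesq_mat_1: "sesq (mat 1) v w = (\<Sum>k\<in>UNIV. w $ k * cnj (v $ k))"
  unfolding sesq_def mat_def
proof (intro sum.cong refl)
  fix k
  have "(\<Sum>j\<in>UNIV. (\<chi> i j. if i = j then 1 else 0) $ k $ j * w $ j * cnj (v $ k)) =
    (\<Sum>j\<in>UNIV. if k = j then w $ j * cnj (v $ k) else 0)"
    by (intro sum.cong) auto
  then show "(\<Sum>j\<in>UNIV. (\<chi> i j. if i = j then 1 else 0) $ k $ j * w $ j * cnj (v $ k)) = w $ k * cnj (v $ k)"
    by simp
qed

lemma norm_vec_power2: "(norm (v::complex^'n))\<^sup>2 = (\<Sum>k\<in>UNIV. (norm (v $ k))\<^sup>2)"
  by (simp add: norm_vec_def L2_set_def sum_nonneg)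

lemma sesq_mat_1_diag: "sesq (mat 1) v v = of_real ((norm v)\<^sup>2)"
  by (simp add: sesq_mat_1 cnj_mult_self norm_vec_power2)

lemma positive_hermitian_mat_1: "positive_hermitian (mat 1)"
  unfolding positive_hermitian_iff sesq_mat_1_diag by (auto simp: hermitian_def mat_def)

text \<open>The minimum over the unit sphere is positive, and homogeneity of degree two extends the
  bound to all vectors.\<close>

lemma positive_hermitian_lower_bound:
  assumes "positive_hermitian g"
  obtains \<kappa> where "\<kappa> > 0" "\<And>v. \<kappa> * (norm v)\<^sup>2 \<le> Re (sesq g v v)"
proof -
  have *: "continuous_on (sphere 0 1) (\<lambda>v. Re (sesq g v v))"
    by (intro continuous_intros)
  have ne: "sphere (0::complex^'a) 1 \<noteq> {}"
  proof -
    have "norm (axis undefined 1 :: complex^'a) = 1"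
      by (rule power2_eq_imp_eq) (simp_all add: norm_vec_power2 axis_def if_distrib[of "\<lambda>x. x\<^sup>2"] if_distrib[of norm] cong: if_cong)
    then show ?thesis by (metis dist_0_norm empty_iff mem_sphere)
  qed
  obtain v0 where v0: "v0 \<in> sphere 0 1" "\<And>v. v \<in> sphere 0 1 \<Longrightarrow> Re (sesq g v0 v0) \<le> Re (sesq g v v)"
    using continuous_attains_inf[OF compact_sphere ne *] by blast
  show thesis
  proof
    show "0 < Re (sesq g v0 v0)"
    proof -
      have "v0 \<noteq> 0" using v0(1) by auto
      then show ?thesis using assms by (simp add: positive_hermitian_iff)
    qed
    fix v :: "complex^'a"
    show "Re (sesq g v0 v0) * (norm v)\<^sup>2 \<le> Re (sesq g v v)"
    proof (cases "v = 0")
      case False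
      have "Re (sesq g v0 v0) \<le> Re (sesq g ((1 / norm v) *\<^sub>R v) ((1 / norm v) *\<^sub>R v))"
        using False by (intro v0(2)) simp
      also have "\<dots> = Re (sesq g v v) / (norm v)\<^sup>2"
        by (simp add: sesq_scaleR power2_eq_square)
      finally show ?thesis
        using False by (simp add: field_simps)
    qed simp
  qed
qed

text \<open>The frame vectors are the rows of \<open>p\<close>; as a change of basis the frame is
  therefore \<open>transpose p\<close>.\<close>

definition orthonormal_frame :: "complex^'n^'n \<Rightarrow> complex^'n^'n \<Rightarrow> bool" where
  "orthonormal_frame g p \<longleftrightarrow> (\<forall>k l. sesq g (p $ k) (p $ l) = (if k = l then 1 else 0))"

lemma orthonormal_frame_axis: "orthonormal_frame (mat 1) (\<chi> k. axis k 1)"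
  unfolding orthonormal_frame_def sesq_mat_1
proof (intro allI)
  fix k l :: 'a
  have "(\<Sum>i\<in>UNIV. (\<chi> k. axis k (1::complex)) $ l $ i * cnj ((\<chi> k. axis k 1) $ k $ i)) =
     (\<Sum>i\<in>UNIV. if i = l then if k = l then 1 else 0 else 0)"
    by (intro sum.cong) (auto simp: axis_def)
  then show "(\<Sum>i\<in>UNIV. (\<chi> k. axis k (1::complex)) $ l $ i * cnj ((\<chi> k. axis k 1) $ k $ i)) = (if k = l then 1 else 0)"
    by simp
qed

text \<open>The defining equations are closed conditions, and coercivity of \<open>g\<close> bounds
  vectors of length one for \<open>g\<close>. Compactness supplies the maximiser in the next
  lemma.\<close>

lemma compact_orthonormal_frames:
  assumes "positive_hermitian g"
  shows "compact {p. orthonormal_frame g p}"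
proof -
  obtain \<kappa> where k: "\<kappa> > 0" "\<And>v. \<kappa> * (norm v)\<^sup>2 \<le> Re (sesq g v v)"
    using positive_hermitian_lower_bound[OF assms] by blast
  have "closed {p. orthonormal_frame g p}"
    unfolding orthonormal_frame_def
    by (intro closed_Collect_all closed_Collect_eq continuous_intros)
  moreover have "bounded {p. orthonormal_frame g p}"
  proof (rule boundedI)
    fix p assume "p \<in> {p. orthonormal_frame g p}"
    then have p: "sesq g (p $ k) (p $ k) = 1" for k
      by (simp add: orthonormal_frame_def)
    have "norm (p $ k) \<le> sqrt (1 / \<kappa>)" for k
    proof -
      have "(norm (p $ k))\<^sup>2 \<le> 1 / \<kappa>"
        using k(1) k(2)[of "p $ k"] p[of k] by (simp add: field_simps)
      then show ?thesis
        by (rule real_le_rsqrt)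
    qed
    then have "(\<Sum>k\<in>UNIV. norm (p $ k)) \<le> (\<Sum>k\<in>(UNIV::'a set). sqrt (1 / \<kappa>))"
      by (intro sum_mono)
    moreover have "norm p \<le> (\<Sum>k\<in>UNIV. norm (p $ k))"
      unfolding norm_vec_def[of p] by (intro L2_set_le_sum) auto
    ultimately show "norm p \<le> (\<Sum>k\<in>(UNIV::'a set). sqrt (1 / \<kappa>))"
      by linarith
  qed
  ultimately show ?thesis
    using compact_eq_bounded_closed by blast
qed

text \<open>Jacobi's argument: a frame that maximises \<open>\<Sum> w\<^sub>i H\<^sub>i\<^sub>i\<close> with distinct weights \<open>w\<^sub>i\<close> is diagonal, as
  otherwise a small rotation in the plane of an off-diagonal entry increases the sum.\<close>

lemma diagonalizing_frame_aux:
  fixes H :: "complex^'n^'n"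
  assumes g: "positive_hermitian g" and H: "hermitian H" and ex: "orthonormal_frame g p0"
  shows "\<exists>p. orthonormal_frame g p \<and> (\<forall>k l. k \<noteq> l \<longrightarrow> sesq H (p $ k) (p $ l) = 0)"
proof -
  have hg: "hermitian g"
    using g by (simp add: positive_hermitian_iff)
  obtain w' :: "'n \<Rightarrow> nat" where inj: "inj w'"
    using finite_imp_inj_to_nat_seg[of "UNIV::'n set"] by auto
  define w where "w i = real (w' i)" for i
  have w: "w i \<noteq> w j" if "i \<noteq> j" for i j
    using inj that by (auto simp: w_def inj_def)
  define \<Phi> where "\<Phi> p = (\<Sum>i\<in>UNIV. w i * Re (sesq H (p $ i) (p $ i)))" for p :: "complex^'n^'n"
  have cont: "continuous_on {p. orthonormal_frame g p} \<Phi>"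
    unfolding \<Phi>_def by (intro continuous_intros)
  obtain p where p: "orthonormal_frame g p" and max: "\<And>q. orthonormal_frame g q \<Longrightarrow> \<Phi> q \<le> \<Phi> p"
    using continuous_attains_sup[OF compact_orthonormal_frames[OF g] _ cont] ex by blast
  have "sesq H (p $ i) (p $ j) = 0" if ij: "i \<noteq> j" for i j
  proof (rule ccontr)
    define b where "b = sesq H (p $ i) (p $ j)"
    assume "\<not> ?thesis"
    then have b: "b \<noteq> 0" by (simp add: b_def)
    \<comment> \<open>The phase of the off-diagonal entry: multiplying p_j by \<open>cnj e\<close>
      turns the entry into the positive real number \<open>norm b\<close>.\<close>
    define e where "e = b / norm b"
    have e: "cnj e * e = 1" "e * cnj e = 1"
      using b by (simp_all add: e_def cnj_mult_self power2_eq_square)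
    have be: "b * cnj e = norm b"
      using b by (simp add: e_def cnj_mult_self power2_eq_square)
    have bc: "sesq H (p $ j) (p $ i) = cnj b"
      by (simp add: b_def sesq_cnj[OF H])
    have eb: "e * cnj b = norm b"
      using arg_cong[OF be, of cnj] by (simp add: mult.commute)
    have pij: "sesq g (p $ k) (p $ l) = (if k = l then 1 else 0)" for k l
      using p by (simp add: orthonormal_frame_def)
    define m where "m = Re (sesq H (p $ i) (p $ i))"
    define m' where "m' = Re (sesq H (p $ j) (p $ j))"
    have mm: "sesq H (p $ i) (p $ i) = of_real m" "sesq H (p $ j) (p $ j) = of_real m'"
      unfolding m_def m'_def using sesq_diag_of_real[OF H] by blast+
    \<comment> \<open>The frame with p_i and p_j rotated by the angle of cosine \<open>c\<close> and
      sine \<open>s\<close> is again orthonormal, so maximality of \<open>p\<close> gives an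
      inequality whose term linear in \<open>s\<close> carries \<open>norm b\<close>.\<close>
    have key: "(w i - w j) * (s\<^sup>2 * (m' - m) + 2 * c * s * norm b) \<le> 0" if cs: "c\<^sup>2 + s\<^sup>2 = 1" for c s :: real
    proof -
      define q1 where "q1 = of_real c *s (p $ i) + (of_real s * cnj e) *s (p $ j)"
      define q2 where "q2 = (- of_real s * e) *s (p $ i) + of_real c *s (p $ j)"
      define q where "q = (\<chi> k. if k = i then q1 else if k = j then q2 else p $ k)"
      note expand = sesq_add_left sesq_add_right sesq_scale_left sesq_scale_right sesq_diff_left sesq_diff_right
      have cs': "of_real c * of_real c + of_real s * of_real s = (1::complex)"
        using cs by (metis of_real_1 of_real_add of_real_mult power2_eq_square)
      have q11: "sesq g q1 q1 = 1"
      proof -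
        have "sesq g q1 q1 = of_real c * of_real c + of_real s * of_real s * (e * cnj e)"
          using ij by (simp add: q1_def expand pij algebra_simps)
        then show ?thesis by (simp add: e cs')
      qed
      have q22: "sesq g q2 q2 = 1"
      proof -
        have "sesq g q2 q2 = of_real c * of_real c + of_real s * of_real s * (e * cnj e)"
          using ij by (simp add: q2_def expand pij algebra_simps)
        then show ?thesis by (simp add: e cs')
      qed
      have q12: "sesq g q1 q2 = 0" "sesq g q2 q1 = 0"
        using ij by (simp_all add: q1_def q2_def expand pij algebra_simps)
      have q1k: "sesq g q1 (p $ k) = 0" "sesq g (p $ k) q1 = 0" if "k \<noteq> i" "k \<noteq> j" for k
        using that by (simp_all add: q1_def expand pij)
      have q2k: "sesq g q2 (p $ k) = 0" "sesq g (p $ k) q2 = 0" if "k \<noteq> i" "k \<noteq> j" for k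
        using that by (simp_all add: q2_def expand pij)
      have "orthonormal_frame g q"
        unfolding orthonormal_frame_def q_def using ij
        by (auto simp: q11 q22 q12 q1k q2k pij)
      then have le: "\<Phi> q \<le> \<Phi> p" by (rule max)
      have split: "\<Phi> r = w i * Re (sesq H (r $ i) (r $ i)) + w j * Re (sesq H (r $ j) (r $ j))
          + (\<Sum>k\<in>UNIV - {i, j}. w k * Re (sesq H (r $ k) (r $ k)))" for r
        unfolding \<Phi>_def using ij
        by (subst sum.subset_diff[of "{i, j}"]) auto
      have rest: "(\<Sum>k\<in>UNIV - {i, j}. w k * Re (sesq H (q $ k) (q $ k))) = (\<Sum>k\<in>UNIV - {i, j}. w k * Re (sesq H (p $ k) (p $ k)))"
        by (intro sum.cong) (auto simp: q_def)
      have H1: "Re (sesq H q1 q1) = c\<^sup>2 * m + s\<^sup>2 * m' + 2 * c * s * norm b"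
      proof -
        have "sesq H q1 q1 = of_real c * of_real c * of_real m + of_real s * of_real s * (cnj e * e) * of_real m'
            + of_real c * of_real s * (b * cnj e) + of_real c * of_real s * (e * cnj b)"
          by (simp add: q1_def expand mm bc b_def[symmetric] algebra_simps)
        then show ?thesis
          unfolding e be eb by (simp add: power2_eq_square)
      qed
      have H2: "Re (sesq H q2 q2) = s\<^sup>2 * m + c\<^sup>2 * m' - 2 * c * s * norm b"
      proof -
        have "sesq H q2 q2 = of_real s * of_real s * (cnj e * e) * of_real m + of_real c * of_real c * of_real m'
            - of_real c * of_real s * (b * cnj e) - of_real c * of_real s * (e * cnj b)"
          by (simp add: q2_def expand mm bc b_def[symmetric] algebra_simps)
        then show ?thesis
          unfolding e be eb by (simp add: power2_eq_square)
      qed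
      have "w i * (c\<^sup>2 * m + s\<^sup>2 * m' + 2 * c * s * norm b) + w j * (s\<^sup>2 * m + c\<^sup>2 * m' - 2 * c * s * norm b)
          \<le> w i * m + w j * m'"
        using le ij unfolding split rest by (simp add: q_def H1 H2 m_def m'_def)
      moreover have "c\<^sup>2 = 1 - s\<^sup>2" using cs by simp
      ultimately show ?thesis
        by (simp add: algebra_simps)
    qed
    define d where "d = w i - w j"
    have d: "d \<noteq> 0" using w[OF ij] by (simp add: d_def)
    define B where "B = \<bar>m' - m\<bar>"
    \<comment> \<open>Small enough that, after division by \<open>t\<close>, the contribution of
      \<open>B\<close> stays below \<open>norm b\<close>; the bound 1/2 keeps \<open>c\<close> away
      from 0. The sign of \<open>d\<close> fixes the direction of rotation.\<close>
    define t where "t = min (1/2) (norm b / (2 * (B + 1)))"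
    have B: "B \<ge> 0" by (simp add: B_def)
    have t: "0 < t" "t \<le> 1/2"
      using b B by (simp add: t_def) (simp only: t_def min.cobounded1)
    have tB: "t * B < norm b"
    proof -
      have "t * B \<le> norm b / (2 * (B + 1)) * B"
        using B by (intro mult_right_mono) (auto simp: t_def)
      also have "\<dots> < norm b"
      proof -
        have "norm b * B < norm b * (2 * (B + 1))"
          using B b by (intro mult_strict_left_mono) auto
        then show ?thesis using B by (simp add: divide_less_eq)
      qed
      finally show ?thesis .
    qed
    define c where "c = sqrt (1 - t\<^sup>2)"
    have t2: "t\<^sup>2 \<le> 1/4" using t power_mono[of t "1/2" 2] by (simp add: power2_eq_square)
    have c2: "c\<^sup>2 + (sgn d * t)\<^sup>2 = 1"
      using d t2 by (simp add: c_def power_mult_distrib sgn_if)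
    have c: "c \<ge> 1/2"
      unfolding c_def using t2 by (intro real_le_rsqrt) (simp add: power2_eq_square)
    have "d * ((sgn d * t)\<^sup>2 * (m' - m) + 2 * c * (sgn d * t) * norm b) \<le> 0"
      using key[OF c2] by (simp add: d_def)
    also have "d * ((sgn d * t)\<^sup>2 * (m' - m) + 2 * c * (sgn d * t) * norm b)
        = \<bar>d\<bar> * t * (sgn d * t * (m' - m) + 2 * c * norm b)"
      using d by (auto simp: sgn_if power2_eq_square algebra_simps)
    finally have "sgn d * t * (m' - m) + 2 * c * norm b \<le> 0"
      using d t by (simp add: mult_le_0_iff)
    moreover have "sgn d * t * (m' - m) \<ge> - (t * B)"
      using d t(1) by (auto simp: sgn_if B_def abs_if algebra_simps)
    moreover have "2 * c * norm b \<ge> norm b"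
      using c mult_right_mono[of 1 "2 * c" "norm b"] by simp
    ultimately show False
      using tB by linarith
  qed
  then show ?thesis
    using p by blast
qed

text \<open>The coordinate axes are a frame for the standard form. Diagonalising \<open>g\<close>
  with respect to that form and normalising each vector gives a frame for \<open>g\<close>; this
  replaces Gram-Schmidt and is why the preceding lemma takes an existing frame as
  hypothesis.\<close>

lemma ex_orthonormal_frame:
  fixes g :: "complex^'n^'n"
  assumes g: "positive_hermitian g"
  shows "\<exists>p. orthonormal_frame g p"
proof -
  have hg: "hermitian g"
    using g by (simp add: positive_hermitian_iff)
  obtain u where u: "orthonormal_frame (mat 1) u" "\<And>k l. k \<noteq> l \<Longrightarrow> sesq g (u $ k) (u $ l) = 0"
    using diagonalizing_frame_aux[OF positive_hermitian_mat_1 hg orthonormal_frame_axis] by blast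
  have pos: "Re (sesq g (u $ k) (u $ k)) > 0" for k
  proof -
    have "u $ k \<noteq> 0"
      using u(1) unfolding orthonormal_frame_def by (metis sesq_zero(1) zero_neq_one)
    then show ?thesis using g by (simp add: positive_hermitian_iff)
  qed
  define r where "r k = 1 / sqrt (Re (sesq g (u $ k) (u $ k)))" for k
  have "orthonormal_frame g (\<chi> k. r k *\<^sub>R u $ k)"
    unfolding orthonormal_frame_def
  proof (intro allI)
    fix k l
    have "complex_of_real (r k) * of_real (r k) * sesq g (u $ k) (u $ k) = of_real (r k * r k * Re (sesq g (u $ k) (u $ k)))"
      by (subst sesq_diag_of_real[OF hg]) simp
    also have "r k * r k * Re (sesq g (u $ k) (u $ k)) = 1"
      using pos[of k] by (simp add: r_def)
    finally have "complex_of_real (r k) * of_real (r k) * sesq g (u $ k) (u $ k) = 1"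
      by simp
    then show "sesq g ((\<chi> k. r k *\<^sub>R u $ k) $ k) ((\<chi> k. r k *\<^sub>R u $ k) $ l) = (if k = l then 1 else 0)"
      using u(2) by (cases "k = l") (simp_all add: sesq_scaleR)
  qed
  then show ?thesis ..
qed

theorem diagonalizing_frame:
  fixes H :: "complex^'n^'n"
  assumes "positive_hermitian g" and "hermitian H"
  obtains p where "orthonormal_frame g p" "\<And>k l. k \<noteq> l \<Longrightarrow> sesq H (p $ k) (p $ l) = 0"
  using ex_orthonormal_frame[OF assms(1)] diagonalizing_frame_aux[OF assms] by blast

section \<open>Inverse, trace and characteristic polynomial in a unitary frame\<close>

definition cadj :: "complex^'n^'n \<Rightarrow> complex^'n^'n" where
  "cadj A = (\<chi> i j. cnj (A $ j $ i))"

lemma sesq_frame: "(cadj (transpose p) ** A ** transpose p) $ k $ l = sesq A (p $ k) (p $ l)"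
proof -
  have "(cadj (transpose p) ** A ** transpose p) $ k $ l =
    (\<Sum>j\<in>UNIV. \<Sum>i\<in>UNIV. cnj (p $ k $ i) * A $ i $ j * p $ l $ j)"
    by (simp add: matrix_matrix_mult_def cadj_def transpose_def sum_distrib_right)
  also have "\<dots> = sesq A (p $ k) (p $ l)"
    unfolding sesq_def by (subst sum.swap) (simp add: mult_ac)
  finally show ?thesis .
qed

lemma orthonormal_frame_matrix:
  assumes "orthonormal_frame g p"
  shows "cadj (transpose p) ** g ** transpose p = mat 1"
  using assms by (simp add: vec_eq_iff sesq_frame orthonormal_frame_def mat_def)

lemma matrix_inv_unique:
  fixes A B :: "'a::field^'n^'n"
  assumes "A ** B = mat 1"
  shows "matrix_inv A = B"
proof -
  have "invertible A"
    using assms invertible_right_inverse by blast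
  then have "matrix_inv A ** A = mat 1"
    unfolding invertible_def matrix_inv_def by (rule someI_ex[THEN conjunct2])
  then have "matrix_inv A ** (A ** B) = B"
    by (simp add: matrix_mul_assoc)
  then show ?thesis
    by (simp add: assms)
qed

text \<open>With the frame vectors as columns of \<open>P\<close>, orthonormality reads
  \<open>cadj P ** g ** P = mat 1\<close>, so \<open>cadj P ** g\<close> is a two-sided inverse of
  \<open>P\<close>.\<close>

lemma matrix_inv_orthonormal_frame:
  assumes "orthonormal_frame g p"
  shows "matrix_inv g = transpose p ** cadj (transpose p)"
proof -
  define P where "P = transpose p"
  have "cadj P ** g ** P = mat 1"
    using orthonormal_frame_matrix[OF assms] by (simp add: P_def)
  then have "P ** (cadj P ** g) = mat 1"
    by (simp add: matrix_left_right_inverse)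
  then have "(P ** cadj P) ** g = mat 1"
    by (simp add: matrix_mul_assoc)
  then have "g ** (P ** cadj P) = mat 1"
    by (simp add: matrix_left_right_inverse)
  then show ?thesis
    unfolding P_def by (rule matrix_inv_unique)
qed

lemma matrix_diff_ldistrib: "A ** (B - C) = A ** B - A ** (C :: 'a::ring_1^'n^'m)"
  by (simp add: vec_eq_iff matrix_matrix_mult_def algebra_simps sum_subtractf)

lemma matrix_diff_rdistrib: "(A - B) ** C = A ** C - B ** (C :: 'a::ring_1^'n^'m)"
  by (simp add: vec_eq_iff matrix_matrix_mult_def algebra_simps sum_subtractf)

text \<open>By cyclicity of the trace the endomorphism may be replaced by the matrix of
  \<open>A\<close> in the frame.\<close>

lemma trace_matrix_inv:
  assumes "orthonormal_frame g p"
  shows "trace (matrix_inv g ** A) = (\<Sum>k\<in>UNIV. sesq A (p $ k) (p $ k))"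
proof -
  define P where "P = transpose p"
  have "trace (matrix_inv g ** A) = trace (P ** (cadj P ** A))"
    by (simp add: matrix_inv_orthonormal_frame[OF assms] P_def matrix_mul_assoc)
  also have "\<dots> = trace (cadj P ** A ** P)"
    by (rule trace_mul_sym)
  also have "\<dots> = (\<Sum>k\<in>UNIV. sesq A (p $ k) (p $ k))"
    by (simp add: trace_def P_def sesq_frame)
  finally show ?thesis .
qed

text \<open>Conjugation by \<open>P\<close> turns \<open>matrix_inv g ** A\<close> into the matrix
  of \<open>A\<close> in the frame, which is diagonal by assumption; its entries are the
  eigenvalues.\<close>

lemma det_charpoly_frame:
  fixes A :: "complex^'n^'n"
  assumes p: "orthonormal_frame g p" and d: "\<And>k l. k \<noteq> l \<Longrightarrow> sesq A (p $ k) (p $ l) = 0"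
  shows "det (mat t - matrix_inv g ** A) = (\<Prod>k\<in>UNIV. t - sesq A (p $ k) (p $ k))"
proof -
  define P where "P = transpose p"
  define Q where "Q = cadj P ** g"
  have QP: "Q ** P = mat 1"
    using orthonormal_frame_matrix[OF p] by (simp add: P_def Q_def)
  then have PQ: "P ** Q = mat 1"
    by (simp add: matrix_left_right_inverse)
  have inv: "matrix_inv g = P ** cadj P"
    using matrix_inv_orthonormal_frame[OF p] by (simp add: P_def)
  have mt: "mat t = (\<chi> i j. t * (mat 1 :: complex^'n^'n) $ i $ j)"
    by (simp add: vec_eq_iff mat_def)
  have Qmt: "Q ** (mat t ** P) = mat t"
  proof -
    have "mat t ** P = (\<chi> i j. t * P $ i $ j)"
      by (simp add: vec_eq_iff matrix_matrix_mult_def mat_def if_distrib [of "\<lambda>x. x * _"] cong: if_cong)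
    then have "Q ** (mat t ** P) = (\<chi> i j. t * (Q ** P) $ i $ j)"
      by (simp add: vec_eq_iff matrix_matrix_mult_def sum_distrib_left mult_ac)
    then show ?thesis
      unfolding QP mt[symmetric] .
  qed
  have "det (mat t - matrix_inv g ** A) = det Q * det P * det (mat t - matrix_inv g ** A)"
    using det_mul[of Q P] by (simp add: QP)
  also have "\<dots> = det (Q ** (mat t - matrix_inv g ** A) ** P)"
    by (simp add: det_mul)
  also have "Q ** (mat t - matrix_inv g ** A) ** P = Q ** (mat t ** P) - (Q ** P) ** (cadj P ** A ** P)"
    by (simp add: inv matrix_mul_assoc matrix_diff_ldistrib matrix_diff_rdistrib)
  also have "\<dots> = mat t - cadj P ** A ** P"
    by (simp add: QP Qmt)
  also have "det \<dots> = (\<Prod>k\<in>UNIV. (mat t - cadj P ** A ** P) $ k $ k)"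
    by (rule det_diagonal) (auto simp: P_def sesq_frame d mat_def)
  also have "\<dots> = (\<Prod>k\<in>UNIV. t - sesq A (p $ k) (p $ k))"
    by (simp add: P_def sesq_frame mat_def)
  finally show ?thesis .
qed

section \<open>Wedge products and the Laplacian\<close>

lemma prod_sum_functions:
  fixes f :: "'n::finite \<Rightarrow> 'm::finite \<Rightarrow> 'a::comm_ring_1"
  shows "(\<Prod>l\<in>UNIV. \<Sum>x\<in>UNIV. f l x) = (\<Sum>u\<in>UNIV. \<Prod>l\<in>UNIV. f l (u l))"
proof -
  have "(\<Prod>l\<in>UNIV. \<Sum>x\<in>UNIV. f l x) = (\<Sum>u\<in>PiE UNIV (\<lambda>_. UNIV). \<Prod>l\<in>UNIV. f l (u l))"
    by (rule prod_sum_PiE) auto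
  then show ?thesis by (simp add: PiE_UNIV_domain)
qed

text \<open>Up to the factor \<open>2 ^ CARD('n)\<close> this is the wedge product of the
  \<open>B l\<close> on a basis indexed by pairs. The arguments are indices rather than vectors, so
  one formula serves for the real frame and for the complex coordinate covectors.\<close>

definition alternating_sum :: "('n::finite \<Rightarrow> 'n \<times> bool \<Rightarrow> 'n \<times> bool \<Rightarrow> complex) \<Rightarrow> complex" where
  "alternating_sum B = (\<Sum>\<pi> | \<pi> permutes (UNIV :: ('n \<times> bool) set).
      of_int (sign \<pi>) * (\<Prod>l\<in>UNIV. B l (\<pi> (l, False)) (\<pi> (l, True))))"

lemma prod_pairs:
  fixes f :: "'n::finite \<times> bool \<Rightarrow> 'a::comm_monoid_mult"
  shows "(\<Prod>s\<in>UNIV. f s) = (\<Prod>l\<in>UNIV. f (l, False) * f (l, True))"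
proof -
  have "(\<Prod>s\<in>UNIV. f s) = (\<Prod>l\<in>UNIV. \<Prod>b\<in>UNIV. f (l, b))"
    by (subst prod.cartesian_product) (simp add: UNIV_Times_UNIV)
  then show ?thesis by (simp add: UNIV_bool mult.commute)
qed

text \<open>A top-degree form picks up the determinant under a linear substitution. After expanding
  the product over all index maps \<open>w\<close>, the signed sum over \<pi> is the determinant of
  the rows of \<open>transpose M\<close> chosen by \<open>w\<close>; it vanishes when
  \<open>w\<close> repeats a row, and otherwise it is the sign of \<open>w\<close> times
  \<open>det M\<close>.\<close>

lemma alternating_sum_substitution:
  fixes M :: "complex^('n::finite \<times> bool)^('n \<times> bool)"
  shows "alternating_sum (\<lambda>l s t. \<Sum>x\<in>UNIV. \<Sum>y\<in>UNIV. M $ s $ x * B l x y * M $ t $ y)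
    = det M * alternating_sum B"
proof -
  define PB where "PB w = (\<Prod>l\<in>UNIV. B l (w (l, False)) (w (l, True)))" for w :: "'n \<times> bool \<Rightarrow> 'n \<times> bool"
  define P where "P = {\<pi>. \<pi> permutes (UNIV :: ('n \<times> bool) set)}"
  \<comment> \<open>Regroups an index map on pairs as a family of pairs of indices, one for each
    factor.\<close>
  define \<Theta> where "\<Theta> w = (\<lambda>l. (w (l, False), w (l, True)))" for w :: "'n \<times> bool \<Rightarrow> 'n \<times> bool"
  have bij: "bij \<Theta>"
  proof (rule bij_betw_byWitness[where f' = "\<lambda>u s. if snd s then snd (u (fst s)) else fst (u (fst s))"])
  qed (auto simp: \<Theta>_def fun_eq_iff)
  have expand: "(\<Prod>l\<in>UNIV. \<Sum>x\<in>UNIV. \<Sum>y\<in>UNIV. M $ \<pi> (l, False) $ x * B l x y * M $ \<pi> (l, True) $ y)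
      = (\<Sum>w\<in>UNIV. PB w * (\<Prod>s\<in>UNIV. M $ \<pi> s $ w s))" for \<pi>
  proof -
    have "(\<Prod>l\<in>UNIV. \<Sum>x\<in>UNIV. \<Sum>y\<in>UNIV. M $ \<pi> (l, False) $ x * B l x y * M $ \<pi> (l, True) $ y)
       = (\<Prod>l\<in>UNIV. \<Sum>q\<in>UNIV. M $ \<pi> (l, False) $ fst q * B l (fst q) (snd q) * M $ \<pi> (l, True) $ snd q)"
      by (simp add: sum.cartesian_product UNIV_Times_UNIV case_prod_beta)
    also have "\<dots> = (\<Sum>u\<in>UNIV. \<Prod>l\<in>UNIV. M $ \<pi> (l, False) $ fst (u l) * B l (fst (u l)) (snd (u l)) * M $ \<pi> (l, True) $ snd (u l))"
      by (rule prod_sum_functions)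
    also have "\<dots> = (\<Sum>w\<in>UNIV. \<Prod>l\<in>UNIV. M $ \<pi> (l, False) $ fst (\<Theta> w l) * B l (fst (\<Theta> w l)) (snd (\<Theta> w l)) * M $ \<pi> (l, True) $ snd (\<Theta> w l))"
      by (rule sum.reindex_bij_betw[OF bij, symmetric])
    also have "\<dots> = (\<Sum>w\<in>UNIV. PB w * (\<Prod>s\<in>UNIV. M $ \<pi> s $ w s))"
      by (intro sum.cong refl) (simp add: PB_def prod_pairs \<Theta>_def prod.distrib[symmetric] mult_ac)
    finally show ?thesis .
  qed
  have inner: "(\<Sum>\<pi>\<in>P. of_int (sign \<pi>) * (\<Prod>s\<in>UNIV. M $ \<pi> s $ w s))
      = (if w permutes UNIV then of_int (sign w) * det M else 0)" for w
  proof -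
    define N where "N = (\<chi> i. transpose M $ w i)"
    have "(\<Sum>\<pi>\<in>P. of_int (sign \<pi>) * (\<Prod>s\<in>UNIV. M $ \<pi> s $ w s)) = det N"
      by (simp add: det_def P_def N_def transpose_def)
    also have "\<dots> = (if w permutes UNIV then of_int (sign w) * det M else 0)"
    proof (cases "w permutes UNIV")
      case True
      then show ?thesis by (simp add: N_def det_permute_rows)
    next
      case False
      then have "\<not> inj w"
        using bij_imp_permutes[of w UNIV] by (auto simp: bij_def finite_UNIV_inj_surj)
      then obtain i j where ij: "i \<noteq> j" "w i = w j" unfolding inj_def by blast
      have "det N = 0"
        by (rule det_identical_rows[OF ij(1)]) (simp add: N_def row_def ij(2))
      then show ?thesis using False by simp
    qed
    finally show ?thesis .
  qed
  have "alternating_sum (\<lambda>l s t. \<Sum>x\<in>UNIV. \<Sum>y\<in>UNIV. M $ s $ x * B l x y * M $ t $ y)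
    = (\<Sum>\<pi>\<in>P. \<Sum>w\<in>UNIV. of_int (sign \<pi>) * (PB w * (\<Prod>s\<in>UNIV. M $ \<pi> s $ w s)))"
    unfolding alternating_sum_def P_def[symmetric] by (simp add: expand sum_distrib_left)
  also have "\<dots> = (\<Sum>w\<in>UNIV. PB w * (\<Sum>\<pi>\<in>P. of_int (sign \<pi>) * (\<Prod>s\<in>UNIV. M $ \<pi> s $ w s)))"
    by (subst sum.swap) (simp add: sum_distrib_left mult_ac)
  also have "\<dots> = (\<Sum>w\<in>UNIV. if w permutes UNIV then PB w * (of_int (sign w) * det M) else 0)"
    by (intro sum.cong refl) (simp add: inner)
  also have "\<dots> = (\<Sum>w\<in>P. PB w * (of_int (sign w) * det M))"
    by (simp add: P_def sum.If_cases)
  also have "\<dots> = det M * alternating_sum B"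
    by (simp add: alternating_sum_def P_def PB_def sum_distrib_left mult_ac)
  finally show ?thesis .
qed

text \<open>The form \<open>i \<Sum> a\<^sub>k\<^sub>j dz\<^sup>j \<and> d\<bar>z\<^sup>k\<close> in the basis \<open>dz\<^sup>j, d\<bar>z\<^sup>k\<close>, whose elements are indexed by
  \<open>(j, False)\<close> and \<open>(k, True)\<close>.\<close>

definition form_coeff :: "complex^'n^'n \<Rightarrow> 'n \<times> bool \<Rightarrow> 'n \<times> bool \<Rightarrow> complex" where
  "form_coeff a x y =
     (if snd x then if snd y then 0 else - \<i> * a $ fst x $ fst y
      else if snd y then \<i> * a $ fst y $ fst x else 0)"

lemma sum_pairs:
  fixes f :: "'n::finite \<times> bool \<Rightarrow> 'a::comm_monoid_add"
  shows "(\<Sum>s\<in>UNIV. f s) = (\<Sum>l\<in>UNIV. f (l, False)) + (\<Sum>l\<in>UNIV. f (l, True))"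
proof -
  have "(\<Sum>s\<in>UNIV. f s) = (\<Sum>l\<in>UNIV. \<Sum>b\<in>UNIV. f (l, b))"
    by (subst sum.cartesian_product) (simp add: UNIV_Times_UNIV)
  then show ?thesis by (simp add: UNIV_bool sum.distrib add.commute)
qed

text \<open>Row \<open>s\<close> holds the values on \<open>std_frame s\<close> of the covectors
  dz^j (second component \<open>False\<close>) and of their conjugates
  (\<open>True\<close>).\<close>

definition frame_coeff :: "complex^('n::finite \<times> bool)^('n \<times> bool)" where
  "frame_coeff = (\<chi> s x. if snd x then cnj (std_frame s $ fst x) else std_frame s $ fst x)"

lemma form_of_std_frame:
  "form_of a (std_frame s) (std_frame t) =
    (\<Sum>x\<in>UNIV. \<Sum>y\<in>UNIV. frame_coeff $ s $ x * form_coeff a x y * frame_coeff $ t $ y)"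
proof -
  have "(\<Sum>x\<in>UNIV. \<Sum>y\<in>UNIV. frame_coeff $ s $ x * form_coeff a x y * frame_coeff $ t $ y) =
    (\<Sum>j\<in>UNIV. \<Sum>k\<in>UNIV. \<i> * a $ k $ j * std_frame s $ j * cnj (std_frame t $ k)) +
    (\<Sum>k\<in>UNIV. \<Sum>j\<in>UNIV. - (\<i> * a $ k $ j * std_frame t $ j * cnj (std_frame s $ k)))"
    by (simp add: sum_pairs form_coeff_def frame_coeff_def mult_ac)
  also have "\<dots> = (\<Sum>j\<in>UNIV. \<Sum>k\<in>UNIV. \<i> * a $ k $ j * std_frame s $ j * cnj (std_frame t $ k)) +
    (\<Sum>j\<in>UNIV. \<Sum>k\<in>UNIV. - (\<i> * a $ k $ j * std_frame t $ j * cnj (std_frame s $ k)))"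
    by (subst (2) sum.swap) simp
  also have "\<dots> = form_of a (std_frame s) (std_frame t)"
    by (simp add: form_of_def sum_distrib_left sum.distrib[symmetric] algebra_simps sum_subtractf sum_negf)
  finally show ?thesis ..
qed

text \<open>Passes from the real frame to the complex coordinate covectors, where a substitution
  \<open>Q ** a ** R\<close> acts in blocks. The determinant of \<open>frame_coeff\<close> is a
  common factor of all wedge products and is never evaluated.\<close>

lemma wedge_on_frame_eq:
  "wedge_on_frame (\<lambda>l. form_of (a l)) =
    det (frame_coeff :: complex^('n \<times> bool)^('n \<times> bool)) * alternating_sum (\<lambda>l. form_coeff (a l)) / 2 ^ CARD('n)" for a :: "'n::finite \<Rightarrow> complex^'n^'n"
proof -
  have "alternating_sum (\<lambda>l s t. form_of (a l) (std_frame s) (std_frame t)) = det (frame_coeff :: complex^('n \<times> bool)^('n \<times> bool)) * alternating_sum (\<lambda>l. form_coeff (a l))"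
    unfolding form_of_std_frame by (rule alternating_sum_substitution)
  then show ?thesis
    by (simp add: wedge_on_frame_def alternating_sum_def)
qed

text \<open>The substitution on covectors that takes \<open>a\<close> to \<open>Q ** a ** R\<close>:
  its block on the dz^j is the transpose of \<open>R\<close>, its block on the conjugates is
  \<open>Q\<close>.\<close>

definition block_matrix :: "complex^'n^'n \<Rightarrow> complex^'n^'n \<Rightarrow> complex^('n::finite \<times> bool)^('n \<times> bool)" where
  "block_matrix Q R = (\<chi> s x. if snd s = snd x then if snd s then Q $ fst s $ fst x else R $ fst x $ fst s else 0)"

lemma form_coeff_mult:
  "form_coeff (Q ** a ** R) s t =
    (\<Sum>x\<in>UNIV. \<Sum>y\<in>UNIV. block_matrix Q R $ s $ x * form_coeff a x y * block_matrix Q R $ t $ y)"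
proof -
  obtain j b where s: "s = (j, b)" by (cases s)
  obtain k c where t: "t = (k, c)" by (cases t)
  have 1: "(Q ** a ** R) $ j $ k = (\<Sum>x\<in>UNIV. \<Sum>y\<in>UNIV. Q $ j $ x * a $ x $ y * R $ y $ k)" for j k
    unfolding matrix_matrix_mult_def by (subst sum.swap) (simp add: sum_distrib_right)
  have 2: "(Q ** a ** R) $ j $ k = (\<Sum>y\<in>UNIV. \<Sum>x\<in>UNIV. Q $ j $ x * a $ x $ y * R $ y $ k)" for j k
    unfolding 1 by (rule sum.swap)
  show ?thesis
    by (cases b; cases c)
      (simp_all add: s t form_coeff_def sum_pairs block_matrix_def 1[of j k] 2[of k j] sum_distrib_left mult_ac sum_negf)
qed

text \<open>\<open>Q\<close> and \<open>R\<close> are independent, so this covers conjugation, where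
  they are inverse to each other, as well as multiplication on one side only.\<close>

lemma wedge_on_frame_mult:
  "wedge_on_frame (\<lambda>l. form_of (Q ** a l ** R)) =
    det (block_matrix Q R) * wedge_on_frame (\<lambda>l. form_of (a l))"
proof -
  have "alternating_sum (\<lambda>l. form_coeff (Q ** a l ** R)) = alternating_sum (\<lambda>l s t.
      \<Sum>x\<in>UNIV. \<Sum>y\<in>UNIV. block_matrix Q R $ s $ x * form_coeff (a l) x y * block_matrix Q R $ t $ y)"
    by (simp only: form_coeff_mult[abs_def])
  also have "\<dots> = det (block_matrix Q R) * alternating_sum (\<lambda>l. form_coeff (a l))"
    by (rule alternating_sum_substitution)
  finally show ?thesis
    by (simp add: wedge_on_frame_eq)
qed

text \<open>Only the permutations that preserve the set of pairs \<open>{(l, False), (l, True)}\<close> contribute to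
  the top power of the standard form; they all contribute with the same sign.\<close>

definition eps :: "'n \<times> bool \<Rightarrow> 'n \<times> bool \<Rightarrow> int" where
  "eps s t = (if fst s = fst t then if snd s = snd t then 0 else if snd t then 1 else - 1 else 0)"

lemma form_of_mat_1_std_frame:
  "form_of (mat 1) (std_frame s) (std_frame t) = 2 * of_int (eps s (t :: 'n::finite \<times> bool))"
proof -
  define v :: "complex^'n" where "v = std_frame s"
  define w :: "complex^'n" where "w = std_frame t"
  have "form_of (mat 1) v w = \<i> * (\<Sum>j\<in>UNIV. \<Sum>k\<in>UNIV. if k = j then v $ j * cnj (w $ j) - w $ j * cnj (v $ j) else 0)"
    unfolding form_of_def mat_def by (intro arg_cong[where f="(*) \<i>"] sum.cong refl) auto
  also have "\<dots> = \<i> * (\<Sum>j\<in>UNIV. v $ j * cnj (w $ j) - w $ j * cnj (v $ j))"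
    by simp
  also have "(\<Sum>j\<in>UNIV. v $ j * cnj (w $ j) - w $ j * cnj (v $ j)) =
     (\<Sum>j\<in>UNIV. if j = fst s then - 2 * \<i> * of_int (eps s t) else 0)"
  proof (intro sum.cong refl)
    fix j
    obtain a b where s: "s = (a, b)" by (cases s)
    obtain c d where t: "t = (c, d)" by (cases t)
    have v: "v $ j = (if j = a then if b then \<i> else 1 else 0)"
      by (auto simp: v_def s std_frame_def axis_def)
    have w: "w $ j = (if j = c then if d then \<i> else 1 else 0)"
      by (auto simp: w_def t std_frame_def axis_def)
    show "v $ j * cnj (w $ j) - w $ j * cnj (v $ j) = (if j = fst s then - 2 * \<i> * of_int (eps s t) else 0)"
      unfolding v w s t eps_def by (cases b; cases d; cases "j = a"; cases "j = c"; simp)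
  qed
  also have "\<dots> = - 2 * \<i> * of_int (eps s t)" by simp
  also have "\<i> * (- 2 * \<i> * of_int (eps s t)) = 2 * complex_of_int (eps s t)"
    by (simp only: complex_eq_iff) simp
  finally show ?thesis unfolding v_def w_def .
qed

lemma inj_imp_permutation: "inj p \<Longrightarrow> permutation (p :: 'a::finite \<Rightarrow> 'a)"
  by (simp add: permutation finite_UNIV_inj_surj bij_def)

text \<open>Exchanging the two slots of a pair reverses both the sign of \<pi> and one factor, so
  pairs in the wrong order can be corrected one at a time; the induction counts them. When all are
  in order and no factor vanishes, \<pi> applies one permutation \<sigma> to both copies of the
  index set.\<close>

lemma sign_prod_eps_nonneg:
  assumes "\<pi> permutes (UNIV :: ('n::finite \<times> bool) set)"
  shows "sign \<pi> * (\<Prod>l\<in>UNIV. eps (\<pi> (l, False)) (\<pi> (l, True))) \<ge> 0"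
  using assms
proof (induction "card {l. snd (\<pi> (l, False))}" arbitrary: \<pi>)
  case 0
  then have F: "\<not> snd (\<pi> (l, False))" for l
    by (auto simp: card_eq_0_iff)
  have bij: "bij \<pi>"
    using 0 by (simp add: permutes_bij)
  show ?case
  proof (cases "\<forall>l. eps (\<pi> (l, False)) (\<pi> (l, True)) \<noteq> 0")
    case False
    then have z: "(\<Prod>l\<in>UNIV. eps (\<pi> (l, False)) (\<pi> (l, True))) = 0"
      by (intro prod_zero) auto
    show ?thesis unfolding z by simp
  next
    case True
    define \<sigma> where "\<sigma> l = fst (\<pi> (l, False))" for l
    have \<pi>F: "\<pi> (l, False) = (\<sigma> l, False)" for l
      using F[of l] by (auto simp: \<sigma>_def prod_eq_iff)
    have \<pi>T: "\<pi> (l, True) = (\<sigma> l, True)" for l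
      using True[rule_format, of l] F[of l] by (auto simp: \<sigma>_def prod_eq_iff eps_def split: if_splits)
    have inj\<sigma>: "inj \<sigma>"
      using bij \<pi>F by (metis bij_pointE injI prod.inject)
    define p where "p s = (if snd s then s else (\<sigma> (fst s), False))" for s
    define \<tau> :: "'n \<times> bool \<Rightarrow> 'n \<times> bool" where "\<tau> s = (fst s, \<not> snd s)" for s
    have "inj p"
    proof (rule injI)
      fix s t assume e: "p s = p t"
      obtain l b m c where s: "s = (l, b)" "t = (m, c)" by (cases s; cases t) auto
      show "s = t"
        using e inj\<sigma> unfolding s by (cases b; cases c) (simp_all add: p_def inj_eq)
    qed
    moreover have "inj \<tau>"
      by (rule injI) (simp add: \<tau>_def prod_eq_iff)
    ultimately have perm: "permutation p" "permutation \<tau>"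
      by (auto intro: inj_imp_permutation)
    \<comment> \<open>The two factors are conjugate under the exchange \<tau> of the copies, so
      their signs agree and \<pi> is even.\<close>
    have "\<pi> = p \<circ> (\<tau> \<circ> p \<circ> \<tau>)"
    proof
      fix s :: "'n \<times> bool"
      obtain l b where s: "s = (l, b)" by (cases s)
      show "\<pi> s = (p \<circ> (\<tau> \<circ> p \<circ> \<tau>)) s"
        unfolding s by (cases b) (simp_all add: p_def \<tau>_def \<pi>F \<pi>T)
    qed
    then have "sign \<pi> = sign p * (sign \<tau> * sign p * sign \<tau>)"
      by (simp only: sign_compose permutation_compose perm)
    then have "sign \<pi> = 1"
      by (simp add: mult_ac)
    moreover have "(\<Prod>l\<in>UNIV. eps (\<pi> (l, False)) (\<pi> (l, True))) = 1"
      by (simp add: \<pi>F \<pi>T eps_def)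
    ultimately show ?thesis by simp
  qed
next
  case (Suc n)
  then obtain l where l: "snd (\<pi> (l, False))"
    by (metis (mono_tags, lifting) Zero_not_Suc card.empty empty_Collect_eq)
  show ?case
  proof (cases "eps (\<pi> (l, False)) (\<pi> (l, True)) = 0")
    case True
    then have z: "(\<Prod>l\<in>UNIV. eps (\<pi> (l, False)) (\<pi> (l, True))) = 0"
      by (intro prod_zero) auto
    show ?thesis unfolding z by simp
  next
    case False
    define \<rho> where "\<rho> = \<pi> \<circ> Transposition.transpose (l, False) (l, True)"
    have perm: "permutation \<pi>"
      using Suc.prems by (auto simp: permutation_permutes)
    have \<rho>: "\<rho> permutes UNIV"
      unfolding \<rho>_def by (intro permutes_compose permutes_swap_id Suc.prems) auto
    have sign: "sign \<rho> = - sign \<pi>"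
      unfolding \<rho>_def by (subst sign_compose[OF perm permutation_swap_id]) (simp add: sign_swap_id)
    have \<rho>l: "\<rho> (l, False) = \<pi> (l, True)" "\<rho> (l, True) = \<pi> (l, False)"
      by (simp_all add: \<rho>_def)
    have \<rho>m: "\<rho> (m, b) = \<pi> (m, b)" if "m \<noteq> l" for m b
      using that by (auto simp: \<rho>_def Transposition.transpose_def)
    have "{m. snd (\<rho> (m, False))} = {m. snd (\<pi> (m, False))} - {l}"
      using l False \<rho>l \<rho>m by (auto simp: eps_def split: if_splits) metis+
    then have "n = card {m. snd (\<rho> (m, False))}"
      using Suc.hyps(2) l by simp
    then have "0 \<le> sign \<rho> * (\<Prod>l\<in>UNIV. eps (\<rho> (l, False)) (\<rho> (l, True)))"
      using \<rho> by (rule Suc.hyps(1))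
    also have "(\<Prod>l\<in>UNIV. eps (\<rho> (l, False)) (\<rho> (l, True))) = - (\<Prod>l\<in>UNIV. eps (\<pi> (l, False)) (\<pi> (l, True)))"
    proof -
      have "(\<Prod>m\<in>UNIV - {l}. eps (\<rho> (m, False)) (\<rho> (m, True))) = (\<Prod>m\<in>UNIV - {l}. eps (\<pi> (m, False)) (\<pi> (m, True)))"
        by (intro prod.cong) (auto simp: \<rho>m)
      moreover have "eps (\<rho> (l, False)) (\<rho> (l, True)) = - eps (\<pi> (l, False)) (\<pi> (l, True))"
        unfolding \<rho>l by (auto simp: eps_def)
      ultimately show ?thesis
        by (simp add: prod.remove[of UNIV l])
    qed
    finally show ?thesis by (simp add: sign)
  qed
qed

text \<open>No permutation contributes a negative term and the identity contributes a positive one,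
  so the sum cannot cancel and need not be computed.\<close>

lemma wedge_on_frame_mat_1:
  "\<exists>r::real. r > 0 \<and> wedge_on_frame (\<lambda>l::'n::finite. form_of (mat 1)) = of_real r"
proof -
  define P where "P = {\<pi>. \<pi> permutes (UNIV :: ('n \<times> bool) set)}"
  define T where "T \<pi> = sign \<pi> * (\<Prod>l\<in>UNIV. eps (\<pi> (l, False)) (\<pi> (l, True)))" for \<pi> :: "'n \<times> bool \<Rightarrow> 'n \<times> bool"
  have fin: "finite P" by (simp add: P_def)
  have "wedge_on_frame (\<lambda>l::'n::finite. form_of (mat 1)) = (\<Sum>\<pi>\<in>P. of_int (T \<pi>))"
    unfolding wedge_on_frame_def P_def[symmetric] form_of_mat_1_std_frame T_def
    by (simp add: prod.distrib sum_divide_distrib)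
  also have "\<dots> = of_real (of_int (\<Sum>\<pi>\<in>P. T \<pi>))" by simp
  finally have "wedge_on_frame (\<lambda>l::'n::finite. form_of (mat 1)) = of_real (of_int (\<Sum>\<pi>\<in>P. T \<pi>))" .
  moreover have "(\<Sum>\<pi>\<in>P. T \<pi>) > 0"
  proof (rule sum_pos2[OF fin])
    show "id \<in> P" by (simp add: P_def permutes_id)
    show "0 < T id" by (simp add: T_def eps_def)
    show "0 \<le> T \<pi>" if "\<pi> \<in> P" for \<pi>
      using that sign_prod_eps_nonneg by (simp add: P_def T_def)
  qed
  ultimately show ?thesis
    by (intro exI[of _ "real_of_int (\<Sum>\<pi>\<in>P. T \<pi>)"]) (simp only: of_int_0_less_iff simp_thms)
qed

lemma wedge_on_frame_mat_1_nz: "wedge_on_frame (\<lambda>l::'n::finite. form_of (mat 1)) \<noteq> 0"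
  using wedge_on_frame_mat_1[where 'n='n] by fastforce

section \<open>The Laplacian as a trace\<close>

lemma laplacian_mat_1_conj:
  fixes U V b :: "complex^'n^'n"
  assumes U: "V ** U = mat 1"
  shows "laplacian (mat 1) (U ** b) = laplacian (mat 1) (b ** U)"
proof -
  have UV: "U ** V = mat 1" using U by (simp add: matrix_left_right_inverse)
  \<comment> \<open>Conjugation fixes \<open>mat 1\<close>, whose wedge power is nonzero, so its
    determinant factor is 1.\<close>
  have d: "det (block_matrix U V) = 1"
    using wedge_on_frame_mult[of U "\<lambda>l. mat 1" V] wedge_on_frame_mat_1_nz[where 'n='n] by (simp add: UV)
  have "wedge_on_frame (\<lambda>m. if m = l then form_of (U ** b) else form_of (mat 1)) =
     wedge_on_frame (\<lambda>m. if m = l then form_of (b ** U) else form_of (mat 1))" for l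
  proof -
    \<comment> \<open>\<open>U ** b\<close> is the conjugate of \<open>b ** U\<close> by
      \<open>U\<close>.\<close>
    have "(\<lambda>m. if m = l then form_of (U ** b) else form_of (mat 1)) = (\<lambda>m. form_of (U ** (if m = l then b ** U else mat 1) ** V))"
      using UV by (auto simp: fun_eq_iff matrix_mul_assoc[symmetric])
    then have "wedge_on_frame (\<lambda>m. if m = l then form_of (U ** b) else form_of (mat 1)) = wedge_on_frame (\<lambda>m. form_of (if m = l then b ** U else mat 1))"
      by (simp add: wedge_on_frame_mult d)
    also have "(\<lambda>m. form_of (if m = l then b ** U else mat 1)) = (\<lambda>m. if m = l then form_of (b ** U) else form_of (mat 1))"
      by auto
    finally show ?thesis .
  qed
  then show ?thesis by (simp add: laplacian_def)
qed

lemma form_of_sum: "form_of (\<Sum>i\<in>I. a i) v w = (\<Sum>i\<in>I. form_of (a i) v w)"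
  by (simp add: form_of_def sum_component sum_distrib_left sum_distrib_right sum.swap[of _ I])

lemma form_of_smult: "form_of (\<chi> k j. c * a $ k $ j) v w = c * form_of a v w"
  by (simp add: form_of_def sum_distrib_left mult_ac)

text \<open>Isolates the single factor that contains \<open>a\<close>; linearity in \<open>a\<close>
  is read off from this form.\<close>

lemma laplacian_split:
  fixes g :: "complex^'n^'n"
  shows "laplacian g a = (\<Sum>l\<in>UNIV. (\<Sum>\<pi> | \<pi> permutes (UNIV :: ('n \<times> bool) set).
     form_of a (std_frame (\<pi> (l, False))) (std_frame (\<pi> (l, True))) *
     (of_int (sign \<pi>) * (\<Prod>m\<in>UNIV - {l}. form_of g (std_frame (\<pi> (m, False))) (std_frame (\<pi> (m, True)))))) / 2 ^ CARD('n))
     / wedge_on_frame (\<lambda>m. form_of g)"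
proof -
  have "(\<Prod>m\<in>UNIV. (if m = l then form_of a else form_of g) (std_frame (\<pi> (m, False))) (std_frame (\<pi> (m, True)))) =
    form_of a (std_frame (\<pi> (l, False))) (std_frame (\<pi> (l, True))) *
     (\<Prod>m\<in>UNIV - {l}. form_of g (std_frame (\<pi> (m, False))) (std_frame (\<pi> (m, True))))" for l and \<pi> :: "'n \<times> bool \<Rightarrow> 'n \<times> bool"
    by (simp add: prod.remove[of UNIV l])
  then show ?thesis
    unfolding laplacian_def wedge_on_frame_def[of "\<lambda>m. if m = _ then form_of a else form_of g"] by (simp add: mult_ac)
qed

lemma laplacian_sum: "laplacian g (\<Sum>i\<in>I. a i) = (\<Sum>i\<in>I. laplacian g (a i))"
  unfolding laplacian_split form_of_sum
  by (simp add: sum_distrib_right sum_divide_distrib sum.swap[of _ I])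

lemma laplacian_smult: "laplacian g (\<chi> k j. c * a $ k $ j) = c * laplacian g a"
  unfolding laplacian_split form_of_smult
  by (simp add: sum_distrib_left mult_ac)

definition matrix_unit :: "'n \<Rightarrow> 'n \<Rightarrow> complex^'n^'n" where
  "matrix_unit k j = (\<chi> a b. if a = k \<and> b = j then 1 else 0)"

lemma matrix_unit_mult: "matrix_unit k j ** matrix_unit l m = (if j = l then matrix_unit k m else 0)"
proof -
  have "(matrix_unit k j ** matrix_unit l m) $ a $ b = (\<Sum>c\<in>UNIV. if c = j then (if a = k \<and> j = l \<and> b = m then 1 else 0) else 0)" for a b
    unfolding matrix_matrix_mult_def matrix_unit_def
  proof (simp, intro conjI impI)
  qed (auto simp: if_distrib[of "\<lambda>x. x * _"] if_distrib[of "\<lambda>x. _ * x"] cong: if_cong intro!: sum.neutral)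
  then show ?thesis by (simp add: vec_eq_iff matrix_unit_def)
qed

lemma laplacian_0: "laplacian g 0 = 0"
  using laplacian_sum[of g "\<lambda>_. 0" "{}"] by simp

lemma laplacian_add: "laplacian g (a + b) = laplacian g a + laplacian g b"
  using laplacian_sum[of g "\<lambda>i. if i then a else b" UNIV] by (simp add: UNIV_bool add.commute)

lemma matrix_add_rdistrib: "(A + B) ** C = A ** C + B ** (C :: complex^'n^'n)"
  by (simp add: vec_eq_iff matrix_matrix_mult_def algebra_simps sum.distrib)

text \<open>Linearity removes the identity from the invertible matrix \<open>mat 1 + E\<close>,
  which carries the commutation over to singular matrices \<open>E\<close>.\<close>

lemma laplacian_mat_1_commute:
  assumes E: "(mat 1 + V) ** (mat 1 + E) = mat 1"
  shows "laplacian (mat 1) (E ** b) = laplacian (mat 1) (b ** E)"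
  using laplacian_mat_1_conj[OF E, of b]
  by (simp add: matrix_add_ldistrib matrix_add_rdistrib laplacian_add)

text \<open>A linear functional that does not distinguish \<open>E ** b\<close> from
  \<open>b ** E\<close> for matrix units \<open>E\<close> is a multiple of the trace; the value at
  \<open>mat 1\<close> fixes the multiple.\<close>

lemma laplacian_mat_1: "laplacian (mat 1) b = trace (b :: complex^'n^'n)"
proof -
  let ?L = "laplacian (mat 1 :: complex^'n^'n)"
  have com: "?L (matrix_unit k j ** b) = ?L (b ** matrix_unit k j)" for k j :: 'n and b
  proof (cases "k = j")
    case True
    \<comment> \<open>A diagonal unit \<open>E\<close> is idempotent, so the inverse of
      \<open>mat 1 + E\<close> is \<open>mat 1 - E / 2\<close>.\<close>
    have "(mat 1 + (\<chi> a b. (-1/2) * matrix_unit k j $ a $ b)) ** (mat 1 + matrix_unit k j) = mat 1"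
    proof -
      have "(\<chi> a b. (-1/2) * matrix_unit k j $ a $ b) ** matrix_unit k j = (\<chi> a b. (-1/2) * (matrix_unit k j ** matrix_unit k j) $ a $ b)"
        by (simp add: vec_eq_iff matrix_matrix_mult_def sum_distrib_left mult_ac)
      then show ?thesis
        using True by (simp add: matrix_add_ldistrib matrix_add_rdistrib matrix_unit_mult)
          (simp add: vec_eq_iff matrix_unit_def)
    qed
    then show ?thesis by (rule laplacian_mat_1_commute)
  next
    case False
    \<comment> \<open>An off-diagonal unit squares to zero, so here the inverse is
      \<open>mat 1 - E\<close>.\<close>
    have "(mat 1 + (- matrix_unit k j)) ** (mat 1 + matrix_unit k j) = mat 1"
    proof -
      have "(- matrix_unit k j) ** matrix_unit k j = - (matrix_unit k j ** matrix_unit k j)"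
        by (simp add: vec_eq_iff matrix_matrix_mult_def sum_negf)
      then show ?thesis
        using False by (simp add: matrix_add_ldistrib matrix_diff_rdistrib matrix_unit_mult)
    qed
    then show ?thesis by (rule laplacian_mat_1_commute)
  qed
  have off: "?L (matrix_unit k j) = 0" if "k \<noteq> j" for k j
    using com[of k k "matrix_unit k j"] that by (simp add: matrix_unit_mult laplacian_0)
  have diag: "?L (matrix_unit k k) = ?L (matrix_unit j j)" for k j
    using com[of k j "matrix_unit j k"] by (simp add: matrix_unit_mult)
  have decomp: "b = (\<Sum>k\<in>UNIV. \<Sum>j\<in>UNIV. (\<chi> x y. b $ k $ j * matrix_unit k j $ x $ y))" for b :: "complex^'n^'n"
  proof -
    have "(\<Sum>k\<in>UNIV. \<Sum>j\<in>UNIV. b $ k $ j * matrix_unit k j $ x $ y) = (\<Sum>k\<in>UNIV. if k = x then (\<Sum>j\<in>UNIV. if j = y then b $ x $ y else 0) else 0)" for x y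
      unfolding matrix_unit_def by (intro sum.cong refl) (auto simp: if_distrib[of "\<lambda>x. _ * x"] cong: if_cong intro!: sum.neutral)
    then show ?thesis by (simp add: vec_eq_iff sum_component)
  qed
  have L: "?L b = (\<Sum>k\<in>UNIV. b $ k $ k * ?L (matrix_unit k k))" for b
  proof -
    have "?L b = (\<Sum>k\<in>UNIV. \<Sum>j\<in>UNIV. b $ k $ j * ?L (matrix_unit k j))"
      by (subst decomp) (simp only: laplacian_sum laplacian_smult)
    also have "\<dots> = (\<Sum>k\<in>UNIV. \<Sum>j\<in>UNIV. if j = k then b $ k $ k * ?L (matrix_unit k k) else 0)"
      by (intro sum.cong refl) (auto simp: off)
    finally show ?thesis by simp
  qed
  define i0 :: 'n where "i0 = undefined"
  have "?L (mat 1) = of_nat CARD('n)"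
    using wedge_on_frame_mat_1_nz[where 'n='n] by (simp add: laplacian_def)
  moreover have "?L (mat 1) = (\<Sum>k\<in>UNIV. ?L (matrix_unit k k))"
    by (subst L) (simp add: mat_def)
  moreover have "(\<Sum>k\<in>UNIV. ?L (matrix_unit k k)) = of_nat CARD('n) * ?L (matrix_unit i0 i0)"
  proof -
    have "(\<Sum>k\<in>UNIV. ?L (matrix_unit k k)) = (\<Sum>k\<in>(UNIV::'n set). ?L (matrix_unit i0 i0))"
      by (rule sum.cong[OF refl diag])
    then show ?thesis by simp
  qed
  ultimately have "?L (matrix_unit i0 i0) = 1" by simp
  then have "?L (matrix_unit k k) = 1" for k using diag[of k i0] by simp
  then show ?thesis by (subst L) (simp add: trace_def)
qed

text \<open>Left multiplication by \<open>g\<close> carries \<open>h ** a\<close> to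
  \<open>a\<close> and \<open>mat 1\<close> to \<open>g\<close>, and it scales numerator and
  denominator of the quotient by the same determinant.\<close>

theorem laplacian_eq_trace:
  fixes g a :: "complex^'n^'n"
  assumes g: "g ** h = mat 1"
  shows "laplacian g a = trace (h ** a)"
proof -
  let ?b = "h ** a"
  have ga: "g ** ?b = a" by (simp add: matrix_mul_assoc g)
  define d where "d = det (block_matrix g (mat 1))"
  have 1: "wedge_on_frame (\<lambda>m. form_of g) = d * wedge_on_frame (\<lambda>m::'n. form_of (mat 1))"
    using wedge_on_frame_mult[of g "\<lambda>m. mat 1" "mat 1"] by (simp add: d_def)
  have 2: "wedge_on_frame (\<lambda>m. if m = l then form_of a else form_of g) =
     d * wedge_on_frame (\<lambda>m. if m = l then form_of ?b else form_of (mat 1))" for l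
  proof -
    have "(\<lambda>m. if m = l then form_of a else form_of g) = (\<lambda>m. form_of (g ** (if m = l then ?b else mat 1) ** mat 1))"
      using ga by (auto simp: fun_eq_iff)
    then have "wedge_on_frame (\<lambda>m. if m = l then form_of a else form_of g) = d * wedge_on_frame (\<lambda>m. form_of (if m = l then ?b else mat 1))"
      by (simp only: wedge_on_frame_mult d_def)
    also have "(\<lambda>m. form_of (if m = l then ?b else mat 1)) = (\<lambda>m. if m = l then form_of ?b else form_of (mat 1))"
      by auto
    finally show ?thesis .
  qed
  have "wedge_on_frame (\<lambda>m::'n. form_of (mat 1)) = det (block_matrix h (mat 1)) * wedge_on_frame (\<lambda>m. form_of g)"
    using wedge_on_frame_mult[of h "\<lambda>m. g" "mat 1"] g[unfolded matrix_left_right_inverse[of g h]] by simp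
  then have "d \<noteq> 0"
    using wedge_on_frame_mat_1_nz[where 'n='n] 1 by auto
  then have "laplacian g a = laplacian (mat 1) ?b"
    unfolding laplacian_def 1 2 by (simp add: sum_distrib_left[symmetric])
  then show ?thesis by (simp add: laplacian_mat_1)
qed

lemma orthonormal_frame_inverse:
  assumes "orthonormal_frame g p"
  shows "g ** matrix_inv g = mat 1"
proof -
  define P where "P = transpose p"
  have "cadj P ** g ** P = mat 1"
    using orthonormal_frame_matrix[OF assms] by (simp add: P_def)
  then have "P ** (cadj P ** g) = mat 1"
    by (simp add: matrix_left_right_inverse)
  then have "(P ** cadj P) ** g = mat 1"
    by (simp add: matrix_mul_assoc)
  then show ?thesis
    by (simp add: matrix_inv_orthonormal_frame[OF assms] P_def matrix_left_right_inverse)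
qed

section \<open>Reality and positivity of the volume density\<close>

lemma wedge_on_frame_form_of_real:
  assumes "hermitian g"
  shows "Im (wedge_on_frame (\<lambda>l. form_of g)) = 0"
proof -
  have "cnj (form_of g v w) = form_of g v w" for v w
  proof -
    have "cnj (form_of g v w) = - \<i> * (\<Sum>j\<in>UNIV. \<Sum>k\<in>UNIV. g $ j $ k * (cnj (v $ j) * w $ k - cnj (w $ j) * v $ k))"
      using assms by (simp add: form_of_def hermitian_def)
    also have "\<dots> = form_of g v w"
      unfolding form_of_def by (subst sum.swap) (simp add: sum_negf[symmetric] sum_distrib_left algebra_simps)
    finally show ?thesis .
  qed
  then have "cnj (wedge_on_frame (\<lambda>l. form_of g)) = wedge_on_frame (\<lambda>l. form_of g)"
    by (simp add: wedge_on_frame_def)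
  then show ?thesis
    by (metis Reals_cnj_iff complex_is_Real_iff)
qed

lemma continuous_on_wedge_on_frame [continuous_intros]:
  assumes "continuous_on S g"
  shows "continuous_on S (\<lambda>x. wedge_on_frame (\<lambda>l. form_of (g x)))"
  unfolding wedge_on_frame_def form_of_def
  by (intro continuous_intros continuous_on_divide assms) auto

theorem wedge_on_frame_pos:
  fixes g :: "complex^'n^'n"
  assumes g: "positive_hermitian g"
  shows "Re (wedge_on_frame (\<lambda>l. form_of g)) > 0"
proof -
  define h where "h t = mat 1 + t *\<^sub>R (g - mat 1)" for t :: real
  have sh: "sesq (h t) v w = (1 - t) * sesq (mat 1) v w + t * sesq g v w" for t v w
    unfolding h_def sesq_def
    by (simp add: sum_distrib_left sum.distrib[symmetric] sum_subtractf[symmetric] scaleR_conv_of_real[where 'a=complex] algebra_simps)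
  have pos: "positive_hermitian (h t)" if "0 \<le> t" "t \<le> 1" for t
    unfolding positive_hermitian_iff
  proof (intro conjI allI impI)
    show "hermitian (h t)"
      using g unfolding positive_hermitian_iff hermitian_def h_def mat_def by auto
    fix v :: "complex^'n" assume v: "v \<noteq> 0"
    have "0 < Re (sesq g v v)" "0 < Re (sesq (mat 1) v v)"
      using g v positive_hermitian_mat_1 unfolding positive_hermitian_iff by blast+
    then have "0 < (1 - t) * Re (sesq (mat 1) v v) + t * Re (sesq g v v)"
      using that by (cases "t = 0") (auto intro: add_nonneg_pos)
    then show "0 < Re (sesq (h t) v v)"
      by (simp add: sh)
  qed
  define \<phi> where "\<phi> t = Re (wedge_on_frame (\<lambda>l. form_of (h t)))" for t
  have nz: "\<phi> t \<noteq> 0" if t: "0 \<le> t" "t \<le> 1" for t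
  proof -
    obtain p where p: "orthonormal_frame (h t) p"
      using ex_orthonormal_frame[OF pos[OF t]] by blast
    let ?i = "matrix_inv (h t)"
    have "wedge_on_frame (\<lambda>m::'n. form_of (mat 1)) = det (block_matrix (mat 1) ?i) * wedge_on_frame (\<lambda>m. form_of (h t))"
      using wedge_on_frame_mult[of "mat 1" "\<lambda>m. h t" ?i] orthonormal_frame_inverse[OF p] by simp
    then have "wedge_on_frame (\<lambda>m. form_of (h t)) \<noteq> 0"
      using wedge_on_frame_mat_1_nz[where 'n='n] by auto
    moreover have "Im (wedge_on_frame (\<lambda>m. form_of (h t))) = 0"
      using pos[OF t] by (intro wedge_on_frame_form_of_real) (simp add: positive_hermitian_iff)
    ultimately show ?thesis by (simp add: \<phi>_def complex_eq_iff)
  qed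
  have cont: "continuous_on {0..1} \<phi>"
    unfolding \<phi>_def h_def by (intro continuous_intros)
  have "\<phi> 0 > 0"
    using wedge_on_frame_mat_1[where 'n='n] by (auto simp: \<phi>_def h_def)
  have "\<phi> 1 > 0"
  proof (rule ccontr)
    assume "\<not> \<phi> 1 > 0"
    then have "\<exists>t\<ge>0. t \<le> 1 \<and> \<phi> t = 0"
      using IVT2'[of \<phi> 1 0 0] \<open>\<phi> 0 > 0\<close> cont by auto
    then show False using nz by blast
  qed
  then show ?thesis by (simp add: \<phi>_def h_def)
qed

section \<open>Eigenvalues\<close>

text \<open>Both sides are values of monic polynomials in \<open>t\<close>; equal polynomials have
  the same roots with multiplicity.\<close>

lemma eigenvalues_unique:
  fixes \<mu> \<nu> :: "'n::finite \<Rightarrow> complex"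
  assumes "\<And>t. (\<Prod>i\<in>UNIV. t - \<mu> i) = (\<Prod>i\<in>UNIV. t - \<nu> i)"
  shows "image_mset \<mu> (mset_set UNIV) = image_mset \<nu> (mset_set UNIV)"
proof -
  have "poly (\<Prod>i\<in>UNIV. [:- \<mu> i, 1:]) t = poly (\<Prod>i\<in>UNIV. [:- \<nu> i, 1:]) t" for t
    using assms[of t] by (simp add: poly_prod)
  then have "(\<Prod>i\<in>UNIV. [:- \<mu> i, 1:]) = (\<Prod>i\<in>UNIV. [:- \<nu> i, 1:])"
    by (simp add: poly_eq_poly_eq_iff[symmetric] fun_eq_iff)
  then have "proots (\<Prod>i\<in>UNIV. [:- \<mu> i, 1:]) = proots (\<Prod>i\<in>UNIV. [:- \<nu> i, 1:])"
    by simp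
  moreover have "proots (\<Prod>i\<in>UNIV. [:- \<mu> i, 1:]) = image_mset \<mu> (mset_set UNIV)" for \<mu> :: "'n \<Rightarrow> complex"
  proof -
    have "proots (\<Prod>i\<in>A. [:- \<mu> i, 1:]) = image_mset \<mu> (mset_set A)" if "finite A" for A
      using that by (subst proots_prod) (auto simp: sum_unfold_sum_mset)
    then show ?thesis by simp
  qed
  ultimately show ?thesis by metis
qed

text \<open>\<open>eigenvalue_vector\<close> leaves the order open, so only order-independent data
  are extracted: the sum for the linear inequality, the product for the determinant estimate, and
  the range for the signs.\<close>

lemma eigenvalue_vector_frame:
  fixes A :: "complex^'n^'n"
  assumes \<mu>: "eigenvalue_vector (matrix_inv g ** A) \<mu>" and p: "orthonormal_frame g p"
    and d: "\<And>k l. k \<noteq> l \<Longrightarrow> sesq A (p $ k) (p $ l) = 0"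
    and A: "hermitian A"
  shows "(\<Sum>i\<in>UNIV. \<mu> $ i) = (\<Sum>k\<in>UNIV. Re (sesq A (p $ k) (p $ k)))"
    and "(\<Prod>i\<in>UNIV. \<mu> $ i) = (\<Prod>k\<in>UNIV. Re (sesq A (p $ k) (p $ k)))"
    and "\<exists>k. \<mu> $ i = Re (sesq A (p $ k) (p $ k))"
proof -
  define \<nu> where "\<nu> k = Re (sesq A (p $ k) (p $ k))" for k
  have \<nu>: "sesq A (p $ k) (p $ k) = of_real (\<nu> k)" for k
    unfolding \<nu>_def by (rule sesq_diag_of_real[OF A])
  have "(\<Prod>i\<in>UNIV. t - complex_of_real (\<mu> $ i)) = (\<Prod>i\<in>UNIV. t - complex_of_real (\<nu> i))" for t
    using \<mu> det_charpoly_frame[OF p d, of t] unfolding eigenvalue_vector_def \<nu> by simp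
  then have "image_mset (\<lambda>i. complex_of_real (\<mu> $ i)) (mset_set UNIV) = image_mset (\<lambda>i. complex_of_real (\<nu> i)) (mset_set UNIV)"
    by (rule eigenvalues_unique)
  then have "image_mset Re (image_mset (\<lambda>i. complex_of_real (\<mu> $ i)) (mset_set UNIV))
     = image_mset Re (image_mset (\<lambda>i. complex_of_real (\<nu> i)) (mset_set UNIV))"
    by simp
  then have m: "image_mset (\<lambda>i. \<mu> $ i) (mset_set UNIV) = image_mset \<nu> (mset_set UNIV)"
    by (simp add: image_mset.compositionality o_def)
  show "(\<Sum>i\<in>UNIV. \<mu> $ i) = (\<Sum>k\<in>UNIV. Re (sesq A (p $ k) (p $ k)))"
    using arg_cong[OF m, of sum_mset] by (simp add: sum_unfold_sum_mset \<nu>_def[abs_def])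
  show "(\<Prod>i\<in>UNIV. \<mu> $ i) = (\<Prod>k\<in>UNIV. Re (sesq A (p $ k) (p $ k)))"
    using arg_cong[OF m, of prod_mset] by (simp add: prod_unfold_prod_mset \<nu>_def[abs_def])
  have "range (\<lambda>i. \<mu> $ i) = range \<nu>"
    using arg_cong[OF m, of set_mset] by simp
  then show "\<exists>k. \<mu> $ i = Re (sesq A (p $ k) (p $ k))"
    unfolding \<nu>_def by blast
qed

section \<open>Twice differentiable functions\<close>

text \<open>The direction precedes the point, so that \<open>dd u h\<close> is again a function and
  derivatives can be iterated.\<close>

definition dd :: "('a::real_normed_vector \<Rightarrow> 'b::real_normed_vector) \<Rightarrow> 'a \<Rightarrow> 'a \<Rightarrow> 'b" where
  "dd u h x = frechet_derivative u (at x) h"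

lemma dd_eq: "(u has_derivative u') (at x) \<Longrightarrow> dd u h x = u' h"
  unfolding dd_def using frechet_derivative_at by metis

lemma Ck_on_0_D: "Ck_on 0 S u \<Longrightarrow> continuous_on S u"
  by simp

lemma Ck_on_Suc: "Ck_on (Suc k) S u \<longleftrightarrow> (\<forall>x\<in>S. u differentiable (at x)) \<and> (\<forall>v. Ck_on k S (dd u v))"
  by (simp add: dd_def[abs_def])

lemma has_derivative_dd:
  "u differentiable (at x) \<Longrightarrow> (u has_derivative (\<lambda>h. dd u h x)) (at x)"
  unfolding dd_def by (simp add: frechet_derivative_works[symmetric])

lemma Ck_on_1_D:
  assumes "Ck_on (Suc k) S u" "x \<in> S"
  shows "(u has_derivative (\<lambda>h. dd u h x)) (at x)"
  using assms has_derivative_dd unfolding Ck_on_Suc by blast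

lemma Ck_on_Suc_imp_continuous:
  assumes "Ck_on (Suc k) S u"
  shows "continuous_on S u"
  using assms unfolding Ck_on_Suc
  by (meson continuous_at_imp_continuous_on differentiable_imp_continuous_within)

lemma Ck_on_cong:
  assumes "open S" "\<And>x. x \<in> S \<Longrightarrow> f x = g x" "Ck_on k S f"
  shows "Ck_on k S g"
  using assms(2,3)
proof (induction k arbitrary: f g)
  case 0
  then show ?case using continuous_on_cong[of S S f g] by auto
next
  case (Suc k)
  have der: "(g has_derivative (\<lambda>h. dd f h x)) (at x)" if "x \<in> S" for x
    using has_derivative_transform_within_open[OF Ck_on_1_D[OF Suc.prems(2) that] assms(1) that] Suc.prems(1) by blast
  have "Ck_on k S (dd g v)" for v
  proof (rule Suc.IH)
    show "Ck_on k S (dd f v)" using Suc.prems(2) unfolding Ck_on_Suc by blast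
    show "dd f v x = dd g v x" if "x \<in> S" for x
      using dd_eq[OF der[OF that]] by simp
  qed
  then show ?case
    unfolding Ck_on_Suc using der differentiable_def by blast
qed

lemma Ck_on_bounded_linear:
  assumes L: "bounded_linear L" and S: "open S" and "Ck_on k S u"
  shows "Ck_on k S (\<lambda>x. L (u x))"
  using assms(3)
proof (induction k arbitrary: u)
  case 0
  then show ?case using bounded_linear.continuous_on[OF L] by auto
next
  case (Suc k)
  have der: "((\<lambda>x. L (u x)) has_derivative (\<lambda>h. L (dd u h x))) (at x)" if "x \<in> S" for x
    by (rule bounded_linear.has_derivative[OF L Ck_on_1_D[OF Suc.prems that]])
  have "Ck_on k S (dd (\<lambda>x. L (u x)) v)" for v
  proof (rule Ck_on_cong[OF S])
    show "Ck_on k S (\<lambda>x. L (dd u v x))"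
      using Suc.prems unfolding Ck_on_Suc by (intro Suc.IH) blast
    show "L (dd u v x) = dd (\<lambda>x. L (u x)) v x" if "x \<in> S" for x
      using dd_eq[OF der[OF that]] by simp
  qed
  then show ?case
    unfolding Ck_on_Suc using der differentiable_def by blast
qed

lemma has_derivative_along_line:
  fixes f :: "'a::real_normed_vector \<Rightarrow> real"
  assumes "(f has_derivative f') (at (y + s *\<^sub>R v))"
  shows "((\<lambda>s. f (y + s *\<^sub>R v)) has_real_derivative f' v) (at s)"
proof -
  have lin: "linear f'" using assms has_derivative_linear by blast
  have "((\<lambda>s. f (y + s *\<^sub>R v)) has_derivative (\<lambda>t. f' (t *\<^sub>R v))) (at s)"
    by (rule has_derivative_compose[of "\<lambda>s. y + s *\<^sub>R v" _ _ _ f]) (auto intro!: derivative_eq_intros assms)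
  moreover have "(\<lambda>t. f' (t *\<^sub>R v)) = (*) (f' v)"
    by (simp add: fun_eq_iff linear_scale[OF lin])
  ultimately show ?thesis
    unfolding has_field_derivative_def by simp
qed

text \<open>Schwarz's theorem: both mixed second derivatives are limits of the same second difference
  quotient.\<close>

lemma second_difference:
  fixes u :: "'a::real_normed_vector \<Rightarrow> real"
  assumes C2: "Ck_on (Suc (Suc 0)) S u" and e: "\<epsilon> > 0"
    and sub: "\<And>s t. 0 \<le> s \<Longrightarrow> s \<le> \<epsilon> \<Longrightarrow> 0 \<le> t \<Longrightarrow> t \<le> \<epsilon> \<Longrightarrow> x + s *\<^sub>R h + t *\<^sub>R k \<in> S"
  shows "\<exists>s t. 0 \<le> s \<and> s \<le> \<epsilon> \<and> 0 \<le> t \<and> t \<le> \<epsilon> \<and>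
    u (x + \<epsilon> *\<^sub>R h + \<epsilon> *\<^sub>R k) - u (x + \<epsilon> *\<^sub>R h) - u (x + \<epsilon> *\<^sub>R k) + u x = \<epsilon> * (\<epsilon> * dd (dd u h) k (x + s *\<^sub>R h + t *\<^sub>R k))"
proof -
  define F where "F s = u (x + s *\<^sub>R h + \<epsilon> *\<^sub>R k) - u (x + s *\<^sub>R h)" for s
  have du: "(u has_derivative (\<lambda>h. dd u h y)) (at y)" if "y \<in> S" for y
    by (rule Ck_on_1_D[OF C2 that])
  have ddu: "(dd u h has_derivative (\<lambda>k. dd (dd u h) k y)) (at y)" if "y \<in> S" for y
    using C2 that Ck_on_1_D unfolding Ck_on_Suc[of "Suc 0"] by blast
  have dF: "(F has_real_derivative dd u h (x + s *\<^sub>R h + \<epsilon> *\<^sub>R k) - dd u h (x + s *\<^sub>R h)) (at s)" if "0 \<le> s" "s \<le> \<epsilon>" for s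
  proof -
    have "((\<lambda>s. u ((x + \<epsilon> *\<^sub>R k) + s *\<^sub>R h)) has_real_derivative dd u h ((x + \<epsilon> *\<^sub>R k) + s *\<^sub>R h)) (at s)"
      by (rule has_derivative_along_line[OF du]) (use sub[of s \<epsilon>] that e in \<open>simp add: algebra_simps\<close>)
    moreover have "((\<lambda>s. u (x + s *\<^sub>R h)) has_real_derivative dd u h (x + s *\<^sub>R h)) (at s)"
      by (rule has_derivative_along_line[OF du]) (use sub[of s 0] that e in \<open>simp add: algebra_simps\<close>)
    ultimately show ?thesis
      unfolding F_def by (auto intro!: derivative_eq_intros simp: algebra_simps)
  qed
  obtain s where s: "0 < s" "s < \<epsilon>" "F \<epsilon> - F 0 = \<epsilon> * (dd u h (x + s *\<^sub>R h + \<epsilon> *\<^sub>R k) - dd u h (x + s *\<^sub>R h))"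
    using MVT2[OF e, of F "\<lambda>s. dd u h (x + s *\<^sub>R h + \<epsilon> *\<^sub>R k) - dd u h (x + s *\<^sub>R h)"] dF by auto
  have dG: "((\<lambda>t. dd u h (x + s *\<^sub>R h + t *\<^sub>R k)) has_real_derivative dd (dd u h) k (x + s *\<^sub>R h + t *\<^sub>R k)) (at t)"
    if "0 \<le> t" "t \<le> \<epsilon>" for t
    by (rule has_derivative_along_line[OF ddu]) (use sub[of s t] that s in simp)
  obtain t where t: "0 < t" "t < \<epsilon>" "dd u h (x + s *\<^sub>R h + \<epsilon> *\<^sub>R k) - dd u h (x + s *\<^sub>R h + 0 *\<^sub>R k) = \<epsilon> * dd (dd u h) k (x + s *\<^sub>R h + t *\<^sub>R k)"
    using MVT2[OF e, of "\<lambda>t. dd u h (x + s *\<^sub>R h + t *\<^sub>R k)" "\<lambda>t. dd (dd u h) k (x + s *\<^sub>R h + t *\<^sub>R k)"] dG by auto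
  show ?thesis
    using s t by (intro exI[of _ s] exI[of _ t]) (simp add: F_def algebra_simps)
qed

theorem mixed_derivatives_commute:
  fixes u :: "'a::real_normed_vector \<Rightarrow> real"
  assumes C2: "Ck_on (Suc (Suc 0)) S u" and S: "open S" and x: "x \<in> S"
  shows "dd (dd u h) k x = dd (dd u k) h x"
proof (rule ccontr)
  assume neq: "\<not> ?thesis"
  define e where "e = \<bar>dd (dd u h) k x - dd (dd u k) h x\<bar> / 2"
  have e: "e > 0" using neq by (simp add: e_def)
  have cont: "continuous_on S (dd (dd u h) k)" for h k
    using C2 unfolding Ck_on_Suc by (simp add: Ck_on_0_D)
  obtain d1 where d1: "d1 > 0" "\<And>y. y \<in> S \<Longrightarrow> dist y x < d1 \<Longrightarrow> \<bar>dd (dd u h) k y - dd (dd u h) k x\<bar> < e"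
    using cont[of h k] x e unfolding continuous_on_iff by (metis dist_real_def)
  obtain d2 where d2: "d2 > 0" "\<And>y. y \<in> S \<Longrightarrow> dist y x < d2 \<Longrightarrow> \<bar>dd (dd u k) h y - dd (dd u k) h x\<bar> < e"
    using cont[of k h] x e unfolding continuous_on_iff by (metis dist_real_def)
  obtain d3 where d3: "d3 > 0" "ball x d3 \<subseteq> S"
    using S x open_contains_ball by blast
  define d where "d = min d1 (min d2 d3)"
  have d: "d > 0" using d1 d2 d3 by (simp add: d_def)
  define N where "N = norm h + norm k + 1"
  \<comment> \<open>As \<open>N\<close> exceeds the sum of the two lengths, the whole parallelogram
    spanned by \<epsilon> h and \<epsilon> k stays within distance \<open>d\<close> of
    \<open>x\<close>.\<close>
  define \<epsilon> where "\<epsilon> = d / (2 * N)"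
  have N: "N > 0" by (simp add: N_def add_nonneg_pos)
  have \<epsilon>: "\<epsilon> > 0" using d N by (simp add: \<epsilon>_def)
  have near: "dist (x + s *\<^sub>R h + t *\<^sub>R k) x < d" if "0 \<le> s" "s \<le> \<epsilon>" "0 \<le> t" "t \<le> \<epsilon>" for s t
  proof -
    have "dist (x + s *\<^sub>R h + t *\<^sub>R k) x \<le> s * norm h + t * norm k"
      using norm_triangle_ineq[of "s *\<^sub>R h" "t *\<^sub>R k"] that by (simp add: dist_norm)
    also have "\<dots> \<le> \<epsilon> * norm h + \<epsilon> * norm k"
      using that by (intro add_mono mult_right_mono) auto
    also have "\<dots> \<le> \<epsilon> * N" using \<epsilon> by (simp add: N_def algebra_simps)
    also have "\<dots> < d" using d N by (simp add: \<epsilon>_def)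
    finally show ?thesis .
  qed
  have inS: "x + s *\<^sub>R h + t *\<^sub>R k \<in> S" if "0 \<le> s" "s \<le> \<epsilon>" "0 \<le> t" "t \<le> \<epsilon>" for s t
    using near[OF that] d3 by (auto simp: d_def dist_commute)
  have inS': "x + s *\<^sub>R k + t *\<^sub>R h \<in> S" if "0 \<le> s" "s \<le> \<epsilon>" "0 \<le> t" "t \<le> \<epsilon>" for s t
    using inS[of t s] that by (simp add: algebra_simps)
  obtain s t where st: "0 \<le> s" "s \<le> \<epsilon>" "0 \<le> t" "t \<le> \<epsilon>"
    "u (x + \<epsilon> *\<^sub>R h + \<epsilon> *\<^sub>R k) - u (x + \<epsilon> *\<^sub>R h) - u (x + \<epsilon> *\<^sub>R k) + u x = \<epsilon> * (\<epsilon> * dd (dd u h) k (x + s *\<^sub>R h + t *\<^sub>R k))"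
    using second_difference[OF C2 \<epsilon> inS] by blast
  obtain s' t' where st': "0 \<le> s'" "s' \<le> \<epsilon>" "0 \<le> t'" "t' \<le> \<epsilon>"
    "u (x + \<epsilon> *\<^sub>R k + \<epsilon> *\<^sub>R h) - u (x + \<epsilon> *\<^sub>R k) - u (x + \<epsilon> *\<^sub>R h) + u x = \<epsilon> * (\<epsilon> * dd (dd u k) h (x + s' *\<^sub>R k + t' *\<^sub>R h))"
    using second_difference[OF C2 \<epsilon> inS'] by blast
  have "x + \<epsilon> *\<^sub>R k + \<epsilon> *\<^sub>R h = x + \<epsilon> *\<^sub>R h + \<epsilon> *\<^sub>R k" by simp
  then have "\<epsilon> * (\<epsilon> * dd (dd u h) k (x + s *\<^sub>R h + t *\<^sub>R k)) = \<epsilon> * (\<epsilon> * dd (dd u k) h (x + s' *\<^sub>R k + t' *\<^sub>R h))"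
    using st(5) st'(5) by (simp only:)
  then have eq: "dd (dd u h) k (x + s *\<^sub>R h + t *\<^sub>R k) = dd (dd u k) h (x + t' *\<^sub>R h + s' *\<^sub>R k)"
    using \<epsilon> by (simp add: algebra_simps)
  have "\<bar>dd (dd u h) k (x + s *\<^sub>R h + t *\<^sub>R k) - dd (dd u h) k x\<bar> < e"
    using st(1-4) by (intro d1 inS) (use near[OF st(1-4)] in \<open>auto simp: d_def\<close>)
  moreover have "\<bar>dd (dd u k) h (x + t' *\<^sub>R h + s' *\<^sub>R k) - dd (dd u k) h x\<bar> < e"
    using st'(1-4) by (intro d2 inS) (use near[OF st'(3,4,1,2)] in \<open>auto simp: d_def\<close>)
  ultimately show False
    unfolding eq e_def by (auto simp: abs_if split: if_splits)
qed

lemma dd_linear: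
  assumes "Ck_on (Suc k) S u" "x \<in> S"
  shows "linear (\<lambda>h. dd u h x)"
  using Ck_on_1_D[OF assms] has_derivative_linear by blast

text \<open>Differentiability gives linearity in the last direction only; the symmetry of second
  derivatives transfers it to the first.\<close>

lemma dd_dd_linear_left:
  assumes C2: "Ck_on (Suc (Suc 0)) S u" and S: "open S" and x: "x \<in> S"
  shows "linear (\<lambda>h. dd (dd u h) k (x::'a::real_normed_vector) :: real)"
proof -
  have "Ck_on (Suc 0) S (dd u k)"
    using C2 unfolding Ck_on_Suc[of "Suc 0"] by blast
  then have "linear (\<lambda>h. dd (dd u k) h x)"
    using dd_linear x by blast
  then show ?thesis
    using mixed_derivatives_commute[OF C2 S x] by simp
qed

lemma dd_dd_linear_right:
  assumes "Ck_on (Suc (Suc 0)) S u" "x \<in> S"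
  shows "linear (\<lambda>k. dd (dd u h) k x)"
  using assms dd_linear unfolding Ck_on_Suc[of "Suc 0"] by blast

text \<open>A negative derivative of \<open>f'\<close> at 0 would make \<open>f'\<close> negative
  just to the right of 0, and by the mean value theorem \<open>f\<close> would drop below its
  minimum.\<close>

lemma local_min_second_derivative:
  fixes f f' :: "real \<Rightarrow> real"
  assumes f: "\<And>t. \<bar>t\<bar> < d \<Longrightarrow> (f has_real_derivative f' t) (at t)"
    and f': "(f' has_real_derivative c) (at 0)"
    and d: "d > 0" and min: "\<And>t. \<bar>t\<bar> < d \<Longrightarrow> f 0 \<le> f t"
  shows "f' 0 = 0" "c \<ge> 0"
proof -
  show 0: "f' 0 = 0"
    using DERIV_local_min[OF f[of 0] d] min d by simp
  show "c \<ge> 0"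
  proof (rule ccontr)
    assume "\<not> c \<ge> 0"
    then obtain e where e: "e > 0" "\<And>h. h > 0 \<Longrightarrow> h < e \<Longrightarrow> f' (0 + h) < f' 0"
      using DERIV_neg_dec_right[OF f'] by auto
    define t where "t = min d e / 2"
    have t: "0 < t" "t < d" "t < e" using d e by (auto simp: t_def min_def)
    obtain z where z: "0 < z" "z < t" "f t - f 0 = (t - 0) * f' z"
      using MVT2[OF t(1), of f f'] f t by auto
    have "f' z < 0" using e(2)[of z] z t 0 by simp
    then have "t * f' z < 0" using t by (simp add: mult_pos_neg)
    then have "f t < f 0" using z by simp
    then show False using min[of t] t by simp
  qed
qed

section \<open>Contact sets\<close>

text \<open>The contact set of \<open>w\<close> with the paraboloids \<open>p \<bullet> (x - x\<^sub>1) - A \<bar>x - x\<^sub>1\<bar>\<^sup>2 + const\<close>, \<open>\<bar>p\<bar> < s\<close>.\<close>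

definition contact_set :: "('a::euclidean_space \<Rightarrow> real) \<Rightarrow> real \<Rightarrow> 'a \<Rightarrow> real \<Rightarrow> real \<Rightarrow> 'a set" where
  "contact_set w A x1 R s = {x \<in> ball x1 R.
     (\<forall>h. \<bar>dd w h x + 2 * A * ((x - x1) \<bullet> h)\<bar> \<le> s * norm h) \<and>
     (\<forall>h. 0 \<le> dd (dd w h) h x + 2 * A * (norm h)\<^sup>2) \<and>
     w x + A * (norm (x - x1))\<^sup>2 \<le> w x1 + s * R}"

text \<open>The gradient of w + A |x - x1|^2, assembled from its components in the standard
  basis.\<close>

definition contact_slope :: "('a::euclidean_space \<Rightarrow> real) \<Rightarrow> real \<Rightarrow> 'a \<Rightarrow> 'a \<Rightarrow> 'a" where
  "contact_slope w A x1 x = (\<Sum>b\<in>Basis. dd w b x *\<^sub>R b) + (2 * A) *\<^sub>R (x - x1)"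

text \<open>For each slope \<open>p\<close> the function w + A |x - x1|^2 - p.(x - x1) attains its
  minimum over the closed ball. Its value at \<open>x1\<close> is \<open>w x1\<close>, and
  \<open>bd\<close> keeps the boundary values above this, so the minimum is interior and is a
  contact point with slope \<open>p\<close>.\<close>

theorem contact_slope_surj:
  fixes w :: "'a::euclidean_space \<Rightarrow> real"
  assumes C2: "Ck_on (Suc (Suc 0)) S w" and S: "open S" and R: "R > 0" "cball x1 R \<subseteq> S"
    and bd: "\<And>x. x \<in> sphere x1 R \<Longrightarrow> w x1 + s * R < w x + A * R\<^sup>2"
  shows "ball 0 s \<subseteq> contact_slope w A x1 ` contact_set w A x1 R s"
proof
  fix p :: 'a assume p: "p \<in> ball 0 s"
  define v where "v x = w x + A * (norm (x - x1))\<^sup>2 - p \<bullet> (x - x1)" for x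
  have dw: "(w has_derivative (\<lambda>h. dd w h x)) (at x)" if "x \<in> S" for x
    by (rule Ck_on_1_D[OF C2 that])
  have ddw: "(dd w h has_derivative (\<lambda>k. dd (dd w h) k x)) (at x)" if "x \<in> S" for x h
    using C2 that Ck_on_1_D unfolding Ck_on_Suc[of "Suc 0"] by blast
  have "continuous_on (cball x1 R) w"
    using Ck_on_Suc_imp_continuous[OF C2] R continuous_on_subset by blast
  then have "continuous_on (cball x1 R) v"
    unfolding v_def by (intro continuous_intros)
  then obtain x where x: "x \<in> cball x1 R" "\<And>y. y \<in> cball x1 R \<Longrightarrow> v x \<le> v y"
    using continuous_attains_inf[OF compact_cball, of x1 R v] R by auto
  have v1: "v x1 = w x1" by (simp add: v_def)
  have px: "p \<bullet> (y - x1) \<le> s * R" if "y \<in> cball x1 R" for y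
  proof -
    have "p \<bullet> (y - x1) \<le> norm p * norm (y - x1)" by (rule norm_cauchy_schwarz)
    also have "\<dots> \<le> s * R"
      using p that order_trans[OF norm_ge_zero, of p s] by (intro mult_mono) (auto simp: dist_norm norm_minus_commute)
    finally show ?thesis .
  qed
  have xb: "x \<in> ball x1 R"
  proof (rule ccontr)
    assume "x \<notin> ball x1 R"
    then have sp: "x \<in> sphere x1 R" using x by auto
    then have "v x1 < v x"
      using bd[OF sp] px[OF x(1)] by (simp add: v_def dist_norm norm_minus_commute)
    then show False using x(2)[of x1] R by simp
  qed
  then have xS: "x \<in> S" using R by auto
  obtain d where d: "d > 0" "ball x d \<subseteq> ball x1 R"
    using xb open_ball open_contains_ball by blast
  have key: "dd w h x + 2 * A * ((x - x1) \<bullet> h) - p \<bullet> h = 0 \<and> 0 \<le> dd (dd w h) h x + 2 * A * (norm h)\<^sup>2" for h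
  proof (cases "h = 0")
    case True
    have "linear (\<lambda>h. dd w h x)" "linear (\<lambda>k. dd (dd w h) k x)"
      using dw[OF xS] ddw[OF xS] has_derivative_linear by blast+
    then show ?thesis using True linear_0 by fastforce
  next
    case False
    define e where "e = d / norm h"
    have e: "e > 0" using d False by (simp add: e_def)
    have inb: "x + t *\<^sub>R h \<in> ball x1 R" if "\<bar>t\<bar> < e" for t
    proof -
      have "dist x (x + t *\<^sub>R h) < d"
        using that False by (simp add: dist_norm e_def field_simps)
      then show ?thesis using d by auto
    qed
    have veq: "v (x + t *\<^sub>R h) = w (x + t *\<^sub>R h) + A * ((norm (x - x1))\<^sup>2 + 2 * t * ((x - x1) \<bullet> h) + t\<^sup>2 * (norm h)\<^sup>2)
        - (p \<bullet> (x - x1) + t * (p \<bullet> h))" for t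
    proof -
      have "(norm (x + t *\<^sub>R h - x1))\<^sup>2 = (norm (x - x1))\<^sup>2 + 2 * t * ((x - x1) \<bullet> h) + t\<^sup>2 * (norm h)\<^sup>2"
        unfolding power2_norm_eq_inner by (simp add: algebra_simps inner_commute power2_eq_square)
      moreover have "p \<bullet> (x + t *\<^sub>R h - x1) = p \<bullet> (x - x1) + t * (p \<bullet> h)"
        by (simp add: algebra_simps)
      ultimately show ?thesis by (simp only: v_def)
    qed
    define f' where "f' t = dd w h (x + t *\<^sub>R h) + A * (2 * ((x - x1) \<bullet> h) + 2 * t * (norm h)\<^sup>2) - p \<bullet> h" for t
    have 1: "((\<lambda>t. v (x + t *\<^sub>R h)) has_real_derivative f' t) (at t)" if "\<bar>t\<bar> < e" for t
    proof -
      have "x + t *\<^sub>R h \<in> S" using inb[OF that] R by auto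
      then show ?thesis
        unfolding veq f'_def by (auto intro!: derivative_eq_intros has_derivative_along_line[OF dw])
    qed
    have 2: "(f' has_real_derivative (dd (dd w h) h x + A * (2 * (norm h)\<^sup>2))) (at 0)"
    proof -
      have "((\<lambda>t. dd w h (x + t *\<^sub>R h)) has_real_derivative dd (dd w h) h x) (at 0)"
        by (rule has_derivative_along_line[of "dd w h" "\<lambda>k. dd (dd w h) k x" x 0 h, simplified]) (rule ddw[OF xS])
      then show ?thesis
        unfolding f'_def by (auto intro!: derivative_eq_intros)
    qed
    have 3: "v (x + 0 *\<^sub>R h) \<le> v (x + t *\<^sub>R h)" if "\<bar>t\<bar> < e" for t
      using x(2)[of "x + t *\<^sub>R h"] inb[OF that] by (simp add: less_imp_le)
    show ?thesis
      using local_min_second_derivative[of e "\<lambda>t. v (x + t *\<^sub>R h)", OF 1 2 e 3]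
      by (simp add: f'_def algebra_simps)
  qed
  have "x \<in> contact_set w A x1 R s"
    unfolding contact_set_def
  proof (intro CollectI conjI allI)
    show "x \<in> ball x1 R" by fact
    fix h
    have "\<bar>dd w h x + 2 * A * ((x - x1) \<bullet> h)\<bar> = \<bar>p \<bullet> h\<bar>" using key[of h] by simp
    also have "\<dots> \<le> norm p * norm h" by (rule Cauchy_Schwarz_ineq2)
    also have "\<dots> \<le> s * norm h" using p by (intro mult_right_mono) auto
    finally show "\<bar>dd w h x + 2 * A * ((x - x1) \<bullet> h)\<bar> \<le> s * norm h" .
    show "0 \<le> dd (dd w h) h x + 2 * A * (norm h)\<^sup>2" using key by blast
    show "w x + A * (norm (x - x1))\<^sup>2 \<le> w x1 + s * R"
      using x(2)[of x1] px[OF x(1)] v1 R by (simp add: v_def)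
  qed
  moreover have "contact_slope w A x1 x = p"
  proof (rule euclidean_eqI)
    fix b :: 'a assume b: "b \<in> Basis"
    have "(\<Sum>c\<in>Basis. dd w c x *\<^sub>R c) \<bullet> b = dd w b x"
      using b by (simp add: inner_sum_left inner_Basis if_distrib cong: if_cong)
    then show "contact_slope w A x1 x \<bullet> b = p \<bullet> b"
      using key[of b] by (simp add: contact_slope_def inner_add_left)
  qed
  ultimately show "p \<in> contact_slope w A x1 ` contact_set w A x1 R s" by blast
qed

section \<open>Determinants of positive semidefinite forms\<close>

text \<open>Every term of the Leibniz expansion has the same bound. The factorial is a crude
  constant, but it depends on the dimension only.\<close>

lemma abs_det_le:
  fixes M :: "real^'m^'m"
  assumes "\<And>s t. \<bar>M $ s $ t\<bar> \<le> a s * b t" and a: "\<And>s. 0 \<le> a s"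
  shows "\<bar>det M\<bar> \<le> fact CARD('m) * ((\<Prod>s\<in>UNIV. a s) * (\<Prod>s\<in>UNIV. b s))"
proof -
  have "\<bar>det M\<bar> \<le> (\<Sum>\<pi> | \<pi> permutes (UNIV::'m set). \<bar>of_int (sign \<pi>) * (\<Prod>i\<in>UNIV. M $ i $ \<pi> i)\<bar>)"
    unfolding det_def by (rule sum_abs)
  also have "\<dots> \<le> (\<Sum>\<pi> | \<pi> permutes (UNIV::'m set). (\<Prod>s\<in>UNIV. a s) * (\<Prod>s\<in>UNIV. b s))"
  proof (rule sum_mono)
    fix \<pi> assume "\<pi> \<in> {\<pi>. \<pi> permutes (UNIV::'m set)}"
    then have bij: "bij \<pi>" by (simp add: permutes_bij)
    have "\<bar>of_int (sign \<pi>) * (\<Prod>i\<in>UNIV. M $ i $ \<pi> i)\<bar> = (\<Prod>i\<in>UNIV. \<bar>M $ i $ \<pi> i\<bar>)"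
      by (simp add: abs_mult abs_prod sign_def)
    also have "\<dots> \<le> (\<Prod>i\<in>UNIV. a i * b (\<pi> i))"
      using assms(1) by (intro prod_mono) auto
    also have "\<dots> = (\<Prod>s\<in>UNIV. a s) * (\<Prod>s\<in>UNIV. b s)"
      by (simp add: prod.distrib prod.reindex_bij_betw[OF bij])
    finally show "\<bar>of_int (sign \<pi>) * (\<Prod>i\<in>UNIV. M $ i $ \<pi> i)\<bar> \<le> (\<Prod>s\<in>UNIV. a s) * (\<Prod>s\<in>UNIV. b s)" .
  qed
  also have "\<dots> = fact CARD('m) * ((\<Prod>s\<in>UNIV. a s) * (\<Prod>s\<in>UNIV. b s))"
    by (simp add: card_permutations[OF refl])
  finally show ?thesis .
qed

lemma semidefinite_Cauchy_Schwarz: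
  fixes B :: "'a::real_vector \<Rightarrow> 'a \<Rightarrow> real"
  assumes B: "bilinear B" and sym: "\<And>x y. B x y = B y x" and pos: "\<And>x. 0 \<le> B x x"
  shows "\<bar>B x y\<bar> \<le> sqrt (B x x) * sqrt (B y y)"
proof -
  have quad: "0 \<le> B x x + 2 * t * B x y + t\<^sup>2 * B y y" for t
    using pos[of "x + t *\<^sub>R y"] sym[of y x]
    by (simp add: bilinear_ladd[OF B] bilinear_radd[OF B] bilinear_lmul[OF B] bilinear_rmul[OF B] power2_eq_square algebra_simps)
  have "(B x y)\<^sup>2 \<le> B x x * B y y"
  proof (cases "B y y = 0")
    case True
    have "B x y = 0"
    proof (rule ccontr)
      assume "B x y \<noteq> 0"
      \<comment> \<open>This parameter makes the quadratic expression equal to -1.\<close>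
      then show False
        using quad[of "- (B x x + 1) / (2 * B x y)"] True by (simp add: field_simps)
    qed
    then show ?thesis using True by simp
  next
    case False
    then have "B y y > 0" using pos[of y] by simp
    then show ?thesis
      using quad[of "- B x y / B y y"] by (simp add: power2_eq_square field_simps)
  qed
  then show ?thesis
    by (metis abs_ge_zero power2_abs real_le_rsqrt real_sqrt_mult)
qed

text \<open>A form of Hadamard's inequality with the determinant in one basis and the diagonal in
  another, so that \<open>q\<close> can be adapted to the equation while \<beta> stays the standard
  basis. Expanding \<beta> in \<open>q\<close> gives the Gram matrix as N M' N^T, and Cauchy-Schwarz
  bounds the entries of M' by its diagonal.\<close>

lemma det_form_le:
  fixes B :: "'a::real_vector \<Rightarrow> 'a \<Rightarrow> real" and \<beta> q :: "'m::finite \<Rightarrow> 'a"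
  assumes B: "bilinear B" and sym: "\<And>x y. B x y = B y x" and pos: "\<And>x. 0 \<le> B x x"
    and c: "\<And>s. \<beta> s = (\<Sum>u\<in>UNIV. c s u *\<^sub>R q u)" "\<And>s u. \<bar>c s u\<bar> \<le> C"
  shows "\<bar>det (\<chi> s t. B (\<beta> s) (\<beta> t))\<bar> \<le> (fact CARD('m) * C ^ CARD('m))\<^sup>2 * (fact CARD('m) * (\<Prod>s\<in>UNIV. B (q s) (q s)))"
proof -
  define N :: "real^'m^'m" where "N = (\<chi> s u. c s u)"
  define M' :: "real^'m^'m" where "M' = (\<chi> s t. B (q s) (q t))"
  have lin: "linear (B x)" "linear (\<lambda>x. B x y)" for x y
    using B by (auto simp: bilinear_def)
  have "(\<chi> s t. B (\<beta> s) (\<beta> t)) = N ** M' ** transpose N"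
  proof -
    have "B (\<beta> s) (\<beta> t) = (\<Sum>v\<in>UNIV. (\<Sum>u\<in>UNIV. c s u * B (q u) (q v)) * c t v)" for s t
    proof -
      have "B (\<beta> s) (\<beta> t) = (\<Sum>v\<in>UNIV. c t v * B (\<beta> s) (q v))"
        unfolding c(1)[of t] by (simp add: linear_sum[OF lin(1)] linear_scale[OF lin(1)])
      moreover have "B (\<beta> s) (q v) = (\<Sum>u\<in>UNIV. c s u * B (q u) (q v))" for v
        unfolding c(1)[of s] by (simp add: linear_sum[OF lin(2)] linear_scale[OF lin(2)])
      ultimately show ?thesis by (simp add: mult.commute)
    qed
    then show ?thesis
      by (simp add: vec_eq_iff matrix_matrix_mult_def N_def M'_def transpose_def)
  qed
  then have eq: "det (\<chi> s t. B (\<beta> s) (\<beta> t)) = (det N)\<^sup>2 * det M'"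
    by (simp add: det_mul det_transpose power2_eq_square)
  have C: "C \<ge> 0" using c(2)[of undefined undefined] by linarith
  have N: "\<bar>det N\<bar> \<le> fact CARD('m) * C ^ CARD('m)"
    using abs_det_le[of N "\<lambda>_. C" "\<lambda>_. 1"] c(2) C by (simp add: N_def)
  have M': "\<bar>det M'\<bar> \<le> fact CARD('m) * (\<Prod>s\<in>UNIV. B (q s) (q s))"
  proof -
    have "\<bar>det M'\<bar> \<le> fact CARD('m) * ((\<Prod>s\<in>UNIV. sqrt (B (q s) (q s))) * (\<Prod>s\<in>UNIV. sqrt (B (q s) (q s))))"
      by (rule abs_det_le) (use semidefinite_Cauchy_Schwarz[OF B sym pos] pos in \<open>auto simp: M'_def\<close>)
    also have "(\<Prod>s\<in>UNIV. sqrt (B (q s) (q s))) * (\<Prod>s\<in>UNIV. sqrt (B (q s) (q s))) = (\<Prod>s\<in>UNIV. B (q s) (q s))"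
      by (simp add: prod.distrib[symmetric] pos)
    finally show ?thesis .
  qed
  have "\<bar>det (\<chi> s t. B (\<beta> s) (\<beta> t))\<bar> = \<bar>det N\<bar>\<^sup>2 * \<bar>det M'\<bar>"
    by (simp add: eq abs_mult)
  also have "\<dots> \<le> (fact CARD('m) * C ^ CARD('m))\<^sup>2 * (fact CARD('m) * (\<Prod>s\<in>UNIV. B (q s) (q s)))"
    using N M' by (intro mult_mono power_mono) auto
  finally show ?thesis .
qed

section \<open>The volume of the image of a differentiable map\<close>

text \<open>Meant for an enumerated orthonormal basis \<beta>: it carries maps of \<open>'a\<close>
  over to \<open>real^'m\<close>, where Jacobians are determinants of matrices.\<close>

definition coord :: "('m::finite \<Rightarrow> 'a::euclidean_space) \<Rightarrow> 'a \<Rightarrow> real^'m" where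
  "coord \<beta> x = (\<chi> s. x \<bullet> \<beta> s)"

definition uncoord :: "('m::finite \<Rightarrow> 'a::euclidean_space) \<Rightarrow> real^'m \<Rightarrow> 'a" where
  "uncoord \<beta> y = (\<Sum>s\<in>UNIV. y $ s *\<^sub>R \<beta> s)"

lemma linear_coord: "linear (coord \<beta>)" and linear_uncoord: "linear (uncoord \<beta>)"
  by (rule linearI; simp add: coord_def vec_eq_iff inner_add_left)
    (rule linearI; simp add: uncoord_def scaleR_add_left sum.distrib scaleR_sum_right)

lemma coord_inverse:
  fixes \<beta> :: "'m::finite \<Rightarrow> 'a::euclidean_space"
  assumes "bij_betw \<beta> UNIV Basis"
  shows "coord \<beta> (uncoord \<beta> y) = y" "uncoord \<beta> (coord \<beta> x) = x"
proof -
  have inB: "\<beta> s \<in> Basis" for s using assms by (auto simp: bij_betw_def)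
  have inj: "\<beta> s = \<beta> t \<longleftrightarrow> s = t" for s t
    using assms by (auto simp: bij_betw_def inj_on_def)
  have ip: "\<beta> s \<bullet> \<beta> t = (if s = t then 1 else 0)" for s t
    using inner_Basis[OF inB inB] inj by simp
  show "coord \<beta> (uncoord \<beta> y) = y"
    by (simp add: ip vec_eq_iff coord_def uncoord_def inner_sum_left if_distrib cong: if_cong)
  have "uncoord \<beta> (coord \<beta> x) = (\<Sum>s\<in>UNIV. (x \<bullet> \<beta> s) *\<^sub>R \<beta> s)"
    by (simp add: coord_def uncoord_def)
  also have "\<dots> = (\<Sum>b\<in>Basis. (x \<bullet> b) *\<^sub>R b)"
    by (rule sum.reindex_bij_betw[OF assms])
  finally show "uncoord \<beta> (coord \<beta> x) = x"
    by (simp add: euclidean_representation)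
qed

lemma borel_measurable_coord [measurable]: "coord \<beta> \<in> borel_measurable borel"
  by (intro borel_measurable_continuous_onI linear_continuous_on linear_conv_bounded_linear[THEN iffD1] linear_coord)

lemma borel_measurable_uncoord [measurable]: "uncoord \<beta> \<in> borel_measurable borel"
  by (intro borel_measurable_continuous_onI linear_continuous_on linear_conv_bounded_linear[THEN iffD1] linear_uncoord)

text \<open>Preimages of boxes are boxes with the same side lengths, and Lebesgue measure is
  determined by its values on boxes.\<close>

lemma lborel_coord:
  fixes \<beta> :: "'m::finite \<Rightarrow> 'a::euclidean_space"
  assumes \<beta>: "bij_betw \<beta> UNIV Basis"
  shows "lborel = distr lborel borel (coord \<beta>)"
proof (rule lborel_eqI)
  have inB: "\<beta> s \<in> Basis" for s using \<beta> by (auto simp: bij_betw_def)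
  have ex: "\<exists>s. b = \<beta> s" if "b \<in> Basis" for b using \<beta> that by (auto simp: bij_betw_def)
  have un: "uncoord \<beta> y \<bullet> \<beta> s = y $ s" for y s
    using coord_inverse(1)[OF \<beta>, of y] by (auto simp: coord_def vec_eq_iff)
  fix l u :: "real^'m"
  assume le: "\<And>b. b \<in> Basis \<Longrightarrow> l \<bullet> b \<le> u \<bullet> b"
  have le': "l $ s \<le> u $ s" for s
    using le[of "axis s 1"] by (simp add: axis_in_Basis_iff inner_axis)
  have "coord \<beta> -` box l u = box (uncoord \<beta> l) (uncoord \<beta> u)"
  proof (intro set_eqI iffI)
    fix x assume "x \<in> coord \<beta> -` box l u"
    then have *: "l $ s < x \<bullet> \<beta> s \<and> x \<bullet> \<beta> s < u $ s" for s by (simp add: mem_box_cart coord_def)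
    show "x \<in> box (uncoord \<beta> l) (uncoord \<beta> u)"
      unfolding mem_box
    proof
      fix b :: 'a assume "b \<in> Basis"
      then obtain s where "b = \<beta> s" using ex by blast
      then show "uncoord \<beta> l \<bullet> b < x \<bullet> b \<and> x \<bullet> b < uncoord \<beta> u \<bullet> b" using *[of s] by (simp add: un)
    qed
  next
    fix x assume "x \<in> box (uncoord \<beta> l) (uncoord \<beta> u)"
    then have "uncoord \<beta> l \<bullet> \<beta> s < x \<bullet> \<beta> s \<and> x \<bullet> \<beta> s < uncoord \<beta> u \<bullet> \<beta> s" for s
      using inB by (simp add: mem_box)
    then show "x \<in> coord \<beta> -` box l u" by (simp add: mem_box_cart coord_def un)
  qed
  then have "emeasure (distr lborel borel (coord \<beta>)) (box l u) = emeasure lborel (box (uncoord \<beta> l) (uncoord \<beta> u))"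
    by (subst emeasure_distr) auto
  also have "\<dots> = (\<Prod>b\<in>Basis. (uncoord \<beta> u - uncoord \<beta> l) \<bullet> b)"
  proof (rule emeasure_lborel_box)
    fix b :: 'a assume "b \<in> Basis"
    then obtain s where "b = \<beta> s" using ex by blast
    then show "uncoord \<beta> l \<bullet> b \<le> uncoord \<beta> u \<bullet> b" using le'[of s] by (simp add: un)
  qed
  also have "(\<Prod>b\<in>Basis. (uncoord \<beta> u - uncoord \<beta> l) \<bullet> b) = (\<Prod>s\<in>UNIV. (uncoord \<beta> u - uncoord \<beta> l) \<bullet> \<beta> s)"
    by (rule prod.reindex_bij_betw[OF \<beta>, symmetric])
  also have "\<dots> = (\<Prod>s\<in>UNIV. (u - l) $ s)"
    by (simp add: inner_diff_left un)
  also have "\<dots> = (\<Prod>b\<in>Basis. (u - l) \<bullet> b)"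
  proof -
    have "bij_betw (\<lambda>s. axis s (1::real)) (UNIV::'m set) Basis"
      by (auto simp: bij_betw_def inj_on_def axis_eq_axis Basis_vec_def)
    from prod.reindex_bij_betw[OF this, of "\<lambda>b. (u - l) \<bullet> b"]
    show ?thesis by (simp add: inner_axis)
  qed
  finally show "emeasure (distr lborel borel (coord \<beta>)) (box l u) = (\<Prod>b\<in>Basis. (u - l) \<bullet> b)" .
qed simp

text \<open>The area formula as an inequality; where \<open>G\<close> is not injective, overlaps
  only diminish the image. Boundedness of \<open>P\<close> and of the Jacobian provides
  integrability.\<close>

theorem emeasure_le_nn_integral_Jacobian:
  fixes G :: "'a::euclidean_space \<Rightarrow> 'a" and \<beta> :: "'m::{finite,wellorder} \<Rightarrow> 'a"
  assumes \<beta>: "bij_betw \<beta> UNIV Basis"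
    and P: "P \<in> sets borel" "bounded P"
    and der: "\<And>x. x \<in> P \<Longrightarrow> (G has_derivative G' x) (at x)"
    and cont: "continuous_on P (\<lambda>x. det (\<chi> s t. G' x (\<beta> t) \<bullet> \<beta> s))"
    and bd: "\<And>x. x \<in> P \<Longrightarrow> \<bar>det (\<chi> s t. G' x (\<beta> t) \<bullet> \<beta> s)\<bar> \<le> B"
    and J: "\<And>x. x \<in> P \<Longrightarrow> \<bar>det (\<chi> s t. G' x (\<beta> t) \<bullet> \<beta> s)\<bar> \<le> J x"
    and Q: "Q \<in> sets borel" "bounded Q" "Q \<subseteq> G ` P"
  shows "emeasure lborel Q \<le> (\<integral>\<^sup>+x. ennreal (J x) * indicator P x \<partial>lborel)"
proof -
  let ?T = "coord \<beta>" and ?U = "uncoord \<beta>"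
  define D where "D x = det (\<chi> s t. G' x (\<beta> t) \<bullet> \<beta> s)" for x
  define f where "f y = ?T (G (?U y))" for y
  define f' where "f' y h = ?T (G' (?U y) (?U h))" for y h
  define S where "S = ?T ` P"
  have S_eq: "S = ?U -` P"
  proof (intro set_eqI iffI)
    fix y assume "y \<in> S" then show "y \<in> ?U -` P" by (auto simp: S_def coord_inverse[OF \<beta>])
  next
    fix y assume "y \<in> ?U -` P"
    then have "?T (?U y) \<in> S" by (auto simp: S_def)
    then show "y \<in> S" by (simp add: coord_inverse[OF \<beta>])
  qed
  have S: "S \<in> sets borel"
    unfolding S_eq using measurable_sets[OF borel_measurable_uncoord P(1)] by simp
  have bS: "bounded S"
    unfolding S_def by (intro bounded_linear_image P linear_conv_bounded_linear[THEN iffD1] linear_coord)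
  have UT: "bounded_linear ?T" "bounded_linear ?U"
    using linear_coord linear_uncoord linear_conv_bounded_linear by blast+
  have derf: "(f has_derivative f' y) (at y within S)" if "y \<in> S" for y
  proof -
    have "(?U has_derivative ?U) (at y)" by (rule bounded_linear_imp_has_derivative[OF UT(2)])
    moreover have "(G has_derivative G' (?U y)) (at (?U y))"
      using that by (intro der) (simp add: S_eq)
    ultimately have "((\<lambda>y. G (?U y)) has_derivative (\<lambda>h. G' (?U y) (?U h))) (at y)"
      by (rule has_derivative_compose)
    then have "(f has_derivative f' y) (at y)"
      unfolding f_def f'_def by (rule bounded_linear.has_derivative[OF UT(1)])
    then show ?thesis by (rule has_derivative_at_withinI)
  qed
  have Uax: "?U (axis t 1) = \<beta> t" for t
    by (simp add: uncoord_def axis_def if_distrib[of "\<lambda>x. x *\<^sub>R _"] cong: if_cong)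
  have detf: "det (matrix (f' y)) = D (?U y)" for y
    unfolding D_def matrix_def f'_def coord_def Uax by simp
  have cont': "continuous_on S (\<lambda>y. D (?U y))"
    by (rule continuous_on_compose2[OF cont[folded D_def]])
      (auto simp: S_eq intro: linear_continuous_on UT)
  have meas: "(\<lambda>y. indicator S y *\<^sub>R \<bar>D (?U y)\<bar>) \<in> borel_measurable borel"
  proof -
    have "continuous_on S (\<lambda>y. \<bar>D (?U y)\<bar>)" by (intro continuous_intros cont')
    then show ?thesis by (rule borel_measurable_continuous_on_indicator[OF S])
  qed
  have finS: "emeasure lborel S < \<infinity>"
    using emeasure_bounded_finite[OF bS] by simp
  have int: "integrable lborel (\<lambda>y. indicator S y *\<^sub>R \<bar>D (?U y)\<bar>)"
  proof (rule integrableI_bounded_set[where A=S and B=B])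
    show "AE x in lborel. x \<in> S \<longrightarrow> norm (indicator S x *\<^sub>R \<bar>D (?U x)\<bar>) \<le> B"
      using bd by (auto simp: S_eq D_def)
  qed (use S meas finS in auto)
  then have sint: "set_integrable lborel S (\<lambda>y. \<bar>D (?U y)\<bar>)"
    by (simp add: set_integrable_def)
  have iS: "(\<lambda>y. \<bar>det (matrix (f' y))\<bar>) integrable_on S"
    unfolding detf using set_borel_integral_eq_integral(1)[OF sint] .
  have Sleb: "S \<in> sets lebesgue" using S by simp
  have fl: "f ` S \<in> lmeasurable"
    by (rule measurable_differentiable_image[OF Sleb derf iS])
  have "measure lebesgue (f ` S) \<le> integral S (\<lambda>y. \<bar>det (matrix (f' y))\<bar>)"
    by (rule measure_differentiable_image[OF Sleb derf iS])
  also have "\<dots> = (LINT y|lborel. indicator S y *\<^sub>R \<bar>D (?U y)\<bar>)"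
    unfolding detf using set_borel_integral_eq_integral(2)[OF sint] by (simp add: set_lebesgue_integral_def)
  finally have le1: "measure lebesgue (f ` S) \<le> (LINT y|lborel. indicator S y *\<^sub>R \<bar>D (?U y)\<bar>)" .
  have TQ_eq: "?T ` Q = ?U -` Q"
    using coord_inverse[OF \<beta>] by (auto simp: image_iff) metis
  have TQ: "?T ` Q \<in> sets borel"
    unfolding TQ_eq using measurable_sets[OF borel_measurable_uncoord Q(1)] by simp
  have sub: "?T ` Q \<subseteq> f ` S"
  proof -
    have "?T ` Q \<subseteq> ?T ` G ` P" using Q(3) by blast
    also have "\<dots> = f ` S" by (simp add: f_def S_def image_image coord_inverse[OF \<beta>])
    finally show ?thesis .
  qed
  have "emeasure lborel Q = emeasure (distr lborel borel ?T) (?T ` Q)"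
  proof (subst emeasure_distr)
    have "?T -` ?T ` Q = Q"
      using coord_inverse(2)[OF \<beta>] by (auto simp: image_iff) metis
    then show "emeasure lborel Q = emeasure lborel (?T -` ?T ` Q \<inter> space lborel)" by simp
  qed (use TQ in auto)
  also have "\<dots> = emeasure lborel (?T ` Q)"
    by (simp add: lborel_coord[OF \<beta>, symmetric])
  also have "\<dots> = emeasure lebesgue (?T ` Q)"
    using TQ by simp
  also have "\<dots> \<le> emeasure lebesgue (f ` S)"
    using fl sub by (intro emeasure_mono) (auto simp: fmeasurable_def)
  also have "\<dots> = ennreal (measure lebesgue (f ` S))"
    using fl by (simp add: emeasure_eq_measure2)
  also have "\<dots> \<le> ennreal (LINT y|lborel. indicator S y *\<^sub>R \<bar>D (?U y)\<bar>)"
    using le1 by (rule ennreal_leI)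
  also have "\<dots> = (\<integral>\<^sup>+y. ennreal (indicator S y *\<^sub>R \<bar>D (?U y)\<bar>) \<partial>lborel)"
    by (rule nn_integral_eq_integral[symmetric, OF int]) simp
  also have "\<dots> = (\<integral>\<^sup>+y. ennreal (indicator S y *\<^sub>R \<bar>D (?U y)\<bar>) \<partial>distr lborel borel ?T)"
    by (simp add: lborel_coord[OF \<beta>, symmetric])
  also have "\<dots> = (\<integral>\<^sup>+x. ennreal (indicator S (?T x) *\<^sub>R \<bar>D (?U (?T x))\<bar>) \<partial>lborel)"
    using meas by (intro nn_integral_distr) auto
  also have "\<dots> \<le> (\<integral>\<^sup>+x. ennreal (J x) * indicator P x \<partial>lborel)"
  proof (rule nn_integral_mono)
    fix x
    show "ennreal (indicator S (?T x) *\<^sub>R \<bar>D (?U (?T x))\<bar>) \<le> ennreal (J x) * indicator P x"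
      using J[of x] by (cases "x \<in> P") (auto simp: S_eq coord_inverse[OF \<beta>] D_def intro!: ennreal_leI)
  qed
  finally show ?thesis .
qed

section \<open>The logarithmic gradient\<close>

text \<open>Squaring removes the corner of the positive part, so the cutoff below is differentiable
  across the boundary of the ball.\<close>

lemma DERIV_pos_part_power2: "((\<lambda>t. (max 0 t)\<^sup>2) has_real_derivative 2 * max 0 t) (at (t::real))"
proof (cases t "0::real" rule: linorder_cases)
  case less
  have "((\<lambda>t. 0) has_real_derivative 2 * max 0 t) (at t)"
    using less by (auto intro!: derivative_eq_intros)
  then show ?thesis
    by (rule has_field_derivative_transform_within_open[where S="{..<0}"]) (use less in auto)
next
  case equal
  have "((\<lambda>h::real. ((max 0 (0 + h))\<^sup>2 - (max 0 0)\<^sup>2) / h) \<longlongrightarrow> 0) (at 0)"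
  proof (rule tendsto_norm_zero_cancel, rule tendsto_sandwich[where f="\<lambda>_. 0" and h="\<lambda>h. \<bar>h\<bar>"])
    show "\<forall>\<^sub>F h in at 0. norm (((max 0 (0 + h))\<^sup>2 - (max 0 0)\<^sup>2) / h) \<le> \<bar>h::real\<bar>"
      by (rule always_eventually) (auto simp: max_def power2_eq_square)
  qed (auto intro: tendsto_rabs_zero)
  then show ?thesis
    using equal by (simp add: DERIV_def)
next
  case greater
  have "((\<lambda>t. t\<^sup>2) has_real_derivative 2 * max 0 t) (at t)"
    using greater by (auto intro!: derivative_eq_intros)
  then show ?thesis
    by (rule has_field_derivative_transform_within_open[where S="{0<..}"]) (use greater in auto)
qed

text \<open>Difference quotients of \<open>f\<close> have integral zero by translation invariance.
  The mean value theorem bounds them by \<open>B\<close> and they vanish off a fixed ball, so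
  dominated convergence passes to the derivative.\<close>

lemma integral_directional_derivative_0:
  fixes f :: "'a::euclidean_space \<Rightarrow> real"
  assumes der: "\<And>x. ((\<lambda>t. f (x + t *\<^sub>R e)) has_real_derivative f' x) (at 0)"
    and meas: "f \<in> borel_measurable borel"
    and supp: "\<And>x. x \<notin> cball z r \<Longrightarrow> f x = 0"
    and bd: "\<And>x. \<bar>f x\<bar> \<le> B0" "\<And>x. \<bar>f' x\<bar> \<le> B"
    and r: "r \<ge> 0"
  shows "integrable lborel f'" "(LINT x|lborel. f' x) = 0"
proof -
  define t where "t n = 1 / real (Suc n)" for n
  define q where "q n x = (f (x + t n *\<^sub>R e) - f x) / t n" for n x
  have t: "0 < t n" "t n \<le> 1" for n by (auto simp: t_def)
  have t0: "t \<longlonglongrightarrow> 0" unfolding t_def by (rule LIMSEQ_Suc[OF lim_1_over_n])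
  have B: "B \<ge> 0" using bd(2)[of z] by linarith
  have [measurable]: "f \<in> borel_measurable borel" by (rule meas)
  have qm: "q n \<in> borel_measurable lborel" for n
    unfolding q_def[abs_def] by simp
  have lim: "(\<lambda>n. q n x) \<longlonglongrightarrow> f' x" for x
  proof -
    have "((\<lambda>h. (f (x + h *\<^sub>R e) - f x) / h) \<longlongrightarrow> f' x) (at 0)"
      using der[of x] by (simp add: DERIV_def)
    moreover have "filterlim t (at 0) sequentially"
      using t0 t(1) by (auto simp: filterlim_at less_imp_neq intro!: always_eventually) (metis less_irrefl)
    ultimately show ?thesis
      unfolding q_def by (rule filterlim_compose)
  qed
  have derx: "((\<lambda>t. f (x + t *\<^sub>R e)) has_real_derivative f' (x + s *\<^sub>R e)) (at s)" for x s
  proof -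
    have "((\<lambda>t. f ((x + s *\<^sub>R e) + t *\<^sub>R e)) has_real_derivative f' (x + s *\<^sub>R e)) (at 0)"
      by (rule der)
    then have "((\<lambda>t. (\<lambda>t. f (x + t *\<^sub>R e)) (t + s)) has_real_derivative f' (x + s *\<^sub>R e)) (at 0)"
      by (simp add: algebra_simps)
    then show ?thesis
      using DERIV_at_within_shift[of "\<lambda>t. f (x + t *\<^sub>R e)" "f' (x + s *\<^sub>R e)" s 0 UNIV] by (simp add: add.commute)
  qed
  have qB: "\<bar>q n x\<bar> \<le> B" for n x
  proof -
    obtain s where "f (x + t n *\<^sub>R e) - f (x + 0 *\<^sub>R e) = (t n - 0) * f' (x + s *\<^sub>R e)"
      using MVT2[OF t(1)[of n], of "\<lambda>s. f (x + s *\<^sub>R e)" "\<lambda>s. f' (x + s *\<^sub>R e)"] derx by blast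
    then have "q n x = f' (x + s *\<^sub>R e)" using t(1)[of n] by (simp add: q_def)
    then show ?thesis using bd(2) by simp
  qed
  \<comment> \<open>The shifts have length at most \<open>norm e\<close>, so enlarging the radius by
    that amount covers the supports of all quotients.\<close>
  have qs: "q n x = 0" if "x \<notin> cball z (r + norm e)" for n x
  proof -
    have "t n * norm e \<le> norm e" using t(2)[of n] t(1)[of n] by (simp add: mult_left_le_one_le less_imp_le)
    then have "dist z x \<le> dist z (x + t n *\<^sub>R e) + norm e"
      using dist_triangle[of z x "x + t n *\<^sub>R e"] t(1)[of n] by (simp add: dist_norm)
    then have "x + t n *\<^sub>R e \<notin> cball z r" "x \<notin> cball z r"
      using that norm_ge_zero[of e] by (auto simp del: norm_ge_zero)
    then show ?thesis by (simp add: q_def supp)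
  qed
  have iw: "integrable lborel (\<lambda>x. B * indicator (cball z (r + norm e)) x)"
    using emeasure_lborel_cball_finite[of z "r + norm e"] by (intro integrable_mult_right integrable_real_indicator) auto
  have bound: "AE x in lborel. norm (q n x) \<le> B * indicator (cball z (r + norm e)) x" for n
    using qB qs by (auto simp: indicator_def)
  have f'm: "f' \<in> borel_measurable lborel"
    by (rule borel_measurable_LIMSEQ_real[OF lim qm])
  have lim': "AE x in lborel. (\<lambda>n. q n x) \<longlonglongrightarrow> f' x" by (simp add: lim)
  show "integrable lborel f'"
    by (rule integrable_dominated_convergence[OF f'm qm iw lim' bound])
  have conv: "(\<lambda>n. LINT x|lborel. q n x) \<longlonglongrightarrow> (LINT x|lborel. f' x)"
    by (rule integral_dominated_convergence[OF f'm qm iw lim' bound])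
  have fint: "integrable lborel f"
  proof (rule integrableI_bounded_set[where A="cball z r" and B=B0])
    show "emeasure lborel (cball z r) < \<infinity>"
      using emeasure_lborel_cball_finite[of z r] by (simp add: top.not_eq_extremum)
  qed (use bd supp in auto)
  have "(LINT x|lborel. q n x) = 0" for n
  proof -
    have eq: "distr lborel borel (\<lambda>x. t n *\<^sub>R e + x) = lborel"
      using lborel_distr_plus[of "t n *\<^sub>R e"] by simp
    have "integrable (distr lborel borel (\<lambda>x. t n *\<^sub>R e + x)) f"
      unfolding eq by (rule fint)
    then have 1: "integrable lborel (\<lambda>x. f (x + t n *\<^sub>R e))"
      by (subst (asm) integrable_distr_eq) (auto simp: add.commute)
    have "(LINT x|lborel. f x) = (LINT x|distr lborel borel (\<lambda>x. t n *\<^sub>R e + x). f x)"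
      unfolding eq ..
    also have "\<dots> = (LINT x|lborel. f (x + t n *\<^sub>R e))"
      by (subst integral_distr) (auto simp: add.commute)
    finally have "(LINT x|lborel. f (x + t n *\<^sub>R e)) = (LINT x|lborel. f x)" ..
    with 1 have "(LINT x|lborel. f (x + t n *\<^sub>R e)) = (LINT x|lborel. f x)" "integrable lborel (\<lambda>x. f (x + t n *\<^sub>R e))"
      by simp_all
    then show ?thesis
      unfolding q_def using fint by (simp add: Bochner_Integration.integral_diff)
  qed
  then have "(\<lambda>n. 0) \<longlonglongrightarrow> (LINT x|lborel. f' x)"
    using conv by simp
  then show "(LINT x|lborel. f' x) = 0"
    using LIMSEQ_unique[OF tendsto_const] by metis
qed

text \<open>Integration by parts against a cutoff: the integrand is the derivative along
  \<open>e\<close> of \<psi>^2 X, extended by zero. The factor 4 comes from the two squares, that of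
  \<psi> and that of the norm.\<close>

lemma integral_cutoff_derivative_0:
  fixes X :: "'a::euclidean_space \<Rightarrow> real"
  assumes S: "open S" "cball z r \<subseteq> S" and r: "r > 0"
    and der: "\<And>x. x \<in> S \<Longrightarrow> ((\<lambda>t. X (x + t *\<^sub>R e)) has_real_derivative X' x) (at 0)"
    and cont: "continuous_on S X" "continuous_on S X'"
  defines "\<psi> \<equiv> \<lambda>x. max 0 (r\<^sup>2 - (norm (x - z))\<^sup>2)"
  shows "integrable lborel (\<lambda>x. indicator (cball z r) x * ((\<psi> x)\<^sup>2 * X' x - 4 * \<psi> x * ((x - z) \<bullet> e) * X x))"
    and "(LINT x|lborel. indicator (cball z r) x * ((\<psi> x)\<^sup>2 * X' x - 4 * \<psi> x * ((x - z) \<bullet> e) * X x)) = 0"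
proof -
  let ?K = "cball z r"
  define f where "f x = indicator ?K x * ((\<psi> x)\<^sup>2 * X x)" for x
  define f' where "f' x = indicator ?K x * ((\<psi> x)\<^sup>2 * X' x - 4 * \<psi> x * ((x - z) \<bullet> e) * X x)" for x
  have \<psi>c: "continuous_on T \<psi>" for T unfolding \<psi>_def by (intro continuous_intros)
  have \<psi>0: "\<psi> x = 0" if "x \<notin> ball z r" for x
  proof -
    have "r \<le> norm (x - z)" using that by (simp add: dist_norm norm_minus_commute)
    then have "r\<^sup>2 \<le> (norm (x - z))\<^sup>2" using r by (intro power_mono) auto
    then show ?thesis by (simp add: \<psi>_def)
  qed
  have f_eq: "f x = (\<psi> x)\<^sup>2 * X x" "f' x = (\<psi> x)\<^sup>2 * X' x - 4 * \<psi> x * ((x - z) \<bullet> e) * X x" for x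
    using \<psi>0[of x] by (cases "x \<in> ?K"; simp add: f_def f'_def)+
  have cK: "continuous_on ?K X" "continuous_on ?K X'"
    using cont S continuous_on_subset by blast+
  have derf: "((\<lambda>t. f (x + t *\<^sub>R e)) has_real_derivative f' x) (at 0)" for x
  proof (cases "x \<in> S")
    case True
    have sq: "(norm (x + t *\<^sub>R e - z))\<^sup>2 = (norm (x - z))\<^sup>2 + 2 * t * ((x - z) \<bullet> e) + t\<^sup>2 * (norm e)\<^sup>2" for t
      unfolding power2_norm_eq_inner by (simp add: algebra_simps inner_commute power2_eq_square)
    have 1: "((\<lambda>t. r\<^sup>2 - (norm (x + t *\<^sub>R e - z))\<^sup>2) has_real_derivative - 2 * ((x - z) \<bullet> e)) (at 0)"
      unfolding sq by (auto intro!: derivative_eq_intros)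
    have 2: "((\<lambda>t. (max 0 t)\<^sup>2) has_real_derivative 2 * \<psi> x) (at (r\<^sup>2 - (norm (x + 0 *\<^sub>R e - z))\<^sup>2))"
      using DERIV_pos_part_power2[of "r\<^sup>2 - (norm (x - z))\<^sup>2"] by (simp add: \<psi>_def)
    have "((\<lambda>t. (\<psi> (x + t *\<^sub>R e))\<^sup>2) has_real_derivative 2 * \<psi> x * (- 2 * ((x - z) \<bullet> e))) (at 0)"
      using DERIV_chain2[OF 2 1] by (simp add: \<psi>_def)
    from DERIV_mult[OF this der[OF True]]
    show ?thesis
      unfolding f_eq by (rule DERIV_cong) (simp add: algebra_simps)
  next
    case False
    then have "x \<notin> ?K" using S by blast
    then have "x \<in> - ?K" by simp
    then obtain d where d: "d > 0" "ball x d \<subseteq> - ?K"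
      using open_Compl[OF closed_cball] open_contains_ball by blast
    have "((\<lambda>t. 0) has_real_derivative f' x) (at 0)"
      using \<open>x \<notin> ?K\<close> by (simp add: f'_def)
    then show ?thesis
    proof (rule has_field_derivative_transform_within_open[where S="ball 0 (d / (norm e + 1))"])
      show "(0::real) \<in> ball 0 (d / (norm e + 1))" using d by (simp add: add_nonneg_pos)
      fix t :: real assume "t \<in> ball 0 (d / (norm e + 1))"
      moreover have "norm e + 1 > 0" by (simp add: add_nonneg_pos)
      ultimately have "\<bar>t\<bar> * (norm e + 1) < d" by (simp add: pos_less_divide_eq)
      then have "\<bar>t\<bar> * norm e < d" using abs_ge_zero[of t] by (simp add: algebra_simps)
      then have "x + t *\<^sub>R e \<in> ball x d" by (simp add: dist_norm)
      then have "x + t *\<^sub>R e \<notin> ?K" using d by blast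
      then show "0 = f (x + t *\<^sub>R e)" by (simp add: f_def)
    qed auto
  qed
  have bdd: "\<exists>B. \<forall>x. \<bar>indicator ?K x * g x\<bar> \<le> B" if "continuous_on ?K g" for g :: "'a \<Rightarrow> real"
  proof -
    have "bounded (g ` ?K)"
      by (intro compact_imp_bounded compact_continuous_image that compact_cball)
    then obtain B where "\<forall>y\<in>g ` ?K. norm y \<le> B"
      unfolding bounded_iff by blast
    then have "\<bar>indicator ?K x * g x\<bar> \<le> max 0 B" for x
      by (cases "x \<in> ?K") (auto simp: le_max_iff_disj)
    then show ?thesis by blast
  qed
  have c1: "continuous_on ?K (\<lambda>x. (\<psi> x)\<^sup>2 * X x)" "continuous_on ?K (\<lambda>x. (\<psi> x)\<^sup>2 * X' x - 4 * \<psi> x * ((x - z) \<bullet> e) * X x)"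
    by (intro continuous_intros \<psi>c cK)+
  obtain B0 where B0: "\<And>x. \<bar>f x\<bar> \<le> B0" using bdd[OF c1(1)] unfolding f_def by blast
  obtain B1 where B1: "\<And>x. \<bar>f' x\<bar> \<le> B1" using bdd[OF c1(2)] unfolding f'_def by blast
  have fm: "f \<in> borel_measurable borel"
    using borel_measurable_continuous_on_indicator[OF _ c1(1)] by (simp add: f_def[abs_def])
  have "integrable lborel f'" "(LINT x|lborel. f' x) = 0"
    by (rule integral_directional_derivative_0[OF derf fm _ B0 B1, of z r]; use r in \<open>simp add: f_def\<close>)+
  then show "integrable lborel (\<lambda>x. indicator (cball z r) x * ((\<psi> x)\<^sup>2 * X' x - 4 * \<psi> x * ((x - z) \<bullet> e) * X x))"
    "(LINT x|lborel. indicator (cball z r) x * ((\<psi> x)\<^sup>2 * X' x - 4 * \<psi> x * ((x - z) \<bullet> e) * X x)) = 0"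
    by (simp_all add: f'_def[abs_def])
qed

lemma Ck_on_1_bounded:
  fixes f :: "'a::euclidean_space \<Rightarrow> real"
  assumes "Ck_on (Suc 0) S f" "compact K" "K \<subseteq> S"
  shows "\<exists>M. \<forall>x\<in>K. \<bar>f x\<bar> \<le> M \<and> \<bar>dd f e x\<bar> \<le> M"
proof -
  have "continuous_on K f" "continuous_on K (dd f e)"
    using assms Ck_on_Suc_imp_continuous continuous_on_subset unfolding Ck_on_Suc by (blast, metis Ck_on_0_D continuous_on_subset)
  then have "bounded (f ` K)" "bounded (dd f e ` K)"
    using assms(2) compact_continuous_image compact_imp_bounded by blast+
  then obtain M1 M2 where "\<And>x. x \<in> K \<Longrightarrow> \<bar>f x\<bar> \<le> M1" "\<And>x. x \<in> K \<Longrightarrow> \<bar>dd f e x\<bar> \<le> M2"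
    unfolding bounded_iff by auto
  then have "\<forall>x\<in>K. \<bar>f x\<bar> \<le> max M1 M2 \<and> \<bar>dd f e x\<bar> \<le> max M1 M2"
    by (auto simp: le_max_iff_disj)
  then show ?thesis ..
qed

text \<open>The component along \<open>b\<close> of the gradient of ln (1 + w).\<close>

definition log_grad :: "('a::euclidean_space \<Rightarrow> real) \<Rightarrow> 'a \<Rightarrow> 'a \<Rightarrow> real" where
  "log_grad w b x = dd w b x / (1 + w x)"

text \<open>With v the gradient of ln (1 + w), the divergence of a v is a first-order remainder,
  plus the contraction of a with D^2 w over 1 + w, minus a(v, v). The inequality for
  \<open>w\<close> bounds the second term by an expression linear in |v|, ellipticity makes the
  third at most -\<kappa> |v|^2, and integration against \<psi>^2 bounds the integral of |v|^2 by
  data that do not involve \<open>w\<close>.\<close>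

theorem log_gradient_bound:
  fixes a :: "'a::euclidean_space \<Rightarrow> 'a \<Rightarrow> 'a \<Rightarrow> real"
  assumes S: "open S" "cball z r \<subseteq> S" and r: "0 < r'" "r' < r"
    and a: "\<And>b c. b \<in> Basis \<Longrightarrow> c \<in> Basis \<Longrightarrow> Ck_on (Suc 0) S (a b c)"
    and \<beta>: "\<And>x b. x \<in> cball z r \<Longrightarrow> b \<in> Basis \<Longrightarrow> \<bar>\<beta> b x\<bar> \<le> M"
    and \<kappa>: "\<kappa> > 0"
    and ell: "\<And>x \<xi>. x \<in> cball z r \<Longrightarrow> \<kappa> * (\<Sum>b\<in>Basis. (\<xi> b)\<^sup>2) \<le> (\<Sum>b\<in>Basis. \<Sum>c\<in>Basis. a b c x * \<xi> b * \<xi> c)"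
  shows "\<exists>C1. \<forall>w. Ck_on (Suc (Suc 0)) S w \<longrightarrow> (\<forall>x\<in>cball z r. 0 \<le> w x) \<longrightarrow>
     (\<forall>x\<in>cball z r. (\<Sum>b\<in>Basis. \<Sum>c\<in>Basis. a b c x * dd (dd w c) b x) + (\<Sum>b\<in>Basis. \<beta> b x * dd w b x) \<le> C0) \<longrightarrow>
     (\<integral>\<^sup>+x. ennreal (\<Sum>b\<in>Basis. (log_grad w b x)\<^sup>2) * indicator (ball z r') x \<partial>lborel) \<le> ennreal C1"
proof -
  let ?K = "cball z r"
  let ?N = "real DIM('a)"
  have "\<exists>A. \<forall>b\<in>Basis. \<forall>c\<in>Basis. \<forall>x\<in>?K. \<bar>a b c x\<bar> \<le> A \<and> \<bar>dd (a b c) b x\<bar> \<le> A"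
  proof -
    have "\<exists>A. \<forall>x\<in>?K. \<bar>a b c x\<bar> \<le> A \<and> \<bar>dd (a b c) b x\<bar> \<le> A" if "b \<in> Basis" "c \<in> Basis" for b c
      using Ck_on_1_bounded[OF a[OF that] compact_cball S(2)] by blast
    then obtain A where A: "\<And>b c x. b \<in> Basis \<Longrightarrow> c \<in> Basis \<Longrightarrow> x \<in> ?K \<Longrightarrow> \<bar>a b c x\<bar> \<le> A b c \<and> \<bar>dd (a b c) b x\<bar> \<le> A b c"
      by metis
    define A' where "A' = (\<Sum>b\<in>Basis. \<Sum>c\<in>Basis. \<bar>A b c\<bar>)"
    have "A b c \<le> A'" if bc: "b \<in> Basis" "c \<in> Basis" for b c
    proof -
      have "\<bar>A b c\<bar> \<le> (\<Sum>c\<in>Basis. \<bar>A b c\<bar>)" using bc by (intro member_le_sum) auto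
      also have "\<dots> \<le> A'" unfolding A'_def using bc by (intro member_le_sum[of b]) (auto intro: sum_nonneg)
      finally show ?thesis by linarith
    qed
    then show ?thesis using A by (intro exI[of _ A']) (meson order_trans)
  qed
  then obtain A0 where A0: "\<And>b c x. b \<in> Basis \<Longrightarrow> c \<in> Basis \<Longrightarrow> x \<in> ?K \<Longrightarrow> \<bar>a b c x\<bar> \<le> A0 \<and> \<bar>dd (a b c) b x\<bar> \<le> A0"
    by blast
  define A where "A = max 0 A0"
  have A: "A \<ge> 0" "\<And>b c x. b \<in> Basis \<Longrightarrow> c \<in> Basis \<Longrightarrow> x \<in> ?K \<Longrightarrow> \<bar>a b c x\<bar> \<le> A"
    "\<And>b c x. b \<in> Basis \<Longrightarrow> c \<in> Basis \<Longrightarrow> x \<in> ?K \<Longrightarrow> \<bar>dd (a b c) b x\<bar> \<le> A"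
    unfolding A_def using A0 by (auto simp: le_max_iff_disj)
  define \<psi> where "\<psi> x = max 0 (r\<^sup>2 - (norm (x - z))\<^sup>2)" for x :: 'a
  have \<psi>: "0 \<le> \<psi> x" "\<psi> x \<le> r\<^sup>2" for x by (auto simp: \<psi>_def)
  define \<psi>0 where "\<psi>0 = r\<^sup>2 - r'\<^sup>2"
  have \<psi>0: "\<psi>0 > 0" using r by (simp add: \<psi>0_def power_strict_mono)
  have \<psi>in: "\<psi>0 \<le> \<psi> x" if "x \<in> ball z r'" for x
  proof -
    have "(norm (x - z))\<^sup>2 \<le> r'\<^sup>2" using that by (intro power_mono) (auto simp: dist_norm norm_minus_commute)
    then show ?thesis by (simp add: \<psi>_def \<psi>0_def)
  qed
  define M' where "M' = max 0 M"
  \<comment> \<open>\<open>?N * A3\<close> bounds the coefficient of \<psi> |v| in the pointwise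
    inequality; \<open>A4\<close> is what remains after that term is absorbed into half of the
    quadratic one.\<close>
  define A3 where "A3 = 4 * r * ?N * A + r\<^sup>2 * ?N * A + r\<^sup>2 * M'"
  define A4 where "A4 = ?N\<^sup>2 * A3\<^sup>2 / (2 * \<kappa>) + r^4 * \<bar>C0\<bar>"
  define C1 where "C1 = 2 * A4 * measure lborel ?K / (\<kappa> * \<psi>0\<^sup>2)"
  have A3: "A3 \<ge> 0" unfolding A3_def M'_def using A(1) r by simp
  show ?thesis
  proof (intro exI[of _ C1] allI impI)
    fix w
    assume C2: "Ck_on (Suc (Suc 0)) S w" and w0: "\<forall>x\<in>?K. 0 \<le> w x"
      and L: "\<forall>x\<in>?K. (\<Sum>b\<in>Basis. \<Sum>c\<in>Basis. a b c x * dd (dd w c) b x) + (\<Sum>b\<in>Basis. \<beta> b x * dd w b x) \<le> C0"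
    \<comment> \<open>\<open>w\<close> is nonnegative only on the closed ball; this open
      neighbourhood keeps 1 + w positive, so that the quotients can be differentiated at the
      boundary of the ball too.\<close>
    define S' where "S' = S \<inter> w -` {-1<..}"
    have cw: "continuous_on S w" by (rule Ck_on_Suc_imp_continuous[OF C2])
    have S': "open S'" "?K \<subseteq> S'" "S' \<subseteq> S"
      unfolding S'_def using cw S w0 by (auto simp: continuous_on_open_vimage Int_commute)
    have w1: "1 + w x > 0" if "x \<in> S'" for x using that by (auto simp: S'_def)
    define v where "v = log_grad w"
    have dw: "(w has_derivative (\<lambda>h. dd w h x)) (at x)" if "x \<in> S'" for x
      using Ck_on_1_D[OF C2] that S' by blast
    have C1': "Ck_on (Suc 0) S (dd w h)" for h
      using C2 unfolding Ck_on_Suc[of "Suc 0"] by blast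
    have ddw: "(dd w h has_derivative (\<lambda>k. dd (dd w h) k x)) (at x)" if "x \<in> S'" for x h
      using Ck_on_1_D[OF C1'] that S' by blast
    have cont_dw: "continuous_on S' (dd w h)" "continuous_on S' (dd (dd w h) k)" "continuous_on S' w" for h k
      using Ck_on_Suc_imp_continuous[OF C1'] C1'[unfolded Ck_on_Suc] cw S'(3) continuous_on_subset by (blast, metis Ck_on_0_D continuous_on_subset, blast)
    \<comment> \<open>The derivative of \<open>v c\<close> along \<open>b\<close>; the quotient rule
      produces the product that becomes the good quadratic term.\<close>
    define v' where "v' b c x = dd (dd w c) b x / (1 + w x) - v c x * v b x" for b c x
    have cont_v: "continuous_on S' (v b)" "continuous_on S' (v' b c)" for b c
      unfolding v_def v'_def log_grad_def using w1 by (auto intro!: continuous_intros cont_dw simp: less_imp_neq[symmetric])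
    have cont_a: "continuous_on S' (a b c)" "continuous_on S' (dd (a b c) b)" if "b \<in> Basis" "c \<in> Basis" for b c
      using Ck_on_Suc_imp_continuous[OF a[OF that]] a[OF that, unfolded Ck_on_Suc] S'(3) continuous_on_subset
      by (blast, metis Ck_on_0_D continuous_on_subset)
    have line: "((\<lambda>t. f (x + t *\<^sub>R b)) has_real_derivative f' b) (at 0)" if "(f has_derivative f') (at x)" for f :: "'a \<Rightarrow> real" and f' x b
      using has_derivative_along_line[of f f' x 0 b] that by simp
    have dv: "((\<lambda>t. v c (x + t *\<^sub>R b)) has_real_derivative v' b c x) (at 0)" if "x \<in> S'" for x b c
    proof -
      have 1: "((\<lambda>t. 1 + w (x + t *\<^sub>R b)) has_real_derivative dd w b x) (at 0)"
        using DERIV_add[OF DERIV_const line[OF dw[OF that]], of 1 b] by simp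
      have "((\<lambda>t. dd w c (x + t *\<^sub>R b) / (1 + w (x + t *\<^sub>R b))) has_real_derivative v' b c x) (at 0)"
        by (rule DERIV_cong[OF DERIV_divide[OF line[OF ddw[OF that]] 1]])
          (use w1[OF that] in \<open>simp_all add: v'_def v_def log_grad_def diff_divide_distrib\<close>)
      then show ?thesis by (simp add: v_def log_grad_def)
    qed
    define X where "X b x = (\<Sum>c\<in>Basis. a b c x * v c x)" for b x
    define X' where "X' b x = (\<Sum>c\<in>Basis. dd (a b c) b x * v c x + a b c x * v' b c x)" for b x
    have dX: "((\<lambda>t. X b (x + t *\<^sub>R b)) has_real_derivative X' b x) (at 0)" if "x \<in> S'" "b \<in> Basis" for x b
      unfolding X_def X'_def
    proof (rule DERIV_sum)
      fix c :: 'a assume c: "c \<in> Basis"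
      have "((\<lambda>t. a b c (x + t *\<^sub>R b)) has_real_derivative dd (a b c) b x) (at 0)"
        using that S' c by (intro line Ck_on_1_D[OF a]) auto
      from DERIV_mult[OF this dv[OF that(1), of c b]]
      show "((\<lambda>t. a b c (x + t *\<^sub>R b) * v c (x + t *\<^sub>R b)) has_real_derivative dd (a b c) b x * v c x + a b c x * v' b c x) (at 0)"
        by (rule DERIV_cong) (simp add: algebra_simps)
    qed
    have cX: "continuous_on S' (X b)" "continuous_on S' (X' b)" if "b \<in> Basis" for b
      unfolding X_def X'_def by (intro continuous_intros cont_v cont_a that; assumption)+
    define q where "q b x = indicator ?K x * ((\<psi> x)\<^sup>2 * X' b x - 4 * \<psi> x * ((x - z) \<bullet> b) * X b x)" for b x
    have r0: "r > 0" using r by simp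
    have q: "integrable lborel (q b)" "(LINT x|lborel. q b x) = 0" if "b \<in> Basis" for b
      using integral_cutoff_derivative_0[OF S'(1,2) r0 dX[OF _ that] cX[OF that]]
      unfolding q_def \<psi>_def by blast+
    define V where "V x = sqrt (\<Sum>b\<in>Basis. (v b x)\<^sup>2)" for x
    have V2: "(V x)\<^sup>2 = (\<Sum>b\<in>Basis. (v b x)\<^sup>2)" for x by (simp add: V_def sum_nonneg)
    have V0: "V x \<ge> 0" for x by (simp add: V_def sum_nonneg)
    have vV: "\<bar>v b x\<bar> \<le> V x" if "b \<in> Basis" for b x
    proof -
      have "(v b x)\<^sup>2 \<le> (\<Sum>b\<in>Basis. (v b x)\<^sup>2)" using that by (intro member_le_sum) auto
      then show ?thesis unfolding V_def using real_le_rsqrt[of "\<bar>v b x\<bar>"] by simp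
    qed
    have cV: "continuous_on ?K V" unfolding V_def
      by (intro continuous_intros continuous_on_subset[OF cont_v(1) S'(2)])
    have point: "(\<Sum>b\<in>Basis. q b x) \<le> indicator ?K x * (A4 - \<kappa> / 2 * ((\<psi> x)\<^sup>2 * (V x)\<^sup>2))" for x
    proof (cases "x \<in> ?K")
      case True
      then have xS: "x \<in> S'" using S' by blast
      have nz: "norm (x - z) \<le> r" using True by (simp add: dist_norm norm_minus_commute)
      have s1: "(\<Sum>b\<in>Basis. X' b x) \<le> ?N\<^sup>2 * A * V x + (\<bar>C0\<bar> + ?N * M' * V x - \<kappa> * (V x)\<^sup>2)"
      proof -
        have "(\<Sum>b\<in>Basis. X' b x) = (\<Sum>b\<in>Basis. \<Sum>c\<in>Basis. dd (a b c) b x * v c x) + (\<Sum>b\<in>Basis. \<Sum>c\<in>Basis. a b c x * v' b c x)"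
          by (simp add: X'_def sum.distrib)
        moreover have "(\<Sum>b\<in>Basis. \<Sum>c\<in>Basis. dd (a b c) b x * v c x) \<le> (\<Sum>b\<in>(Basis::'a set). \<Sum>c\<in>(Basis::'a set). A * V x)"
        proof (intro sum_mono)
          fix b c :: 'a assume bc: "b \<in> Basis" "c \<in> Basis"
          have "dd (a b c) b x * v c x \<le> \<bar>dd (a b c) b x\<bar> * \<bar>v c x\<bar>" by (metis abs_ge_self abs_mult)
          also have "\<dots> \<le> A * V x" using A(1) A(3)[OF bc True] vV[OF bc(2)] by (intro mult_mono) auto
          finally show "dd (a b c) b x * v c x \<le> A * V x" .
        qed
        moreover have "(\<Sum>b\<in>(Basis::'a set). \<Sum>c\<in>(Basis::'a set). A * V x) = ?N\<^sup>2 * A * V x" by (simp add: power2_eq_square)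
        moreover have "(\<Sum>b\<in>Basis. \<Sum>c\<in>Basis. a b c x * v' b c x) =
           (\<Sum>b\<in>Basis. \<Sum>c\<in>Basis. a b c x * dd (dd w c) b x) / (1 + w x) - (\<Sum>b\<in>Basis. \<Sum>c\<in>Basis. a b c x * v b x * v c x)"
          by (simp add: v'_def algebra_simps sum_subtractf sum_divide_distrib)
        moreover have "(\<Sum>b\<in>Basis. \<Sum>c\<in>Basis. a b c x * dd (dd w c) b x) / (1 + w x) \<le> \<bar>C0\<bar> + ?N * M' * V x"
        proof -
          have "(\<Sum>b\<in>Basis. \<Sum>c\<in>Basis. a b c x * dd (dd w c) b x) / (1 + w x) \<le> (C0 - (\<Sum>b\<in>Basis. \<beta> b x * dd w b x)) / (1 + w x)"
            using L True w1[OF xS] by (intro divide_right_mono) (auto simp: algebra_simps)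
          also have "\<dots> = C0 / (1 + w x) - (\<Sum>b\<in>Basis. \<beta> b x * v b x)"
            by (simp add: v_def log_grad_def diff_divide_distrib sum_divide_distrib)
          finally have 1: "(\<Sum>b\<in>Basis. \<Sum>c\<in>Basis. a b c x * dd (dd w c) b x) / (1 + w x) \<le> C0 / (1 + w x) - (\<Sum>b\<in>Basis. \<beta> b x * v b x)" .
          have 2: "C0 / (1 + w x) \<le> \<bar>C0\<bar>"
          proof -
            have "C0 / (1 + w x) \<le> \<bar>C0\<bar> / (1 + w x)" using w1[OF xS] by (intro divide_right_mono) auto
            also have "\<dots> \<le> \<bar>C0\<bar> / 1" using w0 True w1[OF xS] by (intro divide_left_mono) auto
            finally show ?thesis by simp
          qed
          have 3: "- (\<Sum>b\<in>Basis. \<beta> b x * v b x) \<le> (\<Sum>b\<in>(Basis::'a set). M' * V x)"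
            unfolding sum_negf[symmetric]
          proof (intro sum_mono)
            fix b :: 'a assume b: "b \<in> Basis"
            have "- (\<beta> b x * v b x) \<le> \<bar>\<beta> b x\<bar> * \<bar>v b x\<bar>" by (metis abs_ge_minus_self abs_mult)
            also have "\<dots> \<le> M' * V x" using \<beta>[OF True b] vV[OF b] by (intro mult_mono) (auto simp: M'_def)
            finally show "- (\<beta> b x * v b x) \<le> M' * V x" .
          qed
          show ?thesis using 1 2 3 by simp
        qed
        moreover have "\<kappa> * (V x)\<^sup>2 \<le> (\<Sum>b\<in>Basis. \<Sum>c\<in>Basis. a b c x * v b x * v c x)"
          unfolding V2 using ell[OF True, of "\<lambda>b. v b x"] by simp
        ultimately show ?thesis by linarith
      qed
      have s2: "(\<Sum>b\<in>Basis. - (((x - z) \<bullet> b) * X b x)) \<le> r * (?N\<^sup>2 * A * V x)"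
      proof -
        have "(\<Sum>b\<in>Basis. - (((x - z) \<bullet> b) * X b x)) \<le> (\<Sum>b\<in>(Basis::'a set). r * (?N * (A * V x)))"
        proof (rule sum_mono)
          fix b :: 'a assume b: "b \<in> Basis"
          have "\<bar>X b x\<bar> \<le> (\<Sum>c\<in>(Basis::'a set). A * V x)"
            unfolding X_def
          proof (rule order_trans[OF sum_abs sum_mono])
            fix c :: 'a assume c: "c \<in> Basis"
            show "\<bar>a b c x * v c x\<bar> \<le> A * V x"
              unfolding abs_mult using A(1) A(2)[OF b c True] vV[OF c] by (intro mult_mono) auto
          qed
          then have X: "\<bar>X b x\<bar> \<le> ?N * (A * V x)" by simp
          have "- (((x - z) \<bullet> b) * X b x) \<le> \<bar>(x - z) \<bullet> b\<bar> * \<bar>X b x\<bar>" by (metis abs_ge_minus_self abs_mult)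
          also have "\<dots> \<le> r * (?N * (A * V x))"
            using X Basis_le_norm[OF b, of "x - z"] nz r0 by (intro mult_mono) auto
          finally show "- (((x - z) \<bullet> b) * X b x) \<le> r * (?N * (A * V x))" .
        qed
        then show ?thesis by (simp add: power2_eq_square mult_ac)
      qed
      have "(\<Sum>b\<in>Basis. q b x) = (\<psi> x)\<^sup>2 * (\<Sum>b\<in>Basis. X' b x) + 4 * \<psi> x * (\<Sum>b\<in>Basis. - (((x - z) \<bullet> b) * X b x))"
        using True unfolding q_def sum_distrib_left sum.distrib[symmetric] by (intro sum.cong refl) simp
      also have "\<dots> \<le> (\<psi> x)\<^sup>2 * (?N\<^sup>2 * A * V x + (\<bar>C0\<bar> + ?N * M' * V x - \<kappa> * (V x)\<^sup>2)) + 4 * \<psi> x * (r * (?N\<^sup>2 * A * V x))"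
        using s1 s2 \<psi>(1)[of x] by (intro add_mono mult_left_mono) auto
      also have "\<dots> = (\<psi> x * V x) * (\<psi> x * (?N\<^sup>2 * A) + \<psi> x * (?N * M') + 4 * r * (?N\<^sup>2 * A)) + (\<psi> x)\<^sup>2 * \<bar>C0\<bar> - \<kappa> * (\<psi> x * V x)\<^sup>2"
        by (simp add: power2_eq_square algebra_simps)
      also have "\<psi> x * (?N\<^sup>2 * A) + \<psi> x * (?N * M') + 4 * r * (?N\<^sup>2 * A) \<le> ?N * A3"
      proof -
        have "\<psi> x * (?N\<^sup>2 * A) \<le> r\<^sup>2 * (?N\<^sup>2 * A)" using \<psi>[of x] A(1) by (intro mult_right_mono) auto
        moreover have "\<psi> x * (?N * M') \<le> r\<^sup>2 * (?N * M')" using \<psi>[of x] by (intro mult_right_mono) (auto simp: M'_def)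
        ultimately show ?thesis by (simp add: A3_def power2_eq_square algebra_simps)
      qed
      also have "(\<psi> x)\<^sup>2 * \<bar>C0\<bar> \<le> r^4 * \<bar>C0\<bar>"
      proof -
        have "(\<psi> x)\<^sup>2 \<le> (r\<^sup>2)\<^sup>2" using \<psi>[of x] by (intro power_mono) auto
        then show ?thesis by (intro mult_right_mono) auto
      qed
      finally have "(\<Sum>b\<in>Basis. q b x) \<le> (\<psi> x * V x) * (?N * A3) + r^4 * \<bar>C0\<bar> - \<kappa> * (\<psi> x * V x)\<^sup>2"
        using \<psi>(1)[of x] V0[of x] by (simp add: mult_left_mono)
      \<comment> \<open>Young's inequality, with half of the quadratic term spent on the linear
        one.\<close>
      also have "(\<psi> x * V x) * (?N * A3) \<le> (?N * A3)\<^sup>2 / (2 * \<kappa>) + \<kappa> / 2 * (\<psi> x * V x)\<^sup>2"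
      proof -
        have "0 \<le> (?N * A3 - \<kappa> * (\<psi> x * V x))\<^sup>2 / (2 * \<kappa>)" using \<kappa> by simp
        also have "\<dots> = (?N * A3)\<^sup>2 / (2 * \<kappa>) + \<kappa> / 2 * (\<psi> x * V x)\<^sup>2 - (\<psi> x * V x) * (?N * A3)"
          using \<kappa> by (simp add: power2_eq_square field_simps)
        finally show ?thesis by simp
      qed
      finally show ?thesis
        using True by (simp add: A4_def power_mult_distrib algebra_simps)
    qed (simp add: q_def)
    define g where "g x = indicator ?K x * ((\<psi> x)\<^sup>2 * (V x)\<^sup>2)" for x
    have gint: "integrable lborel g"
    proof -
      have "continuous_on ?K (\<lambda>x. (\<psi> x)\<^sup>2 * (V x)\<^sup>2)"
        unfolding \<psi>_def by (intro continuous_intros cV)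
      from borel_integrable_compact[OF compact_cball this] show ?thesis
        by (simp add: g_def[abs_def] indicator_def if_distrib[of "\<lambda>x. x * _"] cong: if_cong)
    qed
    have fin: "emeasure lborel ?K \<noteq> \<infinity>" using emeasure_lborel_cball_finite[of z r] by simp
    have iK: "integrable lborel (\<lambda>x. indicator ?K x * A4)"
      using fin by (intro integrable_mult_left integrable_real_indicator) (auto simp: top.not_eq_extremum)
    have "0 = (LINT x|lborel. (\<Sum>b\<in>Basis. q b x))"
      by (subst Bochner_Integration.integral_sum) (use q in auto)
    also have "\<dots> \<le> (LINT x|lborel. indicator ?K x * A4 - \<kappa> / 2 * g x)"
    proof (rule integral_mono)
      show "integrable lborel (\<lambda>x. \<Sum>b\<in>Basis. q b x)" using q by (intro Bochner_Integration.integrable_sum) auto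
      show "integrable lborel (\<lambda>x. indicator ?K x * A4 - \<kappa> / 2 * g x)"
        using gint iK by (intro Bochner_Integration.integrable_diff integrable_mult_right) auto
      show "(\<Sum>b\<in>Basis. q b x) \<le> indicator ?K x * A4 - \<kappa> / 2 * g x" for x
        using point[of x] by (simp add: g_def algebra_simps)
    qed
    also have "\<dots> = measure lborel ?K * A4 - \<kappa> / 2 * (LINT x|lborel. g x)"
      using gint iK by (subst Bochner_Integration.integral_diff) auto
    finally have gle: "(LINT x|lborel. g x) \<le> 2 * A4 * measure lborel ?K / \<kappa>"
      using \<kappa> by (simp add: field_simps)
    have "(\<integral>\<^sup>+x. ennreal (\<Sum>b\<in>Basis. (log_grad w b x)\<^sup>2) * indicator (ball z r') x \<partial>lborel)
        \<le> (\<integral>\<^sup>+x. ennreal (g x / \<psi>0\<^sup>2) \<partial>lborel)"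
    proof (rule nn_integral_mono)
      fix x
      show "ennreal (\<Sum>b\<in>Basis. (log_grad w b x)\<^sup>2) * indicator (ball z r') x \<le> ennreal (g x / \<psi>0\<^sup>2)"
      proof (cases "x \<in> ball z r'")
        case True
        then have xK: "x \<in> ?K" using r by auto
        have "\<psi>0\<^sup>2 \<le> (\<psi> x)\<^sup>2" using \<psi>in[OF True] \<psi>0 by (intro power_mono) auto
        then have "\<psi>0\<^sup>2 * (V x)\<^sup>2 \<le> (\<psi> x)\<^sup>2 * (V x)\<^sup>2" by (intro mult_right_mono) auto
        then have "(V x)\<^sup>2 \<le> g x / \<psi>0\<^sup>2" using \<psi>0 xK by (simp add: g_def field_simps)
        then show ?thesis using True by (simp add: V2 v_def ennreal_leI)
      qed simp
    qed
    also have "\<dots> = ennreal (LINT x|lborel. g x / \<psi>0\<^sup>2)"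
    proof (rule nn_integral_eq_integral)
      show "integrable lborel (\<lambda>x. g x / \<psi>0\<^sup>2)" using gint by simp
    qed (simp add: g_def)
    also have "\<dots> \<le> ennreal C1"
    proof (rule ennreal_leI)
      have "(LINT x|lborel. g x / \<psi>0\<^sup>2) = (LINT x|lborel. g x) / \<psi>0\<^sup>2" by simp
      also have "\<dots> \<le> (2 * A4 * measure lborel ?K / \<kappa>) / \<psi>0\<^sup>2"
        using gle by (intro divide_right_mono) auto
      finally show "(LINT x|lborel. g x / \<psi>0\<^sup>2) \<le> C1" by (simp add: C1_def)
    qed
    finally show "(\<integral>\<^sup>+x. ennreal (\<Sum>b\<in>Basis. (log_grad w b x)\<^sup>2) * indicator (ball z r') x \<partial>lborel) \<le> ennreal C1" .
  qed
qed

section \<open>Decay of superlevel sets\<close>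

lemma nn_integral_translate:
  fixes f :: "'a::euclidean_space \<Rightarrow> ennreal"
  assumes [measurable]: "f \<in> borel_measurable borel"
  shows "(\<integral>\<^sup>+x. f (x + h) \<partial>lborel) = (\<integral>\<^sup>+x. f x \<partial>lborel)"
proof -
  have eq: "distr lborel borel (\<lambda>x. h + x) = lborel"
    using lborel_distr_plus[of h] by simp
  have "(\<integral>\<^sup>+x. f x \<partial>lborel) = (\<integral>\<^sup>+x. f x \<partial>distr lborel borel (\<lambda>x. h + x))"
    unfolding eq ..
  also have "\<dots> = (\<integral>\<^sup>+x. f (h + x) \<partial>lborel)"
    by (rule nn_integral_distr) auto
  finally show ?thesis by (simp add: add.commute)
qed

text \<open>The fundamental theorem of calculus along the segment from \<open>x\<close> to
  \<open>x + h\<close>.\<close>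

lemma increment_le_nn_integral:
  fixes v :: "'a::euclidean_space \<Rightarrow> real"
  assumes der: "\<And>x. x \<in> B \<Longrightarrow> (v has_derivative v' x) (at x)"
    and cont: "continuous_on B (\<lambda>x. v' x h)"
    and bd: "\<And>x. x \<in> B \<Longrightarrow> \<bar>v' x h\<bar> \<le> norm h * V x"
    and cV: "continuous_on B V"
    and seg: "\<And>s. 0 \<le> s \<Longrightarrow> s \<le> 1 \<Longrightarrow> x + s *\<^sub>R h \<in> B"
  shows "ennreal (v (x + h) - v x) \<le> ennreal (norm h) * (\<integral>\<^sup>+s. ennreal (V (x + s *\<^sub>R h)) * indicator {0..1} s \<partial>lborel)"
proof -
  define g where "g s = v' (x + s *\<^sub>R h) h" for s
  have cg: "continuous_on {0..1} g"
    unfolding g_def by (rule continuous_on_compose2[OF cont]) (auto intro!: continuous_intros seg)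
  have cV': "continuous_on {0..1} (\<lambda>s. V (x + s *\<^sub>R h))"
    by (rule continuous_on_compose2[OF cV]) (auto intro!: continuous_intros seg)
  have int: "(g has_integral (v (x + 1 *\<^sub>R h) - v (x + 0 *\<^sub>R h))) {0..1}"
  proof (rule fundamental_theorem_of_calculus)
    fix s :: real assume s: "s \<in> {0..1}"
    have "((\<lambda>s. v (x + s *\<^sub>R h)) has_real_derivative g s) (at s)"
      unfolding g_def using s by (intro has_derivative_along_line der seg) auto
    then show "((\<lambda>s. v (x + s *\<^sub>R h)) has_vector_derivative g s) (at s within {0..1})"
      by (simp add: has_real_derivative_iff_has_vector_derivative has_vector_derivative_at_within)
  qed simp
  have sg: "set_integrable lborel {0..1} g" "set_integrable lborel {0..1} (\<lambda>s. norm h * V (x + s *\<^sub>R h))"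
    using cg cV' by (auto intro!: borel_integrable_atLeastAtMost' continuous_intros)
  have "v (x + h) - v x = integral {0..1} g"
    using int by (simp add: integral_unique)
  also have "\<dots> = (LINT s:{0..1}|lborel. g s)"
    using set_borel_integral_eq_integral(2)[OF sg(1)] by simp
  also have "\<dots> \<le> (LINT s:{0..1}|lborel. norm h * V (x + s *\<^sub>R h))"
    using bd seg by (intro set_integral_mono sg) (auto simp: g_def abs_le_iff)
  finally have "ennreal (v (x + h) - v x) \<le> ennreal (LINT s:{0..1}|lborel. norm h * V (x + s *\<^sub>R h))"
    by (rule ennreal_leI)
  also have "\<dots> = (\<integral>\<^sup>+s. ennreal (indicator {0..1} s *\<^sub>R (norm h * V (x + s *\<^sub>R h))) \<partial>lborel)"
    unfolding set_lebesgue_integral_def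
  proof (rule nn_integral_eq_integral[symmetric])
    show "integrable lborel (\<lambda>s. indicator {0..1} s *\<^sub>R (norm h * V (x + s *\<^sub>R h)))"
      using sg(2) by (simp add: set_integrable_def)
    show "AE s in lborel. 0 \<le> indicator {0..1} s *\<^sub>R (norm h * V (x + s *\<^sub>R h))"
    proof (rule AE_I2)
      fix s :: real
      show "0 \<le> indicator {0..1} s *\<^sub>R (norm h * V (x + s *\<^sub>R h))"
        using bd[OF seg, of s] abs_ge_zero[of "v' (x + s *\<^sub>R h) h"] by (cases "s \<in> {0..1}") auto
    qed
  qed
  also have "\<dots> = (\<integral>\<^sup>+s. ennreal (norm h) * (ennreal (V (x + s *\<^sub>R h)) * indicator {0..1} s) \<partial>lborel)"
    by (intro nn_integral_cong) (simp add: indicator_def ennreal_mult')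
  also have "\<dots> = ennreal (norm h) * (\<integral>\<^sup>+s. ennreal (V (x + s *\<^sub>R h)) * indicator {0..1} s \<partial>lborel)"
  proof (rule nn_integral_cmult)
    have "(\<lambda>s. ennreal (indicator {0..1} s *\<^sub>R V (x + s *\<^sub>R h))) \<in> borel_measurable borel"
      using borel_measurable_continuous_on_indicator[OF _ cV'] by simp
    also have "(\<lambda>s. ennreal (indicator {0..1} s *\<^sub>R V (x + s *\<^sub>R h))) = (\<lambda>s. ennreal (V (x + s *\<^sub>R h)) * indicator {0..1} s)"
      by (auto simp: indicator_def)
    finally show "(\<lambda>s. ennreal (V (x + s *\<^sub>R h)) * indicator {0..1} s) \<in> borel_measurable lborel" by simp
  qed
  finally show ?thesis .
qed

text \<open>A weak Poincare inequality on a ball, obtained by integrating the increments of \<open>v\<close> over all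
  translations.\<close>

theorem level_sets_product_bound:
  fixes v :: "'a::euclidean_space \<Rightarrow> real"
  assumes der: "\<And>x. x \<in> ball z r \<Longrightarrow> (v has_derivative v' x) (at x)"
    and cont: "\<And>h. continuous_on (ball z r) (\<lambda>x. v' x h)"
    and bd: "\<And>x h. x \<in> ball z r \<Longrightarrow> \<bar>v' x h\<bar> \<le> norm h * V x"
    and cV: "continuous_on (ball z r) V"
    and mt: "m < t"
  shows "emeasure lborel {x \<in> ball z r. v x \<le> m} * emeasure lborel {x \<in> ball z r. t < v x} * ennreal (t - m)
    \<le> emeasure lborel (ball (0::'a) (2 * r)) * ennreal (2 * r) * (\<integral>\<^sup>+x. ennreal (V x) * indicator (ball z r) x \<partial>lborel)"
proof -
  define B where "B = ball z r"
  define W where "W x = ennreal (V x) * indicator B x" for x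
  define E where "E = {x \<in> B. v x \<le> m}"
  define F where "F = {x \<in> B. t < v x}"
  have cv: "continuous_on B v"
    unfolding B_def using der by (meson continuous_at_imp_continuous_on has_derivative_continuous)
  have W[measurable]: "W \<in> borel_measurable borel"
  proof -
    have "(\<lambda>x. ennreal (indicator B x *\<^sub>R V x)) \<in> borel_measurable borel"
      using borel_measurable_continuous_on_indicator[OF _ cV] by (simp add: B_def)
    also have "(\<lambda>x. ennreal (indicator B x *\<^sub>R V x)) = W"
      by (auto simp: W_def indicator_def)
    finally show ?thesis .
  qed
  have F[measurable]: "F \<in> sets borel"
  proof -
    have "open (B \<inter> v -` {t<..})"
      using cv by (intro continuous_open_preimage) (auto simp: B_def)
    also have "B \<inter> v -` {t<..} = F" by (auto simp: F_def)
    finally show ?thesis by simp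
  qed
  have E[measurable]: "E \<in> sets borel"
  proof -
    have "open (B \<inter> v -` {m<..})"
      using cv by (intro continuous_open_preimage) (auto simp: B_def)
    then have "B - (B \<inter> v -` {m<..}) \<in> sets borel" by (auto simp: B_def)
    also have "B - (B \<inter> v -` {m<..}) = E" by (auto simp: E_def)
    finally show ?thesis .
  qed
  define I where "I = (\<integral>\<^sup>+x. W x \<partial>lborel)"
  \<comment> \<open>Two points of the ball differ by less than \<open>2 * r\<close>, so only such
    translations matter.\<close>
  define cut :: "'a \<Rightarrow> ennreal" where "cut = indicator (ball 0 (2 * r))"
  have cut[measurable]: "cut \<in> borel_measurable borel"
    unfolding cut_def by (intro borel_measurable_indicator borel_open open_ball)
  define \<Phi> where "\<Phi> x h = cut h * ennreal (2 * r) * (\<integral>\<^sup>+s. W (x + s *\<^sub>R h) * indicator {0..1} s \<partial>lborel)" for x h :: 'a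
  have point: "indicator E x * indicator F (x + h) * ennreal (t - m) \<le> \<Phi> x h" for x h
  proof (cases "x \<in> E \<and> x + h \<in> F")
    case True
    then have xB: "x \<in> B" "x + h \<in> B" by (auto simp: E_def F_def)
    have seg: "x + s *\<^sub>R h \<in> B" if "0 \<le> s" "s \<le> 1" for s
    proof -
      have "(1 - s) *\<^sub>R x + s *\<^sub>R (x + h) \<in> B"
        using convexD[OF convex_ball xB[unfolded B_def], of "1 - s" s] that by (simp add: B_def)
      then show ?thesis by (simp add: algebra_simps)
    qed
    have nh: "norm h < 2 * r"
      using dist_triangle_lt[of x z "x + h" "2 * r"] xB by (auto simp: B_def dist_norm norm_minus_commute dest: norm_triangle_lt)
    have "ennreal (t - m) \<le> ennreal (v (x + h) - v x)"
      using True by (intro ennreal_leI) (auto simp: E_def F_def)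
    also have "\<dots> \<le> ennreal (norm h) * (\<integral>\<^sup>+s. ennreal (V (x + s *\<^sub>R h)) * indicator {0..1} s \<partial>lborel)"
      by (rule increment_le_nn_integral[where B=B and v'=v']) (use der cont bd cV seg in \<open>auto simp: B_def\<close>)
    also have "(\<integral>\<^sup>+s. ennreal (V (x + s *\<^sub>R h)) * indicator {0..1} s \<partial>lborel) = (\<integral>\<^sup>+s. W (x + s *\<^sub>R h) * indicator {0..1} s \<partial>lborel)"
      using seg by (intro nn_integral_cong) (auto simp: W_def indicator_def)
    also have "ennreal (norm h) * \<dots> \<le> ennreal (2 * r) * \<dots>"
      using nh by (intro mult_right_mono ennreal_leI) auto
    finally show ?thesis
      using True nh by (simp add: \<Phi>_def cut_def)
  qed (auto simp: indicator_def)
  have "emeasure lborel E * emeasure lborel F * ennreal (t - m) = (\<integral>\<^sup>+x. indicator E x * (emeasure lborel F * ennreal (t - m)) \<partial>lborel)"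
    by (subst nn_integral_multc) (auto simp: mult.assoc)
  also have "\<dots> = (\<integral>\<^sup>+x. (\<integral>\<^sup>+h. indicator E x * indicator F (x + h) * ennreal (t - m) \<partial>lborel) \<partial>lborel)"
  proof (rule nn_integral_cong)
    fix x :: 'a
    have "emeasure lborel F = (\<integral>\<^sup>+h. indicator F (h + x) \<partial>lborel)"
      by (subst nn_integral_translate) auto
    then show "indicator E x * (emeasure lborel F * ennreal (t - m)) = (\<integral>\<^sup>+h. indicator E x * indicator F (x + h) * ennreal (t - m) \<partial>lborel)"
      by (simp add: nn_integral_cmult nn_integral_multc mult.assoc add.commute)
  qed
  also have "\<dots> \<le> (\<integral>\<^sup>+x. (\<integral>\<^sup>+h. \<Phi> x h \<partial>lborel) \<partial>lborel)"
    by (intro nn_integral_mono point)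
  \<comment> \<open>With \<open>x\<close> integrated first for fixed \<open>h\<close> and
    \<open>s\<close>, translation invariance turns every slice into the full integral of
    \<open>W\<close>.\<close>
  also have "\<dots> = (\<integral>\<^sup>+h. (\<integral>\<^sup>+x. \<Phi> x h \<partial>lborel) \<partial>lborel)"
  proof (rule lborel_pair.Fubini')
    have [measurable]: "(\<lambda>p::'a \<times> 'a. \<integral>\<^sup>+s. W (snd p + s *\<^sub>R fst p) * indicator {0..1} s \<partial>lborel) \<in> borel_measurable (lborel \<Otimes>\<^sub>M lborel)"
      by (rule lborel.borel_measurable_nn_integral) measurable
    show "(\<lambda>(h, x). \<Phi> x h) \<in> borel_measurable (lborel \<Otimes>\<^sub>M lborel)"
      unfolding \<Phi>_def case_prod_beta by measurable
  qed
  also have "\<dots> = (\<integral>\<^sup>+h. cut h * (ennreal (2 * r) * I) \<partial>lborel)"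
  proof (rule nn_integral_cong)
    fix h :: 'a
    have "(\<integral>\<^sup>+x. \<Phi> x h \<partial>lborel) = cut h * ennreal (2 * r) *
       (\<integral>\<^sup>+x. (\<integral>\<^sup>+s. W (x + s *\<^sub>R h) * indicator {0..1} s \<partial>lborel) \<partial>lborel)"
      unfolding \<Phi>_def by (rule nn_integral_cmult) measurable
    also have "(\<integral>\<^sup>+x. (\<integral>\<^sup>+s. W (x + s *\<^sub>R h) * indicator {0..1} s \<partial>lborel) \<partial>lborel) =
       (\<integral>\<^sup>+s. (\<integral>\<^sup>+x. W (x + s *\<^sub>R h) * indicator {0..1::real} s \<partial>lborel) \<partial>lborel)"
      by (rule lborel_pair.Fubini') measurable
    also have "\<dots> = (\<integral>\<^sup>+s. I * indicator {0..1::real} s \<partial>lborel)"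
      by (intro nn_integral_cong) (simp add: nn_integral_multc nn_integral_translate I_def)
    also have "\<dots> = I"
      by (simp add: nn_integral_cmult)
    finally show "(\<integral>\<^sup>+x. \<Phi> x h \<partial>lborel) = cut h * (ennreal (2 * r) * I)"
      by (simp add: mult.assoc)
  qed
  also have "\<dots> = emeasure lborel (ball (0::'a) (2 * r)) * (ennreal (2 * r) * I)"
    using cut by (subst nn_integral_multc) (auto simp: cut_def)
  finally show ?thesis
    by (simp add: E_def F_def B_def I_def W_def mult.assoc)
qed

section \<open>The measure of contact sets, and linear elliptic inequalities\<close>

definition hess_form :: "('a::euclidean_space \<Rightarrow> real) \<Rightarrow> real \<Rightarrow> 'a \<Rightarrow> 'a \<Rightarrow> 'a \<Rightarrow> real" where
  "hess_form w A x h k = dd (dd w h) k x + 2 * A * (h \<bullet> k)"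

lemma hess_form_bilinear:
  assumes "Ck_on (Suc (Suc 0)) S w" "open S" "x \<in> S"
  shows "bilinear (hess_form w A x)" "hess_form w A x h k = hess_form w A x k h"
proof -
  have l: "linear (\<lambda>h. dd (dd w h) k x)" "linear (\<lambda>k. dd (dd w h) k x)" for h k
    using dd_dd_linear_left[OF assms] dd_dd_linear_right[OF assms(1,3)] by blast+
  show "bilinear (hess_form w A x)"
    unfolding bilinear_def hess_form_def
    by (intro conjI allI linear_compose_add l) (auto intro!: linearI simp: algebra_simps)
  show "hess_form w A x h k = hess_form w A x k h"
    using mixed_derivatives_commute[OF assms] by (simp add: hess_form_def inner_commute)
qed

lemma hess_form_nonneg:
  "x \<in> contact_set w A x1 R s \<Longrightarrow> 0 \<le> hess_form w A x h h"
  by (simp add: contact_set_def hess_form_def power2_norm_eq_inner)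

text \<open>Apart from membership in the open ball, all conditions are closed, and closedness
  survives the intersection over all directions \<open>h\<close>.\<close>

lemma contact_set_borel:
  assumes C2: "Ck_on (Suc (Suc 0)) S w" and R: "cball x1 R \<subseteq> S"
  shows "contact_set w A x1 R s \<in> sets borel"
proof -
  let ?K = "cball x1 R"
  have C1: "Ck_on (Suc 0) S (dd w h)" for h
    using C2 unfolding Ck_on_Suc[of "Suc 0"] by blast
  have c: "continuous_on ?K w" "continuous_on ?K (dd w h)" "continuous_on ?K (dd (dd w h) k)" for h k
    using Ck_on_Suc_imp_continuous[OF C2] Ck_on_Suc_imp_continuous[OF C1] C1[unfolded Ck_on_Suc] R continuous_on_subset
    by (blast, blast, metis Ck_on_0_D continuous_on_subset)
  have "closed (\<Inter>h. {x \<in> ?K. \<bar>dd w h x + 2 * A * ((x - x1) \<bullet> h)\<bar> \<le> s * norm h} \<inter>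
      {x \<in> ?K. 0 \<le> dd (dd w h) h x + 2 * A * (norm h)\<^sup>2} \<inter> {x \<in> ?K. w x + A * (norm (x - x1))\<^sup>2 \<le> w x1 + s * R})"
    by (intro closed_INT ballI closed_Int continuous_on_closed_Collect_le continuous_intros c closed_cball)
  then have "ball x1 R \<inter> (\<Inter>h. {x \<in> ?K. \<bar>dd w h x + 2 * A * ((x - x1) \<bullet> h)\<bar> \<le> s * norm h} \<inter>
      {x \<in> ?K. 0 \<le> dd (dd w h) h x + 2 * A * (norm h)\<^sup>2} \<inter> {x \<in> ?K. w x + A * (norm (x - x1))\<^sup>2 \<le> w x1 + s * R}) \<in> sets borel"
    by auto
  also have "ball x1 R \<inter> (\<Inter>h. {x \<in> ?K. \<bar>dd w h x + 2 * A * ((x - x1) \<bullet> h)\<bar> \<le> s * norm h} \<inter>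
      {x \<in> ?K. 0 \<le> dd (dd w h) h x + 2 * A * (norm h)\<^sup>2} \<inter> {x \<in> ?K. w x + A * (norm (x - x1))\<^sup>2 \<le> w x1 + s * R})
    = contact_set w A x1 R s"
    unfolding contact_set_def by auto
  finally show ?thesis .
qed

text \<open>Alexandrov's estimate: the derivative of \<open>contact_slope\<close> is
  \<open>hess_form\<close>, and the slopes of the contact set fill the ball of radius
  \<open>s\<close>, so the Jacobian inequality applies with this ball as image.\<close>

theorem contact_set_measure:
  fixes w :: "'a::euclidean_space \<Rightarrow> real" and \<beta> :: "'m::{finite,wellorder} \<Rightarrow> 'a"
  assumes \<beta>: "bij_betw \<beta> UNIV Basis"
    and C2: "Ck_on (Suc (Suc 0)) S w" and S: "open S" and R: "R > 0" "cball x1 R \<subseteq> S"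
    and bd: "\<And>x. x \<in> sphere x1 R \<Longrightarrow> w x1 + s * R < w x + A * R\<^sup>2"
    and J: "\<And>x. x \<in> contact_set w A x1 R s \<Longrightarrow> \<bar>det (\<chi> i j. hess_form w A x (\<beta> i) (\<beta> j))\<bar> \<le> J x"
  shows "emeasure lborel (ball (0::'a) s) \<le> (\<integral>\<^sup>+x. ennreal (J x) * indicator (contact_set w A x1 R s) x \<partial>lborel)"
proof -
  let ?P = "contact_set w A x1 R s"
  let ?K = "cball x1 R"
  have PK: "?P \<subseteq> ?K" by (auto simp: contact_set_def)
  have C1: "Ck_on (Suc 0) S (dd w h)" for h
    using C2 unfolding Ck_on_Suc[of "Suc 0"] by blast
  have inB: "\<beta> i \<in> Basis" for i using \<beta> by (auto simp: bij_betw_def)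
  define G' where "G' x k = (\<Sum>b\<in>Basis. dd (dd w b) k x *\<^sub>R b) + (2 * A) *\<^sub>R k" for x k :: 'a
  have der: "(contact_slope w A x1 has_derivative G' x) (at x)" if "x \<in> S" for x
    unfolding contact_slope_def[abs_def] G'_def[abs_def]
    by (auto intro!: derivative_eq_intros Ck_on_1_D[OF C1 that])
  have G'h: "G' x (\<beta> j) \<bullet> \<beta> i = hess_form w A x (\<beta> i) (\<beta> j)" for x i j
  proof -
    have "(\<Sum>b\<in>Basis. dd (dd w b) (\<beta> j) x *\<^sub>R b) \<bullet> \<beta> i = dd (dd w (\<beta> i)) (\<beta> j) x"
      using inB[of i] by (simp add: inner_sum_left inner_Basis if_distrib cong: if_cong)
    then show ?thesis by (simp only: G'_def inner_add_left hess_form_def inner_scaleR_left inner_commute[of "\<beta> i" "\<beta> j"])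
  qed
  have cK: "continuous_on ?K (\<lambda>x. det (\<chi> i j. G' x (\<beta> j) \<bullet> \<beta> i))"
  proof -
    have "continuous_on ?K (dd (dd w h) k)" for h k
      using C1[unfolded Ck_on_Suc] R continuous_on_subset by (metis Ck_on_0_D continuous_on_subset)
    then show ?thesis
      unfolding G'h det_def hess_form_def by (auto intro!: continuous_intros)
  qed
  have "bounded ((\<lambda>x. det (\<chi> i j. G' x (\<beta> j) \<bullet> \<beta> i)) ` ?K)"
    by (intro compact_imp_bounded compact_continuous_image cK compact_cball)
  then obtain B where "\<forall>y\<in>(\<lambda>x. det (\<chi> i j. G' x (\<beta> j) \<bullet> \<beta> i)) ` ?K. norm y \<le> B"
    unfolding bounded_iff by blast
  then have B: "\<bar>det (\<chi> i j. G' x (\<beta> j) \<bullet> \<beta> i)\<bar> \<le> B" if "x \<in> ?K" for x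
    using that unfolding ball_simps real_norm_def by blast
  show ?thesis
  proof (rule emeasure_le_nn_integral_Jacobian[OF \<beta>, where G="contact_slope w A x1" and G'=G' and B=B])
    show "?P \<in> sets borel" by (rule contact_set_borel[OF C2 R(2)])
    show "bounded ?P" using PK bounded_cball bounded_subset by blast
    show "continuous_on ?P (\<lambda>x. det (\<chi> i j. G' x (\<beta> j) \<bullet> \<beta> i))" by (rule continuous_on_subset[OF cK PK])
    show "ball 0 s \<subseteq> contact_slope w A x1 ` ?P" by (rule contact_slope_surj[OF C2 S R bd])
    show "(contact_slope w A x1 has_derivative G' x) (at x)" if "x \<in> ?P" for x
      using that PK R by (intro der) auto
    show "\<bar>det (\<chi> i j. G' x (\<beta> j) \<bullet> \<beta> i)\<bar> \<le> B" if "x \<in> ?P" for x using B that PK by blast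
    show "\<bar>det (\<chi> i j. G' x (\<beta> j) \<bullet> \<beta> i)\<bar> \<le> J x" if "x \<in> ?P" for x using J[OF that] by (simp only: G'h)
  qed auto
qed

text \<open>The coefficients \<open>a\<close> enter only through this form of ellipticity, which for the operators below
  can be read off from a unitary frame.\<close>

definition elliptic_at :: "real \<Rightarrow> ('a::euclidean_space \<Rightarrow> 'a \<Rightarrow> real) \<Rightarrow> bool" where
  "elliptic_at \<kappa> a \<longleftrightarrow> (\<forall>B. bilinear B \<longrightarrow> (\<forall>h k. B h k = B k h) \<longrightarrow> (\<forall>h. 0 \<le> B h h) \<longrightarrow>
     \<kappa> * (\<Sum>b\<in>Basis. B b b) \<le> (\<Sum>b\<in>Basis. \<Sum>c\<in>Basis. a b c * B b c))"

text \<open>Tested on the rank-one form of the vector \<open>y\<close> with components \<xi>, the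
  condition becomes the usual ellipticity.\<close>

lemma elliptic_at_vector:
  assumes "elliptic_at \<kappa> a"
  shows "\<kappa> * (\<Sum>b\<in>Basis. (\<xi> b)\<^sup>2) \<le> (\<Sum>b\<in>Basis. \<Sum>c\<in>Basis. a b c * \<xi> b * \<xi> c)"
proof -
  define y where "y = (\<Sum>b\<in>Basis. \<xi> b *\<^sub>R b)"
  have y: "y \<bullet> b = \<xi> b" if "b \<in> Basis" for b
    using that by (simp add: y_def inner_sum_left inner_Basis if_distrib cong: if_cong)
  have "bilinear (\<lambda>h k. (y \<bullet> h) * (y \<bullet> k))"
    unfolding bilinear_def by (auto intro!: linearI simp: algebra_simps)
  then have "\<kappa> * (\<Sum>b\<in>Basis. (y \<bullet> b) * (y \<bullet> b)) \<le> (\<Sum>b\<in>Basis. \<Sum>c\<in>Basis. a b c * ((y \<bullet> b) * (y \<bullet> c)))"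
    using assms unfolding elliptic_at_def by (auto simp: mult.commute)
  then show ?thesis by (simp add: y power2_eq_square mult.assoc)
qed

definition lin_op :: "('a::euclidean_space \<Rightarrow> 'a \<Rightarrow> 'a \<Rightarrow> real) \<Rightarrow> ('a \<Rightarrow> 'a \<Rightarrow> real) \<Rightarrow> ('a \<Rightarrow> real) \<Rightarrow> 'a \<Rightarrow> real" where
  "lin_op a \<beta> w x = (\<Sum>b\<in>Basis. \<Sum>c\<in>Basis. a b c x * dd (dd w c) b x) + (\<Sum>b\<in>Basis. \<beta> b x * dd w b x)"

lemma emeasure_lborel_ball_eq: "emeasure lborel (ball x r) = ennreal (measure lborel (ball (x::'a::euclidean_space) r))"
  using emeasure_lborel_ball_finite[of x r] less_imp_neq by (intro emeasure_eq_ennreal_measure) fastforce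

text \<open>A paraboloid of opening \<open>A\<close> centred at a point \<open>x1\<close> with
  \<open>w x1\<close> at most \<open>M0\<close> satisfies the boundary condition because
  \<open>w\<close> is nonnegative. On the contact set the gradient is bounded and the shifted
  Hessian is nonnegative, so the inequality for \<open>w\<close> bounds its trace, and with it the
  Jacobian by \<open>J\<close>; the contact set then has at least the measure of the unit ball
  divided by \<open>J\<close>.\<close>

lemma sublevel_set_lower_bound:
  fixes a :: "'a::euclidean_space \<Rightarrow> 'a \<Rightarrow> 'a \<Rightarrow> real" and \<iota> :: "'m::{finite,wellorder} \<Rightarrow> 'a"
  assumes \<iota>: "bij_betw \<iota> UNIV Basis"
    and S: "open S" "cball z (2 * R) \<subseteq> S" and R: "R > 0"
    and a: "\<And>x b c. x \<in> cball z (2 * R) \<Longrightarrow> b \<in> Basis \<Longrightarrow> c \<in> Basis \<Longrightarrow> \<bar>a b c x\<bar> \<le> M"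
    and \<beta>: "\<And>x b. x \<in> cball z (2 * R) \<Longrightarrow> b \<in> Basis \<Longrightarrow> \<bar>\<beta> b x\<bar> \<le> M"
    and \<kappa>: "\<kappa> > 0" and ell: "\<And>x. x \<in> cball z (2 * R) \<Longrightarrow> elliptic_at \<kappa> (\<lambda>b c. a b c x)"
    and M0: "0 \<le> M0"
  shows "\<exists>\<mu>>0. \<forall>w. Ck_on (Suc (Suc 0)) S w \<longrightarrow> (\<forall>x\<in>cball z (2 * R). 0 \<le> w x) \<longrightarrow>
     (\<forall>x\<in>cball z (2 * R). lin_op a \<beta> w x \<le> C0) \<longrightarrow> (\<exists>x\<in>ball z R. w x \<le> M0) \<longrightarrow>
     ennreal \<mu> \<le> emeasure lborel {x \<in> ball z (2 * R). w x \<le> M0 + R}"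
proof -
  let ?N = "real DIM('a)"
  \<comment> \<open>Chosen so that A R^2 exceeds M0 + R, which bounds
    \<open>w x1 + 1 * R\<close>.\<close>
  define A where "A = (M0 + R + 1) / R\<^sup>2"
  have A: "A \<ge> 0" using M0 R by (simp add: A_def)
  have AR: "A * R\<^sup>2 = M0 + R + 1" using R by (simp add: A_def)
  have M: "M \<ge> 0"
  proof -
    have "\<exists>b::'a. b \<in> Basis" using nonempty_Basis by blast
    then obtain b :: 'a where "b \<in> Basis" by blast
    then have "\<bar>\<beta> b z\<bar> \<le> M" using R by (intro \<beta>) auto
    then show ?thesis by linarith
  qed
  \<comment> \<open>Bounds the trace of the shifted Hessian on the contact set: the summands come
    from \<open>C0\<close>, from the drift with gradient at most 1 + 2 A R, and from the shift. The
    maximum with 1 keeps \<open>T\<close> positive.\<close>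
  define T where "T = max 1 ((\<bar>C0\<bar> + ?N * M * (1 + 2 * A * R) + 2 * A * (?N * ?N * M)) / \<kappa>)"
  have T: "T \<ge> 1" by (simp add: T_def)
  define J where "J = (fact CARD('m) * 1 ^ CARD('m))\<^sup>2 * (fact CARD('m) * (\<Prod>i\<in>(UNIV::'m set). T))"
  have J: "J > 0" using T by (auto simp: J_def intro!: prod_pos)
  define \<mu> where "\<mu> = measure lborel (ball (0::'a) 1) / J"
  have vol: "emeasure lborel (ball (0::'a) 1) = ennreal (measure lborel (ball (0::'a) 1))"
    by (rule emeasure_lborel_ball_eq)
  have "measure lborel (ball (0::'a) 1) > 0"
    using content_ball_pos[of 1 "0::'a"] by simp
  then have \<mu>: "\<mu> > 0" using J by (simp add: \<mu>_def)
  show ?thesis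
  proof (intro exI[of _ \<mu>] conjI allI impI \<mu>)
    fix w
    assume C2: "Ck_on (Suc (Suc 0)) S w" and w0: "\<forall>x\<in>cball z (2 * R). 0 \<le> w x"
      and L: "\<forall>x\<in>cball z (2 * R). lin_op a \<beta> w x \<le> C0" and ex: "\<exists>x\<in>ball z R. w x \<le> M0"
    then obtain x1 where x1: "x1 \<in> ball z R" "w x1 \<le> M0" by blast
    have sub: "cball x1 R \<subseteq> ball z (2 * R)"
    proof
      fix x assume "x \<in> cball x1 R"
      then show "x \<in> ball z (2 * R)"
        using x1(1) dist_triangle[of z x x1] by (simp add: dist_commute)
    qed
    have sub': "cball x1 R \<subseteq> cball z (2 * R)" "cball x1 R \<subseteq> S"
      using sub S ball_subset_cball by blast+
    let ?P = "contact_set w A x1 R 1"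
    have PK: "?P \<subseteq> ball x1 R" by (auto simp: contact_set_def)
    have bd: "w x1 + 1 * R < w x + A * R\<^sup>2" if "x \<in> sphere x1 R" for x
    proof -
      have "x \<in> cball z (2 * R)" using that sub' sphere_cball by blast
      then have "0 \<le> w x" using w0 by blast
      then show ?thesis using AR x1 by linarith
    qed
    have le: "\<bar>det (\<chi> i j. hess_form w A x (\<iota> i) (\<iota> j))\<bar> \<le> J" if x: "x \<in> ?P" for x
    proof -
      have xz: "x \<in> cball z (2 * R)" "x \<in> S" and xb: "x \<in> ball x1 R"
        using x PK sub' ball_subset_cball by blast+
      note bil = hess_form_bilinear(1)[OF C2 S(1) xz(2), of A] and sym = hess_form_bilinear(2)[OF C2 S(1) xz(2), of A]
      note pos = hess_form_nonneg[OF x]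
      have db: "\<bar>dd w b x\<bar> \<le> 1 + 2 * A * R" if b: "b \<in> Basis" for b
      proof -
        have "\<bar>dd w b x + 2 * A * ((x - x1) \<bullet> b)\<bar> \<le> 1"
          using x b by (auto simp: contact_set_def dest: spec[of _ b])
        moreover have "\<bar>2 * A * ((x - x1) \<bullet> b)\<bar> \<le> 2 * A * R"
        proof -
          have "\<bar>(x - x1) \<bullet> b\<bar> \<le> R" using Basis_le_norm[OF b, of "x - x1"] xb by (simp add: dist_norm norm_minus_commute)
          then show ?thesis using A by (simp add: abs_mult mult_left_mono)
        qed
        ultimately show ?thesis by linarith
      qed
      have "\<kappa> * (\<Sum>b\<in>Basis. hess_form w A x b b) \<le> (\<Sum>b\<in>Basis. \<Sum>c\<in>Basis. a b c x * hess_form w A x b c)"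
        using ell[OF xz(1)] bil sym pos unfolding elliptic_at_def by blast
      moreover have "(\<Sum>b\<in>Basis. \<Sum>c\<in>Basis. a b c x * hess_form w A x b c) =
          (\<Sum>b\<in>Basis. \<Sum>c\<in>Basis. a b c x * dd (dd w c) b x) + (\<Sum>b\<in>Basis. \<Sum>c\<in>Basis. a b c x * (2 * A * (b \<bullet> c)))"
        unfolding sum.distrib[symmetric] by (intro sum.cong refl) (subst sym, simp add: hess_form_def algebra_simps inner_commute)
      moreover have "(\<Sum>b\<in>Basis. \<Sum>c\<in>Basis. a b c x * (2 * A * (b \<bullet> c))) \<le> (\<Sum>b\<in>(Basis::'a set). \<Sum>c\<in>(Basis::'a set). M * (2 * A))"
      proof (intro sum_mono)
        fix b c :: 'a assume bc: "b \<in> Basis" "c \<in> Basis"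
        have "a b c x * (2 * A * (b \<bullet> c)) \<le> \<bar>a b c x\<bar> * \<bar>2 * A * (b \<bullet> c)\<bar>" by (metis abs_ge_self abs_mult)
        also have "\<dots> \<le> M * (2 * A)"
          using a[OF xz(1) bc] A M bc by (intro mult_mono) (auto simp: inner_Basis)
        finally show "a b c x * (2 * A * (b \<bullet> c)) \<le> M * (2 * A)" .
      qed
      moreover have "(\<Sum>b\<in>Basis. \<Sum>c\<in>Basis. a b c x * dd (dd w c) b x) \<le> C0 - (\<Sum>b\<in>Basis. \<beta> b x * dd w b x)"
        using L xz(1) by (auto simp: lin_op_def algebra_simps)
      moreover have "- (\<Sum>b\<in>Basis. \<beta> b x * dd w b x) \<le> (\<Sum>b\<in>(Basis::'a set). M * (1 + 2 * A * R))"
        unfolding sum_negf[symmetric]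
      proof (rule sum_mono)
        fix b :: 'a assume b: "b \<in> Basis"
        have "- (\<beta> b x * dd w b x) \<le> \<bar>\<beta> b x\<bar> * \<bar>dd w b x\<bar>" by (metis abs_ge_minus_self abs_mult)
        also have "\<dots> \<le> M * (1 + 2 * A * R)" using \<beta>[OF xz(1) b] db[OF b] M by (intro mult_mono) auto
        finally show "- (\<beta> b x * dd w b x) \<le> M * (1 + 2 * A * R)" .
      qed
      ultimately have "\<kappa> * (\<Sum>b\<in>Basis. hess_form w A x b b) \<le> \<bar>C0\<bar> + ?N * M * (1 + 2 * A * R) + 2 * A * (?N * ?N * M)"
        by (simp add: algebra_simps)
      then have "(\<Sum>b\<in>Basis. hess_form w A x b b) \<le> (\<bar>C0\<bar> + ?N * M * (1 + 2 * A * R) + 2 * A * (?N * ?N * M)) / \<kappa>"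
        using \<kappa> by (simp add: field_simps)
      then have tr: "(\<Sum>b\<in>Basis. hess_form w A x b b) \<le> T" by (simp add: T_def)
      have diag: "hess_form w A x (\<iota> i) (\<iota> i) \<le> T" for i
      proof -
        have "\<iota> i \<in> Basis" using \<iota> by (auto simp: bij_betw_def)
        then have "hess_form w A x (\<iota> i) (\<iota> i) \<le> (\<Sum>b\<in>Basis. hess_form w A x b b)"
          using pos by (intro member_le_sum) auto
        then show ?thesis using tr by linarith
      qed
      have "\<bar>det (\<chi> i j. hess_form w A x (\<iota> i) (\<iota> j))\<bar> \<le> (fact CARD('m) * 1 ^ CARD('m))\<^sup>2 * (fact CARD('m) * (\<Prod>i\<in>UNIV. hess_form w A x (\<iota> i) (\<iota> i)))"
        by (rule det_form_le[OF bil sym pos, where c="\<lambda>s u. if s = u then 1 else 0"])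
          (auto simp: if_distrib[of "\<lambda>x. x *\<^sub>R _"] cong: if_cong)
      also have "\<dots> \<le> J"
        unfolding J_def using diag pos by (intro mult_left_mono prod_mono) auto
      finally show ?thesis .
    qed
    have Pm: "?P \<in> sets borel" by (rule contact_set_borel[OF C2 sub'(2)])
    have "ennreal (measure lborel (ball (0::'a) 1)) \<le> (\<integral>\<^sup>+x. ennreal J * indicator ?P x \<partial>lborel)"
      unfolding vol[symmetric] by (rule contact_set_measure[OF \<iota> C2 S(1) R sub'(2) bd le])
    also have "\<dots> = ennreal J * emeasure lborel ?P"
      using Pm by (simp add: nn_integral_cmult_indicator)
    also have "\<dots> \<le> ennreal J * emeasure lborel {x \<in> ball z (2 * R). w x \<le> M0 + R}"
    proof (intro mult_left_mono emeasure_mono)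
      show "?P \<subseteq> {x \<in> ball z (2 * R). w x \<le> M0 + R}"
      proof
        fix x assume x: "x \<in> ?P"
        then have "w x + A * (norm (x - x1))\<^sup>2 \<le> w x1 + 1 * R" unfolding contact_set_def by blast
        moreover have "0 \<le> A * (norm (x - x1))\<^sup>2" using A by simp
        ultimately have "w x \<le> M0 + R" using x1(2) by linarith
        then show "x \<in> {x \<in> ball z (2 * R). w x \<le> M0 + R}"
          using x PK sub ball_subset_cball by blast
      qed
      have "continuous_on (ball z (2 * R)) w"
        using Ck_on_Suc_imp_continuous[OF C2] S ball_subset_cball continuous_on_subset by blast
      then have "open (ball z (2 * R) \<inter> w -` {M0 + R<..})"
        by (intro continuous_open_preimage) auto
      then have "ball z (2 * R) - (ball z (2 * R) \<inter> w -` {M0 + R<..}) \<in> sets lborel" by auto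
      also have "ball z (2 * R) - (ball z (2 * R) \<inter> w -` {M0 + R<..}) = {x \<in> ball z (2 * R). w x \<le> M0 + R}" by auto
      finally show "{x \<in> ball z (2 * R). w x \<le> M0 + R} \<in> sets lborel" .
    qed auto
    finally have "ennreal (1 / J) * ennreal (measure lborel (ball (0::'a) 1)) \<le> ennreal (1 / J) * (ennreal J * emeasure lborel {x \<in> ball z (2 * R). w x \<le> M0 + R})"
      by (rule mult_left_mono) auto
    also have "\<dots> = emeasure lborel {x \<in> ball z (2 * R). w x \<le> M0 + R}"
      using J by (simp add: mult.assoc[symmetric] ennreal_mult'[symmetric])
    also have "ennreal (1 / J) * ennreal (measure lborel (ball (0::'a) 1)) = ennreal \<mu>"
      using J by (simp add: \<mu>_def ennreal_mult'[symmetric])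
    finally show "ennreal \<mu> \<le> emeasure lborel {x \<in> ball z (2 * R). w x \<le> M0 + R}" .
  qed
qed

text \<open>A weak Harnack inequality: the sublevel set of definite measure and the gradient bound for
  \<open>ln (1 + w)\<close> are combined by the Poincare inequality.\<close>

theorem superlevel_set_bound:
  fixes a :: "'a::euclidean_space \<Rightarrow> 'a \<Rightarrow> 'a \<Rightarrow> real" and \<iota> :: "'m::{finite,wellorder} \<Rightarrow> 'a"
  assumes \<iota>: "bij_betw \<iota> UNIV Basis"
    and S: "open S" "cball z (3 * R) \<subseteq> S" and R: "R > 0"
    and a: "\<And>b c. b \<in> Basis \<Longrightarrow> c \<in> Basis \<Longrightarrow> Ck_on (Suc 0) S (a b c)"
    and \<beta>: "\<And>x b. x \<in> cball z (3 * R) \<Longrightarrow> b \<in> Basis \<Longrightarrow> \<bar>\<beta> b x\<bar> \<le> M"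
    and \<kappa>: "\<kappa> > 0" and ell: "\<And>x. x \<in> cball z (3 * R) \<Longrightarrow> elliptic_at \<kappa> (\<lambda>b c. a b c x)"
    and M0: "0 \<le> M0" and \<delta>: "\<delta> > 0"
  shows "\<exists>T. \<forall>w. Ck_on (Suc (Suc 0)) S w \<longrightarrow> (\<forall>x\<in>cball z (3 * R). 0 \<le> w x) \<longrightarrow>
     (\<forall>x\<in>cball z (3 * R). lin_op a \<beta> w x \<le> C0) \<longrightarrow> (\<exists>x\<in>ball z R. w x \<le> M0) \<longrightarrow>
     emeasure lborel {x \<in> ball z (2 * R). T < w x} \<le> ennreal \<delta>"
proof -
  let ?B = "ball z (2 * R)"
  have sub: "cball z (2 * R) \<subseteq> cball z (3 * R)" using R by (simp add: cball_subset_cball_iff)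
  have "\<exists>M'. \<forall>x\<in>cball z (3 * R). \<forall>b\<in>Basis. \<forall>c\<in>Basis. \<bar>a b c x\<bar> \<le> M'"
  proof -
    have "\<exists>A. \<forall>x\<in>cball z (3 * R). \<bar>a b c x\<bar> \<le> A" if "b \<in> Basis" "c \<in> Basis" for b c
      using Ck_on_1_bounded[OF a[OF that] compact_cball S(2)] by blast
    then obtain A where A: "\<And>b c x. b \<in> Basis \<Longrightarrow> c \<in> Basis \<Longrightarrow> x \<in> cball z (3 * R) \<Longrightarrow> \<bar>a b c x\<bar> \<le> A b c"
      by metis
    define A' where "A' = Max ((\<lambda>(b, c). A b c) ` (Basis \<times> Basis))"
    have "A b c \<le> A'" if "b \<in> Basis" "c \<in> Basis" for b c
      unfolding A'_def using that by (intro Max_ge) auto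
    then show ?thesis using A by (intro exI[of _ A']) (meson order_trans)
  qed
  then obtain M' where M': "\<And>x b c. x \<in> cball z (3 * R) \<Longrightarrow> b \<in> Basis \<Longrightarrow> c \<in> Basis \<Longrightarrow> \<bar>a b c x\<bar> \<le> M'" by blast
  obtain \<mu> where \<mu>: "\<mu> > 0" and low: "\<And>w. Ck_on (Suc (Suc 0)) S w \<Longrightarrow> \<forall>x\<in>cball z (2 * R). 0 \<le> w x \<Longrightarrow>
     \<forall>x\<in>cball z (2 * R). lin_op a \<beta> w x \<le> C0 \<Longrightarrow> \<exists>x\<in>ball z R. w x \<le> M0 \<Longrightarrow>
     ennreal \<mu> \<le> emeasure lborel {x \<in> ?B. w x \<le> M0 + R}"
  proof -
    have "\<exists>\<mu>>0. \<forall>w. Ck_on (Suc (Suc 0)) S w \<longrightarrow> (\<forall>x\<in>cball z (2 * R). 0 \<le> w x) \<longrightarrow>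
     (\<forall>x\<in>cball z (2 * R). lin_op a \<beta> w x \<le> C0) \<longrightarrow> (\<exists>x\<in>ball z R. w x \<le> M0) \<longrightarrow>
     ennreal \<mu> \<le> emeasure lborel {x \<in> ball z (2 * R). w x \<le> M0 + R}"
    proof (rule sublevel_set_lower_bound[OF \<iota> S(1) _ R _ _ \<kappa> _ M0, where M="max M M'"])
      show "cball z (2 * R) \<subseteq> S" using sub S by blast
      show "\<bar>a b c x\<bar> \<le> max M M'" if "x \<in> cball z (2 * R)" "b \<in> Basis" "c \<in> Basis" for x b c
        using M'[of x b c] that sub by (auto simp: le_max_iff_disj)
      show "\<bar>\<beta> b x\<bar> \<le> max M M'" if "x \<in> cball z (2 * R)" "b \<in> Basis" for x b
        using \<beta>[of x b] that sub by (auto simp: le_max_iff_disj)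
      show "elliptic_at \<kappa> (\<lambda>b c. a b c x)" if "x \<in> cball z (2 * R)" for x using ell that sub by blast
    qed
    then show ?thesis using that by blast
  qed
  obtain C1 where C1: "\<And>w. Ck_on (Suc (Suc 0)) S w \<Longrightarrow> \<forall>x\<in>cball z (3 * R). 0 \<le> w x \<Longrightarrow>
     \<forall>x\<in>cball z (3 * R). lin_op a \<beta> w x \<le> C0 \<Longrightarrow>
     (\<integral>\<^sup>+x. ennreal (\<Sum>b\<in>Basis. (log_grad w b x)\<^sup>2) * indicator ?B x \<partial>lborel) \<le> ennreal C1"
  proof -
    \<comment> \<open>The gradient bound holds on a smaller ball than the inequality, which accounts
      for the radii 2 R and 3 R.\<close>
    have r: "0 < 2 * R" "2 * R < 3 * R" using R by auto
    have "\<exists>C1. \<forall>w. Ck_on (Suc (Suc 0)) S w \<longrightarrow> (\<forall>x\<in>cball z (3 * R). 0 \<le> w x) \<longrightarrow>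
     (\<forall>x\<in>cball z (3 * R). (\<Sum>b\<in>Basis. \<Sum>c\<in>Basis. a b c x * dd (dd w c) b x) + (\<Sum>b\<in>Basis. \<beta> b x * dd w b x) \<le> C0) \<longrightarrow>
     (\<integral>\<^sup>+x. ennreal (\<Sum>b\<in>Basis. (log_grad w b x)\<^sup>2) * indicator (ball z (2 * R)) x \<partial>lborel) \<le> ennreal C1"
      by (rule log_gradient_bound[OF S r a \<beta> \<kappa>]) (use elliptic_at_vector[OF ell] in auto)
    then show ?thesis using that unfolding lin_op_def by blast
  qed
  \<comment> \<open>The level of ln (1 + w) that corresponds to the sublevel set of measure at least
    \<mu>.\<close>
  define m where "m = ln (1 + (M0 + R))"
  define V0 where "V0 = measure lborel ?B"
  have vB: "emeasure lborel ?B = ennreal V0"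
    unfolding V0_def by (rule emeasure_lborel_ball_eq)
  define V1 where "V1 = measure lborel (ball (0::'a) (2 * (2 * R)))"
  have vB1: "emeasure lborel (ball (0::'a) (2 * (2 * R))) = ennreal V1"
    unfolding V1_def by (rule emeasure_lborel_ball_eq)
  have V: "V0 \<ge> 0" "V1 \<ge> 0" by (auto simp: V0_def V1_def)
  define Q where "Q = V1 * (2 * (2 * R)) * (V0 + \<bar>C1\<bar>)"
  have Q: "Q \<ge> 0" using V R by (simp add: Q_def)
  \<comment> \<open>Makes Q less than \<mu> \<delta> (t - m), which turns the product bound into a
    measure below \<delta>.\<close>
  define t where "t = m + Q / (\<mu> * \<delta>) + 1"
  have tm: "m < t" using Q \<mu> \<delta> by (simp add: t_def add_nonneg_pos)
  show ?thesis
  proof (intro exI[of _ "exp t"] allI impI)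
    fix w
    assume C2: "Ck_on (Suc (Suc 0)) S w" and w0: "\<forall>x\<in>cball z (3 * R). 0 \<le> w x"
      and L: "\<forall>x\<in>cball z (3 * R). lin_op a \<beta> w x \<le> C0" and ex: "\<exists>x\<in>ball z R. w x \<le> M0"
    have BK: "?B \<subseteq> cball z (3 * R)" using sub ball_subset_cball by blast
    have BS: "?B \<subseteq> S" using BK S by blast
    have w1: "1 + w x > 0" if "x \<in> ?B" for x
    proof -
      have "0 \<le> w x" using w0 BK that by blast
      then show ?thesis by linarith
    qed
    define v where "v x = ln (1 + w x)" for x
    define v' where "v' x h = dd w h x / (1 + w x)" for x h
    define V where "V x = sqrt (\<Sum>b\<in>Basis. (log_grad w b x)\<^sup>2)" for x
    have der: "(v has_derivative v' x) (at x)" if "x \<in> ?B" for x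
    proof -
      have "(w has_derivative (\<lambda>h. dd w h x)) (at x)" using Ck_on_1_D[OF C2] that BS by blast
      then have "((\<lambda>x. 1 + w x) has_derivative (\<lambda>h. dd w h x)) (at x)"
        by (auto intro!: derivative_eq_intros)
      then have "((\<lambda>x. ln (1 + w x)) has_derivative (\<lambda>h. dd w h x * inverse (1 + w x))) (at x)"
        by (rule DERIV_compose_FDERIV[of ln "inverse (1 + w x)" "\<lambda>x. 1 + w x" x, OF DERIV_ln[OF w1[OF that]]])
      then show ?thesis by (simp add: v_def[abs_def] v'_def[abs_def] divide_inverse)
    qed
    have C1w: "Ck_on (Suc 0) S (dd w h)" for h
      using C2 unfolding Ck_on_Suc[of "Suc 0"] by blast
    have cw: "continuous_on ?B w" "continuous_on ?B (dd w h)" for h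
      using Ck_on_Suc_imp_continuous[OF C2] Ck_on_Suc_imp_continuous[OF C1w] BS continuous_on_subset by blast+
    have nz: "\<forall>x\<in>?B. 1 + w x \<noteq> 0" using w1 by (metis less_irrefl)
    have cont: "continuous_on ?B (\<lambda>x. v' x h)" for h
      unfolding v'_def by (intro continuous_intros cw nz)
    have cV: "continuous_on ?B V"
      unfolding V_def log_grad_def by (intro continuous_intros cw nz)
    have bd: "\<bar>v' x h\<bar> \<le> norm h * V x" if x: "x \<in> ?B" for x h
    proof -
      have lin: "linear (\<lambda>h. dd w h x)" using dd_linear[OF C2] x BS by blast
      have "dd w h x = dd w (\<Sum>b\<in>Basis. (h \<bullet> b) *\<^sub>R b) x" by (simp add: euclidean_representation)
      also have "\<dots> = (\<Sum>b\<in>Basis. (h \<bullet> b) * dd w b x)"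
        by (simp add: linear_sum[OF lin] linear_scale[OF lin])
      finally have "v' x h = (\<Sum>b\<in>Basis. (h \<bullet> b) * log_grad w b x)"
        by (simp add: v'_def log_grad_def sum_divide_distrib)
      also have "\<bar>\<dots>\<bar> \<le> L2_set (\<lambda>b. h \<bullet> b) Basis * L2_set (\<lambda>b. log_grad w b x) Basis"
        by (rule order_trans[OF sum_abs]) (simp add: abs_mult L2_set_mult_ineq)
      finally show ?thesis by (simp add: V_def L2_set_def norm_eq_sqrt_inner euclidean_inner[of h h] power2_eq_square)
    qed
    let ?E = "{x \<in> ?B. v x \<le> m}" and ?F = "{x \<in> ?B. t < v x}"
    have prod: "emeasure lborel ?E * emeasure lborel ?F * ennreal (t - m)
       \<le> ennreal V1 * ennreal (2 * (2 * R)) * (\<integral>\<^sup>+x. ennreal (V x) * indicator ?B x \<partial>lborel)"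
      unfolding vB1[symmetric] by (rule level_sets_product_bound[OF der cont bd cV tm])
    have "(\<integral>\<^sup>+x. ennreal (V x) * indicator ?B x \<partial>lborel) \<le>
       (\<integral>\<^sup>+x. indicator ?B x + ennreal (\<Sum>b\<in>Basis. (log_grad w b x)\<^sup>2) * indicator ?B x \<partial>lborel)"
    proof (rule nn_integral_mono)
      fix x
      have s: "(\<Sum>b\<in>Basis. (log_grad w b x)\<^sup>2) = (V x)\<^sup>2" by (simp add: V_def sum_nonneg)
      \<comment> \<open>Passes from the bound for the integral of the square to the integral in the
        Poincare inequality.\<close>
      have "V x \<le> 1 + (V x)\<^sup>2"
      proof -
        have "0 \<le> (V x - 1/2)\<^sup>2" by simp
        then show ?thesis by (simp add: power2_eq_square algebra_simps)
      qed
      then have "ennreal (V x) \<le> 1 + ennreal ((V x)\<^sup>2)"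
        by (metis ennreal_1 ennreal_leI ennreal_plus zero_le_one zero_le_power2)
      then show "ennreal (V x) * indicator ?B x \<le> indicator ?B x + ennreal (\<Sum>b\<in>Basis. (log_grad w b x)\<^sup>2) * indicator ?B x"
        unfolding s by (simp add: indicator_def)
    qed
    also have "\<dots> = emeasure lborel ?B + (\<integral>\<^sup>+x. ennreal (\<Sum>b\<in>Basis. (log_grad w b x)\<^sup>2) * indicator ?B x \<partial>lborel)"
    proof (subst nn_integral_add)
      have "continuous_on ?B (\<lambda>x. \<Sum>b\<in>Basis. (log_grad w b x)\<^sup>2)"
        unfolding log_grad_def by (intro continuous_intros cw nz)
      then have "(\<lambda>x. ennreal (indicator ?B x *\<^sub>R (\<Sum>b\<in>Basis. (log_grad w b x)\<^sup>2))) \<in> borel_measurable borel"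
        by (intro measurable_compose[OF borel_measurable_continuous_on_indicator measurable_ennreal]) auto
      also have "(\<lambda>x. ennreal (indicator ?B x *\<^sub>R (\<Sum>b\<in>Basis. (log_grad w b x)\<^sup>2))) = (\<lambda>x. ennreal (\<Sum>b\<in>Basis. (log_grad w b x)\<^sup>2) * indicator ?B x)"
        by (auto simp: indicator_def)
      finally show "(\<lambda>x. ennreal (\<Sum>b\<in>Basis. (log_grad w b x)\<^sup>2) * indicator ?B x) \<in> borel_measurable lborel" by simp
      show "indicator ?B \<in> borel_measurable lborel" by (intro borel_measurable_indicator) auto
    qed auto
    also have "\<dots> \<le> ennreal V0 + ennreal \<bar>C1\<bar>"
      unfolding vB using C1[OF C2 w0 L] by (intro add_left_mono) (erule order_trans, simp add: ennreal_leI)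
    also have "\<dots> = ennreal (V0 + \<bar>C1\<bar>)" using V by simp
    finally have "ennreal V1 * ennreal (2 * (2 * R)) * (\<integral>\<^sup>+x. ennreal (V x) * indicator ?B x \<partial>lborel) \<le>
       ennreal V1 * ennreal (2 * (2 * R)) * ennreal (V0 + \<bar>C1\<bar>)"
      by (intro mult_left_mono) auto
    also have "\<dots> = ennreal Q" using V R by (simp add: Q_def ennreal_mult del: ennreal_plus)
    finally have "emeasure lborel ?E * emeasure lborel ?F * ennreal (t - m) \<le> ennreal Q"
      using prod by (rule order_trans[rotated])
    moreover have "ennreal \<mu> \<le> emeasure lborel ?E"
    proof -
      have "?E = {x \<in> ?B. w x \<le> M0 + R}"
        using w1 M0 R by (auto simp: v_def m_def)
      then show ?thesis using low[OF C2 _ _ ex] w0 L sub by auto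
    qed
    ultimately have le: "ennreal \<mu> * emeasure lborel ?F * ennreal (t - m) \<le> ennreal Q"
      by (meson mult_right_mono order_trans zero_le)
    have "emeasure lborel {x \<in> ?B. exp t < w x} \<le> emeasure lborel ?F"
    proof (rule emeasure_mono)
      show "{x \<in> ?B. exp t < w x} \<subseteq> ?F"
      proof
        fix x assume x: "x \<in> {x \<in> ?B. exp t < w x}"
        then have "exp t < 1 + w x" by auto
        then have "t < v x" unfolding v_def using w1[of x] x by (metis (mono_tags, lifting) exp_less_cancel_iff exp_ln mem_Collect_eq)
        then show "x \<in> ?F" using x by simp
      qed
      have "continuous_on ?B v" unfolding v_def using w1 by (intro continuous_intros cw) (metis less_irrefl)
      then have "open (?B \<inter> v -` {t<..})" by (intro continuous_open_preimage) auto
      also have "?B \<inter> v -` {t<..} = ?F" by auto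
      finally show "?F \<in> sets lborel" by simp
    qed
    also have "emeasure lborel ?F \<le> ennreal \<delta>"
    proof -
      have fin: "emeasure lborel ?F < \<infinity>"
      proof -
        have "emeasure lborel ?F \<le> emeasure lborel ?B" by (intro emeasure_mono) auto
        then show ?thesis unfolding vB using order.strict_trans1 by fastforce
      qed
      then obtain f where f: "f \<ge> 0" "emeasure lborel ?F = ennreal f"
        by (metis ennreal_cases infinity_ennreal_def less_irrefl)
      have "\<mu> * f * (t - m) \<le> Q"
        using le f \<mu> tm Q by (simp add: ennreal_mult'[symmetric] ennreal_mult''[symmetric] del: ennreal_mult'')
      moreover have "Q < \<mu> * \<delta> * (t - m)"
        using \<mu> \<delta> by (simp add: t_def algebra_simps)
      ultimately have "\<mu> * (t - m) * f < \<mu> * (t - m) * \<delta>" by (simp add: algebra_simps)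
      then have "f < \<delta>" using \<mu> tm by (simp add: mult_less_cancel_left_pos)
      then show ?thesis using f by (simp add: ennreal_leI)
    qed
    finally show "emeasure lborel {x \<in> ?B. exp t < w x} \<le> ennreal \<delta>" .
  qed
qed

section \<open>Real and complex Hessians\<close>

definition imul :: "complex^'n \<Rightarrow> complex^'n" where "imul v = \<i> *s v"

lemma scale_eq_scaleR: "c *s v = Re c *\<^sub>R v + Im c *\<^sub>R imul v"
  by (simp add: vec_eq_iff imul_def scaleR_conv_of_real[where 'a=complex]) (simp add: complex_eq_iff)

lemma imul_axis: "imul (axis k 1) = axis k \<i>"
  by (simp add: vec_eq_iff imul_def axis_def)

lemma imul_simps: "imul (v + w) = imul v + imul w" "imul (r *\<^sub>R v) = r *\<^sub>R imul v" "imul (imul v) = - v"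
  by (simp_all add: vec_eq_iff imul_def scaleR_conv_of_real[where 'a=complex] algebra_simps)

lemma norm_imul: "norm (imul v) = norm v"
  by (rule power2_eq_imp_eq) (simp_all add: norm_vec_power2 imul_def norm_mult)

lemma sum_Basis_complex_vec:
  "(\<Sum>b\<in>(Basis :: (complex^'n) set). f b) = (\<Sum>j\<in>UNIV. f (axis j 1) + f (axis j \<i>))"
proof -
  have B: "(Basis :: (complex^'n) set) = (\<Union>j. {axis j 1, axis j \<i>})"
    by (auto simp: Basis_vec_def Basis_complex_def)
  have "(\<Sum>b\<in>(\<Union>j\<in>UNIV. {axis j 1, axis j \<i>}). f b) = (\<Sum>j\<in>UNIV. \<Sum>b\<in>{axis j 1, axis j \<i>}. f (b :: complex^'n))"
    by (rule sum.UNION_disjoint) (auto simp: axis_eq_axis)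
  also have "\<dots> = (\<Sum>j\<in>UNIV. f (axis j 1) + f (axis j \<i>))"
    by (intro sum.cong refl) (simp add: axis_eq_axis)
  finally show ?thesis by (simp add: B)
qed

text \<open>The Hermitian matrix of the (1,1)-part of a real bilinear form: if \<open>B\<close> is the real Hessian of
  \<open>u\<close>, this is the matrix of \<open>i\<partial>\<bar>\<partial>u\<close>.\<close>

definition cform :: "(complex^'n \<Rightarrow> complex^'n \<Rightarrow> real) \<Rightarrow> complex^'n^'n" where
  "cform B = (\<chi> k j. Complex ((B (axis k 1) (axis j 1) + B (axis k \<i>) (axis j \<i>)) / 4)
     ((B (axis k \<i>) (axis j 1) - B (axis k 1) (axis j \<i>)) / 4))"

text \<open>The right-hand side is conjugate linear in \<open>v\<close> and linear in
  \<open>w\<close>, and it agrees with the matrix on the coordinate axes by definition.\<close>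

lemma sesq_cform:
  assumes B: "bilinear B"
  shows "sesq (cform B) v w = Complex ((B v w + B (imul v) (imul w)) / 4) ((B (imul v) w - B v (imul w)) / 4)"
proof -
  define S where "S v w = Complex ((B v w + B (imul v) (imul w)) / 4) ((B (imul v) w - B v (imul w)) / 4)" for v w
  note bl = bilinear_ladd[OF B] bilinear_radd[OF B] bilinear_lmul[OF B] bilinear_rmul[OF B] bilinear_lneg[OF B] bilinear_rneg[OF B] bilinear_lsub[OF B] bilinear_rsub[OF B]
    bilinear_lzero[OF B] bilinear_rzero[OF B]
  have add: "S (v + v') w = S v w + S v' w" "S v (w + w') = S v w + S v w'" for v v' w w'
    by (simp_all add: S_def bl imul_simps complex_eq_iff add_divide_distrib diff_divide_distrib)
  have zero: "S 0 w = 0" "S v 0 = 0" for v w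
    by (simp_all add: S_def bl imul_def complex_eq_iff)
  have scale: "S (c *s v) w = cnj c * S v w" "S v (c *s w) = c * S v w" for c v w
    unfolding scale_eq_scaleR S_def by (simp_all add: bl imul_simps complex_eq_iff field_simps)
  have sum: "S (\<Sum>k\<in>I. f k) w = (\<Sum>k\<in>I. S (f k) w)" "S v (\<Sum>k\<in>I. f k) = (\<Sum>k\<in>I. S v (f k))" if "finite I" for I :: "'a set" and f v w
    using that by (induction I) (simp_all add: zero add)
  have dec: "v = (\<Sum>k\<in>UNIV. v $ k *s axis k 1)" for v :: "complex^'a"
    by (simp add: vec_eq_iff sum_component axis_def if_distrib[of "\<lambda>x. _ * x"] cong: if_cong)
  have "S v w = (\<Sum>k\<in>UNIV. cnj (v $ k) * S (axis k 1) w)"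
    by (subst dec[of v]) (simp add: sum scale)
  also have "\<dots> = (\<Sum>k\<in>UNIV. \<Sum>j\<in>UNIV. cnj (v $ k) * (w $ j * S (axis k 1) (axis j 1)))"
    by (subst dec[of w]) (simp add: sum scale sum_distrib_left)
  also have "\<dots> = sesq (cform B) v w"
    unfolding sesq_def by (intro sum.cong refl) (simp add: cform_def S_def imul_axis mult_ac)
  finally show ?thesis by (simp add: S_def)
qed

lemma sesq_cform_diag:
  assumes "bilinear B" "\<And>h k. B h k = B k h"
  shows "sesq (cform B) v v = of_real ((B v v + B (imul v) (imul v)) / 4)"
  using sesq_cform[OF assms(1), of v v] assms(2)[of v "imul v"] by (simp add: complex_eq_iff)

lemma hermitian_cform:
  assumes "\<And>h k. B h k = B k h"
  shows "hermitian (cform B)"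
  unfolding hermitian_def
proof (intro allI)
  fix k j
  show "cnj (cform B $ k $ j) = cform B $ j $ k"
    by (simp add: cform_def complex_eq_iff assms[of "axis k 1" "axis j 1"] assms[of "axis k \<i>" "axis j \<i>"]
      assms[of "axis k \<i>" "axis j 1"] assms[of "axis k 1" "axis j \<i>"] diff_divide_distrib)
qed

lemma trace_cform:
  "(\<Sum>b\<in>Basis. B b b) = 4 * Re (trace (cform B))"
  by (simp add: sum_Basis_complex_vec trace_def cform_def sum_divide_distrib[symmetric])

text \<open>Writes the contraction of a (1,1)-form with \<open>G\<close> as a real second-order
  operator, which gives the coefficients of the linear inequality in a chart.\<close>

lemma trace_mult_cform:
  fixes B :: "complex^'n \<Rightarrow> complex^'n \<Rightarrow> real"
  assumes sym: "\<And>h k. B h k = B k h"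
  shows "Re (trace (G ** cform B)) = (\<Sum>b\<in>Basis. \<Sum>c\<in>Basis. Re (sesq G b c) / 4 * B b c)"
proof -
  have ax: "sesq G (axis j x) (axis k y) = G $ j $ k * y * cnj x" for j k x y
  proof -
    have "sesq G (axis j x) (axis k y) = (\<Sum>a\<in>UNIV. \<Sum>b\<in>UNIV. if b = k then if a = j then G $ j $ k * y * cnj x else 0 else 0)"
      unfolding sesq_def by (intro sum.cong refl) (auto simp: axis_def)
    then show ?thesis by simp
  qed
  have "(\<Sum>b\<in>Basis. \<Sum>c\<in>Basis. Re (sesq G b c) / 4 * B b c) =
    (\<Sum>j\<in>UNIV. \<Sum>k\<in>UNIV. Re (G $ j $ k) / 4 * B (axis j 1) (axis k 1) - Im (G $ j $ k) / 4 * B (axis j 1) (axis k \<i>)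
      + Im (G $ j $ k) / 4 * B (axis j \<i>) (axis k 1) + Re (G $ j $ k) / 4 * B (axis j \<i>) (axis k \<i>))"
    by (simp add: sum_Basis_complex_vec ax sum.distrib[symmetric] algebra_simps)
  also have "\<dots> = (\<Sum>j\<in>UNIV. \<Sum>k\<in>UNIV. Re (G $ j $ k * cform B $ k $ j))"
  proof (intro sum.cong refl)
    fix j k
    show "Re (G $ j $ k) / 4 * B (axis j 1) (axis k 1) - Im (G $ j $ k) / 4 * B (axis j 1) (axis k \<i>)
      + Im (G $ j $ k) / 4 * B (axis j \<i>) (axis k 1) + Re (G $ j $ k) / 4 * B (axis j \<i>) (axis k \<i>) = Re (G $ j $ k * cform B $ k $ j)"
      unfolding sym[of "axis j 1" "axis k 1"] sym[of "axis j 1" "axis k \<i>"] sym[of "axis j \<i>" "axis k 1"] sym[of "axis j \<i>" "axis k \<i>"]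
      by (simp add: cform_def field_simps)
  qed
  also have "\<dots> = Re (trace (G ** cform B))"
    by (simp add: trace_def matrix_matrix_mult_def)
  finally show ?thesis ..
qed

section \<open>Trace and norm estimates for Hermitian forms\<close>

lemma matrix_inv_mat_1: "matrix_inv (mat 1 :: complex^'n^'n) = mat 1"
  by (rule matrix_inv_unique) simp

text \<open>In a unitary basis that diagonalises \<open>g\<close>, division by the square roots of
  the eigenvalues gives a frame for \<open>g\<close>. The eigenvalues are at most \<open>D\<close>
  and \<open>U\<close> is nonnegative, so each diagonal term of \<open>U\<close> shrinks at most by
  the factor \<open>D\<close>.\<close>

lemma trace_matrix_inv_ge:
  fixes g U :: "complex^'n^'n"
  assumes g: "positive_hermitian g" and D: "D > 0" "\<And>v. Re (sesq g v v) \<le> D * (norm v)\<^sup>2"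
    and U: "\<And>v. 0 \<le> Re (sesq U v v)"
  shows "Re (trace U) / D \<le> Re (trace (matrix_inv g ** U))"
proof -
  have hg: "hermitian g" using g by (simp add: positive_hermitian_iff)
  obtain u where u: "orthonormal_frame (mat 1) u" "\<And>k l. k \<noteq> l \<Longrightarrow> sesq g (u $ k) (u $ l) = 0"
    using diagonalizing_frame[OF positive_hermitian_mat_1 hg] by blast
  have nu: "(norm (u $ k))\<^sup>2 = 1" for k
  proof -
    have "sesq (mat 1) (u $ k) (u $ k) = 1" using u(1) by (simp add: orthonormal_frame_def)
    then have "complex_of_real ((norm (u $ k))\<^sup>2) = complex_of_real 1" by (simp only: sesq_mat_1_diag of_real_1)
    then show ?thesis by (simp only: of_real_eq_iff)
  qed
  define d where "d k = Re (sesq g (u $ k) (u $ k))" for k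
  have d: "0 < d k" "d k \<le> D" for k
  proof -
    have "u $ k \<noteq> 0" using nu[of k] by auto
    then show "0 < d k" using g by (simp add: positive_hermitian_iff d_def)
    show "d k \<le> D" using D(2)[of "u $ k"] nu[of k] by (simp add: d_def)
  qed
  define p where "p = (\<chi> k. (1 / sqrt (d k)) *\<^sub>R u $ k)"
  have p: "orthonormal_frame g p"
    unfolding orthonormal_frame_def
  proof (intro allI)
    fix k l
    have "sesq g (u $ k) (u $ k) = of_real (d k)" unfolding d_def by (rule sesq_diag_of_real[OF hg])
    then have "sesq g (p $ k) (p $ k) = of_real ((1 / sqrt (d k)) * (1 / sqrt (d k)) * d k)"
      by (simp only: p_def vec_lambda_beta sesq_scaleR of_real_mult)
    also have "(1 / sqrt (d k)) * (1 / sqrt (d k)) * d k = 1"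
      using d(1)[of k] by simp
    finally show "sesq g (p $ k) (p $ l) = (if k = l then 1 else 0)"
      using u(2)[of k l] by (cases "k = l") (simp_all add: p_def sesq_scaleR)
  qed
  have "Re (trace U) / D = (\<Sum>k\<in>UNIV. Re (sesq U (u $ k) (u $ k)) / D)"
    using trace_matrix_inv[OF u(1), of U] by (simp add: matrix_inv_mat_1 sum_divide_distrib)
  also have "\<dots> \<le> (\<Sum>k\<in>UNIV. Re (sesq U (u $ k) (u $ k)) / d k)"
    using d U D(1) by (intro sum_mono divide_left_mono mult_pos_pos) auto
  also have "\<dots> = (\<Sum>k\<in>UNIV. Re (sesq U (p $ k) (p $ k)))"
  proof (intro sum.cong refl)
    fix k
    have "sesq U (p $ k) (p $ k) = of_real ((1 / sqrt (d k)) * (1 / sqrt (d k))) * sesq U (u $ k) (u $ k)"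
      by (simp only: p_def vec_lambda_beta sesq_scaleR of_real_mult)
    also have "(1 / sqrt (d k)) * (1 / sqrt (d k)) = 1 / d k"
      using d(1)[of k] by simp
    finally have "sesq U (p $ k) (p $ k) = of_real (1 / d k) * sesq U (u $ k) (u $ k)" .
    then show "Re (sesq U (u $ k) (u $ k)) / d k = Re (sesq U (p $ k) (p $ k))"
      by (simp del: of_real_divide)
  qed
  also have "\<dots> = Re (trace (matrix_inv g ** U))"
    by (simp add: trace_matrix_inv[OF p])
  finally show ?thesis .
qed

lemma norm_sesq_le:
  fixes A :: "complex^'n^'n"
  assumes "\<And>k j. norm (A $ k $ j) \<le> m"
  shows "norm (sesq A v w) \<le> (real CARD('n))\<^sup>2 * m * (norm v * norm w)"
proof -
  have "norm (sesq A v w) \<le> (\<Sum>k\<in>UNIV. \<Sum>j\<in>UNIV. norm (A $ k $ j * w $ j * cnj (v $ k)))"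
    unfolding sesq_def by (intro order_trans[OF norm_sum sum_mono] norm_sum)
  also have "\<dots> \<le> (\<Sum>k\<in>(UNIV::'n set). \<Sum>j\<in>(UNIV::'n set). m * (norm v * norm w))"
  proof (intro sum_mono)
    fix k j
    have "norm (A $ k $ j * w $ j * cnj (v $ k)) = norm (A $ k $ j) * (norm (v $ k) * norm (w $ j))"
      by (simp add: norm_mult)
    also have "\<dots> \<le> m * (norm v * norm w)"
      using assms[of k j] order_trans[OF norm_ge_zero assms[of k j]]
      by (intro mult_mono Finite_Cartesian_Product.norm_nth_le) auto
    finally show "norm (A $ k $ j * w $ j * cnj (v $ k)) \<le> m * (norm v * norm w)" .
  qed
  also have "\<dots> = (real CARD('n))\<^sup>2 * m * (norm v * norm w)"
    by (simp add: power2_eq_square)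
  finally show ?thesis .
qed

lemma frame_expansion:
  assumes "orthonormal_frame g p"
  shows "v = (\<Sum>k\<in>UNIV. sesq g (p $ k) v *s p $ k)"
proof -
  define P where "P = transpose p"
  have "cadj P ** g ** P = mat 1"
    using orthonormal_frame_matrix[OF assms] by (simp add: P_def)
  then have "P ** (cadj P ** g) = mat 1"
    by (simp add: matrix_left_right_inverse)
  then have "v = P *v ((cadj P ** g) *v v)"
    by (simp add: matrix_vector_mul_assoc)
  also have "((cadj P ** g) *v v) = (\<chi> k. sesq g (p $ k) v)"
  proof -
    have "((cadj P ** g) *v v) $ k = sesq g (p $ k) v" for k
      unfolding sesq_def matrix_vector_mult_def matrix_matrix_mult_def
      by (simp add: cadj_def P_def transpose_def sum_distrib_right) (subst sum.swap, simp add: mult_ac)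
    then show ?thesis by (simp add: vec_eq_iff)
  qed
  finally show ?thesis
    by (simp add: vec_eq_iff matrix_vector_mult_def P_def transpose_def sum_component mult.commute)
qed

section \<open>The structural conditions\<close>

text \<open>By Euler's relation \<open>f = \<Sum> \<mu>\<^sub>j f\<^sub>j\<close>, so that \<open>f\<close> dominates each summand.\<close>

lemma structural_prod_le:
  fixes \<mu> :: "real^'n"
  assumes sc: "structural_conditions \<Gamma> f \<gamma>" and \<mu>: "\<mu> \<in> \<Gamma>" and nn: "\<And>i. 0 \<le> \<mu> $ i"
  shows "\<gamma> * (\<Prod>i\<in>UNIV. \<mu> $ i) \<le> f \<mu> ^ CARD('n)"
proof -
  have C1: "Ck_on (Suc 0) \<Gamma> f" and hom: "\<And>t. t > 0 \<Longrightarrow> f (t *\<^sub>R \<mu>) = t * f \<mu>"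
    and pos: "\<And>j. 0 < partial_deriv j f \<mu>" and prod: "\<gamma> \<le> (\<Prod>j\<in>UNIV. partial_deriv j f \<mu>)"
    using sc \<mu> unfolding structural_conditions_def by auto
  have der: "(f has_derivative (\<lambda>h. dd f h \<mu>)) (at \<mu>)"
    by (rule Ck_on_1_D[OF C1 \<mu>])
  have lin: "linear (\<lambda>h. dd f h \<mu>)" using der has_derivative_linear by blast
  have "((\<lambda>t. f (0 + t *\<^sub>R \<mu>)) has_real_derivative dd f \<mu> \<mu>) (at 1)"
    by (rule has_derivative_along_line[of f "\<lambda>h. dd f h \<mu>" 0 1 \<mu>]) (use der in simp)
  moreover have "((\<lambda>t. f (0 + t *\<^sub>R \<mu>)) has_real_derivative f \<mu>) (at 1)"
  proof (rule has_field_derivative_transform_within_open[where S="{0<..}"])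
    show "((\<lambda>t. t * f \<mu>) has_real_derivative f \<mu>) (at 1)" by (auto intro!: derivative_eq_intros)
  qed (use hom in auto)
  ultimately have "f \<mu> = dd f \<mu> \<mu>" using DERIV_unique by blast
  also have "\<mu> = (\<Sum>i\<in>UNIV. \<mu> $ i *\<^sub>R axis i 1)"
    by (simp add: vec_eq_iff sum_component axis_def if_distrib[of "\<lambda>x. _ * x"] cong: if_cong)
  then have "dd f \<mu> \<mu> = dd f (\<Sum>i\<in>UNIV. \<mu> $ i *\<^sub>R axis i 1) \<mu>" by simp
  also have "\<dots> = (\<Sum>i\<in>UNIV. \<mu> $ i * partial_deriv i f \<mu>)"
    unfolding linear_sum[OF lin] linear_scale[OF lin] by (simp add: partial_deriv_def dd_def)
  finally have euler: "f \<mu> = (\<Sum>i\<in>UNIV. \<mu> $ i * partial_deriv i f \<mu>)" .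
  have le: "\<mu> $ i * partial_deriv i f \<mu> \<le> f \<mu>" for i
    unfolding euler using nn pos by (intro member_le_sum) (auto intro!: mult_nonneg_nonneg less_imp_le[OF pos])
  have "\<gamma> * (\<Prod>i\<in>UNIV. \<mu> $ i) \<le> (\<Prod>j\<in>UNIV. partial_deriv j f \<mu>) * (\<Prod>i\<in>UNIV. \<mu> $ i)"
    using prod nn by (intro mult_right_mono prod_nonneg) auto
  also have "\<dots> = (\<Prod>i\<in>UNIV. \<mu> $ i * partial_deriv i f \<mu>)"
    by (simp add: prod.distrib mult.commute)
  also have "\<dots> \<le> (\<Prod>i\<in>(UNIV::'n set). f \<mu>)"
    using nn pos le by (intro prod_mono) (auto intro!: mult_nonneg_nonneg less_imp_le[OF pos])
  finally show ?thesis by simp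
qed

text \<open>The first elementary symmetric polynomial is the sum, so this is what the inclusion of
  \<Gamma> in \<Gamma>_1 provides.\<close>

lemma structural_sum_pos:
  fixes \<mu> :: "real^'n"
  assumes "structural_conditions \<Gamma> f \<gamma>" "\<mu> \<in> \<Gamma>"
  shows "0 < (\<Sum>i\<in>UNIV. \<mu> $ i)"
proof -
  have "\<mu> \<in> Gamma_cone 1"
    using assms unfolding structural_conditions_def admissible_cone_def by blast
  then have "0 < elem_sym 1 \<mu>" by (simp add: Gamma_cone_def)
  also have "elem_sym 1 \<mu> = (\<Sum>S\<in>(\<lambda>i. {i}) ` UNIV. \<Prod>i\<in>S. \<mu> $ i)"
    unfolding elem_sym_def by (intro sum.cong) (auto simp: card_1_singleton_iff)
  also have "\<dots> = (\<Sum>i\<in>UNIV. \<mu> $ i)"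
    by (subst sum.reindex) auto
  finally show ?thesis .
qed

text \<open>Pair the index of the largest \<open>y\<close> with any other index; every other sum contains the maximum.\<close>

lemma prod_le_prod_complement_sums:
  fixes y :: "'n::finite \<Rightarrow> real"
  assumes card: "CARD('n) \<ge> 2" and y: "\<And>i. 0 \<le> y i"
  shows "(\<Prod>i\<in>UNIV. y i) \<le> (\<Prod>i\<in>UNIV. \<Sum>j\<in>UNIV - {i}. y j)"
proof -
  obtain m where m: "\<And>i. y i \<le> y m"
  proof -
    have "Max (range y) \<in> range y" by (rule Max_in) auto
    then obtain m where "Max (range y) = y m" by blast
    then have "y i \<le> y m" for i using Max_ge[of "range y" "y i"] by simp
    then show ?thesis using that by blast
  qed
  have "\<not> (UNIV :: 'n set) \<subseteq> {m}"
    using card card_mono[of "{m}" "UNIV::'n set"] by auto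
  then obtain k where k: "k \<noteq> m" by blast
  define \<sigma> where "\<sigma> = Transposition.transpose m k"
  have bij: "bij \<sigma>" unfolding \<sigma>_def by simp
  have "(\<Prod>i\<in>UNIV. y i) = (\<Prod>i\<in>UNIV. y (\<sigma> i))"
    by (rule prod.reindex_bij_betw[OF bij, symmetric])
  also have "\<dots> \<le> (\<Prod>i\<in>UNIV. \<Sum>j\<in>UNIV - {i}. y j)"
  proof (intro prod_mono conjI y)
    fix i
    show "y (\<sigma> i) \<le> (\<Sum>j\<in>UNIV - {i}. y j)"
    proof (cases "i = m")
      case True
      then have "y (\<sigma> i) = y k" by (simp add: \<sigma>_def)
      also have "\<dots> \<le> (\<Sum>j\<in>UNIV - {i}. y j)" using True k y by (intro member_le_sum) auto
      finally show ?thesis .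
    next
      case False
      have "y (\<sigma> i) \<le> y m" by (rule m)
      also have "\<dots> \<le> (\<Sum>j\<in>UNIV - {i}. y j)" using False y by (intro member_le_sum) auto
      finally show ?thesis .
    qed
  qed
  finally show ?thesis .
qed

section \<open>The (1,1)-form behind the endomorphism, with the Laplacian written as a trace, and
  its determinant estimate\<close>

definition endo_form :: "complex^'n^'n \<Rightarrow> complex^'n^'n \<Rightarrow> complex^'n^'n \<Rightarrow> complex^'n^'n \<Rightarrow> complex^'n^'n" where
  "endo_form g gh \<Phi> \<chi>' = (\<chi> k j. gh $ k $ j + (trace (matrix_inv g ** \<Phi>) * g $ k $ j - \<Phi> $ k $ j) / of_nat (CARD('n) - 1) + \<chi>' $ k $ j)"

lemma sesq_endo_form:
  "sesq (endo_form g gh \<Phi> X) v w = sesq gh v w + (trace (matrix_inv g ** \<Phi>) * sesq g v w - sesq \<Phi> v w) / of_nat (CARD('n) - 1) + sesq X v w"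
  for g :: "complex^'n^'n"
  unfolding sesq_def endo_form_def
  by (simp add: sum_distrib_left sum_divide_distrib sum.distrib[symmetric] sum_subtractf[symmetric] algebra_simps add_divide_distrib diff_divide_distrib)

text \<open>Passing from \<Phi> to (tr \<Phi> g - \<Phi>) / (n - 1) does not change the trace with
  respect to \<open>g\<close>, because tr g = n. The trace of the endomorphism therefore has the
  ordinary Laplacian as principal part.\<close>

lemma trace_endo_form:
  fixes g gh \<Phi> X :: "complex^'n^'n"
  assumes card: "CARD('n) \<ge> 2" and g: "positive_hermitian g"
  shows "trace (matrix_inv g ** endo_form g gh \<Phi> X) = trace (matrix_inv g ** gh) + trace (matrix_inv g ** \<Phi>) + trace (matrix_inv g ** X)"
proof -
  obtain p where p: "orthonormal_frame g p" using ex_orthonormal_frame[OF g] by blast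
  let ?n = "of_nat CARD('n) :: complex"
  let ?t = "trace (matrix_inv g ** \<Phi>)"
  have n1: "of_nat (CARD('n) - 1) = ?n - 1" "?n - 1 \<noteq> 0"
    using card by (simp_all add: of_nat_diff)
  have gg: "sesq g (p $ k) (p $ k) = 1" for k using p by (simp add: orthonormal_frame_def)
  have "trace (matrix_inv g ** endo_form g gh \<Phi> X) = (\<Sum>k\<in>UNIV. sesq gh (p $ k) (p $ k) + (?t - sesq \<Phi> (p $ k) (p $ k)) / (?n - 1) + sesq X (p $ k) (p $ k))"
    by (simp add: trace_matrix_inv[OF p] sesq_endo_form gg n1)
  also have "\<dots> = trace (matrix_inv g ** gh) + (?n * ?t - ?t) / (?n - 1) + trace (matrix_inv g ** X)"
    by (simp add: trace_matrix_inv[OF p] sum.distrib sum_subtractf sum_divide_distrib[symmetric])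
  also have "(?n * ?t - ?t) / (?n - 1) = ?t"
    using n1(2) by (simp add: field_simps)
  finally show ?thesis .
qed

lemma hermitian_endo_form:
  fixes g gh \<Phi> X :: "complex^'n^'n"
  assumes g: "positive_hermitian g" and h: "hermitian gh" "hermitian \<Phi>" "hermitian X"
  shows "hermitian (endo_form g gh \<Phi> X)"
proof -
  obtain p where p: "orthonormal_frame g p" using ex_orthonormal_frame[OF g] by blast
  have hg: "hermitian g" using g by (simp add: positive_hermitian_iff)
  have "cnj (trace (matrix_inv g ** \<Phi>)) = trace (matrix_inv g ** \<Phi>)"
    by (simp add: trace_matrix_inv[OF p] sesq_cnj[OF h(2)])
  then show ?thesis
    using h hg unfolding hermitian_def endo_form_def by simp
qed

lemma norm_sq_scaleR_bounds:
  assumes "orthonormal_frame g p" "\<kappa> > 0" "\<And>v. \<kappa> * (norm v)\<^sup>2 \<le> Re (sesq g v v)"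
  shows "(norm (p $ k))\<^sup>2 \<le> 1 / \<kappa>"
  using assms(1) assms(3)[of "p $ k"] assms(2) by (simp add: orthonormal_frame_def field_simps)

text \<open>In a frame p_k that diagonalises the form H, let \<open>y k\<close> be the shifted
  complex Hessian in direction p_k. The k-th eigenvalue of H is at least the sum of the
  \<open>y j\<close> with j \<noteq> k over n - 1, because by \<open>small\<close> the form
  \<open>gh\<close> outweighs \<open>X\<close> and the shift. Thus f^n controls the product of the
  \<open>y k\<close>, and in the real basis p_k, i p_k the determinant is controlled by the product
  of their squares. Only diagonal values of the Hessian enter, as the frame is adapted to H and not
  to the Hessian.\<close>

theorem contact_determinant_bound:
  fixes g gh X :: "complex^'n^'n" and B0 :: "complex^'n \<Rightarrow> complex^'n \<Rightarrow> real" and \<iota> :: "'m::finite \<Rightarrow> complex^'n"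
    and f :: "real^'n \<Rightarrow> real"
  assumes card: "CARD('n) \<ge> 2" and g: "positive_hermitian g"
    and \<kappa>: "\<kappa> > 0" "\<And>v. \<kappa> * (norm v)\<^sup>2 \<le> Re (sesq g v v)"
    and D: "D > 0" "\<And>v. Re (sesq g v v) \<le> D * (norm v)\<^sup>2"
    and M: "\<And>k j. norm (g $ k $ j) \<le> M"
    and gh: "hermitian gh" "\<And>v. \<kappa>h * (norm v)\<^sup>2 \<le> Re (sesq gh v v)"
    and X: "hermitian X" "\<And>k j. norm (X $ k $ j) \<le> m"
    and B0: "bilinear B0" "\<And>h k. B0 h k = B0 k h"
    and pos: "\<And>h. 0 \<le> B0 h h + 2 * \<epsilon> * (h \<bullet> h)" and \<epsilon>: "\<epsilon> \<ge> 0"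
    and small: "\<epsilon> / \<kappa> \<le> (\<kappa>h - (real CARD('n))\<^sup>2 * m) / D"
    and sc: "structural_conditions \<Gamma> f \<gamma>" and \<gamma>: "\<gamma> > 0"
    and ev: "eigenvalue_vector (matrix_inv g ** endo_form g gh (cform B0) X) \<mu>" and \<mu>: "\<mu> \<in> \<Gamma>"
    and \<iota>: "bij_betw \<iota> UNIV Basis" and cm: "CARD('m) = 2 * CARD('n)"
  shows "\<bar>det (\<chi> i j. B0 (\<iota> i) (\<iota> j) + 2 * \<epsilon> * (\<iota> i \<bullet> \<iota> j))\<bar> \<le>
    (fact CARD('m) * ((real CARD('n))\<^sup>2 * M * sqrt (1 / \<kappa>)) ^ CARD('m))\<^sup>2 * (fact CARD('m) *
      (16 ^ CARD('n) * ((real (CARD('n) - 1)) ^ CARD('n) / \<gamma>)\<^sup>2 * (f \<mu> ^ CARD('n))\<^sup>2))"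
proof -
  let ?n = "CARD('n)"
  let ?n1 = "real (?n - 1)"
  have n1: "?n1 > 0" using card by simp
  define B where "B h k = B0 h k + 2 * \<epsilon> * (h \<bullet> k)" for h k
  have Bb: "bilinear B"
    unfolding B_def bilinear_def using B0(1)
    by (intro conjI allI linear_compose_add) (auto simp: bilinear_def intro!: linearI simp: algebra_simps)
  have Bs: "B h k = B k h" for h k using B0(2) by (simp add: B_def inner_commute)
  have Bp: "0 \<le> B h h" for h using pos by (simp add: B_def)
  define \<Phi> where "\<Phi> = cform B0"
  have h\<Phi>: "hermitian \<Phi>" unfolding \<Phi>_def by (rule hermitian_cform[OF B0(2)])
  define H where "H = endo_form g gh \<Phi> X"
  have hH: "hermitian H" unfolding H_def by (rule hermitian_endo_form[OF g gh(1) h\<Phi> X(1)])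
  obtain p where p: "orthonormal_frame g p" and dH: "\<And>k l. k \<noteq> l \<Longrightarrow> sesq H (p $ k) (p $ l) = 0"
    using diagonalizing_frame[OF g hH] by blast
  have gp: "sesq g (p $ k) (p $ k) = 1" for k using p by (simp add: orthonormal_frame_def)
  define r where "r k = (norm (p $ k))\<^sup>2" for k
  \<comment> \<open>The squared lengths of the frame vectors lie between 1 / D and 1 / \<kappa>; the
    lower bound serves for \<open>gh\<close>, the upper one for the shift.\<close>
  have r_up: "r k \<le> 1 / \<kappa>" for k unfolding r_def by (rule norm_sq_scaleR_bounds[OF p \<kappa>])
  have r_lo: "1 / D \<le> r k" for k
    using D(2)[of "p $ k"] D(1) gp[of k] by (simp add: r_def field_simps)
  \<comment> \<open>The real shift 2 \<epsilon> acts in the two directions p_k and i p_k, and the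
    denominator 4 turns it into \<epsilon> |p_k|^2.\<close>
  define y where "y k = (B (p $ k) (p $ k) + B (imul (p $ k)) (imul (p $ k))) / 4" for k
  have y0: "0 \<le> y k" for k using Bp by (simp add: y_def)
  have \<Phi>y: "sesq \<Phi> (p $ k) (p $ k) = of_real (y k - \<epsilon> * r k)" for k
    unfolding \<Phi>_def sesq_cform_diag[OF B0] y_def B_def r_def
    by (simp only: of_real_eq_iff power2_norm_eq_inner[symmetric] norm_imul) (simp add: field_simps)
  have tr: "trace (matrix_inv g ** \<Phi>) = of_real (\<Sum>k\<in>UNIV. y k - \<epsilon> * r k)"
    by (simp add: trace_matrix_inv[OF p] \<Phi>y del: of_real_diff of_real_mult)
  define lam where "lam k = Re (sesq H (p $ k) (p $ k))" for k
  have n1c: "complex_of_nat (?n - 1) = of_real ?n1" by simp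
  have lam_eq: "lam k = Re (sesq gh (p $ k) (p $ k)) + (\<Sum>j\<in>UNIV - {k}. y j - \<epsilon> * r j) / ?n1 + Re (sesq X (p $ k) (p $ k))" for k
  proof -
    have "(\<Sum>j\<in>UNIV. y j - \<epsilon> * r j) = (y k - \<epsilon> * r k) + (\<Sum>j\<in>UNIV - {k}. y j - \<epsilon> * r j)"
      by (rule sum.remove) auto
    then have "sesq H (p $ k) (p $ k) = sesq gh (p $ k) (p $ k) + of_real ((\<Sum>j\<in>UNIV - {k}. y j - \<epsilon> * r j) / ?n1) + sesq X (p $ k) (p $ k)"
      unfolding H_def sesq_endo_form tr \<Phi>y gp n1c by (simp only: of_real_divide) simp
    then show ?thesis by (simp add: lam_def del: of_real_divide of_real_sum of_real_diff)
  qed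
  have lam_ge: "(\<Sum>j\<in>UNIV - {k}. y j) / ?n1 \<le> lam k" for k
  proof -
    have 1: "\<kappa>h * r k \<le> Re (sesq gh (p $ k) (p $ k))" using gh(2) by (simp add: r_def)
    have "\<bar>Re (sesq X (p $ k) (p $ k))\<bar> \<le> norm (sesq X (p $ k) (p $ k))" by (rule abs_Re_le_cmod)
    also have "\<dots> \<le> (real ?n)\<^sup>2 * m * r k"
      using norm_sesq_le[OF X(2), of "p $ k" "p $ k"] by (simp add: r_def power2_eq_square)
    finally have 2: "- ((real ?n)\<^sup>2 * m * r k) \<le> Re (sesq X (p $ k) (p $ k))" by linarith
    have "(\<Sum>j\<in>UNIV - {k}. \<epsilon> * r j) \<le> (\<Sum>j\<in>UNIV - {k}. \<epsilon> * (1 / \<kappa>))"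
      using r_up \<epsilon> by (intro sum_mono mult_left_mono) auto
    also have "\<dots> = ?n1 * (\<epsilon> / \<kappa>)"
      by (simp add: card_Diff_singleton)
    finally have "(\<Sum>j\<in>UNIV - {k}. \<epsilon> * r j) / ?n1 \<le> \<epsilon> / \<kappa>"
      using n1 by (simp add: field_simps)
    moreover have "\<epsilon> / \<kappa> \<le> (\<kappa>h - (real ?n)\<^sup>2 * m) * r k"
    proof -
      have "0 \<le> (\<kappa>h - (real ?n)\<^sup>2 * m) / D" using small \<epsilon> \<kappa>(1) by (meson divide_nonneg_pos order_trans)
      then have "0 \<le> \<kappa>h - (real ?n)\<^sup>2 * m" using D(1) by (simp add: zero_le_divide_iff)
      then have "(\<kappa>h - (real ?n)\<^sup>2 * m) * (1 / D) \<le> (\<kappa>h - (real ?n)\<^sup>2 * m) * r k"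
        using r_lo by (intro mult_left_mono) auto
      then show ?thesis using small by simp
    qed
    ultimately have "(\<Sum>j\<in>UNIV - {k}. \<epsilon> * r j) / ?n1 \<le> (\<kappa>h - (real ?n)\<^sup>2 * m) * r k" by (rule order_trans)
    then have 3: "0 \<le> \<kappa>h * r k - (real ?n)\<^sup>2 * m * r k - (\<Sum>j\<in>UNIV - {k}. \<epsilon> * r j) / ?n1"
      by (simp add: algebra_simps)
    have arith: "a \<le> G \<Longrightarrow> - b \<le> Y \<Longrightarrow> 0 \<le> a - b - c \<Longrightarrow> t \<le> G + (t - c) + Y" for a b c t G Y :: real
      by linarith
    show ?thesis
      unfolding lam_eq sum_subtractf diff_divide_distrib by (rule arith[OF 1 2 3])
  qed
  have sy0: "0 \<le> (\<Sum>j\<in>UNIV - {k}. y j)" for k using y0 by (intro sum_nonneg) auto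
  have lam0: "0 \<le> lam k" for k
    using lam_ge[of k] sy0[of k] n1 by (meson divide_nonneg_pos order_trans)
  note evf = eigenvalue_vector_frame[OF ev[folded \<Phi>_def, folded H_def] p dH hH, folded lam_def]
  have \<mu>0: "0 \<le> \<mu> $ i" for i using evf(3)[of i] lam0 by auto
  have "(\<Prod>k\<in>UNIV. y k) / ?n1 ^ ?n \<le> (\<Prod>k\<in>UNIV. \<Sum>j\<in>UNIV - {k}. y j) / ?n1 ^ ?n"
    using n1 by (intro divide_right_mono prod_le_prod_complement_sums card y0) auto
  also have "\<dots> = (\<Prod>k\<in>UNIV. (\<Sum>j\<in>UNIV - {k}. y j) / ?n1)"
    by (simp add: prod_dividef)
  also have "\<dots> \<le> (\<Prod>k\<in>UNIV. lam k)"
    using lam_ge sy0 n1 by (intro prod_mono) auto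
  also have "\<dots> = (\<Prod>i\<in>UNIV. \<mu> $ i)" using evf(2) by simp
  also have "\<dots> \<le> f \<mu> ^ ?n / \<gamma>"
    using structural_prod_le[OF sc \<mu> \<mu>0] \<gamma> by (simp add: field_simps)
  finally have prodY: "(\<Prod>k\<in>UNIV. y k) \<le> ?n1 ^ ?n / \<gamma> * f \<mu> ^ ?n"
    using n1 by (simp add: field_simps)
  have "card (UNIV :: 'm set) = card (UNIV :: ('n \<times> bool) set)"
    using cm by simp
  \<comment> \<open>Matches the index type of the real determinant with the pairs that label p_k and
    i p_k.\<close>
  then obtain e :: "'m \<Rightarrow> 'n \<times> bool" where e: "bij_betw e UNIV UNIV"
    using finite_same_card_bij[of "UNIV::'m set" "UNIV::('n \<times> bool) set"] by auto
  define q' where "q' s = (if snd s then imul (p $ fst s) else p $ fst s)" for s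
  define c' where "c' v s = (if snd s then Im (sesq g (p $ fst s) v) else Re (sesq g (p $ fst s) v))" for v s
  define C where "C = (real ?n)\<^sup>2 * M * sqrt (1 / \<kappa>)"
  have M0: "M \<ge> 0" using order_trans[OF norm_ge_zero M] .
  have exp: "\<iota> s = (\<Sum>u\<in>UNIV. c' (\<iota> s) (e u) *\<^sub>R q' (e u))" for s
  proof -
    have "\<iota> s = (\<Sum>k\<in>UNIV. sesq g (p $ k) (\<iota> s) *s p $ k)"
      by (rule frame_expansion[OF p])
    also have "\<dots> = (\<Sum>t\<in>UNIV. c' (\<iota> s) t *\<^sub>R q' t)"
      by (simp add: sum_pairs c'_def q'_def scale_eq_scaleR[of "sesq g _ _"] sum.distrib)
    also have "\<dots> = (\<Sum>u\<in>UNIV. c' (\<iota> s) (e u) *\<^sub>R q' (e u))"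
      by (rule sum.reindex_bij_betw[OF e, symmetric])
    finally show ?thesis .
  qed
  have cC: "\<bar>c' (\<iota> s) t\<bar> \<le> C" for s t
  proof -
    have inB: "\<iota> s \<in> Basis" using \<iota> by (auto simp: bij_betw_def)
    have "\<bar>c' (\<iota> s) t\<bar> \<le> norm (sesq g (p $ fst t) (\<iota> s))"
      by (simp add: c'_def abs_Re_le_cmod abs_Im_le_cmod)
    also have "\<dots> \<le> (real ?n)\<^sup>2 * M * (norm (p $ fst t) * norm (\<iota> s))"
      by (rule norm_sesq_le[OF M])
    also have "\<dots> \<le> (real ?n)\<^sup>2 * M * (sqrt (1 / \<kappa>) * 1)"
      using r_up[of "fst t"] M0 inB unfolding r_def
      by (intro mult_left_mono mult_mono) (auto intro: real_le_rsqrt less_imp_le[OF \<kappa>(1)])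
    finally show ?thesis by (simp add: C_def)
  qed
  have "\<bar>det (\<chi> i j. B (\<iota> i) (\<iota> j))\<bar> \<le> (fact CARD('m) * C ^ CARD('m))\<^sup>2 * (fact CARD('m) * (\<Prod>s\<in>UNIV. B (q' (e s)) (q' (e s))))"
    by (rule det_form_le[OF Bb Bs Bp exp cC])
  also have "(\<Prod>s\<in>UNIV. B (q' (e s)) (q' (e s))) = (\<Prod>t\<in>UNIV. B (q' t) (q' t))"
    by (rule prod.reindex_bij_betw[OF e])
  also have "\<dots> = (\<Prod>k\<in>UNIV. B (p $ k) (p $ k) * B (imul (p $ k)) (imul (p $ k)))"
    by (simp add: prod_pairs q'_def)
  also have "\<dots> \<le> (\<Prod>k\<in>UNIV. 16 * (y k)\<^sup>2)"
  proof (intro prod_mono conjI mult_nonneg_nonneg Bp)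
    fix k
    \<comment> \<open>A crude arithmetic-geometric bound suffices, as \<open>a + b\<close> equals
      \<open>4 * y k\<close>.\<close>
    define a b where "a = B (p $ k) (p $ k)" and "b = B (imul (p $ k)) (imul (p $ k))"
    have "0 \<le> a" "0 \<le> b" using Bp by (simp_all add: a_def b_def)
    then have "0 \<le> a * a + a * b + b * b" by simp
    then have "a * b \<le> (a + b)\<^sup>2" by (simp add: power2_eq_square algebra_simps)
    also have "\<dots> = 16 * (y k)\<^sup>2" by (simp add: y_def a_def b_def power_divide)
    finally show "B (p $ k) (p $ k) * B (imul (p $ k)) (imul (p $ k)) \<le> 16 * (y k)\<^sup>2"
      by (simp add: a_def b_def)
  qed
  also have "\<dots> = 16 ^ ?n * (\<Prod>k\<in>UNIV. y k)\<^sup>2"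
    by (simp add: prod.distrib prod_power_distrib)
  also have "\<dots> \<le> 16 ^ ?n * (?n1 ^ ?n / \<gamma> * f \<mu> ^ ?n)\<^sup>2"
    using prodY y0 by (intro mult_left_mono power_mono prod_nonneg) auto
  finally have "\<bar>det (\<chi> i j. B (\<iota> i) (\<iota> j))\<bar> \<le> (fact CARD('m) * C ^ CARD('m))\<^sup>2 * (fact CARD('m) * (16 ^ ?n * (?n1 ^ ?n / \<gamma> * f \<mu> ^ ?n)\<^sup>2))"
    by (simp add: mult_left_mono)
  then show ?thesis
    by (simp only: B_def C_def power_mult_distrib mult.assoc)
qed

section \<open>Continuously differentiable coefficients\<close>

lemma Ck_on_1_I:
  assumes "\<And>x. x \<in> S \<Longrightarrow> (f has_derivative f' x) (at x)" "\<And>v. continuous_on S (\<lambda>x. f' x v)"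
  shows "Ck_on (Suc 0) S f"
proof -
  have "continuous_on S (dd f v)" for v
    using assms(2)[of v] dd_eq[OF assms(1)] continuous_on_cong[of S S "dd f v" "\<lambda>x. f' x v"] by simp
  then show ?thesis
    unfolding Ck_on_Suc using assms(1) by (auto simp: differentiable_def)
qed

lemma Ck_on_1_dd:
  assumes "Ck_on (Suc 0) S f"
  shows "continuous_on S (dd f v)"
  using assms unfolding Ck_on_Suc by simp

lemma Ck_on_1_const: "Ck_on (Suc 0) S (\<lambda>x. c)"
  by (rule Ck_on_1_I) (auto intro!: derivative_eq_intros)

lemma Ck_on_1_add:
  assumes "Ck_on (Suc 0) S f" "Ck_on (Suc 0) S g"
  shows "Ck_on (Suc 0) S (\<lambda>x. f x + g x)"
  by (rule Ck_on_1_I[where f'="\<lambda>x h. dd f h x + dd g h x"])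
    (auto intro!: has_derivative_add Ck_on_1_D continuous_intros Ck_on_1_dd assms)

lemma Ck_on_1_mult:
  fixes f g :: "_ \<Rightarrow> 'b::real_normed_algebra"
  assumes "Ck_on (Suc 0) S f" "Ck_on (Suc 0) S g"
  shows "Ck_on (Suc 0) S (\<lambda>x. f x * g x)"
proof (rule Ck_on_1_I)
  show "((\<lambda>x. f x * g x) has_derivative (\<lambda>h. f x * dd g h x + dd f h x * g x)) (at x)" if "x \<in> S" for x
    by (intro has_derivative_mult Ck_on_1_D[OF assms(1) that] Ck_on_1_D[OF assms(2) that])
  show "continuous_on S (\<lambda>x. f x * dd g v x + dd f v x * g x)" for v
    by (intro continuous_intros Ck_on_1_dd assms Ck_on_Suc_imp_continuous[OF assms(1)] Ck_on_Suc_imp_continuous[OF assms(2)])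
qed

lemma Ck_on_1_inverse:
  fixes f :: "_ \<Rightarrow> 'b::real_normed_field"
  assumes f: "Ck_on (Suc 0) S f" and nz: "\<And>x. x \<in> S \<Longrightarrow> f x \<noteq> 0"
  shows "Ck_on (Suc 0) S (\<lambda>x. inverse (f x))"
proof (rule Ck_on_1_I)
  show "((\<lambda>x. inverse (f x)) has_derivative (\<lambda>h. - (inverse (f x) * dd f h x * inverse (f x)))) (at x)" if "x \<in> S" for x
    by (rule Deriv.has_derivative_inverse[OF nz[OF that] Ck_on_1_D[OF f that]])
  have "\<forall>x\<in>S. f x \<noteq> 0" using nz by blast
  then show "continuous_on S (\<lambda>x. - (inverse (f x) * dd f v x * inverse (f x)))" for v
    by (intro continuous_intros Ck_on_1_dd f Ck_on_Suc_imp_continuous[OF f])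
qed

lemma Ck_on_1_sum: "(\<And>i. i \<in> I \<Longrightarrow> Ck_on (Suc 0) S (f i)) \<Longrightarrow> Ck_on (Suc 0) S (\<lambda>x. \<Sum>i\<in>I. f i x)"
  by (induction I rule: infinite_finite_induct) (auto simp del: Ck_on.simps intro: Ck_on_1_const Ck_on_1_add)

lemma Ck_on_1_prod:
  fixes f :: "_ \<Rightarrow> _ \<Rightarrow> 'b::real_normed_field"
  shows "(\<And>i. i \<in> I \<Longrightarrow> Ck_on (Suc 0) S (f i)) \<Longrightarrow> Ck_on (Suc 0) S (\<lambda>x. \<Prod>i\<in>I. f i x)"
  by (induction I rule: infinite_finite_induct) (auto simp del: Ck_on.simps intro: Ck_on_1_const Ck_on_1_mult)

lemma Ck_on_1_det:
  fixes A :: "_ \<Rightarrow> complex^'n^'n"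
  assumes "\<And>i j. Ck_on (Suc 0) S (\<lambda>x. A x $ i $ j)"
  shows "Ck_on (Suc 0) S (\<lambda>x. det (A x))"
  unfolding det_def by (intro Ck_on_1_sum Ck_on_1_mult Ck_on_1_const Ck_on_1_prod assms)

text \<open>Cramer's rule exhibits the entries of the inverse as quotients of polynomials in the
  entries of \<open>A\<close>, from which their differentiability follows.\<close>

lemma matrix_inv_Cramer:
  fixes A :: "complex^'n^'n"
  assumes "A ** B = mat 1"
  shows "det A \<noteq> 0" "matrix_inv A $ k $ l = det (\<chi> i j. if j = k then axis l 1 $ i else A $ i $ j) * inverse (det A)"
proof -
  show nz: "det A \<noteq> 0"
    using arg_cong[OF assms, of det] by (auto simp: det_mul)
  have "matrix_inv A = B" by (rule matrix_inv_unique[OF assms])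
  have "A *v (B *v axis l 1) = axis l 1"
    by (simp add: matrix_vector_mul_assoc assms)
  then have "B *v axis l 1 = (\<chi> k. det (\<chi> i j. if j = k then axis l 1 $ i else A $ i $ j) / det A)"
    using cramer[OF nz] by blast
  moreover have "(B *v axis l 1) $ k = B $ k $ l"
    by (simp add: matrix_vector_mult_def axis_def if_distrib[of "\<lambda>x. _ * x"] cong: if_cong)
  ultimately show "matrix_inv A $ k $ l = det (\<chi> i j. if j = k then axis l 1 $ i else A $ i $ j) * inverse (det A)"
    by (simp add: \<open>matrix_inv A = B\<close> divide_inverse)
qed

lemma positive_hermitian_inverse:
  assumes "positive_hermitian g"
  shows "g ** matrix_inv g = mat 1"
  using ex_orthonormal_frame[OF assms] orthonormal_frame_inverse by blast

lemma Ck_on_1_matrix_inv: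
  fixes g :: "_ \<Rightarrow> complex^'n^'n"
  assumes S: "open S" and g: "\<And>i j. Ck_on (Suc 0) S (\<lambda>x. g x $ i $ j)" and pos: "\<And>x. x \<in> S \<Longrightarrow> positive_hermitian (g x)"
  shows "Ck_on (Suc 0) S (\<lambda>x. matrix_inv (g x) $ k $ l)"
proof (rule Ck_on_cong[OF S])
  note inv = matrix_inv_Cramer[OF positive_hermitian_inverse[OF pos]]
  show "det (\<chi> i j. if j = k then axis l 1 $ i else g x $ i $ j) * inverse (det (g x)) = matrix_inv (g x) $ k $ l" if "x \<in> S" for x
    using inv(2)[OF that] by simp
  show "Ck_on (Suc 0) S (\<lambda>x. det (\<chi> i j. if j = k then axis l 1 $ i else g x $ i $ j) * inverse (det (g x)))"
  proof (intro Ck_on_1_mult Ck_on_1_inverse Ck_on_1_det g inv(1))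
    fix i j
    show "Ck_on (Suc 0) S (\<lambda>x. (\<chi> i j. if j = k then axis l 1 $ i else g x $ i $ j) $ i $ j)"
      using g[of i j] Ck_on_1_const[of S "axis l 1 $ i"] by (cases "j = k") (simp_all del: Ck_on.simps)
  qed
qed

section \<open>Calculus in a chart\<close>

lemma is_chart_facts:
  assumes "is_chart X c"
  shows "open (chart_image c)"
    and "z \<in> chart_image c \<Longrightarrow> chart_inv c z \<in> fst c"
    and "z \<in> chart_image c \<Longrightarrow> snd c (chart_inv c z) = z"
    and "x \<in> fst c \<Longrightarrow> snd c x \<in> chart_image c"
    and "x \<in> fst c \<Longrightarrow> chart_inv c (snd c x) = x"
proof -
  have hm: "homeomorphic_map (subtopology X (fst c)) (top_of_set (chart_image c)) (snd c)"
    and op: "openin X (fst c)" and "open (chart_image c)"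
    using assms by (auto simp: is_chart_def)
  then show "open (chart_image c)" by simp
  have ts: "topspace (subtopology X (fst c)) = fst c"
    using openin_subset[OF op] by auto
  have inj: "inj_on (snd c) (fst c)"
    using homeomorphic_imp_injective_map[OF hm] unfolding ts .
  show "z \<in> chart_image c \<Longrightarrow> chart_inv c z \<in> fst c"
    unfolding chart_inv_def chart_image_def by (rule inv_into_into)
  show "z \<in> chart_image c \<Longrightarrow> snd c (chart_inv c z) = z"
    unfolding chart_inv_def chart_image_def by (rule f_inv_into_f)
  show "x \<in> fst c \<Longrightarrow> snd c x \<in> chart_image c"
    by (simp add: chart_image_def)
  show "x \<in> fst c \<Longrightarrow> chart_inv c (snd c x) = x"
    unfolding chart_inv_def using inj by (rule inv_into_f_f)
qed

lemma d_z_in_chart: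
  assumes "(\<phi> \<circ> chart_inv c has_derivative (\<lambda>h. dd (\<phi> \<circ> chart_inv c) h z)) (at z)"
  defines "u \<equiv> \<phi> \<circ> chart_inv c"
  shows "d_z j (in_chart c \<phi>) z = Complex (dd u (axis j 1) z / 2) (- dd u (axis j \<i>) z / 2)"
    and "d_zbar j (in_chart c \<phi>) z = Complex (dd u (axis j 1) z / 2) (dd u (axis j \<i>) z / 2)"
proof -
  have "(in_chart c \<phi> has_derivative (\<lambda>h. complex_of_real (dd u h z))) (at z)"
    using has_derivative_of_real[OF assms(1)[folded u_def]] by (simp add: in_chart_def[abs_def] u_def o_def)
  from frechet_derivative_at[OF this, symmetric]
  show "d_z j (in_chart c \<phi>) z = Complex (dd u (axis j 1) z / 2) (- dd u (axis j \<i>) z / 2)"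
    and "d_zbar j (in_chart c \<phi>) z = Complex (dd u (axis j 1) z / 2) (dd u (axis j \<i>) z / 2)"
    by (simp_all add: d_z_def d_zbar_def complex_eq_iff)
qed

text \<open>The formula for the first Wirtinger derivative is known on \<open>S\<close> only; as
  \<open>S\<close> is open, it may be differentiated once more there.\<close>

lemma ddbar_in_chart:
  fixes \<phi> :: "'a \<Rightarrow> real" and c :: "('a, 'n::finite) chart"
  assumes C2: "Ck_on (Suc (Suc 0)) S (\<phi> \<circ> chart_inv c)" and S: "open S" and z: "z \<in> S" "snd c x = z"
  defines "u \<equiv> \<phi> \<circ> chart_inv c"
  shows "ddbar c \<phi> x = cform (\<lambda>h k. dd (dd u h) k z)"
proof -
  have C1: "Ck_on (Suc 0) S (dd u h)" for h
    using C2 unfolding u_def Ck_on_Suc[of "Suc 0"] by blast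
  have du: "(u has_derivative (\<lambda>h. dd u h y)) (at y)" if "y \<in> S" for y
    using Ck_on_1_D[OF C2 that] by (simp add: u_def)
  have ddu: "(dd u h has_derivative (\<lambda>k. dd (dd u h) k y)) (at y)" if "y \<in> S" for y h
    by (rule Ck_on_1_D[OF C1 that])
  have "d_z j (d_zbar k (in_chart c \<phi>)) z = cform (\<lambda>h k. dd (dd u h) k z) $ k $ j" for j k
  proof -
    define W where "W y = (complex_of_real (dd u (axis k 1) y) + \<i> * of_real (dd u (axis k \<i>) y)) / 2" for y
    have eq: "W y = d_zbar k (in_chart c \<phi>) y" if "y \<in> S" for y
      using d_z_in_chart(2)[OF du[OF that, unfolded u_def], of k] by (simp add: W_def u_def complex_eq_iff)
    have "(W has_derivative (\<lambda>h. (complex_of_real (dd (dd u (axis k 1)) h z) + \<i> * of_real (dd (dd u (axis k \<i>)) h z)) / 2)) (at z)"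
      unfolding W_def[abs_def]
      by (auto intro!: derivative_eq_intros has_derivative_of_real ddu[OF z(1)] simp: field_simps)
    then have "(d_zbar k (in_chart c \<phi>) has_derivative (\<lambda>h. (complex_of_real (dd (dd u (axis k 1)) h z) + \<i> * of_real (dd (dd u (axis k \<i>)) h z)) / 2)) (at z)"
      by (rule has_derivative_transform_within_open[OF _ S z(1)]) (simp add: eq)
    from frechet_derivative_at[OF this, symmetric] show ?thesis
      by (simp add: d_z_def cform_def complex_eq_iff field_simps)
  qed
  then show ?thesis by (simp add: ddbar_def vec_eq_iff z(2))
qed

text \<open>The two halves of \<chi>[\<phi>] are conjugate transposes of each other. This gives
  Hermitian symmetry, and for Hermitian \<open>G\<close> it makes the trace twice the real part of
  the sum of \<phi>_j \<tau>_j, which is the derivative of \<phi> along the vector \<tau>.\<close>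

lemma chi_form_facts:
  fixes \<phi> :: "'a \<Rightarrow> real" and c :: "('a, 'n::finite) chart"
  assumes du: "(\<phi> \<circ> chart_inv c has_derivative (\<lambda>h. dd (\<phi> \<circ> chart_inv c) h z)) (at z)" and z: "snd c x = z"
  defines "u \<equiv> \<phi> \<circ> chart_inv c"
  shows "hermitian (chi_form \<theta> c \<phi> x)"
    and "(\<And>h. \<bar>dd u h z\<bar> \<le> s * norm h) \<Longrightarrow> (\<And>j. norm (\<theta> c x $ j) \<le> \<Theta>) \<Longrightarrow> norm (chi_form \<theta> c \<phi> x $ k $ j) \<le> 2 * s * \<Theta>"
    and "hermitian G \<Longrightarrow> Re (trace (G ** chi_form \<theta> c \<phi> x)) = dd u (\<chi> j. \<Sum>k\<in>UNIV. G $ j $ k * cnj (\<theta> c x $ k)) z"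
proof -
  note dz = d_z_in_chart[OF du, folded u_def]
  have lin: "linear (\<lambda>h. dd u h z)" using du has_derivative_linear unfolding u_def by blast
  have cnjd: "d_zbar k (in_chart c \<phi>) z = cnj (d_z k (in_chart c \<phi>) z)" for k
    by (simp add: dz complex_eq_iff)
  show "hermitian (chi_form \<theta> c \<phi> x)"
    unfolding hermitian_def chi_form_def by (simp add: z cnjd mult.commute add.commute)
  show "norm (chi_form \<theta> c \<phi> x $ k $ j) \<le> 2 * s * \<Theta>"
    if s: "\<And>h. \<bar>dd u h z\<bar> \<le> s * norm h" and \<Theta>: "\<And>j. norm (\<theta> c x $ j) \<le> \<Theta>" for k j
  proof -
    have na: "norm (axis j a :: complex^'n) = norm a" for j a
      by (rule power2_eq_imp_eq) (simp_all add: norm_vec_power2 axis_def if_distrib[of norm] if_distrib[of "\<lambda>x. x\<^sup>2"] cong: if_cong)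
    have d: "norm (d_z j (in_chart c \<phi>) z) \<le> s" for j
    proof -
      have "norm (d_z j (in_chart c \<phi>) z) \<le> \<bar>dd u (axis j 1) z / 2\<bar> + \<bar>- dd u (axis j \<i>) z / 2\<bar>"
        unfolding dz using cmod_le[of "Complex (dd u (axis j 1) z / 2) (- dd u (axis j \<i>) z / 2)"] by simp
      also have "\<dots> \<le> s" using s[of "axis j 1"] s[of "axis j \<i>"] by (simp add: na)
      finally show ?thesis .
    qed
    have s0: "0 \<le> s" using order_trans[OF norm_ge_zero d] .
    have "norm (chi_form \<theta> c \<phi> x $ k $ j) \<le> norm (d_z j (in_chart c \<phi>) z) * norm (\<theta> c x $ k) + norm (\<theta> c x $ j) * norm (d_z k (in_chart c \<phi>) z)"
      unfolding chi_form_def by (simp add: z cnjd) (rule order_trans[OF norm_triangle_ineq], simp add: norm_mult)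
    also have "\<dots> \<le> s * \<Theta> + \<Theta> * s"
      using d \<Theta> s0 order_trans[OF norm_ge_zero \<Theta>] by (intro add_mono mult_mono) auto
    finally show ?thesis by (simp add: mult_ac)
  qed
  show "Re (trace (G ** chi_form \<theta> c \<phi> x)) = dd u (\<chi> j. \<Sum>k\<in>UNIV. G $ j $ k * cnj (\<theta> c x $ k)) z" if G: "hermitian G"
  proof -
    define \<tau> where "\<tau> j = (\<Sum>k\<in>UNIV. G $ j $ k * cnj (\<theta> c x $ k))" for j
    define p where "p j = d_z j (in_chart c \<phi>) z" for j
    have "trace (G ** chi_form \<theta> c \<phi> x) = (\<Sum>j\<in>UNIV. \<Sum>k\<in>UNIV. G $ j $ k * (p j * cnj (\<theta> c x $ k))) + (\<Sum>j\<in>UNIV. \<Sum>k\<in>UNIV. G $ j $ k * (\<theta> c x $ j * cnj (p k)))"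
      by (simp add: trace_def matrix_matrix_mult_def chi_form_def z cnjd p_def distrib_left sum.distrib)
    also have "(\<Sum>j\<in>UNIV. \<Sum>k\<in>UNIV. G $ j $ k * (p j * cnj (\<theta> c x $ k))) = (\<Sum>j\<in>UNIV. p j * \<tau> j)"
      by (simp add: \<tau>_def sum_distrib_left mult_ac)
    also have "(\<Sum>j\<in>UNIV. \<Sum>k\<in>UNIV. G $ j $ k * (\<theta> c x $ j * cnj (p k))) = (\<Sum>k\<in>UNIV. cnj (p k * \<tau> k))"
    proof (subst sum.swap, intro sum.cong refl)
      fix k
      have "cnj (p k * \<tau> k) = (\<Sum>j\<in>UNIV. cnj (p k) * (cnj (G $ k $ j) * \<theta> c x $ j))"
        by (simp add: \<tau>_def sum_distrib_left)
      also have "\<dots> = (\<Sum>j\<in>UNIV. G $ j $ k * (\<theta> c x $ j * cnj (p k)))"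
        using G by (simp add: hermitian_def mult_ac)
      finally show "(\<Sum>j\<in>UNIV. G $ j $ k * (\<theta> c x $ j * cnj (p k))) = cnj (p k * \<tau> k)" ..
    qed
    finally have "Re (trace (G ** chi_form \<theta> c \<phi> x)) = (\<Sum>j\<in>UNIV. 2 * Re (p j * \<tau> j))"
      by (simp only: plus_complex.simps Re_sum cnj.simps mult_2 sum.distrib)
    also have "\<dots> = (\<Sum>j\<in>UNIV. Re (\<tau> j) * dd u (axis j 1) z + Im (\<tau> j) * dd u (axis j \<i>) z)"
      by (intro sum.cong refl) (simp add: p_def dz)
    also have "\<dots> = dd u (\<Sum>j\<in>UNIV. Re (\<tau> j) *\<^sub>R axis j 1 + Im (\<tau> j) *\<^sub>R axis j \<i>) z"
      by (simp add: linear_sum[OF lin] linear_add[OF lin] linear_scale[OF lin])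
    also have "(\<Sum>j\<in>UNIV. Re (\<tau> j) *\<^sub>R axis j 1 + Im (\<tau> j) *\<^sub>R axis j \<i>) = (\<chi> j. \<tau> j)"
    proof -
      have "(\<Sum>j\<in>UNIV. (Re (\<tau> j) *\<^sub>R axis j (1::complex) + Im (\<tau> j) *\<^sub>R axis j \<i>) $ i) = (\<Sum>j\<in>UNIV. if j = i then \<tau> i else 0)" for i
        by (intro sum.cong refl) (auto simp: axis_def complex_eq_iff)
      then show ?thesis by (simp add: vec_eq_iff sum_component)
    qed
    finally show ?thesis by (simp add: \<tau>_def)
  qed
qed

lemma tilde_h_eq:
  fixes \<omega> :: "('a, 'n::finite) chart \<Rightarrow> 'a \<Rightarrow> complex^'n^'n"
  assumes "positive_hermitian (\<omega> c x)"
  shows "tilde_h \<omega> \<omega>h \<theta> \<phi> c x = matrix_inv (\<omega> c x) ** endo_form (\<omega> c x) (\<omega>h c x) (ddbar c \<phi> x) (chi_form \<theta> c \<phi> x)"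
  unfolding tilde_h_def endo_form_def laplacian_eq_trace[OF positive_hermitian_inverse[OF assms]] ..

section \<open>Charts and topology\<close>

lemma chart_image_of_open:
  assumes c: "is_chart X c" and U: "openin X U"
  shows "open {z \<in> chart_image c. chart_inv c z \<in> U}"
proof -
  have hm: "homeomorphic_map (subtopology X (fst c)) (top_of_set (chart_image c)) (snd c)"
    using c by (simp add: is_chart_def)
  have "openin (subtopology X (fst c)) (U \<inter> fst c)"
    using U by (auto simp: openin_subtopology)
  then have "openin (top_of_set (chart_image c)) (snd c ` (U \<inter> fst c))"
    using homeomorphic_imp_open_map[OF hm] by (auto simp: open_map_def)
  then have "open (snd c ` (U \<inter> fst c))"
    using openin_open_trans is_chart_facts(1)[OF c] by blast
  also have "snd c ` (U \<inter> fst c) = {z \<in> chart_image c. chart_inv c z \<in> U}"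
  proof (intro set_eqI iffI)
    fix z assume "z \<in> snd c ` (U \<inter> fst c)"
    then obtain x where "x \<in> U" "x \<in> fst c" "z = snd c x" by blast
    then show "z \<in> {z \<in> chart_image c. chart_inv c z \<in> U}"
      using is_chart_facts(4,5)[OF c, of x] by simp
  next
    fix z assume "z \<in> {z \<in> chart_image c. chart_inv c z \<in> U}"
    then show "z \<in> snd c ` (U \<inter> fst c)"
      using is_chart_facts(2,3)[OF c, of z] by (intro image_eqI[of _ _ "chart_inv c z"]) auto
  qed
  finally show ?thesis .
qed

lemma complex_manifold_facts:
  assumes "complex_manifold X A"
  shows "c \<in> A \<Longrightarrow> is_chart X c" "x \<in> topspace X \<Longrightarrow> \<exists>c\<in>A. x \<in> fst c" "c \<in> A \<Longrightarrow> fst c \<subseteq> topspace X"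
  using assms unfolding complex_manifold_def by blast+

lemma chart_inv_image_open:
  assumes c: "is_chart X c" and V: "open V" "V \<subseteq> chart_image c"
  shows "openin X (chart_inv c ` V)"
proof -
  have hm: "homeomorphic_map (subtopology X (fst c)) (top_of_set (chart_image c)) (snd c)" and op: "openin X (fst c)"
    using c by (auto simp: is_chart_def)
  have "continuous_map (subtopology X (fst c)) (top_of_set (chart_image c)) (snd c)"
    using hm homeomorphic_imp_continuous_map by blast
  moreover have "openin (top_of_set (chart_image c)) V"
    using V by (auto simp: openin_open)
  ultimately have "openin (subtopology X (fst c)) {x \<in> topspace (subtopology X (fst c)). snd c x \<in> V}"
    by (rule openin_continuous_map_preimage)
  then have "openin X {x \<in> topspace (subtopology X (fst c)). snd c x \<in> V}"
    using op openin_open_subtopology by blast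
  also have "{x \<in> topspace (subtopology X (fst c)). snd c x \<in> V} = chart_inv c ` V"
  proof -
    have "topspace (subtopology X (fst c)) = fst c" using openin_subset[OF op] by auto
    then show ?thesis using is_chart_facts[OF c] V(2) by (auto simp: image_iff subset_iff) metis
  qed
  finally show ?thesis .
qed

lemma continuous_map_of_charts:
  fixes \<phi> :: "'a \<Rightarrow> real"
  assumes man: "complex_manifold X A" and cont: "\<And>c. c \<in> A \<Longrightarrow> continuous_on (chart_image c) (\<phi> \<circ> chart_inv c)"
  shows "continuous_map X euclideanreal \<phi>"
  unfolding continuous_map_def
proof (intro conjI allI impI)
  fix U :: "real set" assume "openin euclidean U"
  then have U: "open U" by simp
  show "openin X {x \<in> topspace X. \<phi> x \<in> U}"
  proof (subst openin_subopen, intro ballI)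
    fix x assume x: "x \<in> {x \<in> topspace X. \<phi> x \<in> U}"
    then obtain c where c: "c \<in> A" "x \<in> fst c" using complex_manifold_facts(2)[OF man] by blast
    have ch: "is_chart X c" by (rule complex_manifold_facts(1)[OF man c(1)])
    note cf = is_chart_facts[OF ch]
    define V where "V = chart_image c \<inter> (\<phi> \<circ> chart_inv c) -` U"
    have V: "open V" "V \<subseteq> chart_image c"
      unfolding V_def using cont[OF c(1)] cf(1) U by (auto intro: continuous_open_preimage)
    have "openin X (chart_inv c ` V)" by (rule chart_inv_image_open[OF ch V])
    moreover have "x \<in> chart_inv c ` V"
      using cf(4,5)[OF c(2)] x by (intro image_eqI[of _ _ "snd c x"]) (auto simp: V_def)
    moreover have "chart_inv c ` V \<subseteq> {x \<in> topspace X. \<phi> x \<in> U}"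
      using openin_subset[OF \<open>openin X (chart_inv c ` V)\<close>] by (auto simp: V_def)
    ultimately show "\<exists>T. openin X T \<and> x \<in> T \<and> T \<subseteq> {x \<in> topspace X. \<phi> x \<in> U}" by blast
  qed
qed simp

section \<open>The entropy bound in a chart\<close>

lemma sets_chart_volume: "sets (chart_volume X \<omega> c) = sets (sigma (topspace X) {U. openin X U})"
  by (simp add: chart_volume_def)

text \<open>The measure of a chart lies below the supremum, so a bound for the entropy on X passes
  to every chart.\<close>

lemma nn_integral_chart_volume_le:
  assumes "c \<in> A"
  shows "nn_integral (chart_volume X \<omega> c) G \<le> nn_integral (volume_measure X A \<omega>) G"
proof (rule nn_integral_mono_measure)
  have "sets (volume_measure X A \<omega>) = sets (sigma (topspace X) {U. openin X U})"
    unfolding volume_measure_def by (rule sets_SUP[OF sets_chart_volume]) (use assms in auto)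
  then show "sets (chart_volume X \<omega> c) = sets (volume_measure X A \<omega>)"
    by (simp only: sets_chart_volume)
  show "chart_volume X \<omega> c \<le> volume_measure X A \<omega>"
    unfolding volume_measure_def by (rule SUP_upper[OF assms])
qed

lemma measurable_chart_inv:
  assumes c: "is_chart X c"
  shows "chart_inv c \<in> measurable (restrict_space lborel (chart_image c)) (sigma (topspace X) {U. openin X U})"
proof (rule measurable_measure_of)
  note cf = is_chart_facts[OF c]
  show "{U. openin X U} \<subseteq> Pow (topspace X)" using openin_subset by auto
  have "fst c \<subseteq> topspace X" using c openin_subset by (auto simp: is_chart_def)
  then show "chart_inv c \<in> space (restrict_space lborel (chart_image c)) \<rightarrow> topspace X"
    using cf(2) by (auto simp: space_restrict_space)
  fix U assume "U \<in> {U. openin X U}"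
  then have o: "open {z \<in> chart_image c. chart_inv c z \<in> U}" using chart_image_of_open[OF c] by simp
  have "chart_inv c -` U \<inter> space (restrict_space lborel (chart_image c)) = {z \<in> chart_image c. chart_inv c z \<in> U}"
    by (auto simp: space_restrict_space)
  then show "chart_inv c -` U \<inter> space (restrict_space lborel (chart_image c)) \<in> sets (restrict_space lborel (chart_image c))"
    using o cf(1) by (auto simp: sets_restrict_space_iff)
qed

lemma smooth_11_form_continuous:
  assumes "smooth_11_form A \<omega>" "c \<in> A"
  shows "continuous_on (chart_image c) (\<lambda>z. \<omega> c (chart_inv c z))"
proof -
  have e: "continuous_on (chart_image c) (\<lambda>z. \<omega> c (chart_inv c z) $ k $ j)" for k j
    using assms unfolding smooth_11_form_def smooth_on_def by (meson Ck_on_0_D)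
  have "continuous_on (chart_image c) (\<lambda>z. \<chi> k. \<chi> j. \<omega> c (chart_inv c z) $ k $ j)"
    by (intro continuous_intros e)
  then show ?thesis by (rule continuous_on_eq) (simp add: vec_eq_iff)
qed

lemma volume_density_continuous_pos:
  assumes \<omega>: "hermitian_metric A \<omega>" and c: "c \<in> A" "is_chart X c"
  shows "continuous_on (chart_image c) (volume_density \<omega> c)" "z \<in> chart_image c \<Longrightarrow> 0 < volume_density \<omega> c z"
proof -
  have cont: "continuous_on (chart_image c) (\<lambda>z. \<omega> c (chart_inv c z))"
    using \<omega> unfolding hermitian_metric_def by (intro smooth_11_form_continuous[OF _ c(1)]) blast
  show "continuous_on (chart_image c) (volume_density \<omega> c)"
    unfolding volume_density_def[abs_def] by (intro continuous_intros cont)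
  show "0 < volume_density \<omega> c z" if "z \<in> chart_image c"
    unfolding volume_density_def using \<omega> c is_chart_facts(2)[OF c(2) that]
    by (intro wedge_on_frame_pos) (auto simp: hermitian_metric_def)
qed

lemma smooth_function_continuous:
  assumes "smooth_function A F" "c \<in> A"
  shows "continuous_on (chart_image c) (F \<circ> chart_inv c)"
  using assms unfolding smooth_function_def smooth_on_def by (meson Ck_on_0_D)

text \<open>Split at \<open>F = \<tau>\<close>: the exponential is bounded on one part, and the weight \<open>\<bar>F\<bar>\<^sup>p \<ge> \<tau>\<^sup>p\<close> gains on the
  other.\<close>

theorem entropy_chart_bound:
  fixes A :: "('a, 'n::finite) chart set" and F :: "'a \<Rightarrow> real"
  assumes man: "complex_manifold X A" and \<omega>: "hermitian_metric A \<omega>" and c: "c \<in> A"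
    and \<rho>: "\<rho> > 0" "\<And>z. z \<in> K \<Longrightarrow> \<rho> \<le> volume_density \<omega> c z" and K: "K \<subseteq> chart_image c"
    and p: "p > 0" and F: "smooth_function A F" and ent: "entropy_norm X A \<omega> p F \<le> ennreal E" and E: "E \<ge> 0"
    and P: "P \<in> sets borel" "P \<subseteq> K" and \<tau>: "\<tau> > 0"
  shows "(\<integral>\<^sup>+z. ennreal (exp (2 * real CARD('n) * F (chart_inv c z))) * indicator P z \<partial>lborel)
    \<le> ennreal (exp (2 * real CARD('n) * \<tau>)) * emeasure lborel P + ennreal (E / (\<rho> * \<tau> powr p))"
proof -
  let ?S = "chart_image c"
  let ?N = "2 * real CARD('n)"
  have ch: "is_chart X c" using man c by (auto simp: complex_manifold_def)
  have S: "open ?S" using is_chart_facts(1)[OF ch] .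
  define G where "G x = ennreal ((1 + \<bar>F x\<bar> powr p) * exp (?N * F x))" for x
  define u where "u = F \<circ> chart_inv c"
  have cu: "continuous_on ?S u" unfolding u_def by (rule smooth_function_continuous[OF F c])
  have cF: "continuous_map X euclideanreal F"
    by (rule continuous_map_of_charts[OF man smooth_function_continuous[OF F]])
  have Fm: "F \<in> borel_measurable (sigma (topspace X) {U. openin X U})"
  proof (rule borel_measurableI)
    fix U :: "real set" assume U: "open U"
    have "openin X {x \<in> topspace X. F x \<in> U}"
      by (rule openin_continuous_map_preimage[OF cF]) (use U in simp)
    also have "{x \<in> topspace X. F x \<in> U} = F -` U \<inter> topspace X" by auto
    finally have "F -` U \<inter> topspace X \<in> {U. openin X U}" by simp
    then show "F -` U \<inter> space (sigma (topspace X) {U. openin X U}) \<in> sets (sigma (topspace X) {U. openin X U})"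
      using openin_subset by (subst sets_measure_of) (auto simp: space_measure_of_conv intro: sigma_sets.Basic)
  qed
  have Gm: "G \<in> borel_measurable (sigma (topspace X) {U. openin X U})"
    unfolding G_def[abs_def] using Fm by measurable
  have \<rho>c: "continuous_on ?S (volume_density \<omega> c)" by (rule volume_density_continuous_pos(1)[OF \<omega> c ch])
  have \<rho>m: "volume_density \<omega> c \<in> borel_measurable (restrict_space lborel ?S)"
    using borel_measurable_continuous_on_restrict[OF \<rho>c] by (simp cong: measurable_cong_sets add: sets_restrict_space)
  have cm: "chart_inv c \<in> measurable (density (restrict_space lborel ?S) (\<lambda>z. ennreal (volume_density \<omega> c z))) (sigma (topspace X) {U. openin X U})"
    using measurable_chart_inv[OF ch] by simp
  have "(\<integral>\<^sup>+z. (ennreal (volume_density \<omega> c z) * G (chart_inv c z)) * indicator ?S z \<partial>lborel)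
     = (\<integral>\<^sup>+z. ennreal (volume_density \<omega> c z) * G (chart_inv c z) \<partial>restrict_space lborel ?S)"
    using S by (subst nn_integral_restrict_space) auto
  also have "\<dots> = (\<integral>\<^sup>+z. G (chart_inv c z) \<partial>density (restrict_space lborel ?S) (\<lambda>z. ennreal (volume_density \<omega> c z)))"
    using measurable_compose[OF measurable_chart_inv[OF ch] Gm] \<rho>m by (subst nn_integral_density) auto
  also have "\<dots> = nn_integral (chart_volume X \<omega> c) G"
    unfolding chart_volume_def using Gm by (subst nn_integral_distr[OF cm]) simp_all
  also have "\<dots> \<le> nn_integral (volume_measure X A \<omega>) G"
    by (rule nn_integral_chart_volume_le[OF c])
  also have "\<dots> \<le> ennreal E"
    using ent by (simp add: entropy_norm_def G_def[abs_def])
  finally have vol: "(\<integral>\<^sup>+z. (ennreal (volume_density \<omega> c z) * G (chart_inv c z)) * indicator ?S z \<partial>lborel) \<le> ennreal E" .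
  have t: "\<tau> powr p > 0" using \<tau> by simp
  have point: "ennreal (exp (?N * F (chart_inv c z))) * indicator P z \<le>
     ennreal (exp (?N * \<tau>)) * indicator P z + ennreal (1 / (\<rho> * \<tau> powr p)) * ((ennreal (volume_density \<omega> c z) * G (chart_inv c z)) * indicator ?S z)" for z
  proof (cases "z \<in> P")
    case True
    then have zK: "z \<in> K" "z \<in> ?S" using P K by auto
    define y where "y = F (chart_inv c z)"
    have "exp (?N * y) \<le> exp (?N * \<tau>) + 1 / (\<rho> * \<tau> powr p) * (volume_density \<omega> c z * ((1 + \<bar>y\<bar> powr p) * exp (?N * y)))"
    proof (cases "y \<le> \<tau>")
      case True
      have "0 \<le> volume_density \<omega> c z" using \<rho>(1) \<rho>(2)[OF zK(1)] by linarith
      then have "0 \<le> 1 / (\<rho> * \<tau> powr p) * (volume_density \<omega> c z * ((1 + \<bar>y\<bar> powr p) * exp (?N * y)))"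
        using \<rho>(1) t by (intro mult_nonneg_nonneg divide_nonneg_nonneg add_nonneg_nonneg) auto
      moreover have "exp (?N * y) \<le> exp (?N * \<tau>)" using True by (simp add: mult_left_mono)
      ultimately show ?thesis by linarith
    next
      case False
      then have "\<tau> powr p \<le> \<bar>y\<bar> powr p" using \<tau> p by (intro powr_mono2) auto
      then have "\<rho> * \<tau> powr p \<le> volume_density \<omega> c z * (1 + \<bar>y\<bar> powr p)"
        using \<rho>(1) \<rho>(2)[OF zK(1)] t by (intro mult_mono) auto
      then have "\<rho> * \<tau> powr p * exp (?N * y) \<le> volume_density \<omega> c z * (1 + \<bar>y\<bar> powr p) * exp (?N * y)"
        by (intro mult_right_mono) auto
      then have "exp (?N * y) \<le> 1 / (\<rho> * \<tau> powr p) * (volume_density \<omega> c z * ((1 + \<bar>y\<bar> powr p) * exp (?N * y)))"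
        using \<rho>(1) t by (simp add: field_simps)
      then show ?thesis by (rule order_trans) simp
    qed
    then have "ennreal (exp (?N * y)) \<le> ennreal (exp (?N * \<tau>) + 1 / (\<rho> * \<tau> powr p) * (volume_density \<omega> c z * ((1 + \<bar>y\<bar> powr p) * exp (?N * y))))"
      by (rule ennreal_leI)
    also have "\<dots> = ennreal (exp (?N * \<tau>)) + ennreal (1 / (\<rho> * \<tau> powr p)) * (ennreal (volume_density \<omega> c z) * ennreal ((1 + \<bar>y\<bar> powr p) * exp (?N * y)))"
    proof -
      have v: "0 \<le> volume_density \<omega> c z" using \<rho>(1) \<rho>(2)[OF zK(1)] by linarith
      have a: "0 \<le> (1 + \<bar>y\<bar> powr p) * exp (?N * y)" by (intro mult_nonneg_nonneg add_nonneg_nonneg) auto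
      have b: "0 \<le> 1 / (\<rho> * \<tau> powr p)" using \<rho>(1) t by simp
      show ?thesis
        using v a b by (subst ennreal_plus) (auto simp only: ennreal_mult mult_nonneg_nonneg exp_ge_zero)
    qed
    finally show ?thesis using True zK by (simp add: y_def G_def)
  qed simp
  have m2: "(\<lambda>z. (ennreal (volume_density \<omega> c z) * G (chart_inv c z)) * indicator ?S z) \<in> borel_measurable lborel"
  proof -
    have "continuous_on ?S (\<lambda>z. volume_density \<omega> c z * ((1 + \<bar>u z\<bar> powr p) * exp (?N * u z)))"
      using p by (intro continuous_intros \<rho>c cu continuous_on_powr') auto
    then have "(\<lambda>z. ennreal (indicator ?S z *\<^sub>R (volume_density \<omega> c z * ((1 + \<bar>u z\<bar> powr p) * exp (?N * u z))))) \<in> borel_measurable borel"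
      using S by (intro measurable_compose[OF borel_measurable_continuous_on_indicator measurable_ennreal]) auto
    also have "(\<lambda>z. ennreal (indicator ?S z *\<^sub>R (volume_density \<omega> c z * ((1 + \<bar>u z\<bar> powr p) * exp (?N * u z))))) =
       (\<lambda>z. (ennreal (volume_density \<omega> c z) * G (chart_inv c z)) * indicator ?S z)"
    proof
      fix z
      have "0 \<le> (1 + \<bar>u z\<bar> powr p) * exp (?N * u z)" by (intro mult_nonneg_nonneg add_nonneg_nonneg) auto
      then show "ennreal (indicator ?S z *\<^sub>R (volume_density \<omega> c z * ((1 + \<bar>u z\<bar> powr p) * exp (?N * u z)))) =
         (ennreal (volume_density \<omega> c z) * G (chart_inv c z)) * indicator ?S z"
        by (simp add: indicator_def G_def u_def ennreal_mult'')
    qed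
    finally show ?thesis by simp
  qed
  have "(\<integral>\<^sup>+z. ennreal (exp (?N * F (chart_inv c z))) * indicator P z \<partial>lborel) \<le>
    (\<integral>\<^sup>+z. ennreal (exp (?N * \<tau>)) * indicator P z + ennreal (1 / (\<rho> * \<tau> powr p)) * ((ennreal (volume_density \<omega> c z) * G (chart_inv c z)) * indicator ?S z) \<partial>lborel)"
    by (intro nn_integral_mono point)
  also have "\<dots> = ennreal (exp (?N * \<tau>)) * emeasure lborel P + ennreal (1 / (\<rho> * \<tau> powr p)) * (\<integral>\<^sup>+z. (ennreal (volume_density \<omega> c z) * G (chart_inv c z)) * indicator ?S z \<partial>lborel)"
    using P(1) m2 by (subst nn_integral_add) (auto simp: nn_integral_cmult_indicator nn_integral_cmult)
  also have "\<dots> \<le> ennreal (exp (?N * \<tau>)) * emeasure lborel P + ennreal (1 / (\<rho> * \<tau> powr p)) * ennreal E"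
    using vol by (intro add_left_mono mult_left_mono) auto
  also have "ennreal (1 / (\<rho> * \<tau> powr p)) * ennreal E = ennreal (E / (\<rho> * \<tau> powr p))"
    using \<rho>(1) t E by (simp add: ennreal_mult''[symmetric])
  finally show ?thesis .
qed

section \<open>The a priori estimate\<close>

text \<open>Joint compactness of \<open>K\<close> and the unit sphere makes the constant uniform in
  the point.\<close>

lemma sesq_lower_bound_compact:
  fixes g :: "'b::metric_space \<Rightarrow> complex^'n^'n"
  assumes K: "compact K" and g: "continuous_on K g" and pos: "\<And>z. z \<in> K \<Longrightarrow> positive_hermitian (g z)"
  shows "\<exists>\<kappa>>0. \<forall>z\<in>K. \<forall>v. \<kappa> * (norm v)\<^sup>2 \<le> Re (sesq (g z) v v)"
proof (cases "K = {}")
  case False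
  let ?Q = "K \<times> sphere (0::complex^'n) 1"
  have "norm (axis undefined 1 :: complex^'n) = 1"
    by (rule power2_eq_imp_eq) (simp_all add: norm_vec_power2 axis_def if_distrib[of "\<lambda>x. x\<^sup>2"] if_distrib[of norm] cong: if_cong)
  then have ne: "?Q \<noteq> {}" using False by force
  have cQ: "compact ?Q" using K by (intro compact_Times) auto
  have "continuous_on ?Q (\<lambda>q. Re (sesq (g (fst q)) (snd q) (snd q)))"
    by (intro continuous_intros continuous_on_compose2[OF g]) auto
  then obtain q where q: "q \<in> ?Q" "\<And>q'. q' \<in> ?Q \<Longrightarrow> Re (sesq (g (fst q)) (snd q) (snd q)) \<le> Re (sesq (g (fst q')) (snd q') (snd q'))"
    using continuous_attains_inf[OF cQ ne] by blast
  define \<kappa> where "\<kappa> = Re (sesq (g (fst q)) (snd q) (snd q))"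
  have "fst q \<in> K" "snd q \<noteq> 0" using q(1) by auto
  then have "\<kappa> > 0" using pos unfolding \<kappa>_def positive_hermitian_iff by blast
  moreover have "\<kappa> * (norm v)\<^sup>2 \<le> Re (sesq (g z) v v)" if z: "z \<in> K" for z v
  proof (cases "v = 0")
    case False
    have "\<kappa> \<le> Re (sesq (g z) ((1 / norm v) *\<^sub>R v) ((1 / norm v) *\<^sub>R v))"
      using q(2)[of "(z, (1 / norm v) *\<^sub>R v)"] z False by (simp add: \<kappa>_def)
    also have "\<dots> = Re (sesq (g z) v v) / (norm v)\<^sup>2"
      by (simp add: sesq_scaleR power2_eq_square)
    finally show ?thesis using False by (simp add: field_simps)
  qed simp
  ultimately show ?thesis by blast
qed (auto intro: exI[of _ 1])

lemma entries_bound_compact: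
  fixes g :: "'b::metric_space \<Rightarrow> complex^'n^'n"
  assumes K: "compact K" and g: "continuous_on K g"
  shows "\<exists>M>0. \<forall>z\<in>K. \<forall>k j. norm (g z $ k $ j) \<le> M"
proof -
  have "bounded (g ` K)" by (intro compact_imp_bounded compact_continuous_image K g)
  then obtain M where M: "\<And>z. z \<in> K \<Longrightarrow> norm (g z) \<le> M" unfolding bounded_iff by blast
  have "norm (g z $ k $ j) \<le> max 1 M" if "z \<in> K" for z k j
  proof -
    have "norm (g z $ k $ j) \<le> norm (g z $ k)" by (rule Finite_Cartesian_Product.norm_nth_le)
    also have "\<dots> \<le> norm (g z)" by (rule Finite_Cartesian_Product.norm_nth_le)
    finally show ?thesis using M[OF that] by simp
  qed
  then show ?thesis by (intro exI[of _ "max 1 M"]) auto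
qed

lemma hermitian_matrix_inv:
  assumes "positive_hermitian g"
  shows "hermitian (matrix_inv g)"
proof -
  obtain p where p: "orthonormal_frame g p" using ex_orthonormal_frame[OF assms] by blast
  show ?thesis
    unfolding matrix_inv_orthonormal_frame[OF p] hermitian_def matrix_matrix_mult_def
    by (simp add: cadj_def mult.commute)
qed

lemma Ck_on_2_uminus:
  fixes u :: "'a::euclidean_space \<Rightarrow> real"
  assumes C2: "Ck_on (Suc (Suc 0)) S u" and S: "open S"
  shows "Ck_on (Suc (Suc 0)) S (\<lambda>x. - u x)"
    and "x \<in> S \<Longrightarrow> dd (\<lambda>x. - u x) h x = - dd u h x"
    and "x \<in> S \<Longrightarrow> dd (dd (\<lambda>x. - u x) h) k x = - dd (dd u h) k x"
proof -
  show "Ck_on (Suc (Suc 0)) S (\<lambda>x. - u x)"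
    by (rule Ck_on_bounded_linear[OF bounded_linear_minus[OF bounded_linear_ident] S C2])
  have 1: "dd (\<lambda>x. - u x) h x = - dd u h x" if "x \<in> S" for x h
    by (rule dd_eq[OF has_derivative_minus[OF Ck_on_1_D[OF C2 that]]])
  then show "x \<in> S \<Longrightarrow> dd (\<lambda>x. - u x) h x = - dd u h x" .
  have C1: "Ck_on (Suc 0) S (dd u h)"
    using C2 unfolding Ck_on_Suc[of "Suc 0"] by blast
  show "dd (dd (\<lambda>x. - u x) h) k x = - dd (dd u h) k x" if x: "x \<in> S"
  proof (rule dd_eq)
    have "((\<lambda>x. - dd u h x) has_derivative (\<lambda>k. - dd (dd u h) k x)) (at x)"
      by (rule has_derivative_minus[OF Ck_on_1_D[OF C1 x]])
    then show "(dd (\<lambda>x. - u x) h has_derivative (\<lambda>k. - dd (dd u h) k x)) (at x)"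
      by (rule has_derivative_transform_within_open[OF _ S x]) (simp add: 1)
  qed
qed

text \<open>The type \<open>'n bit0\<close> has twice as many elements as \<open>'n\<close>, the
  real dimension of the chart, and it is well-ordered as the index type of the Jacobian inequality
  has to be.\<close>

lemma ex_basis_enumeration: "\<exists>\<iota> :: 'n::finite bit0 \<Rightarrow> complex^'n. bij_betw \<iota> UNIV Basis"
proof -
  have "card (UNIV :: 'n bit0 set) = card (Basis :: (complex^'n) set)"
    by simp
  then show ?thesis
    using finite_same_card_bij[of "UNIV :: 'n bit0 set" "Basis :: (complex^'n) set"] by simp
qed

section \<open>The geometric data and the linear inequality in charts\<close>

locale hermitian_setting =
  fixes X :: "'a topology" and A :: "('a, 'n::finite) chart set"
    and \<omega> \<omega>h :: "('a, 'n) chart \<Rightarrow> 'a \<Rightarrow> complex^'n^'n" and \<theta> :: "('a, 'n) chart \<Rightarrow> 'a \<Rightarrow> complex^'n"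
  assumes card: "CARD('n) \<ge> 2"
    and man: "complex_manifold X A"
    and \<omega>: "hermitian_metric A \<omega>" and \<omega>h: "hermitian_metric A \<omega>h" and \<theta>: "smooth_10_form A \<theta>"
begin

text \<open>Since no \<Gamma>, f or F occurs, a bound that is uniform over this set depends on the
  geometry alone.\<close>

definition subsolutions :: "('a \<Rightarrow> real) set" where
  "subsolutions = {\<phi>. Ck_function 2 A \<phi> \<and> (\<forall>x\<in>topspace X. \<phi> x \<le> 0) \<and>
     (\<forall>c\<in>A. \<forall>x\<in>fst c. 0 \<le> Re (trace (tilde_h \<omega> \<omega>h \<theta> \<phi> c x)))}"

lemma chart: "c \<in> A \<Longrightarrow> is_chart X c"
  by (rule complex_manifold_facts(1)[OF man])

lemma metric_pos:
  assumes "c \<in> A" "z \<in> chart_image c"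
  shows "positive_hermitian (\<omega> c (chart_inv c z))" "positive_hermitian (\<omega>h c (chart_inv c z))"
  using \<omega> \<omega>h assms is_chart_facts(2)[OF chart[OF assms(1)] assms(2)] unfolding hermitian_metric_def by blast+

lemma metric_cont:
  assumes "c \<in> A"
  shows "continuous_on (chart_image c) (\<lambda>z. \<omega> c (chart_inv c z))" "continuous_on (chart_image c) (\<lambda>z. \<omega>h c (chart_inv c z))"
  using \<omega> \<omega>h unfolding hermitian_metric_def by (blast intro: smooth_11_form_continuous[OF _ assms])+

lemma form_cont: "c \<in> A \<Longrightarrow> continuous_on (chart_image c) (\<lambda>z. \<theta> c (chart_inv c z) $ j)"
  using \<theta> unfolding smooth_10_form_def smooth_on_def by (meson Ck_on_0_D)

lemma Ck_function_2_D: "Ck_function 2 A \<phi> \<Longrightarrow> c \<in> A \<Longrightarrow> Ck_on (Suc (Suc 0)) (chart_image c) (\<phi> \<circ> chart_inv c)"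
  by (simp only: Ck_function_def numeral_2_eq_2)

definition inv_metric :: "('a, 'n) chart \<Rightarrow> complex^'n \<Rightarrow> complex^'n^'n" where
  "inv_metric c z = matrix_inv (\<omega> c (chart_inv c z))"

text \<open>The 1/4 comes from expressing the complex Hessian through real second
  derivatives.\<close>

definition second_coeff :: "('a, 'n) chart \<Rightarrow> complex^'n \<Rightarrow> complex^'n \<Rightarrow> complex^'n \<Rightarrow> real" where
  "second_coeff c b b' z = Re (sesq (inv_metric c z) b b') / 4"

text \<open>The vector along which \<phi> is differentiated in the trace of \<chi>[\<phi>].\<close>

definition drift :: "('a, 'n) chart \<Rightarrow> complex^'n \<Rightarrow> complex^'n" where
  "drift c z = (\<chi> j. \<Sum>k\<in>UNIV. inv_metric c z $ j $ k * cnj (\<theta> c (chart_inv c z) $ k))"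

lemma inv_metric_C1: "c \<in> A \<Longrightarrow> Ck_on (Suc 0) (chart_image c) (\<lambda>z. inv_metric c z $ k $ l)"
  unfolding inv_metric_def
proof (rule Ck_on_1_matrix_inv)
  assume c: "c \<in> A"
  show "open (chart_image c)" by (rule is_chart_facts(1)[OF chart[OF c]])
  show "Ck_on (Suc 0) (chart_image c) (\<lambda>z. \<omega> c (chart_inv c z) $ i $ j)" for i j
    using \<omega> c unfolding hermitian_metric_def smooth_11_form_def smooth_on_def by blast
  show "positive_hermitian (\<omega> c (chart_inv c z))" if "z \<in> chart_image c" for z
    by (rule metric_pos(1)[OF c that])
qed

lemma inv_metric_cont: "c \<in> A \<Longrightarrow> continuous_on (chart_image c) (\<lambda>z. inv_metric c z $ k $ l)"
  by (rule Ck_on_Suc_imp_continuous[OF inv_metric_C1])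

lemma second_coeff_C1:
  assumes c: "c \<in> A"
  shows "Ck_on (Suc 0) (chart_image c) (second_coeff c b b')"
proof -
  have S: "open (chart_image c)" by (rule is_chart_facts(1)[OF chart[OF c]])
  have 1: "Ck_on (Suc 0) (chart_image c) (\<lambda>z. sesq (inv_metric c z) b b')"
    unfolding sesq_def by (intro Ck_on_1_sum Ck_on_1_mult Ck_on_1_const inv_metric_C1 c)
  have L: "bounded_linear (\<lambda>y. Re y / 4)"
    by (intro bounded_linear_divide bounded_linear_Re bounded_linear_compose[OF bounded_linear_divide bounded_linear_Re])
  show ?thesis
    unfolding second_coeff_def[abs_def] by (rule Ck_on_bounded_linear[OF L S 1])
qed

text \<open>The (1,1)-part of a nonnegative real form is nonnegative, so the trace comparison with
  the upper bound \<open>D\<close> of the metric applies; the 4 is the ratio of the real to the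
  complex trace.\<close>

lemma second_coeff_elliptic:
  assumes c: "c \<in> A" and z: "z \<in> chart_image c" and D: "D > 0" "\<And>v. Re (sesq (\<omega> c (chart_inv c z)) v v) \<le> D * (norm v)\<^sup>2"
  shows "elliptic_at (1 / (4 * D)) (\<lambda>b b'. second_coeff c b b' z)"
  unfolding elliptic_at_def
proof (intro allI impI)
  fix B :: "complex^'n \<Rightarrow> complex^'n \<Rightarrow> real"
  assume B: "bilinear B" "\<forall>h k. B h k = B k h" "\<forall>h. 0 \<le> B h h"
  have "Re (trace (cform B)) / D \<le> Re (trace (inv_metric c z ** cform B))"
    unfolding inv_metric_def
  proof (rule trace_matrix_inv_ge[OF metric_pos(1)[OF c z] D])
    show "0 \<le> Re (sesq (cform B) v v)" for v
    proof -
      have "sesq (cform B) v v = of_real ((B v v + B (imul v) (imul v)) / 4)"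
        using B(2) by (intro sesq_cform_diag B(1)) blast
      then show ?thesis using B(3) by (simp only: Re_complex_of_real) simp
    qed
  qed
  also have "\<dots> = (\<Sum>b\<in>Basis. \<Sum>b'\<in>Basis. second_coeff c b b' z * B b b')"
    using trace_mult_cform[of B "inv_metric c z"] B(2) by (simp add: second_coeff_def)
  finally show "1 / (4 * D) * (\<Sum>b\<in>Basis. B b b) \<le> (\<Sum>b\<in>Basis. \<Sum>b'\<in>Basis. second_coeff c b b' z * B b b')"
    by (simp add: trace_cform)
qed

text \<open>For w = -\<phi> the trace of the endomorphism enters with a minus sign, so its
  nonnegativity bounds L w from above by the trace of \<omega>_h, which is locally bounded.\<close>

lemma lin_op_eq:
  assumes \<phi>: "Ck_function 2 A \<phi>" and c: "c \<in> A" and z: "z \<in> chart_image c"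
  shows "lin_op (second_coeff c) (\<lambda>b z. drift c z \<bullet> b) (\<lambda>z. - \<phi> (chart_inv c z)) z =
    Re (trace (inv_metric c z ** \<omega>h c (chart_inv c z))) - Re (trace (tilde_h \<omega> \<omega>h \<theta> \<phi> c (chart_inv c z)))"
proof -
  let ?S = "chart_image c" and ?x = "chart_inv c z"
  define u where "u = \<phi> \<circ> chart_inv c"
  have S: "open ?S" by (rule is_chart_facts(1)[OF chart[OF c]])
  have x: "snd c ?x = z" by (rule is_chart_facts(3)[OF chart[OF c] z])
  have C2: "Ck_on (Suc (Suc 0)) ?S u" unfolding u_def by (rule Ck_function_2_D[OF \<phi> c])
  define B where "B h k = dd (dd u h) k z" for h k
  have sym: "B h k = B k h" for h k unfolding B_def by (rule mixed_derivatives_commute[OF C2 S z])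
  have du: "(u has_derivative (\<lambda>h. dd u h z)) (at z)" by (rule Ck_on_1_D[OF C2 z])
  have lin: "linear (\<lambda>h. dd u h z)" by (rule dd_linear[OF C2 z])
  note g = metric_pos(1)[OF c z]
  have "trace (tilde_h \<omega> \<omega>h \<theta> \<phi> c ?x) = trace (inv_metric c z ** \<omega>h c ?x) + trace (inv_metric c z ** ddbar c \<phi> ?x) + trace (inv_metric c z ** chi_form \<theta> c \<phi> ?x)"
    unfolding tilde_h_eq[of \<omega>, OF g] inv_metric_def by (rule trace_endo_form[OF card g])
  moreover have "ddbar c \<phi> ?x = cform B"
    unfolding B_def u_def by (rule ddbar_in_chart[OF C2[unfolded u_def] S z x])
  moreover have "Re (trace (inv_metric c z ** cform B)) = (\<Sum>b\<in>Basis. \<Sum>b'\<in>Basis. second_coeff c b b' z * B b' b)"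
    unfolding trace_mult_cform[OF sym] second_coeff_def by (intro sum.cong refl) (subst sym, rule refl)
  moreover have "Re (trace (inv_metric c z ** chi_form \<theta> c \<phi> ?x)) = dd u (drift c z) z"
    unfolding drift_def u_def
    by (rule chi_form_facts(3)[OF du[unfolded u_def] x]) (simp add: inv_metric_def hermitian_matrix_inv[OF g])
  moreover have "dd u (drift c z) z = (\<Sum>b\<in>Basis. (drift c z \<bullet> b) * dd u b z)"
  proof -
    have "dd u (drift c z) z = dd u (\<Sum>b\<in>Basis. (drift c z \<bullet> b) *\<^sub>R b) z" by (simp add: euclidean_representation)
    then show ?thesis by (simp add: linear_sum[OF lin] linear_scale[OF lin])
  qed
  ultimately have tr: "Re (trace (tilde_h \<omega> \<omega>h \<theta> \<phi> c ?x)) = Re (trace (inv_metric c z ** \<omega>h c ?x)) +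
     (\<Sum>b\<in>Basis. \<Sum>b'\<in>Basis. second_coeff c b b' z * B b' b) + (\<Sum>b\<in>Basis. (drift c z \<bullet> b) * dd u b z)"
    by simp
  have "lin_op (second_coeff c) (\<lambda>b z. drift c z \<bullet> b) (\<lambda>z. - u z) z =
     - (\<Sum>b\<in>Basis. \<Sum>b'\<in>Basis. second_coeff c b b' z * B b' b) - (\<Sum>b\<in>Basis. (drift c z \<bullet> b) * dd u b z)"
    unfolding lin_op_def by (simp add: Ck_on_2_uminus[OF C2 S] z B_def sum_negf)
  then show ?thesis using tr by (simp add: u_def)
qed

text \<open>The weak Harnack estimate for w = -\<phi>. Its constants are bounds for the metrics and
  \<theta> on the tripled ball, so one \<open>T\<close> serves for every member of
  \<open>subsolutions\<close>.\<close>

theorem local_decay: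
  assumes c: "c \<in> A" and R: "R > 0" "cball z0 (3 * R) \<subseteq> chart_image c" and \<delta>: "\<delta> > 0" and M0: "M0 \<ge> 0"
  shows "\<exists>T. \<forall>\<phi>\<in>subsolutions. (\<exists>z\<in>ball z0 R. - \<phi> (chart_inv c z) \<le> M0) \<longrightarrow>
    emeasure lborel {z \<in> ball z0 (2 * R). T < - \<phi> (chart_inv c z)} \<le> ennreal \<delta>"
proof -
  let ?S = "chart_image c" and ?K = "cball z0 (3 * R)"
  have S: "open ?S" by (rule is_chart_facts(1)[OF chart[OF c]])
  obtain \<iota> :: "'n bit0 \<Rightarrow> complex^'n" where \<iota>: "bij_betw \<iota> UNIV Basis" using ex_basis_enumeration by blast
  obtain M where M: "M > 0" "\<And>z k j. z \<in> ?K \<Longrightarrow> norm (\<omega> c (chart_inv c z) $ k $ j) \<le> M"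
    using entries_bound_compact[OF compact_cball continuous_on_subset[OF metric_cont(1)[OF c] R(2)]] by blast
  define D where "D = (real CARD('n))\<^sup>2 * M"
  have D: "D > 0" using M(1) by (simp add: D_def)
  have gD: "Re (sesq (\<omega> c (chart_inv c z)) v v) \<le> D * (norm v)\<^sup>2" if "z \<in> ?K" for z v
    using complex_Re_le_cmod[of "sesq (\<omega> c (chart_inv c z)) v v"] norm_sesq_le[OF M(2)[OF that], of v v]
    by (simp add: D_def power2_eq_square)
  have "continuous_on ?S (drift c)"
    unfolding drift_def[abs_def] by (intro continuous_intros inv_metric_cont form_cont c)
  then have "bounded (drift c ` ?K)"
    using R by (intro compact_imp_bounded compact_continuous_image compact_cball) (rule continuous_on_subset)
  then obtain M1 where M1: "\<And>z. z \<in> ?K \<Longrightarrow> norm (drift c z) \<le> M1" unfolding bounded_iff by blast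
  have "continuous_on ?S (\<lambda>z. Re (trace (inv_metric c z ** \<omega>h c (chart_inv c z))))"
    unfolding trace_def matrix_matrix_mult_def by (simp, intro continuous_intros inv_metric_cont metric_cont(2) c)
  then have "bounded ((\<lambda>z. Re (trace (inv_metric c z ** \<omega>h c (chart_inv c z)))) ` ?K)"
    using R by (intro compact_imp_bounded compact_continuous_image compact_cball) (rule continuous_on_subset)
  then obtain C0 where C0: "\<And>z. z \<in> ?K \<Longrightarrow> \<bar>Re (trace (inv_metric c z ** \<omega>h c (chart_inv c z)))\<bar> \<le> C0"
    unfolding bounded_iff ball_simps real_norm_def by blast
  have "\<exists>T. \<forall>w. Ck_on (Suc (Suc 0)) ?S w \<longrightarrow> (\<forall>x\<in>?K. 0 \<le> w x) \<longrightarrow>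
     (\<forall>x\<in>?K. lin_op (second_coeff c) (\<lambda>b z. drift c z \<bullet> b) w x \<le> C0) \<longrightarrow> (\<exists>x\<in>ball z0 R. w x \<le> M0) \<longrightarrow>
     emeasure lborel {x \<in> ball z0 (2 * R). T < w x} \<le> ennreal \<delta>"
  proof (rule superlevel_set_bound[OF \<iota> S R(2,1)])
    show "\<bar>drift c x \<bullet> b\<bar> \<le> M1" if "x \<in> ?K" "b \<in> Basis" for x b
      using Basis_le_norm[OF that(2), of "drift c x"] M1[OF that(1)] by linarith
    show "elliptic_at (1 / (4 * D)) (\<lambda>b b'. second_coeff c b b' x)" if "x \<in> ?K" for x
      using that R by (intro second_coeff_elliptic[OF c _ D gD]) auto
  qed (use D M0 \<delta> second_coeff_C1[OF c] in auto)
  then obtain T where T: "\<And>w. Ck_on (Suc (Suc 0)) ?S w \<Longrightarrow> \<forall>x\<in>?K. 0 \<le> w x \<Longrightarrow>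
     \<forall>x\<in>?K. lin_op (second_coeff c) (\<lambda>b z. drift c z \<bullet> b) w x \<le> C0 \<Longrightarrow> \<exists>x\<in>ball z0 R. w x \<le> M0 \<Longrightarrow>
     emeasure lborel {x \<in> ball z0 (2 * R). T < w x} \<le> ennreal \<delta>" by blast
  show ?thesis
  proof (intro exI[of _ T] ballI impI)
    fix \<phi> assume \<phi>: "\<phi> \<in> subsolutions" and ex: "\<exists>z\<in>ball z0 R. - \<phi> (chart_inv c z) \<le> M0"
    have C2: "Ck_function 2 A \<phi>" using \<phi> by (simp add: subsolutions_def)
    have inX: "chart_inv c z \<in> fst c" "chart_inv c z \<in> topspace X" if "z \<in> ?K" for z
      using that R(2) is_chart_facts(2)[OF chart[OF c]] complex_manifold_facts(3)[OF man c] by blast+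
    show "emeasure lborel {z \<in> ball z0 (2 * R). T < - \<phi> (chart_inv c z)} \<le> ennreal \<delta>"
    proof (rule T)
      show "Ck_on (Suc (Suc 0)) ?S (\<lambda>z. - \<phi> (chart_inv c z))"
        using Ck_on_2_uminus(1)[OF Ck_function_2_D[OF C2 c] S] by (simp only: o_def)
      show "\<forall>x\<in>?K. 0 \<le> - \<phi> (chart_inv c x)" using \<phi> inX by (simp add: subsolutions_def)
      show "\<forall>x\<in>?K. lin_op (second_coeff c) (\<lambda>b z. drift c z \<bullet> b) (\<lambda>z. - \<phi> (chart_inv c z)) x \<le> C0"
      proof
        fix z assume z: "z \<in> ?K"
        have "0 \<le> Re (trace (tilde_h \<omega> \<omega>h \<theta> \<phi> c (chart_inv c z)))"
          using \<phi> inX(1)[OF z] c unfolding subsolutions_def by blast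
        then show "lin_op (second_coeff c) (\<lambda>b z. drift c z \<bullet> b) (\<lambda>z. - \<phi> (chart_inv c z)) z \<le> C0"
          using lin_op_eq[OF C2 c, of z] z R(2) C0[OF z] by auto
      qed
    qed (rule ex)
  qed
qed

text \<open>The trace is the sum of the eigenvalues in whatever order, hence positive since \<Gamma>
  lies in \<Gamma>_1.\<close>

lemma solution_subsolution:
  assumes sc: "structural_conditions \<Gamma> f \<gamma>" and \<phi>: "Ck_function 2 A \<phi>" "\<And>x. x \<in> topspace X \<Longrightarrow> \<phi> x \<le> 0"
    and sol: "solves_equation A \<omega> \<omega>h \<theta> \<Gamma> f F \<phi>"
  shows "\<phi> \<in> subsolutions"
proof -
  have "0 \<le> Re (trace (tilde_h \<omega> \<omega>h \<theta> \<phi> c x))" if c: "c \<in> A" and x: "x \<in> fst c" for c x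
  proof -
    note cf = is_chart_facts[OF chart[OF c]]
    define z where "z = snd c x"
    have z: "z \<in> chart_image c" "chart_inv c z = x" using cf(4,5)[OF x] by (simp_all add: z_def)
    have g: "positive_hermitian (\<omega> c x)" "positive_hermitian (\<omega>h c x)" using metric_pos[OF c z(1)] z(2) by simp_all
    note C2 = Ck_function_2_D[OF \<phi>(1) c]
    have du: "(\<phi> \<circ> chart_inv c has_derivative (\<lambda>h. dd (\<phi> \<circ> chart_inv c) h z)) (at z)" by (rule Ck_on_1_D[OF C2 z(1)])
    define H where "H = endo_form (\<omega> c x) (\<omega>h c x) (ddbar c \<phi> x) (chi_form \<theta> c \<phi> x)"
    have "hermitian (ddbar c \<phi> x)"
      unfolding ddbar_in_chart[OF C2 cf(1) z(1) z_def[symmetric]]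
      by (rule hermitian_cform[OF mixed_derivatives_commute[OF C2 cf(1) z(1)]])
    then have H: "hermitian H"
      unfolding H_def using g chi_form_facts(1)[OF du z_def[symmetric]]
      by (intro hermitian_endo_form) (auto simp: positive_hermitian_iff)
    obtain \<mu> where \<mu>: "eigenvalue_vector (tilde_h \<omega> \<omega>h \<theta> \<phi> c x) \<mu>" "\<mu> \<in> \<Gamma>"
      using sol c x unfolding solves_equation_def by blast
    obtain p where p: "orthonormal_frame (\<omega> c x) p" "\<And>k l. k \<noteq> l \<Longrightarrow> sesq H (p $ k) (p $ l) = 0"
      using diagonalizing_frame[OF g(1) H] by blast
    have "(\<Sum>i\<in>UNIV. \<mu> $ i) = (\<Sum>k\<in>UNIV. Re (sesq H (p $ k) (p $ k)))"
      using \<mu>(1) unfolding tilde_h_eq[of \<omega>, OF g(1)] H_def[symmetric] by (rule eigenvalue_vector_frame(1)[OF _ p H])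
    also have "\<dots> = Re (trace (tilde_h \<omega> \<omega>h \<theta> \<phi> c x))"
      unfolding tilde_h_eq[of \<omega>, OF g(1)] H_def[symmetric] trace_matrix_inv[OF p(1)] by simp
    finally show ?thesis using structural_sum_pos[OF sc \<mu>(2)] by simp
  qed
  then show ?thesis using \<phi> by (simp add: subsolutions_def)
qed

section \<open>Alexandrov's estimate for the equation near the minimum\<close>

theorem local_contact_bound:
  assumes c: "c \<in> A" and R: "R > 0" "cball z0 (2 * R) \<subseteq> chart_image c" and \<gamma>: "\<gamma> > 0"
    and \<iota>: "bij_betw \<iota> (UNIV :: 'n bit0 set) Basis"
  shows "\<exists>\<epsilon>>0. \<exists>C>0. \<forall>\<Gamma> f F \<phi>. structural_conditions \<Gamma> f \<gamma> \<longrightarrow> Ck_function 2 A \<phi> \<longrightarrow> solves_equation A \<omega> \<omega>h \<theta> \<Gamma> f F \<phi> \<longrightarrow>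
    (\<forall>x1\<in>ball z0 R. \<forall>z\<in>contact_set (\<phi> \<circ> chart_inv c) \<epsilon> x1 R (\<epsilon> * R / 2).
      \<bar>det (\<chi> i j. hess_form (\<phi> \<circ> chart_inv c) \<epsilon> z (\<iota> i) (\<iota> j))\<bar> \<le> C * exp (2 * real CARD('n) * F (chart_inv c z)))"
proof -
  let ?S = "chart_image c" and ?K = "cball z0 (2 * R)" and ?n = "CARD('n)"
  note cf = is_chart_facts[OF chart[OF c]]
  have cg: "continuous_on ?K (\<lambda>z. \<omega> c (chart_inv c z))" "continuous_on ?K (\<lambda>z. \<omega>h c (chart_inv c z))"
    using metric_cont[OF c] R(2) continuous_on_subset by blast+
  obtain \<kappa> where \<kappa>: "\<kappa> > 0" "\<And>z v. z \<in> ?K \<Longrightarrow> \<kappa> * (norm v)\<^sup>2 \<le> Re (sesq (\<omega> c (chart_inv c z)) v v)"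
    using sesq_lower_bound_compact[OF compact_cball cg(1)] metric_pos(1)[OF c] R(2) by blast
  obtain \<kappa>h where \<kappa>h: "\<kappa>h > 0" "\<And>z v. z \<in> ?K \<Longrightarrow> \<kappa>h * (norm v)\<^sup>2 \<le> Re (sesq (\<omega>h c (chart_inv c z)) v v)"
    using sesq_lower_bound_compact[OF compact_cball cg(2)] metric_pos(2)[OF c] R(2) by blast
  obtain M where M: "M > 0" "\<And>z k j. z \<in> ?K \<Longrightarrow> norm (\<omega> c (chart_inv c z) $ k $ j) \<le> M"
    using entries_bound_compact[OF compact_cball cg(1)] by blast
  define D where "D = (real ?n)\<^sup>2 * M"
  have D: "D > 0" using M(1) by (simp add: D_def)
  have gD: "Re (sesq (\<omega> c (chart_inv c z)) v v) \<le> D * (norm v)\<^sup>2" if "z \<in> ?K" for z v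
    using complex_Re_le_cmod[of "sesq (\<omega> c (chart_inv c z)) v v"] norm_sesq_le[OF M(2)[OF that], of v v]
    by (simp add: D_def power2_eq_square)
  have "continuous_on ?K (\<lambda>z. \<chi> j. \<theta> c (chart_inv c z) $ j)"
    by (intro continuous_intros continuous_on_subset[OF form_cont[OF c] R(2)])
  then have "bounded ((\<lambda>z. \<chi> j. \<theta> c (chart_inv c z) $ j) ` ?K)"
    by (intro compact_imp_bounded compact_continuous_image compact_cball)
  then obtain \<Theta>0 where "\<And>z. z \<in> ?K \<Longrightarrow> norm (\<chi> j. \<theta> c (chart_inv c z) $ j) \<le> \<Theta>0" unfolding bounded_iff by blast
  then have \<Theta>0: "\<And>z. z \<in> ?K \<Longrightarrow> norm (\<theta> c (chart_inv c z)) \<le> \<Theta>0" by (simp only: vec_nth_inverse)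
  define \<Theta> where "\<Theta> = max 0 \<Theta>0"
  have \<Theta>: "\<Theta> \<ge> 0" "\<And>z j. z \<in> ?K \<Longrightarrow> norm (\<theta> c (chart_inv c z) $ j) \<le> \<Theta>"
    using \<Theta>0 order_trans[OF Finite_Cartesian_Product.norm_nth_le] by (fastforce simp: \<Theta>_def le_max_iff_disj)+
  \<comment> \<open>Chosen so that \<epsilon> D / \<kappa> + n^2 m + \<epsilon> equals \<kappa>h,
    where m = 6 \<epsilon> R \<Theta> bounds \<chi>[\<phi>] on the contact set. The last \<epsilon>
    is slack and keeps \<open>q\<close> positive.\<close>
  define q where "q = D / \<kappa> + (real ?n)\<^sup>2 * (6 * R * \<Theta>) + 1"
  have q: "q > 0" using D \<kappa>(1) R(1) \<Theta>(1) by (auto simp: q_def intro!: add_nonneg_pos add_nonneg_nonneg)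
  define \<epsilon> where "\<epsilon> = \<kappa>h / q"
  have \<epsilon>: "\<epsilon> > 0" using q \<kappa>h(1) by (simp add: \<epsilon>_def)
  define m where "m = 2 * (3 * \<epsilon> * R) * \<Theta>"
  have small: "\<epsilon> / \<kappa> \<le> (\<kappa>h - (real ?n)\<^sup>2 * m) / D"
  proof -
    have "\<epsilon> * q = \<kappa>h" using q by (simp add: \<epsilon>_def)
    then have "\<epsilon> * (D / \<kappa>) + (real ?n)\<^sup>2 * m + \<epsilon> = \<kappa>h"
      by (simp add: q_def m_def algebra_simps)
    then have "\<epsilon> * (D / \<kappa>) \<le> \<kappa>h - (real ?n)\<^sup>2 * m" using \<epsilon> by linarith
    then show ?thesis using D by (simp add: field_simps)
  qed
  define N where "N = CARD('n bit0)"
  define C where "C = (fact N * ((real ?n)\<^sup>2 * M * sqrt (1 / \<kappa>)) ^ N)\<^sup>2 * (fact N * (16 ^ ?n * ((real (?n - 1)) ^ ?n / \<gamma>)\<^sup>2))"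
  have C: "C > 0"
  proof -
    have "0 < (real ?n)\<^sup>2 * M * sqrt (1 / \<kappa>)" using M(1) \<kappa>(1) by simp
    moreover have "0 < (real (?n - 1)) ^ ?n / \<gamma>" using card \<gamma> by simp
    ultimately show ?thesis unfolding C_def by (intro mult_pos_pos[of "_\<^sup>2"] mult_pos_pos[of "fact _"] mult_pos_pos[of "16 ^ _"] zero_less_power fact_gt_zero) (simp_all only: zero_less_numeral)
  qed
  show ?thesis
  proof (rule exI[of _ \<epsilon>], rule conjI[OF \<epsilon>], rule exI[of _ C], rule conjI[OF C], intro allI impI ballI)
    fix \<Gamma> :: "(real^'n) set" and f F \<phi> x1 z
    assume sc: "structural_conditions \<Gamma> f \<gamma>" and \<phi>: "Ck_function 2 A \<phi>" and sol: "solves_equation A \<omega> \<omega>h \<theta> \<Gamma> f F \<phi>"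
      and x1: "x1 \<in> ball z0 R" and z: "z \<in> contact_set (\<phi> \<circ> chart_inv c) \<epsilon> x1 R (\<epsilon> * R / 2)"
    let ?x = "chart_inv c z"
    define u where "u = \<phi> \<circ> chart_inv c"
    have zb: "z \<in> ball x1 R" using z by (simp add: contact_set_def)
    then have zK: "z \<in> ?K" using x1 dist_triangle[of z0 z x1] by simp
    then have zS: "z \<in> ?S" using R(2) by blast
    have xz: "snd c ?x = z" by (rule cf(3)[OF zS])
    note C2 = Ck_function_2_D[OF \<phi> c, folded u_def]
    have du: "(u has_derivative (\<lambda>h. dd u h z)) (at z)" by (rule Ck_on_1_D[OF C2 zS])
    note g = metric_pos[OF c zS]
    define B0 where "B0 h k = dd (dd u h) k z" for h k
    have B0: "bilinear B0" "\<And>h k. B0 h k = B0 k h"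
      using dd_dd_linear_left[OF C2 cf(1) zS] dd_dd_linear_right[OF C2 zS] mixed_derivatives_commute[OF C2 cf(1) zS]
      by (auto simp: bilinear_def B0_def)
    have pos: "0 \<le> B0 h h + 2 * \<epsilon> * (h \<bullet> h)" for h
      using z by (simp add: contact_set_def B0_def u_def power2_norm_eq_inner)
    \<comment> \<open>The slope is at most \<epsilon> R / 2 and the paraboloid has gradient at most
      2 \<epsilon> R; the sum is rounded up to 3 \<epsilon> R.\<close>
    have dub: "\<bar>dd u h z\<bar> \<le> (3 * \<epsilon> * R) * norm h" for h
    proof -
      have "\<bar>dd u h z + 2 * \<epsilon> * ((z - x1) \<bullet> h)\<bar> \<le> \<epsilon> * R / 2 * norm h"
        using z unfolding contact_set_def u_def by blast
      moreover have "\<bar>2 * \<epsilon> * ((z - x1) \<bullet> h)\<bar> \<le> 2 * \<epsilon> * (R * norm h)"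
      proof -
        have "\<bar>(z - x1) \<bullet> h\<bar> \<le> norm (z - x1) * norm h" by (rule Cauchy_Schwarz_ineq2)
        also have "\<dots> \<le> R * norm h" using zb by (intro mult_right_mono) (auto simp: dist_norm norm_minus_commute)
        finally show ?thesis using \<epsilon> by (simp add: abs_mult)
      qed
      moreover have "0 \<le> \<epsilon> * R * norm h" using \<epsilon> R(1) by simp
      ultimately have "\<bar>dd u h z\<bar> \<le> \<epsilon> * R / 2 * norm h + 2 * \<epsilon> * (R * norm h)" by linarith
      also have "\<dots> \<le> (3 * \<epsilon> * R) * norm h"
        using \<open>0 \<le> \<epsilon> * R * norm h\<close> by (simp add: algebra_simps)
      finally show ?thesis .
    qed
    have Xm: "norm (chi_form \<theta> c \<phi> ?x $ k $ j) \<le> m" for k j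
      unfolding m_def
    proof (rule chi_form_facts(2)[OF du[unfolded u_def] xz])
      show "\<bar>dd (\<phi> \<circ> chart_inv c) h z\<bar> \<le> (3 * \<epsilon> * R) * norm h" for h using dub[of h] by (simp only: u_def)
      show "norm (\<theta> c ?x $ j) \<le> \<Theta>" for j by (rule \<Theta>(2)[OF zK])
    qed
    have Xh: "hermitian (chi_form \<theta> c \<phi> ?x)"
      by (rule chi_form_facts(1)[OF du[unfolded u_def] xz])
    have "?x \<in> fst c" by (rule cf(2)[OF zS])
    then obtain \<mu> where \<mu>: "eigenvalue_vector (tilde_h \<omega> \<omega>h \<theta> \<phi> c ?x) \<mu>" "\<mu> \<in> \<Gamma>" "f \<mu> = exp (F ?x)"
      using sol c unfolding solves_equation_def by blast
    have "ddbar c \<phi> ?x = cform B0"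
      unfolding B0_def u_def by (rule ddbar_in_chart[OF C2[unfolded u_def] cf(1) zS xz])
    then have ev: "eigenvalue_vector (matrix_inv (\<omega> c ?x) ** endo_form (\<omega> c ?x) (\<omega>h c ?x) (cform B0) (chi_form \<theta> c \<phi> ?x)) \<mu>"
      using \<mu>(1) by (simp add: tilde_h_eq[of \<omega>, OF g(1)])
    have "\<bar>det (\<chi> i j. B0 (\<iota> i) (\<iota> j) + 2 * \<epsilon> * (\<iota> i \<bullet> \<iota> j))\<bar> \<le>
      (fact N * ((real ?n)\<^sup>2 * M * sqrt (1 / \<kappa>)) ^ N)\<^sup>2 * (fact N * (16 ^ ?n * ((real (?n - 1)) ^ ?n / \<gamma>)\<^sup>2 * (f \<mu> ^ ?n)\<^sup>2))"
      unfolding N_def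
    proof (rule contact_determinant_bound[OF card g(1) \<kappa>(1) \<kappa>(2)[OF zK] D gD[OF zK] M(2)[OF zK] _ \<kappa>h(2)[OF zK] Xh Xm B0 pos _ small sc \<gamma> ev \<mu>(2) \<iota>])
      show "hermitian (\<omega>h c ?x)" using g(2) by (simp add: positive_hermitian_iff)
    qed (use \<epsilon> in auto)
    also have "\<dots> = C * (f \<mu> ^ ?n)\<^sup>2" by (simp add: C_def mult_ac)
    also have "(f \<mu> ^ ?n)\<^sup>2 = exp (2 * real ?n * F ?x)"
      unfolding \<mu>(3) by (simp add: exp_of_nat_mult[symmetric] power_mult[symmetric] mult_ac)
    finally show "\<bar>det (\<chi> i j. hess_form (\<phi> \<circ> chart_inv c) \<epsilon> z (\<iota> i) (\<iota> j))\<bar> \<le> C * exp (2 * real ?n * F ?x)"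
      by (simp add: hess_form_def B0_def u_def)
  qed
qed

text \<open>If -\<phi> exceeded T + \<epsilon> R^2 at the minimum, the contact set would lie in the
  set where -\<phi> > T and have measure at most \<delta>. The entropy bound would then make the
  integral of the Jacobian smaller than the volume of the ball of slopes.\<close>

theorem local_minimum_bound:
  assumes c: "c \<in> A" and R: "R > 0" "cball z0 (2 * R) \<subseteq> chart_image c" and \<gamma>: "\<gamma> > 0" and p: "p > 0" and E: "E > 0"
  shows "\<exists>\<delta>>0. \<exists>C. \<forall>\<Gamma> f F \<phi> x1 T. structural_conditions \<Gamma> f \<gamma> \<longrightarrow> smooth_function A F \<longrightarrow> entropy_norm X A \<omega> p F \<le> ennreal E \<longrightarrow>
    Ck_function 2 A \<phi> \<longrightarrow> solves_equation A \<omega> \<omega>h \<theta> \<Gamma> f F \<phi> \<longrightarrow> x1 \<in> ball z0 R \<longrightarrow>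
    (\<forall>z\<in>ball z0 (2 * R). \<phi> (chart_inv c x1) \<le> \<phi> (chart_inv c z)) \<longrightarrow>
    emeasure lborel {z \<in> ball z0 (2 * R). T < - \<phi> (chart_inv c z)} \<le> ennreal \<delta> \<longrightarrow> - \<phi> (chart_inv c x1) \<le> T + C"
proof -
  let ?S = "chart_image c" and ?K = "cball z0 (2 * R)" and ?n = "CARD('n)"
  note ch = chart[OF c]
  note cf = is_chart_facts[OF ch]
  obtain \<iota> :: "'n bit0 \<Rightarrow> complex^'n" where \<iota>: "bij_betw \<iota> UNIV Basis" using ex_basis_enumeration by blast
  obtain \<epsilon> C where \<epsilon>: "\<epsilon> > 0" and C: "C > 0" and con: "\<And>\<Gamma> f F \<phi> x1 z. structural_conditions \<Gamma> f \<gamma> \<Longrightarrow> Ck_function 2 A \<phi> \<Longrightarrow>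
    solves_equation A \<omega> \<omega>h \<theta> \<Gamma> f F \<phi> \<Longrightarrow> x1 \<in> ball z0 R \<Longrightarrow> z \<in> contact_set (\<phi> \<circ> chart_inv c) \<epsilon> x1 R (\<epsilon> * R / 2) \<Longrightarrow>
      \<bar>det (\<chi> i j. hess_form (\<phi> \<circ> chart_inv c) \<epsilon> z (\<iota> i) (\<iota> j))\<bar> \<le> C * exp (2 * real ?n * F (chart_inv c z))"
    using local_contact_bound[OF c R \<gamma> \<iota>] by metis
  have "continuous_on ?K (volume_density \<omega> c)"
    using volume_density_continuous_pos(1)[OF \<omega> c ch] R(2) continuous_on_subset by blast
  then obtain zm where zm: "zm \<in> ?K" "\<And>z. z \<in> ?K \<Longrightarrow> volume_density \<omega> c zm \<le> volume_density \<omega> c z"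
    using continuous_attains_inf[OF compact_cball, of z0 "2 * R" "volume_density \<omega> c"] R(1) by auto
  define \<rho> where "\<rho> = volume_density \<omega> c zm"
  have \<rho>: "\<rho> > 0" "\<And>z. z \<in> ?K \<Longrightarrow> \<rho> \<le> volume_density \<omega> c z"
    using volume_density_continuous_pos(2)[OF \<omega> c ch] zm R(2) by (auto simp: \<rho>_def)
  \<comment> \<open>Half of the limiting slope: at a minimum the boundary condition needs s R <
    \<epsilon> R^2.\<close>
  define s where "s = \<epsilon> * R / 2"
  have s: "s > 0" using \<epsilon> R(1) by (simp add: s_def)
  define v where "v = measure lborel (ball (0::complex^'n) s)"
  have v: "v > 0" using content_ball_pos[OF s, of "0::complex^'n"] by (simp add: v_def)
  \<comment> \<open>\<open>\<tau>\<close> makes the part with F > \<tau> contribute at most v / 4,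
    and then \<open>\<delta>\<close> does the same for the part with F \<le> \<tau>; the total v / 2
    is less than v.\<close>
  define \<tau> where "\<tau> = (4 * C * E / (\<rho> * v)) powr (1 / p)"
  have \<tau>: "\<tau> > 0" using C E \<rho>(1) v by (simp add: \<tau>_def)
  have \<tau>p: "\<tau> powr p = 4 * C * E / (\<rho> * v)"
    using p C E \<rho>(1) v by (simp add: \<tau>_def powr_powr)
  define \<delta> where "\<delta> = v / (4 * C * exp (2 * real ?n * \<tau>))"
  have \<delta>: "\<delta> > 0" using v C by (simp add: \<delta>_def)
  show ?thesis
  proof (rule exI[of _ \<delta>], rule conjI[OF \<delta>], rule exI[of _ "\<epsilon> * R\<^sup>2"], intro allI impI)
    fix \<Gamma> :: "(real^'n) set" and f F \<phi> x1 T
    assume sc: "structural_conditions \<Gamma> f \<gamma>" and F: "smooth_function A F" and ent: "entropy_norm X A \<omega> p F \<le> ennreal E"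
      and \<phi>: "Ck_function 2 A \<phi>" and sol: "solves_equation A \<omega> \<omega>h \<theta> \<Gamma> f F \<phi>" and x1: "x1 \<in> ball z0 R"
      and min: "\<forall>z\<in>ball z0 (2 * R). \<phi> (chart_inv c x1) \<le> \<phi> (chart_inv c z)"
      and dec: "emeasure lborel {z \<in> ball z0 (2 * R). T < - \<phi> (chart_inv c z)} \<le> ennreal \<delta>"
    show "- \<phi> (chart_inv c x1) \<le> T + \<epsilon> * R\<^sup>2"
    proof (rule ccontr)
      assume "\<not> ?thesis"
      then have big: "T + \<epsilon> * R\<^sup>2 < - \<phi> (chart_inv c x1)" by simp
      define u where "u = \<phi> \<circ> chart_inv c"
      note C2 = Ck_function_2_D[OF \<phi> c, folded u_def]
      have sub: "cball x1 R \<subseteq> ball z0 (2 * R)"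
      proof
        fix x assume "x \<in> cball x1 R"
        then show "x \<in> ball z0 (2 * R)"
          using x1 dist_triangle[of z0 x x1] by (simp add: dist_commute)
      qed
      have sub': "cball x1 R \<subseteq> ?S" "cball x1 R \<subseteq> ?K" using sub R(2) ball_subset_cball by blast+
      let ?P = "contact_set u \<epsilon> x1 R s"
      have PK: "?P \<subseteq> cball x1 R" by (auto simp: contact_set_def)
      have Pm: "?P \<in> sets borel" by (rule contact_set_borel[OF C2 sub'(1)])
      have sR: "s * R < \<epsilon> * R\<^sup>2" using \<epsilon> R(1) by (simp add: s_def power2_eq_square)
      have "emeasure lborel (ball (0::complex^'n) s) \<le> (\<integral>\<^sup>+z. ennreal (C * exp (2 * real ?n * F (chart_inv c z))) * indicator ?P z \<partial>lborel)"
      proof (rule contact_set_measure[OF \<iota> C2 cf(1) R(1) sub'(1)])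
        fix x assume "x \<in> sphere x1 R"
        then have "x \<in> ball z0 (2 * R)" using sub sphere_cball by blast
        then have "u x1 \<le> u x" using min by (simp add: u_def)
        then show "u x1 + s * R < u x + \<epsilon> * R\<^sup>2" using sR by linarith
      next
        fix x assume "x \<in> ?P"
        then show "\<bar>det (\<chi> i j. hess_form u \<epsilon> x (\<iota> i) (\<iota> j))\<bar> \<le> C * exp (2 * real ?n * F (chart_inv c x))"
          using con[OF sc \<phi> sol x1] unfolding u_def s_def by blast
      qed
      also have "\<dots> = ennreal C * (\<integral>\<^sup>+z. ennreal (exp (2 * real ?n * F (chart_inv c z))) * indicator ?P z \<partial>lborel)"
      proof -
        have "continuous_on ?S (\<lambda>z. exp (2 * real ?n * (F \<circ> chart_inv c) z))"
          by (intro continuous_intros smooth_function_continuous[OF F c])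
        then have "continuous_on ?P (\<lambda>z. exp (2 * real ?n * (F \<circ> chart_inv c) z))"
          using PK sub' continuous_on_subset by blast
        then have "(\<lambda>z. ennreal (indicator ?P z *\<^sub>R exp (2 * real ?n * (F \<circ> chart_inv c) z))) \<in> borel_measurable borel"
          using Pm by (intro measurable_compose[OF borel_measurable_continuous_on_indicator measurable_ennreal]) auto
        also have "(\<lambda>z. ennreal (indicator ?P z *\<^sub>R exp (2 * real ?n * (F \<circ> chart_inv c) z))) = (\<lambda>z. ennreal (exp (2 * real ?n * F (chart_inv c z))) * indicator ?P z)"
          by (auto simp: indicator_def)
        finally have m: "(\<lambda>z. ennreal (exp (2 * real ?n * F (chart_inv c z))) * indicator ?P z) \<in> borel_measurable lborel" by simp
        show ?thesis
          using C by (subst nn_integral_cmult[OF m, symmetric]) (simp add: ennreal_mult mult.assoc)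
      qed
      also have "\<dots> \<le> ennreal C * (ennreal (exp (2 * real ?n * \<tau>)) * emeasure lborel ?P + ennreal (E / (\<rho> * \<tau> powr p)))"
        using E PK sub'(2)
        by (intro mult_left_mono entropy_chart_bound[OF man \<omega> c \<rho> R(2) p F ent _ Pm _ \<tau>]) auto
      also have "\<dots> \<le> ennreal C * (ennreal (exp (2 * real ?n * \<tau>)) * ennreal \<delta> + ennreal (E / (\<rho> * \<tau> powr p)))"
      proof (intro mult_left_mono add_right_mono)
        have "?P \<subseteq> {z \<in> ball z0 (2 * R). T < - \<phi> (chart_inv c z)}"
        proof
          fix z assume z: "z \<in> ?P"
          have "u z + \<epsilon> * (norm (z - x1))\<^sup>2 \<le> u x1 + s * R" using z by (simp add: contact_set_def)
          moreover have "0 \<le> \<epsilon> * (norm (z - x1))\<^sup>2" using \<epsilon> by simp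
          ultimately have "u z < - T" using sR big by (simp add: u_def)
          then show "z \<in> {z \<in> ball z0 (2 * R). T < - \<phi> (chart_inv c z)}" using z PK sub by (auto simp: u_def)
        qed
        then have "emeasure lborel ?P \<le> emeasure lborel {z \<in> ball z0 (2 * R). T < - \<phi> (chart_inv c z)}"
        proof (rule emeasure_mono)
          have "ball z0 (2 * R) \<subseteq> ?S" using R(2) ball_subset_cball by blast
          then have "continuous_on (ball z0 (2 * R)) u" using Ck_on_Suc_imp_continuous[OF C2] continuous_on_subset by blast
          then have "open (ball z0 (2 * R) \<inter> u -` {..<- T})" by (intro continuous_open_preimage) auto
          also have "ball z0 (2 * R) \<inter> u -` {..<- T} = {z \<in> ball z0 (2 * R). T < - \<phi> (chart_inv c z)}"
            by (auto simp: u_def)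
          finally show "{z \<in> ball z0 (2 * R). T < - \<phi> (chart_inv c z)} \<in> sets lborel" by simp
        qed
        then show "emeasure lborel ?P \<le> ennreal \<delta>" using dec by (rule order_trans)
      qed auto
      also have "\<dots> = ennreal (C * (exp (2 * real ?n * \<tau>) * \<delta> + E / (\<rho> * \<tau> powr p)))"
        using C \<delta> E \<rho>(1) \<tau> by (simp add: ennreal_mult ennreal_plus del: ennreal_plus)
          (simp add: ennreal_mult'[symmetric])
      also have "C * (exp (2 * real ?n * \<tau>) * \<delta> + E / (\<rho> * \<tau> powr p)) = v / 2"
        unfolding \<tau>p \<delta>_def using C E \<rho>(1) v by (simp add: field_simps)
      finally have "ennreal v \<le> ennreal (v / 2)"
        unfolding v_def emeasure_lborel_ball_eq .
      then show False using v by (simp add: ennreal_le_iff)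
    qed
  qed
qed

text \<open>Closed by construction, and open by the decay estimate.\<close>

definition bounded_near :: "('a \<Rightarrow> real) set \<Rightarrow> 'a set" where
  "bounded_near V = {y \<in> topspace X. \<forall>U. openin X U \<and> y \<in> U \<longrightarrow> (\<exists>M. \<forall>\<phi>\<in>V. \<exists>x\<in>U. - \<phi> x \<le> M)}"

lemma bounded_nearD:
  "y \<in> bounded_near V \<Longrightarrow> openin X U \<Longrightarrow> y \<in> U \<Longrightarrow> \<exists>M. \<forall>\<phi>\<in>V. \<exists>x\<in>U. - \<phi> x \<le> M"
  by (simp add: bounded_near_def)

text \<open>If -\<phi> exceeded \<open>T\<close> on a small ball around a point of
  \<open>ball z0 R\<close>, its superlevel set would contain a ball of volume \<open>v\<close>,
  which the decay estimate with \<delta> = v / 2 excludes. So a bound at one point of the ball gives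
  a bound near every point of it.\<close>

lemma bounded_near_chart_ball:
  assumes c: "c \<in> A" and R: "R > 0" "cball z0 (3 * R) \<subseteq> chart_image c" and V: "V \<subseteq> subsolutions"
    and M: "\<And>\<phi>. \<phi> \<in> V \<Longrightarrow> \<exists>z\<in>ball z0 R. - \<phi> (chart_inv c z) \<le> M"
  shows "chart_inv c ` ball z0 R \<subseteq> bounded_near V"
proof
  fix y assume "y \<in> chart_inv c ` ball z0 R"
  then obtain z where z: "z \<in> ball z0 R" "y = chart_inv c z" by blast
  note ch = chart[OF c]
  note cf = is_chart_facts[OF ch]
  have sub: "ball z0 R \<subseteq> chart_image c"
    using R ball_subset_cball[of z0 R] cball_subset_cball_iff[of z0 R z0 "3 * R"] by auto
  then have zS: "z \<in> chart_image c" using z by blast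
  show "y \<in> bounded_near V"
    unfolding bounded_near_def
  proof (intro CollectI conjI allI impI)
    show "y \<in> topspace X" using cf(2)[OF zS] complex_manifold_facts(3)[OF man c] z by blast
    fix U assume U: "openin X U \<and> y \<in> U"
    have "open ({w \<in> chart_image c. chart_inv c w \<in> U} \<inter> ball z0 R)"
      using chart_image_of_open[OF ch, of U] U by auto
    moreover have "z \<in> {w \<in> chart_image c. chart_inv c w \<in> U} \<inter> ball z0 R" using z zS U by auto
    ultimately obtain r where r: "r > 0" "ball z r \<subseteq> {w \<in> chart_image c. chart_inv c w \<in> U} \<inter> ball z0 R"
      using open_contains_ball by blast
    define v where "v = measure lborel (ball z r)"
    have v: "v > 0" using content_ball_pos[OF r(1), of z] by (simp add: v_def)
    obtain T where T: "\<And>\<phi>. \<phi> \<in> subsolutions \<Longrightarrow> \<exists>z\<in>ball z0 R. - \<phi> (chart_inv c z) \<le> max 0 M \<Longrightarrow>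
       emeasure lborel {z \<in> ball z0 (2 * R). T < - \<phi> (chart_inv c z)} \<le> ennreal (v / 2)"
      using local_decay[OF c R, of "v / 2" "max 0 M"] v by auto
    have "\<exists>x\<in>U. - \<phi> x \<le> T" if \<phi>: "\<phi> \<in> V" for \<phi>
    proof (rule ccontr)
      assume no: "\<not> ?thesis"
      have \<phi>s: "\<phi> \<in> subsolutions" using \<phi> V by blast
      have "ball z r \<subseteq> {z \<in> ball z0 (2 * R). T < - \<phi> (chart_inv c z)}"
        using r(2) no R(1) by (force simp: not_le)
      then have "emeasure lborel (ball z r) \<le> emeasure lborel {z \<in> ball z0 (2 * R). T < - \<phi> (chart_inv c z)}"
      proof (rule emeasure_mono)
        have C2: "Ck_on (Suc (Suc 0)) (chart_image c) (\<phi> \<circ> chart_inv c)"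
          using \<phi>s by (intro Ck_function_2_D c) (simp add: subsolutions_def)
        have "ball z0 (2 * R) \<subseteq> chart_image c" using R ball_subset_cball[of z0 "2 * R"] cball_subset_cball_iff[of z0 "2 * R" z0 "3 * R"] by auto
        then have "continuous_on (ball z0 (2 * R)) (\<phi> \<circ> chart_inv c)" using Ck_on_Suc_imp_continuous[OF C2] continuous_on_subset by blast
        then have "open (ball z0 (2 * R) \<inter> (\<phi> \<circ> chart_inv c) -` {..<- T})" by (intro continuous_open_preimage) auto
        also have "ball z0 (2 * R) \<inter> (\<phi> \<circ> chart_inv c) -` {..<- T} = {z \<in> ball z0 (2 * R). T < - \<phi> (chart_inv c z)}"
          by auto
        finally show "{z \<in> ball z0 (2 * R). T < - \<phi> (chart_inv c z)} \<in> sets lborel" by simp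
      qed
      also have "\<dots> \<le> ennreal (v / 2)"
      proof (rule T[OF \<phi>s])
        obtain w where "w \<in> ball z0 R" "- \<phi> (chart_inv c w) \<le> M" using M[OF \<phi>] by blast
        then show "\<exists>z\<in>ball z0 R. - \<phi> (chart_inv c z) \<le> max 0 M" by (intro bexI[of _ w]) auto
      qed
      finally have "ennreal v \<le> ennreal (v / 2)" unfolding v_def emeasure_lborel_ball_eq .
      then show False using v by (simp add: ennreal_le_iff)
    qed
    then show "\<exists>M. \<forall>\<phi>\<in>V. \<exists>x\<in>U. - \<phi> x \<le> M" by blast
  qed
qed

text \<open>The tripled ball has to lie in the chart because the decay estimate uses it.\<close>

definition good_ball :: "('a, 'n) chart \<times> (complex^'n) \<times> real \<Rightarrow> bool" where
  "good_ball q \<longleftrightarrow> (case q of (c, z0, R) \<Rightarrow> c \<in> A \<and> R > 0 \<and> cball z0 (3 * R) \<subseteq> chart_image c)"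

definition ball_of :: "('a, 'n) chart \<times> (complex^'n) \<times> real \<Rightarrow> 'a set" where
  "ball_of q = (case q of (c, z0, R) \<Rightarrow> chart_inv c ` ball z0 R)"

lemma ball_of_open: "good_ball q \<Longrightarrow> openin X (ball_of q)"
proof -
  assume "good_ball q"
  then obtain c z0 R where q: "q = (c, z0, R)" "c \<in> A" "R > 0" "cball z0 (3 * R) \<subseteq> chart_image c"
    by (auto simp: good_ball_def split: prod.splits)
  have "ball z0 R \<subseteq> chart_image c"
    using q ball_subset_cball[of z0 R] cball_subset_cball_iff[of z0 R z0 "3 * R"] by auto
  then show ?thesis
    unfolding ball_of_def q(1) by (auto intro: chart_inv_image_open[OF chart[OF q(2)]])
qed

lemma ex_good_ball:
  assumes "y \<in> topspace X"
  shows "\<exists>c z0 R. good_ball (c, z0, R) \<and> y \<in> ball_of (c, z0, R)"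
proof -
  obtain c where c: "c \<in> A" "y \<in> fst c" using complex_manifold_facts(2)[OF man assms] by blast
  note cf = is_chart_facts[OF chart[OF c(1)]]
  obtain e where e: "e > 0" "ball (snd c y) e \<subseteq> chart_image c"
    using cf(1) cf(4)[OF c(2)] open_contains_ball by blast
  have "cball (snd c y) (3 * (e / 6)) \<subseteq> ball (snd c y) e" using e(1) by (auto simp: cball_subset_ball_iff)
  then have "good_ball (c, snd c y, e / 6)" using c e by (auto simp: good_ball_def)
  moreover have "y \<in> ball_of (c, snd c y, e / 6)"
    using e(1) cf(5)[OF c(2)] by (auto simp: ball_of_def image_iff intro!: bexI[of _ "snd c y"])
  ultimately show ?thesis by blast
qed

text \<open>Connectedness replaces an explicit chain of balls starting from \<open>q\<close>, so the
  growth of the bound along a chain is not tracked.\<close>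

theorem bounded_near_everywhere:
  assumes conn: "connected_space X" and good: "good_ball q" and V: "V \<subseteq> subsolutions"
    and zero: "\<And>\<phi>. \<phi> \<in> V \<Longrightarrow> \<exists>x\<in>ball_of q. - \<phi> x \<le> 0"
  shows "bounded_near V = topspace X"
proof -
  obtain c z0 R where q: "q = (c, z0, R)" "c \<in> A" "R > 0" "cball z0 (3 * R) \<subseteq> chart_image c"
    using good by (auto simp: good_ball_def split: prod.splits)
  have "chart_inv c ` ball z0 R \<subseteq> bounded_near V"
    using zero by (intro bounded_near_chart_ball[OF q(2-4) V, of 0]) (auto simp: q(1) ball_of_def)
  then have ne: "bounded_near V \<noteq> {}" using q(3) by auto
  have "openin X (bounded_near V)"
  proof (subst openin_subopen, intro ballI)
    fix y assume y: "y \<in> bounded_near V"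
    then have "y \<in> topspace X" by (simp add: bounded_near_def)
    then obtain c' z' R' where g: "good_ball (c', z', R')" "y \<in> ball_of (c', z', R')" using ex_good_ball by blast
    then have g': "c' \<in> A" "R' > 0" "cball z' (3 * R') \<subseteq> chart_image c'" by (auto simp: good_ball_def)
    have op: "openin X (ball_of (c', z', R'))" by (rule ball_of_open[OF g(1)])
    obtain M where M: "\<And>\<phi>. \<phi> \<in> V \<Longrightarrow> \<exists>x\<in>ball_of (c', z', R'). - \<phi> x \<le> M"
      using bounded_nearD[OF y op g(2)] by blast
    have "ball_of (c', z', R') \<subseteq> bounded_near V"
      unfolding ball_of_def using M by (auto simp: ball_of_def intro!: subsetD[OF bounded_near_chart_ball[OF g' V, of M]])
    then show "\<exists>T. openin X T \<and> y \<in> T \<and> T \<subseteq> bounded_near V" using op g(2) by blast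
  qed
  moreover have "closedin X (bounded_near V)"
    unfolding closedin_def
  proof
    show "bounded_near V \<subseteq> topspace X" by (auto simp: bounded_near_def)
    show "openin X (topspace X - bounded_near V)"
    proof (subst openin_subopen, intro ballI)
      fix y assume y: "y \<in> topspace X - bounded_near V"
      then obtain U where U: "openin X U" "y \<in> U" "\<not> (\<exists>M. \<forall>\<phi>\<in>V. \<exists>x\<in>U. - \<phi> x \<le> M)"
        unfolding bounded_near_def by blast
      then have "U \<subseteq> topspace X - bounded_near V"
        using openin_subset[OF U(1)] unfolding bounded_near_def by blast
      then show "\<exists>T. openin X T \<and> y \<in> T \<and> T \<subseteq> topspace X - bounded_near V" using U by blast
    qed
  qed
  ultimately show ?thesis
    using conn ne unfolding connected_space_clopen_in by blast
qed

text \<open>The place where \<phi> vanishes is not known in advance. A finite cover by good balls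
  sorts the solutions into families \<open>V q\<close> according to a ball that contains a zero, and
  each family is bounded near every point. The minimum also lies in one of these balls, so finitely
  many constants suffice.\<close>

theorem uniform_bound:
  assumes comp: "compact_space X" and conn: "connected_space X" and ne: "topspace X \<noteq> {}"
    and \<gamma>: "\<gamma> > 0" and p: "p > 0" and E: "E > 0"
  shows "\<exists>C>0. \<forall>\<Gamma> f F \<phi>. structural_conditions \<Gamma> f \<gamma> \<longrightarrow> smooth_function A F \<longrightarrow> entropy_norm X A \<omega> p F \<le> ennreal E \<longrightarrow>
    Ck_function 2 A \<phi> \<longrightarrow> solves_equation A \<omega> \<omega>h \<theta> \<Gamma> f F \<phi> \<longrightarrow> (SUP x\<in>topspace X. \<phi> x) = 0 \<longrightarrow>
    (SUP x\<in>topspace X. \<bar>\<phi> x\<bar>) \<le> C"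
proof -
  obtain \<F> where \<F>: "finite \<F>" "\<F> \<subseteq> ball_of ` {q. good_ball q}" "topspace X \<subseteq> \<Union>\<F>"
  proof -
    have "\<forall>U\<in>ball_of ` {q. good_ball q}. openin X U" using ball_of_open by blast
    moreover have "topspace X \<subseteq> \<Union>(ball_of ` {q. good_ball q})" using ex_good_ball by blast
    ultimately show ?thesis using that comp[unfolded compact_space_alt, rule_format, of "ball_of ` {q. good_ball q}"] by blast
  qed
  obtain Q where Q: "finite Q" "Q \<subseteq> {q. good_ball q}" "\<F> = ball_of ` Q"
    using finite_subset_image[OF \<F>(1,2)] by blast
  define V where "V q = {\<phi> \<in> subsolutions. \<exists>x\<in>ball_of q. - \<phi> x \<le> 0}" for q
  have near: "bounded_near (V q) = topspace X" if "q \<in> Q" for q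
    by (rule bounded_near_everywhere[OF conn]) (use that Q(2) in \<open>auto simp: V_def\<close>)
  \<comment> \<open>One constant for each pair of balls: a zero of \<phi> lies in
    \<open>ball_of q\<close>, its minimum in \<open>ball_of q'\<close>.\<close>
  have loc: "\<exists>L. \<forall>\<Gamma> f F \<phi> x. structural_conditions \<Gamma> f \<gamma> \<longrightarrow> smooth_function A F \<longrightarrow> entropy_norm X A \<omega> p F \<le> ennreal E \<longrightarrow>
    Ck_function 2 A \<phi> \<longrightarrow> solves_equation A \<omega> \<omega>h \<theta> \<Gamma> f F \<phi> \<longrightarrow> \<phi> \<in> V q \<longrightarrow> x \<in> ball_of q' \<longrightarrow>
    (\<forall>y\<in>topspace X. \<phi> x \<le> \<phi> y) \<longrightarrow> - \<phi> x \<le> L" if qq: "q \<in> Q" "q' \<in> Q" for q q'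
  proof -
    have g: "good_ball q'" using qq Q by blast
    then obtain c z0 R where q': "q' = (c, z0, R)" "c \<in> A" "R > 0" "cball z0 (3 * R) \<subseteq> chart_image c"
      by (auto simp: good_ball_def split: prod.splits)
    have "cball z0 (2 * R) \<subseteq> cball z0 (3 * R)" using q'(3) by (simp add: cball_subset_cball_iff)
    then have R2: "cball z0 (2 * R) \<subseteq> chart_image c" using q'(4) by blast
    obtain \<delta> C where \<delta>: "\<delta> > 0" and C: "\<And>\<Gamma> f F \<phi> x1 T. structural_conditions \<Gamma> f \<gamma> \<Longrightarrow> smooth_function A F \<Longrightarrow> entropy_norm X A \<omega> p F \<le> ennreal E \<Longrightarrow>
      Ck_function 2 A \<phi> \<Longrightarrow> solves_equation A \<omega> \<omega>h \<theta> \<Gamma> f F \<phi> \<Longrightarrow> x1 \<in> ball z0 R \<Longrightarrow>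
      \<forall>z\<in>ball z0 (2 * R). \<phi> (chart_inv c x1) \<le> \<phi> (chart_inv c z) \<Longrightarrow>
      emeasure lborel {z \<in> ball z0 (2 * R). T < - \<phi> (chart_inv c z)} \<le> ennreal \<delta> \<Longrightarrow> - \<phi> (chart_inv c x1) \<le> T + C"
      using local_minimum_bound[OF q'(2,3) R2 \<gamma> p E] by (elim exE conjE) blast
    have op: "openin X (ball_of q')" by (rule ball_of_open[OF g])
    have "chart_inv c z0 \<in> ball_of q'" using q' by (auto simp: ball_of_def)
    moreover have "ball_of q' \<subseteq> bounded_near (V q)" unfolding near[OF qq(1)] by (rule openin_subset[OF op])
    ultimately obtain M where M: "\<And>\<phi>. \<phi> \<in> V q \<Longrightarrow> \<exists>x\<in>ball_of q'. - \<phi> x \<le> M"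
      using bounded_nearD[OF _ op] by blast
    \<comment> \<open>The \<delta> is the one demanded by the estimate at the minimum, so
      \<open>T\<close> depends only on the two balls and the fixed data.\<close>
    obtain T where T: "\<And>\<phi>. \<phi> \<in> subsolutions \<Longrightarrow> \<exists>z\<in>ball z0 R. - \<phi> (chart_inv c z) \<le> max 0 M \<Longrightarrow>
       emeasure lborel {z \<in> ball z0 (2 * R). T < - \<phi> (chart_inv c z)} \<le> ennreal \<delta>"
      using local_decay[OF q'(2-4) \<delta>, of "max 0 M"] by auto
    show ?thesis
    proof (intro exI[of _ "T + C"] allI impI)
      fix \<Gamma> :: "(real^'n) set" and f F \<phi> x
      assume as: "structural_conditions \<Gamma> f \<gamma>" "smooth_function A F" "entropy_norm X A \<omega> p F \<le> ennreal E"
        "Ck_function 2 A \<phi>" "solves_equation A \<omega> \<omega>h \<theta> \<Gamma> f F \<phi>" and \<phi>: "\<phi> \<in> V q" and x: "x \<in> ball_of q'"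
        and min: "\<forall>y\<in>topspace X. \<phi> x \<le> \<phi> y"
      obtain x1 where x1: "x1 \<in> ball z0 R" "x = chart_inv c x1" using x by (auto simp: ball_of_def q'(1))
      show "- \<phi> x \<le> T + C"
        unfolding x1(2)
      proof (rule C[OF as x1(1)])
        show "\<forall>z\<in>ball z0 (2 * R). \<phi> (chart_inv c x1) \<le> \<phi> (chart_inv c z)"
        proof
          fix z assume "z \<in> ball z0 (2 * R)"
          then have "z \<in> chart_image c" using R2 ball_subset_cball by blast
          then have "chart_inv c z \<in> topspace X"
            using is_chart_facts(2)[OF chart[OF q'(2)]] complex_manifold_facts(3)[OF man q'(2)] by blast
          then show "\<phi> (chart_inv c x1) \<le> \<phi> (chart_inv c z)" using min x1(2) by blast
        qed
        show "emeasure lborel {z \<in> ball z0 (2 * R). T < - \<phi> (chart_inv c z)} \<le> ennreal \<delta>"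
        proof (rule T)
          show "\<phi> \<in> subsolutions" using \<phi> by (simp add: V_def)
          obtain w where w: "w \<in> ball z0 R" "- \<phi> (chart_inv c w) \<le> M"
            using M[OF \<phi>] unfolding ball_of_def q'(1) by auto
          then show "\<exists>z\<in>ball z0 R. - \<phi> (chart_inv c z) \<le> max 0 M" by (intro bexI[of _ w]) auto
        qed
      qed
    qed
  qed
  obtain L where L: "\<And>q q' \<Gamma> f F \<phi> x. q \<in> Q \<Longrightarrow> q' \<in> Q \<Longrightarrow> structural_conditions \<Gamma> f \<gamma> \<Longrightarrow> smooth_function A F \<Longrightarrow> entropy_norm X A \<omega> p F \<le> ennreal E \<Longrightarrow>
    Ck_function 2 A \<phi> \<Longrightarrow> solves_equation A \<omega> \<omega>h \<theta> \<Gamma> f F \<phi> \<Longrightarrow> \<phi> \<in> V q \<Longrightarrow> x \<in> ball_of q' \<Longrightarrow>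
    \<forall>y\<in>topspace X. \<phi> x \<le> \<phi> y \<Longrightarrow> - \<phi> x \<le> L q q'"
    using loc by metis
  \<comment> \<open>Inserting 1 keeps \<open>C\<close> positive.\<close>
  define C where "C = Max (insert 1 ((\<lambda>(q, q'). L q q') ` (Q \<times> Q)))"
  have fin: "finite (insert 1 ((\<lambda>(q, q'). L q q') ` (Q \<times> Q)))" using Q(1) by simp
  have C1: "1 \<le> C" unfolding C_def by (rule Max_ge[OF fin]) simp
  have CL: "L q q' \<le> C" if "q \<in> Q" "q' \<in> Q" for q q'
    unfolding C_def using that by (intro Max_ge[OF fin]) auto
  show ?thesis
  proof (intro exI[of _ C] conjI allI impI)
    show "0 < C" using C1 by simp
    fix \<Gamma> :: "(real^'n) set" and f F \<phi>
    assume as: "structural_conditions \<Gamma> f \<gamma>" "smooth_function A F" "entropy_norm X A \<omega> p F \<le> ennreal E"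
      "Ck_function 2 A \<phi>" "solves_equation A \<omega> \<omega>h \<theta> \<Gamma> f F \<phi>" and sup: "(SUP x\<in>topspace X. \<phi> x) = 0"
    have cm: "continuous_map X euclideanreal \<phi>"
      using Ck_on_Suc_imp_continuous[OF Ck_function_2_D[OF as(4)]] by (intro continuous_map_of_charts[OF man]) blast
    have cpt: "compact (\<phi> ` topspace X)"
    proof -
      have "compactin euclideanreal (\<phi> ` topspace X)"
        using image_compactin[OF _ cm] comp by (auto simp: compact_space_def)
      then show ?thesis by simp
    qed
    have bdd: "bdd_above (\<phi> ` topspace X)" by (intro bounded_imp_bdd_above compact_imp_bounded cpt)
    have le0: "\<phi> x \<le> 0" if "x \<in> topspace X" for x
      using cSUP_upper[OF that bdd] sup by simp
    obtain x0 where x0: "x0 \<in> topspace X" "\<phi> x0 = 0"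
    proof -
      have "Sup (\<phi> ` topspace X) \<in> \<phi> ` topspace X"
        using ne by (intro closed_contains_Sup bdd compact_imp_closed cpt) auto
      then show ?thesis using that sup by auto
    qed
    obtain xm where xm: "xm \<in> topspace X" "\<forall>y\<in>topspace X. \<phi> xm \<le> \<phi> y"
      using compact_attains_inf[OF cpt] ne by auto
    have sub: "\<phi> \<in> subsolutions" by (rule solution_subsolution[OF as(1,4) le0 as(5)])
    obtain q where q: "q \<in> Q" "x0 \<in> ball_of q" using x0 \<F>(3) Q(3) by blast
    obtain q' where q': "q' \<in> Q" "xm \<in> ball_of q'" using xm \<F>(3) Q(3) by blast
    have "\<phi> \<in> V q" using sub q(2) x0(2) by (auto simp: V_def intro!: bexI[of _ x0])
    then have "- \<phi> xm \<le> C"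
      using L[OF q(1) q'(1) as _ q'(2) xm(2)] CL[OF q(1) q'(1)] by linarith
    then have "\<bar>\<phi> x\<bar> \<le> C" if "x \<in> topspace X" for x
      using le0[OF that] xm(2) that by fastforce
    then show "(SUP x\<in>topspace X. \<bar>\<phi> x\<bar>) \<le> C"
      using ne by (intro cSUP_least) auto
  qed
qed

end

theorem theorem4:
  fixes X :: "'a topology"
    and A :: "('a, 'n::finite) chart set"
    and \<omega> \<omega>\<^sub>h :: "('a, 'n) chart \<Rightarrow> 'a \<Rightarrow> complex^'n^'n"
    and \<theta> :: "('a, 'n) chart \<Rightarrow> 'a \<Rightarrow> complex^'n"
    and p \<gamma> K :: real
  assumes "CARD('n) \<ge> 2"
    and "compact_connected_complex_manifold X A"
    and "hermitian_metric A \<omega>"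
    and "hermitian_metric A \<omega>\<^sub>h"
    and "smooth_10_form A \<theta>"
    and "p > 2 * real CARD('n)"
    and "\<gamma> > 0"
    and "K > 0"
  shows "\<exists>C>0. \<forall>(\<Gamma> :: (real^'n) set) (f :: real^'n \<Rightarrow> real) (F :: 'a \<Rightarrow> real) (\<phi> :: 'a \<Rightarrow> real).
           structural_conditions \<Gamma> f \<gamma> \<longrightarrow>
           smooth_function A F \<longrightarrow>
           entropy_norm X A \<omega> p F \<le> ennreal K \<longrightarrow>
           Ck_function 2 A \<phi> \<longrightarrow>
           solves_equation A \<omega> \<omega>\<^sub>h \<theta> \<Gamma> f F \<phi> \<longrightarrow>
           (SUP x\<in>topspace X. \<phi> x) = 0 \<longrightarrow>
           (SUP x\<in>topspace X. \<bar>\<phi> x\<bar>) \<le> C"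
proof -
  have m: "complex_manifold X A" and comp: "compact_space X" and conn: "connected_space X" and ne: "topspace X \<noteq> {}"
    using assms(2) by (simp_all add: compact_connected_complex_manifold_def)
  interpret hermitian_setting X A \<omega> \<omega>\<^sub>h \<theta>
    by unfold_locales (use assms(1,3-5) m in simp_all)
  have "p > 0" using assms(6) of_nat_0_le_iff[of "CARD('n)"] by linarith
  then show ?thesis by (rule uniform_bound[OF comp conn ne assms(7) _ assms(8)])
qed

end
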